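(* Fix constants $\mu_{\min},\mu_{\max},\Phi,\eta,L,w_{\min},w_{\max},w_{\mathrm{sep}}>0$ with $w_{\min}\le 1$ and an integer $d\ge 1$, none of which depend on $n$. For each $n$, let $N_1,\dots,N_n$ be an $n$-variate Hawkes process satisfying assumptions (A1)--(A6) of the context with these constants, and let $G^*$ be its dependency graph. If $T=\log^{100}(n)$, $\epsilon=\log^{-17}(n)$ and $h=w_{\min}w_{\mathrm{sep}}\mu_{\min}/8$, then the algorithm described in the context, run on $N_1,\dots,N_n$ observed in $[0,T]$ with parameters $(T,\epsilon,h)$, outputs a graph $\widehat G$ satisfying $\widehat G=G^*$ with probability $1-o(1)$ as $n\to\infty$.
   Context: Setting (multivariate non-stationary Hawkes process). Let $n\ge 2$ and $[n]=\{1,\dots,n\}$. $N_1,\dots,N_n$ are point processes on $[0,\infty)$, with no simultaneous events, where $N_i(t)$ is the number of events at node $i$ in $[0,t]$ and $N_i[a,b]$ is the number of events at node $i$ in the interval $[a,b]$; $\{\mathcal F_t\}_{t\ge 0}$ is the natural filtration of $(N_1,\dots,N_n)$. The rate function of $N_i$ is $\lambda_i(t)=\lim_{\epsilon\downarrow 0}\epsilon^{-1}\left(\mathbb E[N_i(t+\epsilon)\mid\mathcal F_t]-N_i(t)\right)$, and it is given by $$\lambda_i(t)=\mu_i(t)+\sum_{j=1}^n w_{ij}\int_0^t\phi_{ij}(t,s)\,dN_j(s),$$ where an event at time $t$ itself is included in the integral (so an event at $j$ at time $t$ makes $\lambda_i$ jump by $w_{ij}$ at time $t$). Here $\mu_i\ge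 0$ is deterministic, $\phi_{ij}\ge0$ is a deterministic delay kernel and $w_{ij}\ge 0$. The functions and weights may depend on $n$. Assumptions. (A1) $\mu_{\min}\le\mu_i(t)\le\mu_{\max}$ for all $i\in[n]$, $t\ge 0$. (A2) For all $i,j$, $\phi_{ij}$ is continuous and non-negative; for all $s\ge0$, $\phi_{ij}(s,s)=1$ and $\phi_{ij}(\cdot,s)$ is decreasing. (A3) $\int_0^t\phi_{ij}(t,x)\,dx\le\Phi$ for all $i,j\in[n]$, $t\ge0$, and $\sum_{j=1}^n w_{ij}\int_0^t\phi_{ij}(t,x)\,dx\le 1-\eta$ for all $i\in[n]$, $t\ge 0$. (A4) $|\mu_i'(t)|/\mu_i(t)\le L$ for all $i\in[n]$, $t\ge 0$, and $|\frac{\partial}{\partial t}\phi_{ij}(t,s)|/\phi_{ij}(t,s)\le L$ for all $i,j\in[n]$, $t\ge s\ge 0$. (A5) For all $i,j\in[n]$, either $w_{ij}=0$ or $w_{\min}\le w_{ij}\le w_{\max}$; and $w_{ii}-w_{ij}\ge w_{\mathrm{sep}}$ for all distinct $i,j\in[n]$. (A6) For each $i\in[n]$ at most $d$ of the numbers $\{w_{ij}\}_{j\in[n]}$ are nonzero. Dependency graph. $G^*$ is the undirected graph with vertex set $[n]$ in which, for distinct $i,j$, $(i,j)$ is an edge if and only if $w_{ij}>0$ or $w_{ji}>0$. Statistics. For $i,j\in[n]$, $t\ge0$, $\epsilon>0$ let $X_{ij}(t,\epsilon)=\mathbf 1(N_i[t,t+\epsilon]=1,\ N_j[t+\epsilon,t+2\epsilon]=1)$,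 and for $a,b,c\in[n]$ let $X_{abc}(t,\epsilon)=\mathbf 1(N_a[t,t+\epsilon]=1,\ N_b[t+\epsilon,t+2\epsilon]=1,\ N_c[t+2\epsilon,t+3\epsilon]=1)$. Let $$\Delta^{(1)}_{ij}(t,\epsilon)=X_{ij}(t,\epsilon)-X_{ji}(t,\epsilon),\qquad \Delta^{(2)}_{ij}(t,\epsilon)=X_{iij}(t,\epsilon)-2X_{iji}(t,\epsilon)+X_{jii}(t,\epsilon),$$ and, for $m\in\{1,2\}$, $$D^{(m)}_{ij}(T,\epsilon)=\sum_{k=0}^{\lfloor T/(3\epsilon)\rfloor}\Delta^{(m)}_{ij}(k\epsilon,\epsilon).$$ Algorithm. Input: $N_1,\dots,N_n$ observed on $[0,T]$, $\epsilon>0$, threshold $h>0$. Start with $\widehat G$ the empty graph on $[n]$. For each (ordered) pair of distinct $i,j\in[n]$, add the undirected edge $(i,j)$ to $\widehat G$ if $$\frac{|D^{(1)}_{ij}(T,\epsilon)|}{T\epsilon}+\frac{|D^{(2)}_{ij}(T,\epsilon)|}{T\epsilon^2}\ge h.$$ Return $\widehat G$. *)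

theory Defs
  imports "HOL-Probability.Probability"
begin

text \<open>
  Nodes are the numbers in \<open>{1..n}\<close>. A (simple) point configuration is given by its event
  times: \<open>x i\<close> is the set of times of the events at node \<open>i\<close>. A point process is a random
  configuration \<open>E\<close>, where \<open>E i \<omega>\<close> is the set of event times of node \<open>i\<close> in the outcome \<open>\<omega>\<close>.
\<close>

definition num_events :: "(nat \<Rightarrow> real set) \<Rightarrow> nat \<Rightarrow> real \<Rightarrow> real \<Rightarrow> nat" where
  "num_events x i a b = card (x i \<inter> {a..b})"

definition counting_process :: "(nat \<Rightarrow> 'a \<Rightarrow> real set) \<Rightarrow> nat \<Rightarrow> real \<Rightarrow> 'a \<Rightarrow> nat" where
  "counting_process E i t \<omega> = num_events (\<lambda>j. E j \<omega>) i 0 t"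

definition natural_filtration ::
    "'a measure \<Rightarrow> nat \<Rightarrow> (nat \<Rightarrow> 'a \<Rightarrow> real set) \<Rightarrow> real \<Rightarrow> 'a measure" where
  "natural_filtration M n E t =
     sigma (space M)
       {counting_process E j s -` B \<inter> space M | j s B. j \<in> {1..n} \<and> 0 \<le> s \<and> s \<le> t}"

text \<open>
  The Hawkes rate in a configuration \<open>x\<close>. The inner sum is the integral of \<open>\<phi> i j t\<close> over \<open>{0..t}\<close>
  against the counting measure of \<open>x j\<close>; an event at time \<open>t\<close> itself contributes.
\<close>

definition hawkes_rate ::
    "nat \<Rightarrow> (nat \<Rightarrow> real \<Rightarrow> real) \<Rightarrow> (nat \<Rightarrow> nat \<Rightarrow> real \<Rightarrow> real \<Rightarrow> real) \<Rightarrow> (nat \<Rightarrow> nat \<Rightarrow> real) \<Rightarrow>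
     (nat \<Rightarrow> real set) \<Rightarrow> nat \<Rightarrow> real \<Rightarrow> real" where
  "hawkes_rate n \<mu> \<phi> w x i t =
     \<mu> i t + (\<Sum>j=1..n. w i j * (\<Sum>s\<in>x j \<inter> {0..t}. \<phi> i j t s))"

text \<open>
  \<open>r t\<close> is the limit, as \<open>\<epsilon>\<close> decreases to 0, of
  \<open>(\<^bold>E[N_i(t + \<epsilon>) | F_t] - N_i(t)) / \<epsilon>\<close>. The conditional expectations are only determined up to
  null sets, and almost sure convergence at each fixed \<open>t\<close> would not determine the dynamics (it
  also holds, with the same rate, after adding for each event a further event with a fixed delay).
  The limit is therefore taken in mean. The nonnegative integral is used because the Bochner
  integral of a non-integrable function is 0.
\<close>

definition has_rate ::
    "'a measure \<Rightarrow> nat \<Rightarrow> (nat \<Rightarrow> 'a \<Rightarrow> real set) \<Rightarrow> nat \<Rightarrow> (real \<Rightarrow> 'a \<Rightarrow> real) \<Rightarrow> bool" where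
  "has_rate M n E i r \<longleftrightarrow>
     (\<forall>t\<ge>0.
        ((\<lambda>\<epsilon>. \<integral>\<^sup>+ \<omega>. ennreal \<bar>(real_cond_exp M (natural_filtration M n E t)
                                 (\<lambda>\<omega>'. real (counting_process E i (t + \<epsilon>) \<omega>')) \<omega>
                               - real (counting_process E i t \<omega>)) / \<epsilon> - r t \<omega>\<bar> \<partial>M)
          \<longlongrightarrow> 0) (at_right 0))"

text \<open>
  The assumption \<open>no_fixed_time\<close> is part of having a rate: a one-sided limit at every \<open>t\<close> does not
  see an event that has positive probability of occurring exactly at a fixed time, because such an
  event at time \<open>t\<close> is already counted in \<open>N_i(t)\<close>.
\<close>

locale hawkes_process = prob_space M
  for M :: "'a measure" +
  fixes n :: nat
    and E :: "nat \<Rightarrow> 'a \<Rightarrow> real set"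
    and \<mu> :: "nat \<Rightarrow> real \<Rightarrow> real"
    and \<phi> :: "nat \<Rightarrow> nat \<Rightarrow> real \<Rightarrow> real \<Rightarrow> real"
    and w :: "nat \<Rightarrow> nat \<Rightarrow> real"
  assumes mu_nonneg: "\<And>i t. i \<in> {1..n} \<Longrightarrow> 0 \<le> t \<Longrightarrow> 0 \<le> \<mu> i t"
    and phi_nonneg: "\<And>i j s t. i \<in> {1..n} \<Longrightarrow> j \<in> {1..n} \<Longrightarrow> 0 \<le> s \<Longrightarrow> s \<le> t \<Longrightarrow> 0 \<le> \<phi> i j t s"
    and w_nonneg: "\<And>i j. i \<in> {1..n} \<Longrightarrow> j \<in> {1..n} \<Longrightarrow> 0 \<le> w i j"
    and events_nonneg: "\<And>i \<omega>. i \<in> {1..n} \<Longrightarrow> \<omega> \<in> space M \<Longrightarrow> E i \<omega> \<subseteq> {0..}"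
    and locally_finite:
      "\<And>i \<omega> t. i \<in> {1..n} \<Longrightarrow> \<omega> \<in> space M \<Longrightarrow> finite (E i \<omega> \<inter> {0..t})"
    and counts_measurable:
      "\<And>i t. i \<in> {1..n} \<Longrightarrow> 0 \<le> t \<Longrightarrow> counting_process E i t \<in> measurable M (count_space UNIV)"
    and counts_integrable:
      "\<And>i t. i \<in> {1..n} \<Longrightarrow> 0 \<le> t \<Longrightarrow> integrable M (\<lambda>\<omega>. real (counting_process E i t \<omega>))"
    and no_simultaneous: "AE \<omega> in M. disjoint_family_on (\<lambda>i. E i \<omega>) {1..n}"
    and no_fixed_time: "\<And>i t. i \<in> {1..n} \<Longrightarrow> 0 \<le> t \<Longrightarrow> AE \<omega> in M. t \<notin> E i \<omega>"
    and rate: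
      "\<And>i. i \<in> {1..n} \<Longrightarrow> has_rate M n E i (\<lambda>t \<omega>. hawkes_rate n \<mu> \<phi> w (\<lambda>j. E j \<omega>) i t)"

definition base_rates_bounded :: "nat \<Rightarrow> (nat \<Rightarrow> real \<Rightarrow> real) \<Rightarrow> real \<Rightarrow> real \<Rightarrow> bool" where
  "base_rates_bounded n \<mu> \<mu>_min \<mu>_max \<longleftrightarrow>
     (\<forall>i\<in>{1..n}. \<forall>t\<ge>0. \<mu>_min \<le> \<mu> i t \<and> \<mu> i t \<le> \<mu>_max)"

text \<open>Kernels \<open>\<phi> i j t s\<close> are only considered for \<open>0 \<le> s \<le> t\<close>.\<close>

definition kernels_regular :: "nat \<Rightarrow> (nat \<Rightarrow> nat \<Rightarrow> real \<Rightarrow> real \<Rightarrow> real) \<Rightarrow> bool" where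
  "kernels_regular n \<phi> \<longleftrightarrow>
     (\<forall>i\<in>{1..n}. \<forall>j\<in>{1..n}.
        continuous_on {(t, s). 0 \<le> s \<and> s \<le> t} (\<lambda>(t, s). \<phi> i j t s) \<and>
        (\<forall>s\<ge>0. \<forall>t\<ge>s. 0 \<le> \<phi> i j t s) \<and>
        (\<forall>s\<ge>0. \<phi> i j s s = 1) \<and>
        (\<forall>s\<ge>0. antimono_on {s..} (\<lambda>t. \<phi> i j t s)))"

definition kernels_subcritical ::
    "nat \<Rightarrow> (nat \<Rightarrow> nat \<Rightarrow> real \<Rightarrow> real \<Rightarrow> real) \<Rightarrow> (nat \<Rightarrow> nat \<Rightarrow> real) \<Rightarrow> real \<Rightarrow> real \<Rightarrow> bool" where
  "kernels_subcritical n \<phi> w \<Phi> \<eta> \<longleftrightarrow>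
     (\<forall>i\<in>{1..n}. \<forall>j\<in>{1..n}. \<forall>t\<ge>0. integral {0..t} (\<lambda>x. \<phi> i j t x) \<le> \<Phi>) \<and>
     (\<forall>i\<in>{1..n}. \<forall>t\<ge>0. (\<Sum>j=1..n. w i j * integral {0..t} (\<lambda>x. \<phi> i j t x)) \<le> 1 - \<eta>)"

text \<open>Derivatives at the left end point of the domain are one-sided.\<close>

definition log_derivatives_bounded ::
    "nat \<Rightarrow> (nat \<Rightarrow> real \<Rightarrow> real) \<Rightarrow> (nat \<Rightarrow> nat \<Rightarrow> real \<Rightarrow> real \<Rightarrow> real) \<Rightarrow> real \<Rightarrow> bool" where
  "log_derivatives_bounded n \<mu> \<phi> L \<longleftrightarrow>
     (\<forall>i\<in>{1..n}. \<forall>t\<ge>0.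
        \<exists>D. (\<mu> i has_real_derivative D) (at t within {0..}) \<and> \<bar>D\<bar> / \<mu> i t \<le> L) \<and>
     (\<forall>i\<in>{1..n}. \<forall>j\<in>{1..n}. \<forall>s\<ge>0. \<forall>t\<ge>s.
        \<exists>D. ((\<lambda>u. \<phi> i j u s) has_real_derivative D) (at t within {s..}) \<and> \<bar>D\<bar> / \<phi> i j t s \<le> L)"

definition weights_separated ::
    "nat \<Rightarrow> (nat \<Rightarrow> nat \<Rightarrow> real) \<Rightarrow> real \<Rightarrow> real \<Rightarrow> real \<Rightarrow> bool" where
  "weights_separated n w w_min w_max w_sep \<longleftrightarrow>
     (\<forall>i\<in>{1..n}. \<forall>j\<in>{1..n}. w i j = 0 \<or> w_min \<le> w i j \<and> w i j \<le> w_max) \<and>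
     (\<forall>i\<in>{1..n}. \<forall>j\<in>{1..n}. i \<noteq> j \<longrightarrow> w_sep \<le> w i i - w i j)"

definition weights_sparse :: "nat \<Rightarrow> (nat \<Rightarrow> nat \<Rightarrow> real) \<Rightarrow> nat \<Rightarrow> bool" where
  "weights_sparse n w d \<longleftrightarrow> (\<forall>i\<in>{1..n}. card {j \<in> {1..n}. w i j \<noteq> 0} \<le> d)"

text \<open>A graph is a pair of its vertex set and its set of (two-element) undirected edges.\<close>

definition dependency_graph :: "nat \<Rightarrow> (nat \<Rightarrow> nat \<Rightarrow> real) \<Rightarrow> nat set \<times> nat set set" where
  "dependency_graph n w =
     ({1..n}, {{i, j} | i j. i \<in> {1..n} \<and> j \<in> {1..n} \<and> i \<noteq> j \<and> (w i j > 0 \<or> w j i > 0)})"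

definition X2 :: "(nat \<Rightarrow> real set) \<Rightarrow> nat \<Rightarrow> nat \<Rightarrow> real \<Rightarrow> real \<Rightarrow> real" where
  "X2 x i j t \<epsilon> =
     of_bool (num_events x i t (t + \<epsilon>) = 1 \<and> num_events x j (t + \<epsilon>) (t + 2 * \<epsilon>) = 1)"

definition X3 :: "(nat \<Rightarrow> real set) \<Rightarrow> nat \<Rightarrow> nat \<Rightarrow> nat \<Rightarrow> real \<Rightarrow> real \<Rightarrow> real" where
  "X3 x a b c t \<epsilon> =
     of_bool (num_events x a t (t + \<epsilon>) = 1 \<and>
              num_events x b (t + \<epsilon>) (t + 2 * \<epsilon>) = 1 \<and>
              num_events x c (t + 2 * \<epsilon>) (t + 3 * \<epsilon>) = 1)"

definition Delta1 :: "(nat \<Rightarrow> real set) \<Rightarrow> nat \<Rightarrow> nat \<Rightarrow> real \<Rightarrow> real \<Rightarrow> real" where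
  "Delta1 x i j t \<epsilon> = X2 x i j t \<epsilon> - X2 x j i t \<epsilon>"

definition Delta2 :: "(nat \<Rightarrow> real set) \<Rightarrow> nat \<Rightarrow> nat \<Rightarrow> real \<Rightarrow> real \<Rightarrow> real" where
  "Delta2 x i j t \<epsilon> = X3 x i i j t \<epsilon> - 2 * X3 x i j i t \<epsilon> + X3 x j i i t \<epsilon>"

definition D1 :: "(nat \<Rightarrow> real set) \<Rightarrow> nat \<Rightarrow> nat \<Rightarrow> real \<Rightarrow> real \<Rightarrow> real" where
  "D1 x i j T \<epsilon> = (\<Sum>k = 0..nat \<lfloor>T / (3 * \<epsilon>)\<rfloor>. Delta1 x i j (real k * \<epsilon>) \<epsilon>)"

definition D2 :: "(nat \<Rightarrow> real set) \<Rightarrow> nat \<Rightarrow> nat \<Rightarrow> real \<Rightarrow> real \<Rightarrow> real" where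
  "D2 x i j T \<epsilon> = (\<Sum>k = 0..nat \<lfloor>T / (3 * \<epsilon>)\<rfloor>. Delta2 x i j (real k * \<epsilon>) \<epsilon>)"

text \<open>
  The test is not symmetric in \<open>i\<close> and \<open>j\<close>: an edge is added as soon as one of the two ordered
  pairs passes it.
\<close>

definition estimated_graph ::
    "nat \<Rightarrow> (nat \<Rightarrow> real set) \<Rightarrow> real \<Rightarrow> real \<Rightarrow> real \<Rightarrow> nat set \<times> nat set set" where
  "estimated_graph n x T \<epsilon> h =
     ({1..n}, {{i, j} | i j. i \<in> {1..n} \<and> j \<in> {1..n} \<and> i \<noteq> j \<and>
                 \<bar>D1 x i j T \<epsilon>\<bar> / (T * \<epsilon>) + \<bar>D2 x i j T \<epsilon>\<bar> / (T * \<epsilon>\<^sup>2) \<ge> h})"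

end

theory Submission
  imports Defs "HOL-Real_Asymp.Real_Asymp"
begin

text \<open>
  With \<open>\<lambda>\<close> the vector of rates at time \<open>t\<close>, the summands of the two statistics have conditional means
  \<open>\<epsilon>\<^sup>2 g\<^sub>1\<close> and \<open>\<epsilon>\<^sup>3 g\<^sub>2\<close> up to higher order, where \<open>g\<^sub>1 = \<lambda>\<^sub>i w\<^sub>j\<^sub>i - \<lambda>\<^sub>j w\<^sub>i\<^sub>j\<close> and
  \<open>g\<^sub>2 = w\<^sub>i\<^sub>j (\<lambda>\<^sub>j (w\<^sub>i\<^sub>j + w\<^sub>i\<^sub>i) - 2 \<lambda>\<^sub>i w\<^sub>j\<^sub>i)\<close>. Both vanish for non-neighbours, while
  \<open>g\<^sub>2 + 2 w\<^sub>i\<^sub>j g\<^sub>1 = w\<^sub>i\<^sub>j \<lambda>\<^sub>j (w\<^sub>i\<^sub>i - w\<^sub>i\<^sub>j)\<close> is bounded away from zero when \<open>w\<^sub>i\<^sub>j > 0\<close>.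

  The rate in the sense of one-sided derivatives yields the compensator formula
  \<open>E (\<Sum> H(s)) = \<integral> E (H(s) \<lambda>\<^sub>i(s)) ds\<close>, the sum running over the events of node \<open>i\<close>, for adapted
  left-continuous \<open>H\<close>. Everything else is derived from it after stopping the process when a rate
  exceeds \<open>B = (log n)\<^sup>2\<close>: moments of counts in short windows, hence the expansion of the conditional
  means, and an exponential moment of the intensity which, by subcriticality, shows that the process
  is stopped before time \<open>T\<close> with probability at most \<open>exp (- c (log n)\<^sup>2)\<close> up to polynomial factors.
  Azuma's inequality then controls the fluctuations of all statistics simultaneously.
\<close>

text \<open>The hypothesis on the rate is a statement about first moments at fixed times, and the
  counts are only known to be integrable. Functionals are therefore made bounded by a rate cap
  \<open>B\<close> and a count cap \<open>K\<close> before the compensator formula is applied.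
  Conditional means appear as expectations against arbitrary nonnegative bounded weights
  \<open>Z\<close> measurable at the start of a window; the weight for the next window absorbs the
  indicator of the previous one, which is how expansions over several windows are chained.

  Neither statistic suffices alone: \<open>g\<^sub>1\<close> vanishes when the two cross effects
  balance, and exactly then \<open>g\<^sub>2\<close> reduces to the positive combination.

  The powers of log n fit as follows. With B = (log n)^2 the exit probability exp(-c B) beats every
  power of n. The relative error of the expansion is of order B^4 \<epsilon> = (log n)^(8-17). The
  exponent in Azuma's inequality is of order T \<epsilon>^5 = (log n)^(100-85), well above the log n
  needed for a union over all pairs of nodes.\<close>

section \<open>Calculus with one-sided derivatives\<close>

text \<open>At the last point \<open>s\<close> where the growth of \<open>f\<close> from
  \<open>a\<close> still has slope at most \<open>e\<close>, the right derivative 0 extends the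
  bound a little beyond \<open>s\<close>. Continuity makes the set of such points compact, so that a
  last point exists.\<close>

lemma right_derivative_zero_const:
  fixes f :: "real \<Rightarrow> real"
  assumes "a \<le> b" "continuous_on {a..b} f"
    and deriv: "\<And>t. a \<le> t \<Longrightarrow> t < b \<Longrightarrow> (f has_real_derivative 0) (at_right t)"
  shows "f b = f a"
proof (rule ccontr)
  assume ne: "f b \<noteq> f a"
  then have ab: "a < b" using assms(1) by (cases "a = b") auto
  \<comment> \<open>Half of the average slope, so that \<open>b\<close> itself violates the bound
    that defines \<open>S\<close>.\<close>
  define e where "e = \<bar>f b - f a\<bar> / (2 * (b - a))"
  have e: "e > 0" using ne ab by (simp add: e_def)
  define S where "S = {t \<in> {a..b}. \<bar>f t - f a\<bar> \<le> e * (t - a)}"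
  have "closed S" unfolding S_def
    by (intro continuous_on_closed_Collect_le continuous_intros assms)
  moreover have "bounded S" unfolding S_def by (rule bounded_subset[of "{a..b}"]) auto
  ultimately have "compact S" by (simp add: compact_eq_bounded_closed)
  moreover have "a \<in> S" using ab by (simp add: S_def)
  ultimately obtain s where s: "s \<in> S" "\<And>t. t \<in> S \<Longrightarrow> t \<le> s"
    using compact_attains_sup[of S] by blast
  have "b \<notin> S"
  proof
    assume "b \<in> S"
    then have "\<bar>f b - f a\<bar> \<le> e * (b - a)" by (simp add: S_def)
    also have "e * (b - a) = \<bar>f b - f a\<bar> / 2" using ab by (simp add: e_def divide_simps)
    finally show False using ne by simp
  qed
  then have sb: "s < b" using s(1) by (cases "s = b") (auto simp: S_def)
  have sa: "a \<le> s" using s(1) by (simp add: S_def)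
  have "((\<lambda>u. (f u - f s) / (u - s)) \<longlongrightarrow> 0) (at_right s)"
    using deriv[OF sa sb] by (simp add: has_field_derivative_iff)
  then have "eventually (\<lambda>u. \<bar>(f u - f s) / (u - s)\<bar> < e) (at_right s)"
    using e by (auto dest: tendstoD simp: dist_real_def)
  moreover have "eventually (\<lambda>u. u \<in> {s<..<b}) (at_right s)"
    using sb by (rule eventually_at_right_real)
  ultimately have "eventually (\<lambda>u. \<bar>(f u - f s) / (u - s)\<bar> < e \<and> u \<in> {s<..<b}) (at_right s)"
    by eventually_elim auto
  then obtain u where u: "\<bar>(f u - f s) / (u - s)\<bar> < e" "s < u" "u < b"
    using eventually_happens'[OF trivial_limit_at_right_real] by fastforce
  have "\<bar>f u - f s\<bar> \<le> e * (u - s)" using u(1,2) by (simp add: abs_divide field_simps)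
  moreover have "\<bar>f s - f a\<bar> \<le> e * (s - a)" using s(1) by (simp add: S_def)
  ultimately have "\<bar>f u - f a\<bar> \<le> e * (u - a)" by (simp add: algebra_simps)
  then have "u \<in> S" using u sa by (simp add: S_def)
  then show False using s(2)[of u] u(2) by simp
qed

text \<open>This fundamental theorem of calculus needs only right derivatives, which is all that a
  rate defined by a limit from the right provides. Subtracting the indefinite integral of
  \<open>f'\<close> leaves a function with right derivative 0.\<close>

lemma integral_right_derivative:
  fixes f f' :: "real \<Rightarrow> real"
  assumes "a \<le> b" "continuous_on {a..b} f" "continuous_on {a..b} f'"
    and deriv: "\<And>t. a \<le> t \<Longrightarrow> t < b \<Longrightarrow> (f has_real_derivative f' t) (at_right t)"
  shows "integral {a..b} f' = f b - f a"
proof -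
  define h where "h = (\<lambda>t. f t - integral {a..t} f')"
  have "h b = h a"
  proof (rule right_derivative_zero_const[OF assms(1)])
    show "continuous_on {a..b} h" unfolding h_def
      by (intro continuous_intros assms indefinite_integral_continuous_1
          integrable_continuous_interval)
    fix t assume t: "a \<le> t" "t < b"
    have "((\<lambda>x. integral {a..x} f') has_real_derivative f' t) (at t within {a..b})"
      using integral_has_vector_derivative[OF assms(3), of t] t
      by (simp add: has_real_derivative_iff_has_vector_derivative)
    then have "((\<lambda>x. integral {a..x} f') has_real_derivative f' t) (at t within {t..b})"
      by (rule DERIV_subset) (use t in auto)
    then have "((\<lambda>x. integral {a..x} f') has_real_derivative f' t) (at_right t)"
      using t(2) by (simp add: at_within_Icc_at_right)
    from DERIV_diff[OF deriv[OF t] this] show "(h has_real_derivative 0) (at_right t)"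
      by (simp add: h_def)
  qed
  then show ?thesis by (simp add: h_def)
qed

lemma mvt_abs_le:
  fixes f :: "real \<Rightarrow> real"
  assumes "a \<le> b" "continuous_on {a..b} f"
    and "\<And>x. a < x \<Longrightarrow> x < b \<Longrightarrow> \<exists>D. (f has_real_derivative D) (at x) \<and> \<bar>D\<bar> \<le> C"
  shows "\<bar>f b - f a\<bar> \<le> C * (b - a)"
proof (cases "a = b")
  case False
  then have ab: "a < b" using assms(1) by simp
  from mvt[OF ab assms(2), of "\<lambda>x h. deriv f x * h"] obtain \<xi> where
    \<xi>: "a < \<xi>" "\<xi> < b" "f b - f a = deriv f \<xi> * (b - a)"
    using assms(3) by (metis DERIV_imp_deriv has_field_derivative_def)
  with assms(3)[of \<xi>] have "\<bar>deriv f \<xi>\<bar> \<le> C" by (metis DERIV_imp_deriv)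
  then show ?thesis using \<xi>(3) ab by (simp add: abs_mult mult_right_mono)
qed simp

lemma abs_diff_le_max:
  fixes x y b :: real
  assumes "0 \<le> x" "x \<le> b" "0 \<le> y" "y \<le> b"
  shows "\<bar>x - y\<bar> \<le> b"
  using assms by linarith

text \<open>The coefficients 1, -2, 1 are those of the three-window statistic.\<close>

lemma weighted_abs_le:
  fixes x p q s u :: real
  assumes "x = p - 2 * q + s" "\<bar>p\<bar> \<le> u" "\<bar>q\<bar> \<le> u" "\<bar>s\<bar> \<le> u"
  shows "\<bar>x\<bar> \<le> 4 * u"
  using assms by linarith

section \<open>Grids, and sums over the points of a configuration\<close>

definition gridpt :: "real \<Rightarrow> real \<Rightarrow> nat \<Rightarrow> nat \<Rightarrow> real" where
  "gridpt a b m k = a + real k * (b - a) / real m"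

text \<open>Left end of the grid cell that contains \<open>s\<close>. Cells are open on the left,
  hence a ceiling minus 1 instead of a floor: the value lies strictly before \<open>s\<close> even
  when \<open>s\<close> is itself a grid point. For \<open>m = 0\<close> division by zero gives the
  value \<open>a\<close>.\<close>

definition gridleft :: "real \<Rightarrow> real \<Rightarrow> nat \<Rightarrow> real \<Rightarrow> real" where
  "gridleft a b m s = gridpt a b m (nat (\<lceil>(s - a) * real m / (b - a)\<rceil> - 1))"

lemma gridpt_0 [simp]: "gridpt a b m 0 = a"
  by (simp add: gridpt_def)

lemma gridpt_last [simp]: "m > 0 \<Longrightarrow> gridpt a b m m = b"
  by (simp add: gridpt_def)

lemma gridpt_mono: "a \<le> b \<Longrightarrow> k \<le> l \<Longrightarrow> gridpt a b m k \<le> gridpt a b m l"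
  by (simp add: gridpt_def divide_right_mono mult_right_mono)

lemma gridpt_range: "a \<le> b \<Longrightarrow> m > 0 \<Longrightarrow> k \<le> m \<Longrightarrow> gridpt a b m k \<in> {a..b}"
  using gridpt_mono[of a b 0 k m] gridpt_mono[of a b k m m] by simp

lemma gridleft_eq:
  assumes "a < b" "m > 0" "gridpt a b m k < s" "s \<le> gridpt a b m (Suc k)"
  shows "gridleft a b m s = gridpt a b m k"
proof -
  have "\<lceil>(s - a) * real m / (b - a)\<rceil> = int k + 1"
    using assms by (intro ceiling_unique) (auto simp: gridpt_def field_simps)
  then show ?thesis by (simp add: gridleft_def)
qed

lemma gridcell_ex:
  assumes "a < b" "m > 0" "s \<in> {a<..b}"
  obtains k where "k < m" "gridpt a b m k < s" "s \<le> gridpt a b m (Suc k)"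
proof -
  define x where "x = (s - a) * real m / (b - a)"
  have x: "0 < x" "x \<le> m" using assms by (auto simp: x_def field_simps)
  define k where "k = nat (\<lceil>x\<rceil> - 1)"
  have k: "int k = \<lceil>x\<rceil> - 1" using x by (simp add: k_def)
  then have kr: "real k < x" "x \<le> real k + 1" by linarith+
  have "k < m" using kr x by linarith
  moreover have "gridpt a b m k < s" "s \<le> gridpt a b m (Suc k)"
    using kr assms by (auto simp: x_def gridpt_def field_simps)
  ultimately show ?thesis using that by blast
qed

lemma gridcell_disjoint:
  assumes "a < b" "m > 0" "k \<noteq> l"
  shows "{gridpt a b m k<..gridpt a b m (Suc k)} \<inter> {gridpt a b m l<..gridpt a b m (Suc l)} = {}"
proof -
  have "gridpt a b m k \<noteq> gridpt a b m l" using assms by (auto simp: gridpt_def)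
  then show ?thesis using gridleft_eq[OF assms(1,2), of k] gridleft_eq[OF assms(1,2), of l]
    by (metis disjoint_iff greaterThanAtMost_iff)
qed

lemma gridcell_union:
  assumes "a < b" "m > 0"
  shows "(\<Union>k<m. {gridpt a b m k<..gridpt a b m (Suc k)}) = {a<..b}"
proof
  show "(\<Union>k<m. {gridpt a b m k<..gridpt a b m (Suc k)}) \<subseteq> {a<..b}"
  proof
    fix x assume "x \<in> (\<Union>k<m. {gridpt a b m k<..gridpt a b m (Suc k)})"
    then obtain k where k: "k < m" "gridpt a b m k < x" "x \<le> gridpt a b m (Suc k)" by auto
    then show "x \<in> {a<..b}"
      using gridpt_range[of a b m k] gridpt_range[of a b m "Suc k"] assms by auto
  qed
  show "{a<..b} \<subseteq> (\<Union>k<m. {gridpt a b m k<..gridpt a b m (Suc k)})"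
  proof
    fix s assume "s \<in> {a<..b}"
    from gridcell_ex[OF assms this] obtain k where
      "k < m" "gridpt a b m k < s" "s \<le> gridpt a b m (Suc k)" .
    then show "s \<in> (\<Union>k<m. {gridpt a b m k<..gridpt a b m (Suc k)})" by auto
  qed
qed

lemma gridleft_range:
  assumes "a < b" "m > 0" "s \<in> {a<..b}"
  shows "gridleft a b m s \<in> {a..<s}" "s - (b - a) / real m \<le> gridleft a b m s"
proof -
  from gridcell_ex[OF assms] obtain k where
    k: "k < m" "gridpt a b m k < s" "s \<le> gridpt a b m (Suc k)" .
  have eq: "gridleft a b m s = gridpt a b m k" by (rule gridleft_eq[OF assms(1,2) k(2,3)])
  show "gridleft a b m s \<in> {a..<s}"
    using eq k gridpt_range[of a b m k] assms by auto
  show "s - (b - a) / real m \<le> gridleft a b m s"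
    using k(3) unfolding eq by (simp add: gridpt_def add_divide_distrib distrib_right)
qed

lemma gridleft_tendsto:
  assumes "a < b" "s \<in> {a<..b}"
  shows "filterlim (\<lambda>m. gridleft a b m s) (at_left s) sequentially"
proof -
  have lt: "\<forall>\<^sub>F m in sequentially. gridleft a b m s < s"
  proof (rule eventually_mono[OF eventually_gt_at_top[of 0]])
    fix m :: nat assume "m > 0"
    from gridleft_range(1)[OF assms(1) this assms(2)] show "gridleft a b m s < s" by simp
  qed
  have "(\<lambda>m. s - (b - a) / real m) \<longlonglongrightarrow> s"
    by real_asymp
  then have "(\<lambda>m. gridleft a b m s) \<longlonglongrightarrow> s"
  proof (rule tendsto_sandwich[rotated 2])
    show "(\<lambda>m. s) \<longlonglongrightarrow> s" by simp
    show "\<forall>\<^sub>F m in sequentially. s - (b - a) / real m \<le> gridleft a b m s"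
      by (rule eventually_mono[OF eventually_gt_at_top[of 0]], rule gridleft_range(2)) (use assms in auto)
    show "\<forall>\<^sub>F m in sequentially. gridleft a b m s \<le> s"
      by (rule eventually_mono[OF lt]) simp
  qed
  with lt show ?thesis by (auto simp: filterlim_at elim: eventually_mono)
qed

lemma sum_grid_eq:
  fixes H :: "real \<Rightarrow> real"
  assumes "a < b" "m > 0" "finite (X \<inter> {a<..b})"
  shows "(\<Sum>k<m. H (gridpt a b m k) * card (X \<inter> {gridpt a b m k<..gridpt a b m (Suc k)}))
       = (\<Sum>s\<in>X \<inter> {a<..b}. H (gridleft a b m s))"
proof -
  have "(\<Sum>s\<in>X \<inter> {a<..b}. H (gridleft a b m s))
      = (\<Sum>s\<in>(\<Union>k<m. X \<inter> {gridpt a b m k<..gridpt a b m (Suc k)}). H (gridleft a b m s))"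
    using gridcell_union[OF assms(1,2)] by (intro sum.cong) auto
  also have "\<dots> = (\<Sum>k<m. \<Sum>s\<in>X \<inter> {gridpt a b m k<..gridpt a b m (Suc k)}. H (gridleft a b m s))"
  proof (intro sum.UNION_disjoint)
    show "\<forall>k\<in>{..<m}. finite (X \<inter> {gridpt a b m k<..gridpt a b m (Suc k)})"
      using gridcell_union[OF assms(1,2)] by (auto intro: finite_subset[OF _ assms(3)])
    show "\<forall>i\<in>{..<m}. \<forall>j\<in>{..<m}. i \<noteq> j \<longrightarrow>
       X \<inter> {gridpt a b m i<..gridpt a b m (Suc i)} \<inter> (X \<inter> {gridpt a b m j<..gridpt a b m (Suc j)}) = {}"
      using gridcell_disjoint[OF assms(1,2)] by blast
  qed auto
  also have "\<dots> = (\<Sum>k<m. H (gridpt a b m k) * card (X \<inter> {gridpt a b m k<..gridpt a b m (Suc k)}))"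
  proof (intro sum.cong refl)
    fix k
    have "(\<Sum>s\<in>X \<inter> {gridpt a b m k<..gridpt a b m (Suc k)}. H (gridleft a b m s))
        = (\<Sum>s\<in>X \<inter> {gridpt a b m k<..gridpt a b m (Suc k)}. H (gridpt a b m k))"
      by (intro sum.cong refl arg_cong[where f = H] gridleft_eq[OF assms(1,2)]) auto
    then show "(\<Sum>s\<in>X \<inter> {gridpt a b m k<..gridpt a b m (Suc k)}. H (gridleft a b m s))
        = H (gridpt a b m k) * card (X \<inter> {gridpt a b m k<..gridpt a b m (Suc k)})"
      by (simp add: mult.commute)
  qed
  finally show ?thesis ..
qed

text \<open>Each grid sum evaluates \<open>H\<close> strictly before the events it is paired with,
  so it uses only information from the start of a cell; left continuity of \<open>H\<close> recovers
  the values at the events in the limit.\<close>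

lemma sum_grid_tendsto:
  fixes H :: "real \<Rightarrow> real"
  assumes "a < b" "finite (X \<inter> {a<..b})" "\<And>s. s \<in> {a<..b} \<Longrightarrow> (H \<longlongrightarrow> H s) (at_left s)"
  shows "(\<lambda>m. \<Sum>k<m. H (gridpt a b m k) * card (X \<inter> {gridpt a b m k<..gridpt a b m (Suc k)}))
      \<longlonglongrightarrow> (\<Sum>s\<in>X \<inter> {a<..b}. H s)"
proof -
  have "(\<lambda>m. \<Sum>s\<in>X \<inter> {a<..b}. H (gridleft a b m s)) \<longlonglongrightarrow> (\<Sum>s\<in>X \<inter> {a<..b}. H s)"
    by (intro tendsto_sum filterlim_compose[OF assms(3) gridleft_tendsto] assms) auto
  moreover have "\<forall>\<^sub>F m in sequentially. (\<Sum>s\<in>X \<inter> {a<..b}. H (gridleft a b m s)) =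
     (\<Sum>k<m. H (gridpt a b m k) * card (X \<inter> {gridpt a b m k<..gridpt a b m (Suc k)}))"
    by (rule eventually_mono[OF eventually_gt_at_top[of 0]], rule sum_grid_eq[symmetric])
      (use assms in auto)
  ultimately show ?thesis by (rule Lim_transform_eventually)
qed

section \<open>Finite and locally finite point sets\<close>

lemma locally_finite_gap:
  fixes X :: "real set"
  assumes "\<And>t. finite (X \<inter> {0..t})" "X \<subseteq> {0..}"
  obtains \<delta> where "\<delta> > 0" "X \<inter> {t - \<delta><..<t + \<delta>} \<subseteq> {t}"
proof -
  define A where "A = X \<inter> {0..t + 1} - {t}"
  have "finite A" unfolding A_def using assms(1) by blast
  from finite_set_avoid[OF this, of t] obtain d where
    d: "d > 0" "\<forall>x\<in>A. x \<noteq> t \<longrightarrow> d \<le> dist t x" by blast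
  show ?thesis
  proof (rule that[of "min d 1"])
    show "X \<inter> {t - min d 1<..<t + min d 1} \<subseteq> {t}"
    proof
      fix x assume x: "x \<in> X \<inter> {t - min d 1<..<t + min d 1}"
      show "x \<in> {t}"
      proof (rule ccontr)
        assume "x \<notin> {t}"
        then have "x \<in> A" using x assms(2) by (auto simp: A_def)
        with d(2) \<open>x \<notin> {t}\<close> have "d \<le> dist t x" by blast
        with x show False by (auto simp: dist_real_def)
      qed
    qed
  qed (use d in auto)
qed

lemma sum_left_continuous:
  fixes h :: "real \<Rightarrow> real"
  assumes "\<And>t. finite (X \<inter> {0..t})" "X \<subseteq> {0..}"
  shows "((\<lambda>s. \<Sum>u\<in>X \<inter> {r<..<s}. h u) \<longlongrightarrow> (\<Sum>u\<in>X \<inter> {r<..<s}. h u)) (at_left s)"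
proof -
  obtain \<delta> where \<delta>: "\<delta> > 0" "X \<inter> {s - \<delta><..<s + \<delta>} \<subseteq> {s}"
    by (rule locally_finite_gap[OF assms, where t = s])
  have "\<forall>\<^sub>F x in at_left s. (\<Sum>u\<in>X \<inter> {r<..<s}. h u) = (\<Sum>u\<in>X \<inter> {r<..<x}. h u)"
    using eventually_at_left_real[of "s - \<delta>" s, simplified, OF \<delta>(1)]
  proof eventually_elim
    case (elim x)
    have "u < x" if "u \<in> X" "u < s" for u
    proof (rule ccontr)
      assume "\<not> u < x"
      then have "u \<in> X \<inter> {s - \<delta><..<s + \<delta>}" using that elim \<delta>(1) by auto
      then show False using \<delta>(2) that by auto
    qed
    then have "X \<inter> {r<..<s} = X \<inter> {r<..<x}" using elim by force
    then show ?case by simp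
  qed
  then show ?thesis by (rule tendsto_eventually[OF eventually_mono]) auto
qed

text \<open>Induction removing the point with the largest time. The exponent in each summand
  involves only strictly earlier points, which makes the summand a predictable integrand.
  Injectivity of \<open>\<tau>\<close> ensures that every other point is strictly earlier than the
  last one.\<close>

lemma exp_sum_telescope:
  fixes f :: "'b \<Rightarrow> real" and \<tau> :: "'b \<Rightarrow> real"
  assumes "finite P" "inj_on \<tau> P"
  shows "exp (\<Sum>p\<in>P. f p) = 1 + (\<Sum>p\<in>P. exp (\<Sum>q\<in>{q\<in>P. \<tau> q < \<tau> p}. f q) * (exp (f p) - 1))"
  using assms
proof (induction "card P" arbitrary: P)
  case 0
  then show ?case by simp
next
  case (Suc k)
  then have ne: "P \<noteq> {}" by auto
  have "Max (\<tau> ` P) \<in> \<tau> ` P" using Suc.prems ne by (intro Max_in) auto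
  then obtain p where p: "p \<in> P" "\<tau> p = Max (\<tau> ` P)" by force
  define Q where "Q = P - {p}"
  have P: "P = insert p Q" "p \<notin> Q" using p by (auto simp: Q_def)
  have fin: "finite Q" using Suc.prems by (simp add: Q_def)
  have lt: "\<tau> q < \<tau> p" if "q \<in> Q" for q
  proof -
    have "\<tau> q \<le> \<tau> p" using that Suc.prems p by (auto simp: Q_def)
    moreover have "\<tau> q \<noteq> \<tau> p" using that Suc.prems p by (auto simp: Q_def inj_on_def)
    ultimately show ?thesis by simp
  qed
  have "k = card Q" using Suc.hyps(2) Suc.prems p by (simp add: Q_def)
  moreover have "inj_on \<tau> Q" using Suc.prems by (auto simp: Q_def inj_on_def)
  ultimately have IH: "exp (\<Sum>p\<in>Q. f p) = 1 + (\<Sum>p\<in>Q. exp (\<Sum>q\<in>{q\<in>Q. \<tau> q < \<tau> p}. f q) * (exp (f p) - 1))"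
    using Suc.hyps(1) fin by blast
  have 1: "{q \<in> P. \<tau> q < \<tau> p} = Q" using lt P by auto
  have 2: "{q \<in> P. \<tau> q < \<tau> p'} = {q \<in> Q. \<tau> q < \<tau> p'}" if "p' \<in> Q" for p'
    using lt[OF that] P by auto
  have "(\<Sum>p\<in>P. exp (\<Sum>q\<in>{q\<in>P. \<tau> q < \<tau> p}. f q) * (exp (f p) - 1))
     = exp (\<Sum>q\<in>Q. f q) * (exp (f p) - 1) + (\<Sum>p\<in>Q. exp (\<Sum>q\<in>{q\<in>Q. \<tau> q < \<tau> p}. f q) * (exp (f p) - 1))"
    using 1 2 P fin by (simp cong: sum.cong)
  moreover have "exp (\<Sum>p\<in>P. f p) = exp (\<Sum>p\<in>Q. f p) * exp (f p)"
    using P fin by (simp add: exp_add)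
  ultimately show ?case using IH by (simp add: algebra_simps)
qed

text \<open>Pairs are split according to which coordinate is later. Each half is a sum, over the
  later point, of a count strictly before it, and this is a form to which the compensator formula
  applies.\<close>

lemma card_offdiagonal_eq:
  fixes X Y :: "real set"
  assumes "finite X" "finite Y"
  shows "card {(x, y) \<in> X \<times> Y. x \<noteq> y} = (\<Sum>x\<in>X. card (Y \<inter> {..<x})) + (\<Sum>y\<in>Y. card (X \<inter> {..<y}))"
proof -
  have "{(x, y) \<in> X \<times> Y. x \<noteq> y} = (SIGMA x:X. Y \<inter> {..<x}) \<union> prod.swap ` (SIGMA y:Y. X \<inter> {..<y})"
    by (auto simp: image_iff)
  moreover have "card \<dots> = card (SIGMA x:X. Y \<inter> {..<x}) + card (prod.swap ` (SIGMA y:Y. X \<inter> {..<y}))"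
    by (rule card_Un_disjoint) (use assms in auto)
  moreover have "card (prod.swap ` (SIGMA y:Y. X \<inter> {..<y})) = card (SIGMA y:Y. X \<inter> {..<y})"
    by (rule card_image) (auto simp: inj_on_def)
  ultimately show ?thesis using assms by simp
qed

section \<open>A concentration inequality\<close>

lemma exp_le_quadratic:
  fixes x :: real
  assumes "\<bar>x\<bar> \<le> 1"
  shows "exp x \<le> 1 + x + x\<^sup>2"
proof (cases "0 \<le> x")
  case True
  then show ?thesis using exp_bound[of x] assms by simp
next
  case False
  then have pos: "0 < 1 + x + x\<^sup>2" using assms by (simp add: add_pos_nonneg) (smt (verit) zero_less_power2)
  \<comment> \<open>The second factor is the quadratic Taylor lower bound for exp(-x), valid since x
    is negative here.\<close>
  have "1 \<le> (1 + x + x\<^sup>2) * (1 - x + x\<^sup>2 / 2)"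
  proof -
    have "(1 + x + x\<^sup>2) * (1 - x + x\<^sup>2 / 2) = 1 + x\<^sup>2 * (1 - x) / 2 + (x\<^sup>2)\<^sup>2 / 2"
      by (simp add: power2_eq_square field_simps)
    then show ?thesis using False by simp
  qed
  also have "\<dots> \<le> (1 + x + x\<^sup>2) * exp (- x)"
    using exp_lower_Taylor_quadratic[of "- x"] False pos by (intro mult_left_mono) auto
  finally show ?thesis by (simp add: exp_minus field_simps)
qed

text \<open>
  The drift \<open>r\<close> is deterministic, \<open>\<rho>\<close> is only small in mean. Its conditional expectations are
  subtracted along with \<open>r\<close> and controlled by Markov's inequality.
\<close>

lemma (in prob_space) azuma_upper:
  fixes G :: "nat \<Rightarrow> 'a measure" and Y \<rho> :: "nat \<Rightarrow> 'a \<Rightarrow> real"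
  assumes sub: "\<And>m. subalgebra M (G m)" and mono: "\<And>m. subalgebra (G (Suc m)) (G m)"
    and Y: "\<And>m. Y m \<in> borel_measurable (G (Suc m))" "\<And>m \<omega>. \<omega> \<in> space M \<Longrightarrow> \<bar>Y m \<omega>\<bar> \<le> c"
    and \<rho>: "\<And>m. integrable M (\<rho> m)" "\<And>m \<omega>. \<omega> \<in> space M \<Longrightarrow> 0 \<le> \<rho> m \<omega>"
    and drift: "\<And>m Z z. Z \<in> borel_measurable (G m) \<Longrightarrow> (\<And>\<omega>. \<omega> \<in> space M \<Longrightarrow> 0 \<le> Z \<omega>) \<Longrightarrow>
      (\<And>\<omega>. \<omega> \<in> space M \<Longrightarrow> Z \<omega> \<le> z) \<Longrightarrow>
      expectation (\<lambda>\<omega>. Z \<omega> * Y m \<omega>) \<le> r * expectation Z + expectation (\<lambda>\<omega>. Z \<omega> * \<rho> m \<omega>)"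
    and r: "0 \<le> r" and x: "0 < x" "x \<le> 2 * real N * c" and y: "0 < y" and N: "0 < N"
  shows "prob {\<omega> \<in> space M. real N * r + y + x \<le> (\<Sum>m<N. Y m \<omega>)}
    \<le> exp (- x\<^sup>2 / (4 * real N * c\<^sup>2)) + (\<Sum>m<N. expectation (\<rho> m)) / y"
proof -
  have c: "0 < c" using x N by (smt (verit) mult_nonneg_nonpos of_nat_0_le_iff)
  \<comment> \<open>The minimiser of N \<theta>^2 c^2 - \<theta> x. The hypothesis
    \<open>x \<le> 2 * real N * c\<close> is what gives \<theta> c \<le> 1, the range in which the
    quadratic bound on exp is available.\<close>
  define \<theta> where "\<theta> = x / (2 * real N * c\<^sup>2)"
  have \<theta>: "0 < \<theta>" "\<theta> * c \<le> 1" using x c N by (auto simp: \<theta>_def power2_eq_square field_simps)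
  \<comment> \<open>A version of the conditional expectation that is nonnegative everywhere, not
    just almost surely, and known at time \<open>m\<close>; it can therefore be placed inside the
    exponent.\<close>
  define q where "q = (\<lambda>m \<omega>. max 0 (real_cond_exp M (G m) (\<rho> m) \<omega>))"
  have q_meas: "q m \<in> borel_measurable (G m)" for m
    unfolding q_def by (intro borel_measurable_max borel_measurable_cond_exp) auto
  have q0: "0 \<le> q m \<omega>" for m \<omega> by (simp add: q_def)
  have from_G: "f \<in> borel_measurable M" if "f \<in> borel_measurable (G m)" for f :: "'a \<Rightarrow> real" and m
    by (rule measurable_from_subalg[OF sub that])
  have q: "integrable M (q m)" "integrable M (\<lambda>\<omega>. Z \<omega> * q m \<omega>)"
    "expectation (\<lambda>\<omega>. Z \<omega> * \<rho> m \<omega>) = expectation (\<lambda>\<omega>. Z \<omega> * q m \<omega>)"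
    if Z: "Z \<in> borel_measurable (G m)" "\<And>\<omega>. \<omega> \<in> space M \<Longrightarrow> 0 \<le> Z \<omega>" "\<And>\<omega>. \<omega> \<in> space M \<Longrightarrow> Z \<omega> \<le> z" for m Z z
  proof -
    interpret s: finite_measure_subalgebra M "G m" by unfold_locales (rule sub)
    have ae: "AE \<omega> in M. q m \<omega> = real_cond_exp M (G m) (\<rho> m) \<omega>"
    proof -
      have "AE \<omega> in M. 0 \<le> real_cond_exp M (G m) (\<rho> m) \<omega>"
        by (rule s.real_cond_exp_pos) (use \<rho> in auto)
      then show ?thesis by eventually_elim (simp add: q_def)
    qed
    have int: "integrable M (\<lambda>\<omega>. Z \<omega> * \<rho> m \<omega>)"
      by (rule Bochner_Integration.integrable_bound[of _ "\<lambda>\<omega>. z * \<rho> m \<omega>"])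
        (use \<rho> from_G[OF Z(1)] Z(2,3) in \<open>auto simp: abs_mult intro!: AE_I2 mult_right_mono, force?\<close>)
    note ce = s.real_cond_exp_intg[OF int Z(1) borel_measurable_integrable[OF \<rho>(1)]]
    show "integrable M (q m)"
      by (rule integrable_cong_AE_imp[OF s.real_cond_exp_int(1)[OF \<rho>(1)] from_G[OF q_meas]])
        (use ae in \<open>eventually_elim, simp\<close>)
    show "integrable M (\<lambda>\<omega>. Z \<omega> * q m \<omega>)"
      by (rule integrable_cong_AE_imp[OF ce(1)])
        (use ae from_G[OF q_meas] from_G[OF Z(1)] in auto)
    show "expectation (\<lambda>\<omega>. Z \<omega> * \<rho> m \<omega>) = expectation (\<lambda>\<omega>. Z \<omega> * q m \<omega>)"
      unfolding ce(2)[symmetric]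
      by (rule integral_cong_AE) (use ae from_G[OF q_meas] from_G[OF Z(1)] in auto)
  qed
  have q_int: "integrable M (q m)" and Eq: "expectation (q m) = expectation (\<rho> m)" for m
    using q(1,3)[of "\<lambda>_. 1" m 1] by auto
  \<comment> \<open>With the drift \<open>r\<close> and \<open>q\<close> subtracted, this
    exponential process is a supermartingale up to a factor exp(\<theta>^2 c^2) per step.\<close>
  define W where "W = (\<lambda>k \<omega>. exp (\<theta> * (\<Sum>m<k. Y m \<omega> - r - q m \<omega>)))"
  have Gmono: "f \<in> borel_measurable (G k)" if "f \<in> borel_measurable (G m)" "m \<le> k" for f :: "'a \<Rightarrow> real" and m k
    using that(2,1) by (induction rule: dec_induct) (auto intro: measurable_from_subalg[OF mono])
  have W_meas: "W k \<in> borel_measurable (G k)" for k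
    unfolding W_def
  proof (intro borel_measurable_exp[THEN measurable_compose[rotated]] borel_measurable_times borel_measurable_sum borel_measurable_diff)
    fix m assume "m \<in> {..<k}"
    then show "Y m \<in> borel_measurable (G k)" "q m \<in> borel_measurable (G k)"
      by (auto intro: Gmono[OF Y(1)] Gmono[OF q_meas])
  qed auto
  have W_bound: "W k \<omega> \<le> exp (\<theta> * (real k * c))" if "\<omega> \<in> space M" for k \<omega>
  proof -
    have "(\<Sum>m<k. Y m \<omega> - r - q m \<omega>) \<le> (\<Sum>m<k. c)"
      using Y(2)[OF that] q0 r by (intro sum_mono) (smt (verit))
    then show ?thesis unfolding W_def using \<theta>(1) by simp
  qed
  have W0: "0 \<le> W k \<omega>" for k \<omega> by (simp add: W_def)
  have W_int: "integrable M (W k)" for k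
    by (rule integrable_const_bound[of _ "exp (\<theta> * (real k * c))"])
      (use W_bound W0 from_G[OF W_meas] in auto)
  have step: "expectation (W (Suc k)) \<le> exp (\<theta>\<^sup>2 * c\<^sup>2) * expectation (W k)" for k
  proof -
    \<comment> \<open>The part of \<open>W (Suc k)\<close> that is known at time \<open>k\<close>.
      It is nonnegative and bounded, so the drift hypothesis can be used with this weight.\<close>
    define Z where "Z = (\<lambda>\<omega>. W k \<omega> * exp (- \<theta> * (r + q k \<omega>)))"
    have Z_meas: "Z \<in> borel_measurable (G k)" unfolding Z_def using W_meas q_meas by measurable
    have Z0: "0 \<le> Z \<omega>" for \<omega> using W0 by (simp add: Z_def)
    have ZW: "Z \<omega> \<le> W k \<omega>" for \<omega>
      unfolding Z_def using W0[of k \<omega>] \<theta>(1) r q0[of k \<omega>] by (intro mult_left_le) auto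
    have Zb: "Z \<omega> \<le> exp (\<theta> * (real k * c))" if "\<omega> \<in> space M" for \<omega>
      using ZW[of \<omega>] W_bound[OF that, of k] by simp
    have Z_int: "integrable M Z"
      by (rule integrable_const_bound[of _ "exp (\<theta> * (real k * c))"])
        (use Zb Z0 from_G[OF Z_meas] in auto)
    note qZ = q[OF Z_meas Z0 Zb]
    have ZY_int: "integrable M (\<lambda>\<omega>. Z \<omega> * Y k \<omega>)"
    proof (rule Bochner_Integration.integrable_bound[of _ "\<lambda>\<omega>. c * Z \<omega>"])
      show "AE \<omega> in M. norm (Z \<omega> * Y k \<omega>) \<le> norm (c * Z \<omega>)"
      proof (rule AE_I2)
        fix \<omega> assume "\<omega> \<in> space M"
        from mult_left_mono[OF Y(2)[OF this, of k] Z0[of \<omega>]] show "norm (Z \<omega> * Y k \<omega>) \<le> norm (c * Z \<omega>)"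
          using Z0[of \<omega>] c by (simp add: abs_mult mult.commute)
      qed
    qed (use Z_int from_G[OF Z_meas] from_G[OF Y(1)] in auto)
    have "expectation (W (Suc k)) \<le> expectation (\<lambda>\<omega>. (1 + \<theta>\<^sup>2 * c\<^sup>2) * Z \<omega> + \<theta> * (Z \<omega> * Y k \<omega>))"
    proof (rule integral_mono[OF W_int])
      show "integrable M (\<lambda>\<omega>. (1 + \<theta>\<^sup>2 * c\<^sup>2) * Z \<omega> + \<theta> * (Z \<omega> * Y k \<omega>))" using Z_int ZY_int by simp
      fix \<omega> assume \<omega>: "\<omega> \<in> space M"
      have W_Suc: "W (Suc k) \<omega> = Z \<omega> * exp (\<theta> * Y k \<omega>)"
        unfolding W_def Z_def by (simp add: algebra_simps flip: exp_add)
      have Yc: "\<bar>\<theta> * Y k \<omega>\<bar> \<le> \<theta> * c" using Y(2)[OF \<omega>, of k] \<theta>(1) by (simp add: abs_mult)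
      then have "exp (\<theta> * Y k \<omega>) \<le> 1 + \<theta> * Y k \<omega> + (\<theta> * Y k \<omega>)\<^sup>2"
        using \<theta>(2) by (intro exp_le_quadratic) simp
      also have "(\<theta> * Y k \<omega>)\<^sup>2 \<le> (\<theta> * c)\<^sup>2" using Yc by (simp add: abs_le_square_iff[symmetric])
      finally have "Z \<omega> * exp (\<theta> * Y k \<omega>) \<le> Z \<omega> * (1 + \<theta> * Y k \<omega> + (\<theta> * c)\<^sup>2)"
        using Z0 by (intro mult_left_mono) auto
      then show "W (Suc k) \<omega> \<le> (1 + \<theta>\<^sup>2 * c\<^sup>2) * Z \<omega> + \<theta> * (Z \<omega> * Y k \<omega>)"
        unfolding W_Suc by (simp add: power_mult_distrib algebra_simps)
    qed
    also have "\<dots> = (1 + \<theta>\<^sup>2 * c\<^sup>2) * expectation Z + \<theta> * expectation (\<lambda>\<omega>. Z \<omega> * Y k \<omega>)"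
      using Z_int ZY_int by simp
    also have "\<dots> \<le> (1 + \<theta>\<^sup>2 * c\<^sup>2) * expectation Z + \<theta> * (r * expectation Z + expectation (\<lambda>\<omega>. Z \<omega> * q k \<omega>))"
      using drift[OF Z_meas Z0 Zb] qZ(3) \<theta>(1) by simp
    also have "\<dots> = expectation (\<lambda>\<omega>. (1 + \<theta>\<^sup>2 * c\<^sup>2 + \<theta> * r) * Z \<omega> + \<theta> * (Z \<omega> * q k \<omega>))"
      using Z_int qZ(2) by (simp add: algebra_simps)
    also have "\<dots> \<le> expectation (\<lambda>\<omega>. exp (\<theta>\<^sup>2 * c\<^sup>2) * W k \<omega>)"
    proof (rule integral_mono)
      show "integrable M (\<lambda>\<omega>. (1 + \<theta>\<^sup>2 * c\<^sup>2 + \<theta> * r) * Z \<omega> + \<theta> * (Z \<omega> * q k \<omega>))" using Z_int qZ(2) by simp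
      show "integrable M (\<lambda>\<omega>. exp (\<theta>\<^sup>2 * c\<^sup>2) * W k \<omega>)" using W_int by simp
      fix \<omega>
      \<comment> \<open>The accumulated drift terms have the form 1 + u. Passing to exp u cancels
        the factor by which \<open>Z\<close> differs from \<open>W k\<close>.\<close>
      have "1 + (\<theta>\<^sup>2 * c\<^sup>2 + \<theta> * (r + q k \<omega>)) \<le> exp (\<theta>\<^sup>2 * c\<^sup>2 + \<theta> * (r + q k \<omega>))" by (rule exp_ge_add_one_self)
      from mult_left_mono[OF this Z0[of \<omega>]]
      have "(1 + \<theta>\<^sup>2 * c\<^sup>2 + \<theta> * r) * Z \<omega> + \<theta> * (Z \<omega> * q k \<omega>) \<le> Z \<omega> * exp (\<theta>\<^sup>2 * c\<^sup>2 + \<theta> * (r + q k \<omega>))"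
        by (simp add: algebra_simps)
      also have "\<dots> = exp (\<theta>\<^sup>2 * c\<^sup>2) * W k \<omega>" unfolding Z_def by (simp add: exp_add exp_minus)
      finally show "(1 + \<theta>\<^sup>2 * c\<^sup>2 + \<theta> * r) * Z \<omega> + \<theta> * (Z \<omega> * q k \<omega>) \<le> exp (\<theta>\<^sup>2 * c\<^sup>2) * W k \<omega>" .
    qed
    finally show ?thesis by simp
  qed
  have EW: "expectation (W k) \<le> exp (real k * (\<theta>\<^sup>2 * c\<^sup>2))" for k
  proof (induction k)
    case 0
    then show ?case by (simp add: W_def prob_space)
  next
    case (Suc k)
    have "expectation (W (Suc k)) \<le> exp (\<theta>\<^sup>2 * c\<^sup>2) * expectation (W k)" by (rule step)
    also have "\<dots> \<le> exp (\<theta>\<^sup>2 * c\<^sup>2) * exp (real k * (\<theta>\<^sup>2 * c\<^sup>2))" by (intro mult_left_mono Suc.IH) auto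
    finally show ?case by (simp add: algebra_simps flip: exp_add)
  qed
  define A where "A = {\<omega> \<in> space M. exp (\<theta> * x) \<le> W N \<omega>}"
  define B where "B = {\<omega> \<in> space M. y \<le> (\<Sum>m<N. q m \<omega>)}"
  have A_sets: "A \<in> sets M" unfolding A_def using from_G[OF W_meas] by measurable
  have B_sets: "B \<in> sets M" unfolding B_def using from_G[OF q_meas] by measurable
  \<comment> \<open>A large sum forces either a large total of the \<open>q m\<close>, which
    Markov's inequality bounds in mean, or a large value of \<open>W N\<close>.\<close>
  have "prob {\<omega> \<in> space M. real N * r + y + x \<le> (\<Sum>m<N. Y m \<omega>)} \<le> prob (A \<union> B)"
  proof (rule finite_measure_mono[OF _ sets.Un[OF A_sets B_sets]], rule subsetI)
    fix \<omega> assume "\<omega> \<in> {\<omega> \<in> space M. real N * r + y + x \<le> (\<Sum>m<N. Y m \<omega>)}"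
    then have \<omega>: "\<omega> \<in> space M" "real N * r + y + x \<le> (\<Sum>m<N. Y m \<omega>)" by auto
    show "\<omega> \<in> A \<union> B"
    proof (rule ccontr)
      assume no: "\<omega> \<notin> A \<union> B"
      then have "(\<Sum>m<N. q m \<omega>) < y" using \<omega> by (auto simp: B_def)
      moreover have "(\<Sum>m<N. Y m \<omega> - r - q m \<omega>) < x"
        using no \<omega> \<theta>(1) by (auto simp: A_def W_def not_le)
      moreover have "(\<Sum>m<N. Y m \<omega> - r - q m \<omega>) = (\<Sum>m<N. Y m \<omega>) - real N * r - (\<Sum>m<N. q m \<omega>)"
        by (simp add: sum_subtractf)
      ultimately show False using \<omega>(2) by linarith
    qed
  qed
  also have "\<dots> \<le> prob A + prob B" by (rule measure_Un_le[OF A_sets B_sets])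
  also have "prob B \<le> expectation (\<lambda>\<omega>. \<Sum>m<N. q m \<omega>) / y"
    unfolding B_def by (rule integral_Markov_inequality_measure[OF _ sets.top _ y])
      (use q_int q0 in \<open>auto intro!: AE_I2 sum_nonneg\<close>)
  also have "expectation (\<lambda>\<omega>. \<Sum>m<N. q m \<omega>) = (\<Sum>m<N. expectation (\<rho> m))"
    using q_int Eq by simp
  also have "prob A \<le> expectation (W N) / exp (\<theta> * x)"
    unfolding A_def by (rule integral_Markov_inequality_measure[OF W_int sets.top]) (use W0 in auto)
  also have "\<dots> \<le> exp (real N * (\<theta>\<^sup>2 * c\<^sup>2)) / exp (\<theta> * x)" by (intro divide_right_mono EW) auto
  also have "\<dots> = exp (real N * (\<theta>\<^sup>2 * c\<^sup>2) - \<theta> * x)" by (simp add: exp_diff)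
  also have "real N * (\<theta>\<^sup>2 * c\<^sup>2) - \<theta> * x = - x\<^sup>2 / (4 * real N * c\<^sup>2)"
    using c N by (simp add: \<theta>_def power2_eq_square field_simps)
  finally show ?thesis by simp
qed

lemma (in prob_space) azuma_two_sided:
  fixes G :: "nat \<Rightarrow> 'a measure" and Y \<rho> :: "nat \<Rightarrow> 'a \<Rightarrow> real"
  assumes sub: "\<And>m. subalgebra M (G m)" and mono: "\<And>m. subalgebra (G (Suc m)) (G m)"
    and Y: "\<And>m. Y m \<in> borel_measurable (G (Suc m))" "\<And>m \<omega>. \<omega> \<in> space M \<Longrightarrow> \<bar>Y m \<omega>\<bar> \<le> c"
    and \<rho>: "\<And>m. integrable M (\<rho> m)" "\<And>m \<omega>. \<omega> \<in> space M \<Longrightarrow> 0 \<le> \<rho> m \<omega>"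
    and drift: "\<And>m Z z. Z \<in> borel_measurable (G m) \<Longrightarrow> (\<And>\<omega>. \<omega> \<in> space M \<Longrightarrow> 0 \<le> Z \<omega>) \<Longrightarrow>
      (\<And>\<omega>. \<omega> \<in> space M \<Longrightarrow> Z \<omega> \<le> z) \<Longrightarrow>
      \<bar>expectation (\<lambda>\<omega>. Z \<omega> * Y m \<omega>)\<bar> \<le> r * expectation Z + expectation (\<lambda>\<omega>. Z \<omega> * \<rho> m \<omega>)"
    and r: "0 \<le> r" and x: "0 < x" "x \<le> 2 * real N * c" and y: "0 < y" and N: "0 < N"
  shows "prob {\<omega> \<in> space M. real N * r + y + x \<le> \<bar>\<Sum>m<N. Y m \<omega>\<bar>}
    \<le> 2 * (exp (- x\<^sup>2 / (4 * real N * c\<^sup>2)) + (\<Sum>m<N. expectation (\<rho> m)) / y)"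
proof -
  let ?S = "\<lambda>\<omega>. \<Sum>m<N. Y m \<omega>" and ?a = "real N * r + y + x"
  have YM: "Y m \<in> borel_measurable M" for m by (rule measurable_from_subalg[OF sub Y(1)])
  have "prob {\<omega> \<in> space M. ?a \<le> \<bar>?S \<omega>\<bar>}
      \<le> prob ({\<omega> \<in> space M. ?a \<le> ?S \<omega>} \<union> {\<omega> \<in> space M. ?a \<le> (\<Sum>m<N. - Y m \<omega>)})"
  proof (rule finite_measure_mono)
    show "{\<omega> \<in> space M. ?a \<le> ?S \<omega>} \<union> {\<omega> \<in> space M. ?a \<le> (\<Sum>m<N. - Y m \<omega>)} \<in> sets M"
      using YM by measurable
  qed (auto simp: sum_negf abs_real_def split: if_splits)
  also have "\<dots> \<le> prob {\<omega> \<in> space M. ?a \<le> ?S \<omega>} + prob {\<omega> \<in> space M. ?a \<le> (\<Sum>m<N. - Y m \<omega>)}"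
    by (rule measure_Un_le) (use YM in measurable)
  also have "prob {\<omega> \<in> space M. ?a \<le> ?S \<omega>} \<le> exp (- x\<^sup>2 / (4 * real N * c\<^sup>2)) + (\<Sum>m<N. expectation (\<rho> m)) / y"
  proof (rule azuma_upper[where G = G and Y = Y and \<rho> = \<rho> and c = c, OF sub mono Y \<rho> _ r x y N])
    fix m :: nat and Z :: "'a \<Rightarrow> real" and z :: real
    assume "Z \<in> borel_measurable (G m)" "\<And>\<omega>. \<omega> \<in> space M \<Longrightarrow> 0 \<le> Z \<omega>" "\<And>\<omega>. \<omega> \<in> space M \<Longrightarrow> Z \<omega> \<le> z"
    from drift[OF this] show "expectation (\<lambda>\<omega>. Z \<omega> * Y m \<omega>) \<le> r * expectation Z + expectation (\<lambda>\<omega>. Z \<omega> * \<rho> m \<omega>)"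
      by simp
  qed
  also have "prob {\<omega> \<in> space M. ?a \<le> (\<Sum>m<N. - Y m \<omega>)} \<le> exp (- x\<^sup>2 / (4 * real N * c\<^sup>2)) + (\<Sum>m<N. expectation (\<rho> m)) / y"
  proof (rule azuma_upper[where G = G and Y = "\<lambda>m \<omega>. - Y m \<omega>" and \<rho> = \<rho> and c = c, OF sub mono _ _ \<rho> _ r x y N])
    fix m :: nat and Z :: "'a \<Rightarrow> real" and z :: real
    assume "Z \<in> borel_measurable (G m)" "\<And>\<omega>. \<omega> \<in> space M \<Longrightarrow> 0 \<le> Z \<omega>" "\<And>\<omega>. \<omega> \<in> space M \<Longrightarrow> Z \<omega> \<le> z"
    from drift[OF this] show "expectation (\<lambda>\<omega>. Z \<omega> * - Y m \<omega>) \<le> r * expectation Z + expectation (\<lambda>\<omega>. Z \<omega> * \<rho> m \<omega>)"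
      by simp
  qed (use Y in auto)
  finally show ?thesis by simp
qed

lemma (in prob_space) integrable_bounded:
  fixes f :: "'a \<Rightarrow> real"
  assumes "f \<in> borel_measurable M" "\<And>\<omega>. \<omega> \<in> space M \<Longrightarrow> \<bar>f \<omega>\<bar> \<le> c"
  shows "integrable M f"
  by (rule integrable_const_bound[of _ c]) (use assms in auto)

lemma (in prob_space) integrable_bounded_mult:
  fixes Z f :: "'a \<Rightarrow> real"
  assumes "integrable M f" "Z \<in> borel_measurable M" "\<And>\<omega>. \<omega> \<in> space M \<Longrightarrow> \<bar>Z \<omega>\<bar> \<le> c"
  shows "integrable M (\<lambda>\<omega>. Z \<omega> * f \<omega>)"
proof (rule Bochner_Integration.integrable_bound[of _ "\<lambda>\<omega>. c * f \<omega>"])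
  show "AE \<omega> in M. norm (Z \<omega> * f \<omega>) \<le> norm (c * f \<omega>)"
  proof (rule AE_I2)
    fix \<omega> assume "\<omega> \<in> space M"
    then have "\<bar>Z \<omega>\<bar> \<le> \<bar>c\<bar>" using assms(3) by fastforce
    then show "norm (Z \<omega> * f \<omega>) \<le> norm (c * f \<omega>)" by (simp add: abs_mult mult_right_mono)
  qed
qed (use assms in auto)

lemma (in prob_space) abs_expectation_diff_le:
  fixes f g h :: "'a \<Rightarrow> real"
  assumes "integrable M f" "integrable M g" "integrable M h" "AE \<omega> in M. \<bar>f \<omega> - g \<omega>\<bar> \<le> h \<omega>"
  shows "\<bar>expectation f - expectation g\<bar> \<le> expectation h"
proof -
  have "\<bar>expectation f - expectation g\<bar> = \<bar>expectation (\<lambda>\<omega>. f \<omega> - g \<omega>)\<bar>" using assms by simp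
  also have "\<dots> \<le> expectation (\<lambda>\<omega>. \<bar>f \<omega> - g \<omega>\<bar>)" by (rule integral_abs_bound)
  also have "\<dots> \<le> expectation h" by (rule integral_mono_AE) (use assms in auto)
  finally show ?thesis .
qed

lemma (in prob_space) expectation_weighted_sum:
  fixes f :: "nat \<Rightarrow> 'a \<Rightarrow> real" and n :: nat
  assumes f: "\<And>j. j \<in> {1..n} \<Longrightarrow> integrable M (f j)" and g: "integrable M g"
  shows "expectation (\<lambda>\<omega>. x * (\<Sum>j=1..n. v j * f j \<omega>) + g \<omega>)
    = x * (\<Sum>j=1..n. v j * expectation (f j)) + expectation g"
proof -
  have vf: "integrable M (\<lambda>\<omega>. v j * f j \<omega>)" if "j \<in> {1..n}" for j using f[OF that] by simp
  then have s: "integrable M (\<lambda>\<omega>. \<Sum>j=1..n. v j * f j \<omega>)"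
    by (rule Bochner_Integration.integrable_sum)
  have "expectation (\<lambda>\<omega>. \<Sum>j=1..n. v j * f j \<omega>) = (\<Sum>j=1..n. expectation (\<lambda>\<omega>. v j * f j \<omega>))"
    by (rule Bochner_Integration.integral_sum[OF vf])
  then show ?thesis using s g by simp
qed

section \<open>Consequences of the assumptions on base rates, kernels and weights\<close>

locale hawkes_setting = hawkes_process M n E \<mu> \<phi> w
  for M :: "'a measure" and n E \<mu> \<phi> w +
  fixes \<mu>_min \<mu>_max \<Phi> \<eta> L w_min w_max w_sep :: real and d :: nat
  assumes mu_min_pos: "\<mu>_min > 0" and eta_pos: "\<eta> > 0" and L_pos: "L > 0"
    and w_min_pos: "w_min > 0" and w_max_pos: "w_max > 0" and w_sep_pos: "w_sep > 0"
    and n_pos: "n \<ge> 1"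
    and base: "base_rates_bounded n \<mu> \<mu>_min \<mu>_max"
    and regular: "kernels_regular n \<phi>"
    and subcritical: "kernels_subcritical n \<phi> w \<Phi> \<eta>"
    and log_derivatives: "log_derivatives_bounded n \<mu> \<phi> L"
    and separated: "weights_separated n w w_min w_max w_sep"
    and sparse: "weights_sparse n w d"
begin

abbreviation F :: "real \<Rightarrow> 'a measure" where "F \<equiv> natural_filtration M n E"

definition lam :: "nat \<Rightarrow> real \<Rightarrow> 'a \<Rightarrow> real" where
  "lam i t \<omega> = hawkes_rate n \<mu> \<phi> w (\<lambda>j. E j \<omega>) i t"

definition cnt :: "nat \<Rightarrow> real \<Rightarrow> 'a \<Rightarrow> real" where
  "cnt i t \<omega> = real (counting_process E i t \<omega>)"

lemma lam_eq: "lam i t \<omega> = \<mu> i t + (\<Sum>j=1..n. w i j * (\<Sum>s\<in>E j \<omega> \<inter> {0..t}. \<phi> i j t s))"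
  by (simp add: lam_def hawkes_rate_def)

lemma cnt_eq: "cnt i t \<omega> = real (card (E i \<omega> \<inter> {0..t}))"
  by (simp add: cnt_def counting_process_def num_events_def)

lemma cnt_nonneg [simp]: "0 \<le> cnt i t \<omega>"
  by (simp add: cnt_def)

lemma events_finite:
  assumes "i \<in> {1..n}" "\<omega> \<in> space M" "S \<subseteq> {..t}"
  shows "finite (E i \<omega> \<inter> S)"
  by (rule finite_subset[OF _ locally_finite[OF assms(1,2), of t]])
    (use events_nonneg[OF assms(1,2)] assms(3) in auto)

lemma card_Ioc:
  assumes "i \<in> {1..n}" "\<omega> \<in> space M" "0 \<le> x" "x \<le> y"
  shows "real (card (E i \<omega> \<inter> {x<..y})) = cnt i y \<omega> - cnt i x \<omega>"
proof -
  have "E i \<omega> \<inter> {0..y} = (E i \<omega> \<inter> {0..x}) \<union> (E i \<omega> \<inter> {x<..y})" using assms(3,4) by auto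
  moreover have "finite (E i \<omega> \<inter> {0..x})" "finite (E i \<omega> \<inter> {x<..y})"
    using assms(4) by (auto intro!: events_finite[OF assms(1,2), where t = y])
  then have "card ((E i \<omega> \<inter> {0..x}) \<union> (E i \<omega> \<inter> {x<..y}))
      = card (E i \<omega> \<inter> {0..x}) + card (E i \<omega> \<inter> {x<..y})"
    by (rule card_Un_disjoint) auto
  ultimately show ?thesis by (simp add: cnt_eq)
qed

lemma cnt_mono:
  assumes "i \<in> {1..n}" "\<omega> \<in> space M" "x \<le> y"
  shows "cnt i x \<omega> \<le> cnt i y \<omega>"
  unfolding cnt_eq of_nat_le_iff using assms(3)
  by (intro card_mono events_finite[OF assms(1,2), where t = y]) auto

lemma space_F [simp]: "space (F t) = space M"
  by (simp add: natural_filtration_def space_measure_of_conv)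

lemma sets_F:
  "sets (F t) = sigma_sets (space M)
    {counting_process E j s -` B \<inter> space M | j s B. j \<in> {1..n} \<and> 0 \<le> s \<and> s \<le> t}"
  unfolding natural_filtration_def by (rule sets_measure_of) auto

lemma cnt_measurable_F:
  assumes "i \<in> {1..n}" "0 \<le> s" "s \<le> t"
  shows "cnt i s \<in> borel_measurable (F t)"
proof -
  have "counting_process E i s \<in> measurable (F t) (count_space UNIV)"
  proof (rule measurableI)
    fix B show "counting_process E i s -` B \<inter> space (F t) \<in> sets (F t)"
      unfolding sets_F space_F using assms by (intro sigma_sets.Basic) blast
  qed simp
  then show ?thesis unfolding cnt_def by measurable
qed

lemma subalgebra_F: "subalgebra M (F t)"
  unfolding subalgebra_def sets_F space_F
proof (intro conjI refl sigma_sets_le_sets_iff[THEN iffD2])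
  show "{counting_process E j s -` B \<inter> space M | j s B. j \<in> {1..n} \<and> 0 \<le> s \<and> s \<le> t} \<subseteq> sets M"
    using counts_measurable by (auto intro!: measurable_sets)
qed

lemma subalgebra_F_mono: "s \<le> t \<Longrightarrow> subalgebra (F t) (F s)"
  unfolding subalgebra_def sets_F space_F
  by (intro conjI refl sigma_sets_mono') fastforce

lemma measurable_F_M: "f \<in> borel_measurable (F t) \<Longrightarrow> f \<in> borel_measurable M"
  by (rule measurable_from_subalg[OF subalgebra_F])

lemma measurable_F_mono: "f \<in> borel_measurable (F s) \<Longrightarrow> s \<le> t \<Longrightarrow> f \<in> borel_measurable (F t)"
  by (rule measurable_from_subalg[OF subalgebra_F_mono])

lemma w_bounds:
  assumes "i \<in> {1..n}" "j \<in> {1..n}"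
  shows "0 \<le> w i j" "w i j \<le> w_max" "w i j \<noteq> 0 \<Longrightarrow> w_min \<le> w i j"
proof -
  have "w i j = 0 \<or> w_min \<le> w i j \<and> w i j \<le> w_max"
    using separated assms unfolding weights_separated_def by blast
  then show "w i j \<le> w_max" "w i j \<noteq> 0 \<Longrightarrow> w_min \<le> w i j" using w_max_pos by auto
qed (rule w_nonneg[OF assms])

lemma mu_bounds:
  assumes "i \<in> {1..n}" "0 \<le> t"
  shows "\<mu>_min \<le> \<mu> i t" "\<mu> i t \<le> \<mu>_max"
  using base assms unfolding base_rates_bounded_def by blast+

lemma mu_max_pos: "\<mu>_max > 0"
proof -
  have "1 \<in> {1..n}" using n_pos by simp
  from mu_bounds[OF this order_refl] show ?thesis using mu_min_pos by linarith
qed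

lemma mu_deriv:
  assumes "i \<in> {1..n}" "0 \<le> t"
  obtains D where "(\<mu> i has_real_derivative D) (at t within {0..})" "\<bar>D\<bar> \<le> L * \<mu> i t"
proof -
  obtain D where "(\<mu> i has_real_derivative D) (at t within {0..})" "\<bar>D\<bar> / \<mu> i t \<le> L"
    using log_derivatives assms unfolding log_derivatives_bounded_def by blast
  moreover have "\<mu> i t > 0" using mu_bounds(1)[OF assms] mu_min_pos by simp
  ultimately show ?thesis using that by (simp add: divide_le_eq)
qed

lemma mu_continuous: "i \<in> {1..n} \<Longrightarrow> continuous_on {0..} (\<mu> i)"
  unfolding continuous_on_eq_continuous_within
  by (metis atLeast_iff mu_deriv DERIV_continuous)

lemma mu_Lipschitz:
  assumes "i \<in> {1..n}" "0 \<le> u" "u \<le> t"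
  shows "\<bar>\<mu> i t - \<mu> i u\<bar> \<le> L * \<mu>_max * (t - u)"
proof (rule mvt_abs_le[OF assms(3)])
  show "continuous_on {u..t} (\<mu> i)"
    by (rule continuous_on_subset[OF mu_continuous[OF assms(1)]]) (use assms in auto)
  fix x assume x: "u < x" "x < t"
  obtain D where D: "(\<mu> i has_real_derivative D) (at x within {0..})" "\<bar>D\<bar> \<le> L * \<mu> i x"
    by (rule mu_deriv[OF assms(1), of x]) (use x assms in auto)
  have "at x within {0..} = at x" using x assms by (intro at_within_interior) auto
  moreover have "L * \<mu> i x \<le> L * \<mu>_max" using mu_bounds(2)[OF assms(1), of x] x assms L_pos by simp
  ultimately show "\<exists>D. (\<mu> i has_real_derivative D) (at x) \<and> \<bar>D\<bar> \<le> L * \<mu>_max" using D by auto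
qed

context
  fixes i j assumes ij: "i \<in> {1..n}" "j \<in> {1..n}"
begin

lemma phi_nonneg': "0 \<le> s \<Longrightarrow> s \<le> t \<Longrightarrow> 0 \<le> \<phi> i j t s"
  by (rule phi_nonneg[OF ij])

lemma phi_diag: "0 \<le> s \<Longrightarrow> \<phi> i j s s = 1"
  using regular ij unfolding kernels_regular_def by blast

lemma phi_antimono: "0 \<le> s \<Longrightarrow> s \<le> u \<Longrightarrow> u \<le> t \<Longrightarrow> \<phi> i j t s \<le> \<phi> i j u s"
  using regular ij unfolding kernels_regular_def by (auto simp: monotone_on_def)

lemma phi_le_1: "0 \<le> s \<Longrightarrow> s \<le> t \<Longrightarrow> \<phi> i j t s \<le> 1"
  using phi_antimono[of s s t] phi_diag by simp

lemma phi_continuous_second: "0 \<le> t \<Longrightarrow> continuous_on {0..t} (\<phi> i j t)"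
proof -
  assume t: "0 \<le> t"
  have "continuous_on {(t, s). 0 \<le> s \<and> s \<le> t} (\<lambda>(t, s). \<phi> i j t s)"
    using regular ij unfolding kernels_regular_def by blast
  then have "continuous_on {0..t} ((\<lambda>(t, s). \<phi> i j t s) \<circ> (\<lambda>s. (t, s)))"
    by (intro continuous_on_compose continuous_intros) (auto elim: continuous_on_subset)
  then show ?thesis by (simp add: comp_def)
qed

lemma phi_deriv:
  assumes "0 \<le> s" "s \<le> t"
  obtains D where "((\<lambda>u. \<phi> i j u s) has_real_derivative D) (at t within {s..})" "\<bar>D\<bar> / \<phi> i j t s \<le> L"
  using log_derivatives ij assms unfolding log_derivatives_bounded_def by blast

lemma phi_continuous_first: "0 \<le> s \<Longrightarrow> continuous_on {s..} (\<lambda>u. \<phi> i j u s)"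
  unfolding continuous_on_eq_continuous_within
  by (metis atLeast_iff phi_deriv DERIV_continuous)

text \<open>By monotonicity the kernel at an intermediate time is at most its value at
  \<open>u\<close>, so the bound on the logarithmic derivative becomes a bound relative to that
  earlier value.\<close>

lemma phi_decay:
  assumes "0 \<le> s" "s \<le> u" "u \<le> t"
  shows "\<phi> i j u s - \<phi> i j t s \<le> L * (t - u) * \<phi> i j u s"
proof -
  have "\<bar>\<phi> i j t s - \<phi> i j u s\<bar> \<le> L * \<phi> i j u s * (t - u)"
  proof (rule mvt_abs_le[OF assms(3)])
    show "continuous_on {u..t} (\<lambda>u. \<phi> i j u s)"
      by (rule continuous_on_subset[OF phi_continuous_first[OF assms(1)]]) (use assms in auto)
    fix x assume x: "u < x" "x < t"
    have sx: "s \<le> x" using x assms by simp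
    obtain D where D: "((\<lambda>u. \<phi> i j u s) has_real_derivative D) (at x within {s..})"
        "\<bar>D\<bar> / \<phi> i j x s \<le> L"
      by (rule phi_deriv[OF assms(1) sx])
    have D': "((\<lambda>u. \<phi> i j u s) has_real_derivative D) (at x)"
      using D(1) at_within_interior[of x "{s..}"] x assms by auto
    have nonneg: "0 \<le> \<phi> i j x s" using phi_nonneg'[OF assms(1) sx] .
    have "\<bar>D\<bar> \<le> L * \<phi> i j x s"
    proof (cases "\<phi> i j x s = 0")
      case True
      \<comment> \<open>Where the kernel vanishes the quotient in the hypothesis is 0 by convention
        and gives no information on \<open>D\<close>; but a zero of a nonnegative function is a
        local minimum.\<close>
      have "D = 0"
      proof (rule DERIV_local_min[OF D'])
        show "0 < x - s" using x assms by simp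
        show "\<forall>y. \<bar>x - y\<bar> < x - s \<longrightarrow> \<phi> i j x s \<le> \<phi> i j y s"
          using True phi_nonneg'[OF assms(1)] by simp
      qed
      then show ?thesis using True by simp
    qed (use D(2) nonneg in \<open>simp add: divide_le_eq\<close>)
    also have "\<dots> \<le> L * \<phi> i j u s" using phi_antimono[of s u x] assms x L_pos by simp
    finally show "\<exists>D. ((\<lambda>u. \<phi> i j u s) has_real_derivative D) (at x) \<and> \<bar>D\<bar> \<le> L * \<phi> i j u s"
      using D' by auto
  qed
  then show ?thesis by (simp add: algebra_simps)
qed

end

section \<open>Regularity of the paths\<close>

lemma events_eventually_right:
  assumes "j \<in> {1..n}" "\<omega> \<in> space M"
  shows "\<forall>\<^sub>F u in at_right t. E j \<omega> \<inter> {0..u} = E j \<omega> \<inter> {0..t}"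
proof -
  obtain \<delta> where \<delta>: "\<delta> > 0" "E j \<omega> \<inter> {t - \<delta><..<t + \<delta>} \<subseteq> {t}"
    by (rule locally_finite_gap[OF locally_finite[OF assms] events_nonneg[OF assms]])
  have "\<forall>\<^sub>F u in at_right t. u \<in> {t<..<t + \<delta>}"
    by (rule eventually_at_right_real) (use \<delta> in simp)
  then show ?thesis
  proof eventually_elim
    case (elim u)
    have "x \<le> t" if "x \<in> E j \<omega>" "x \<le> u" for x
    proof (rule ccontr)
      assume "\<not> x \<le> t"
      then have "x \<in> E j \<omega> \<inter> {t - \<delta><..<t + \<delta>}" using that elim \<delta>(1) by auto
      then have "x = t" using \<delta>(2) by blast
      then show False using \<open>\<not> x \<le> t\<close> by simp
    qed
    then show ?case using elim by force
  qed
qed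

lemma events_eventually:
  assumes "j \<in> {1..n}" "\<omega> \<in> space M" "t \<notin> E j \<omega>"
  shows "\<forall>\<^sub>F u in at t within S. E j \<omega> \<inter> {0..u} = E j \<omega> \<inter> {0..t}"
proof -
  obtain \<delta> where \<delta>: "\<delta> > 0" "E j \<omega> \<inter> {t - \<delta><..<t + \<delta>} \<subseteq> {t}"
    by (rule locally_finite_gap[OF locally_finite[OF assms(1,2)] events_nonneg[OF assms(1,2)]])
  have "\<forall>\<^sub>F u in at t. dist u t < \<delta>" using \<delta>(1) by (auto simp: eventually_at)
  then have "\<forall>\<^sub>F u in at t within S. dist u t < \<delta>"
    using at_le[of S UNIV t] filter_leD by blast
  then show ?thesis
  proof eventually_elim
    case (elim u)
    have "x \<le> t \<longleftrightarrow> x \<le> u" if "x \<in> E j \<omega>" for x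
    proof (rule ccontr)
      assume "\<not> (x \<le> t \<longleftrightarrow> x \<le> u)"
      then have "x \<in> E j \<omega> \<inter> {t - \<delta><..<t + \<delta>}" using that elim by (auto simp: dist_real_def)
      then show False using \<delta>(2) assms(3) by auto
    qed
    then show ?case by force
  qed
qed

text \<open>The condition \<open>side\<close> concerns events exactly at \<open>t\<close>: the
  kernel of such an event starts there, so it is only continuous from the right. The two useful
  cases are limits from the right at any time, and two-sided limits at times without events.\<close>

lemma lam_tendsto:
  assumes i: "i \<in> {1..n}" and \<omega>: "\<omega> \<in> space M" and t: "0 \<le> t" and S: "S \<subseteq> {0..}"
    and ev: "\<And>j. j \<in> {1..n} \<Longrightarrow> \<forall>\<^sub>F u in at t within S. E j \<omega> \<inter> {0..u} = E j \<omega> \<inter> {0..t}"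
    and side: "\<And>j s. j \<in> {1..n} \<Longrightarrow> s \<in> E j \<omega> \<Longrightarrow> s \<le> t \<Longrightarrow> s < t \<or> S \<subseteq> {s..}"
  shows "((\<lambda>u. lam i u \<omega>) \<longlongrightarrow> lam i t \<omega>) (at t within S)"
  unfolding lam_eq
proof (intro tendsto_add tendsto_sum tendsto_mult tendsto_const)
  have "(\<mu> i \<longlongrightarrow> \<mu> i t) (at t within {0..})"
    using mu_continuous[OF i] t by (simp add: continuous_on_def)
  then show "(\<mu> i \<longlongrightarrow> \<mu> i t) (at t within S)" by (rule tendsto_within_subset[OF _ S])
next
  fix j assume j: "j \<in> {1..n}"
  have *: "((\<lambda>u. \<phi> i j u s) \<longlongrightarrow> \<phi> i j t s) (at t within S)" if s: "s \<in> E j \<omega> \<inter> {0..t}" for s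
  proof -
    have lim: "((\<lambda>u. \<phi> i j u s) \<longlongrightarrow> \<phi> i j t s) (at t within {s..})"
      using phi_continuous_first[OF i j, of s] s by (simp add: continuous_on_def)
    show ?thesis
    proof (cases "s < t")
      case True
      then have "at t within {s..} = at t" by (intro at_within_interior) auto
      with lim have "((\<lambda>u. \<phi> i j u s) \<longlongrightarrow> \<phi> i j t s) (at t)" by simp
      then show ?thesis by (rule tendsto_within_subset) simp
    qed (use side[OF j, of s] s tendsto_within_subset[OF lim] in auto)
  qed
  have "((\<lambda>u. \<Sum>s\<in>E j \<omega> \<inter> {0..t}. \<phi> i j u s) \<longlongrightarrow> (\<Sum>s\<in>E j \<omega> \<inter> {0..t}. \<phi> i j t s)) (at t within S)"
    by (intro tendsto_sum *)
  then show "((\<lambda>u. \<Sum>s\<in>E j \<omega> \<inter> {0..u}. \<phi> i j u s) \<longlongrightarrow> (\<Sum>s\<in>E j \<omega> \<inter> {0..t}. \<phi> i j t s)) (at t within S)"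
    by (rule Lim_transform_eventually) (use ev[OF j] in eventually_elim, simp)
qed

lemma lam_right_continuous:
  assumes "i \<in> {1..n}" "\<omega> \<in> space M" "0 \<le> t"
  shows "((\<lambda>u. lam i u \<omega>) \<longlongrightarrow> lam i t \<omega>) (at_right t)"
  by (rule lam_tendsto[OF assms _ events_eventually_right]) (use assms in auto)

lemma lam_continuous:
  assumes "i \<in> {1..n}" "\<omega> \<in> space M" "0 \<le> t" "\<forall>j\<in>{1..n}. t \<notin> E j \<omega>"
  shows "((\<lambda>u. lam i u \<omega>) \<longlongrightarrow> lam i t \<omega>) (at t within {0..})"
  by (rule lam_tendsto[OF assms(1-3) _ events_eventually]) (use assms in \<open>auto simp: le_less\<close>)

lemma cnt_continuous:
  assumes "i \<in> {1..n}" "\<omega> \<in> space M" "t \<notin> E i \<omega>"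
  shows "((\<lambda>u. cnt i u \<omega>) \<longlongrightarrow> cnt i t \<omega>) (at t within {0..})"
proof (rule tendsto_eventually)
  show "\<forall>\<^sub>F u in at t within {0..}. cnt i u \<omega> = cnt i t \<omega>"
    using events_eventually[OF assms, of "{0..}"] by eventually_elim (simp add: cnt_eq)
qed

lemma AE_no_event_at: "0 \<le> t \<Longrightarrow> AE \<omega> in M. \<forall>j\<in>{1..n}. t \<notin> E j \<omega>"
  by (intro AE_finite_allI no_fixed_time) auto

section \<open>Measurability\<close>

text \<open>The filtration is generated by counts at fixed times, not by the positions of events.
  The sum is reached as a limit of grid sums, which involve only counts and values of
  \<open>H\<close> at grid points.\<close>

lemma sum_events_measurable:
  fixes H :: "real \<Rightarrow> 'a \<Rightarrow> real"
  assumes i: "i \<in> {1..n}" and ab: "0 \<le> a" "a \<le> b"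
    and H: "\<And>s. s \<in> {a..b} \<Longrightarrow> H s \<in> borel_measurable (F s)"
    and lc: "\<And>s \<omega>. \<omega> \<in> space M \<Longrightarrow> s \<in> {a<..b} \<Longrightarrow> ((\<lambda>u. H u \<omega>) \<longlongrightarrow> H s \<omega>) (at_left s)"
  shows "(\<lambda>\<omega>. \<Sum>s\<in>E i \<omega> \<inter> {a<..b}. H s \<omega>) \<in> borel_measurable (F b)"
proof (cases "a = b")
  case False
  then have ab': "a < b" using ab by simp
  show ?thesis
  proof (rule borel_measurable_LIMSEQ_real)
    fix \<omega> assume "\<omega> \<in> space (F b)"
    then have \<omega>: "\<omega> \<in> space M" by simp
    show "(\<lambda>m. \<Sum>k<m. H (gridpt a b m k) \<omega> * card (E i \<omega> \<inter> {gridpt a b m k<..gridpt a b m (Suc k)}))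
      \<longlonglongrightarrow> (\<Sum>s\<in>E i \<omega> \<inter> {a<..b}. H s \<omega>)"
      by (rule sum_grid_tendsto[OF ab' events_finite[OF i \<omega>, where t = b] lc[OF \<omega>]]) auto
  next
    fix m
    show "(\<lambda>\<omega>. \<Sum>k<m. H (gridpt a b m k) \<omega> * card (E i \<omega> \<inter> {gridpt a b m k<..gridpt a b m (Suc k)}))
      \<in> borel_measurable (F b)"
    proof (intro borel_measurable_sum borel_measurable_times)
      fix k assume "k \<in> {..<m}"
      then have k: "gridpt a b m k \<in> {a..b}" "gridpt a b m (Suc k) \<in> {a..b}"
          "gridpt a b m k \<le> gridpt a b m (Suc k)"
        using gridpt_range[OF ab(2), of m k] gridpt_range[OF ab(2), of m "Suc k"]
          gridpt_mono[OF ab(2), of k "Suc k" m] by auto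
      show "H (gridpt a b m k) \<in> borel_measurable (F b)"
        by (rule measurable_F_mono[OF H]) (use k in auto)
      have "(\<lambda>\<omega>. cnt i (gridpt a b m (Suc k)) \<omega> - cnt i (gridpt a b m k) \<omega>) \<in> borel_measurable (F b)"
        using k ab by (intro borel_measurable_diff cnt_measurable_F i) auto
      then show "(\<lambda>\<omega>. real (card (E i \<omega> \<inter> {gridpt a b m k<..gridpt a b m (Suc k)}))) \<in> borel_measurable (F b)"
        by (subst measurable_cong[where g = "\<lambda>\<omega>. cnt i (gridpt a b m (Suc k)) \<omega> - cnt i (gridpt a b m k) \<omega>"])
          (use k ab in \<open>auto intro!: card_Ioc[OF i]\<close>)
    qed
  qed
qed simp

text \<open>Events at time 0 are separated from the rest because the sums over events run over
  intervals open on the left.\<close>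

lemma lam_measurable_F:
  assumes "i \<in> {1..n}" "0 \<le> t"
  shows "lam i t \<in> borel_measurable (F t)"
proof -
  have "(\<lambda>\<omega>. \<mu> i t + (\<Sum>j=1..n. w i j * (\<phi> i j t 0 * cnt j 0 \<omega> + (\<Sum>s\<in>E j \<omega> \<inter> {0<..t}. \<phi> i j t s))))
      \<in> borel_measurable (F t)"
  proof (intro borel_measurable_add borel_measurable_sum borel_measurable_times borel_measurable_const
      cnt_measurable_F sum_events_measurable)
    fix j s assume j: "j \<in> {1..n}" and s: "s \<in> {0<..t}"
    have "(\<phi> i j t \<longlongrightarrow> \<phi> i j t s) (at s within {0..t})"
      using phi_continuous_second[OF assms(1) j assms(2)] s by (simp add: continuous_on_def)
    then have "(\<phi> i j t \<longlongrightarrow> \<phi> i j t s) (at s within {0..s})"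
      by (rule tendsto_within_subset) (use s in auto)
    then show "(\<phi> i j t \<longlongrightarrow> \<phi> i j t s) (at_left s)"
      using s by (simp add: at_within_Icc_at_left)
  qed (use assms in auto)
  also have "?this \<longleftrightarrow> ?thesis"
  proof (rule measurable_cong)
    fix \<omega> assume "\<omega> \<in> space (F t)"
    then have \<omega>: "\<omega> \<in> space M" by simp
    have "\<phi> i j t 0 * cnt j 0 \<omega> + (\<Sum>s\<in>E j \<omega> \<inter> {0<..t}. \<phi> i j t s) = (\<Sum>s\<in>E j \<omega> \<inter> {0..t}. \<phi> i j t s)"
      if j: "j \<in> {1..n}" for j
    proof -
      have "E j \<omega> \<inter> {0..t} = (E j \<omega> \<inter> {0..0}) \<union> (E j \<omega> \<inter> {0<..t})" using assms by auto
      then have "(\<Sum>s\<in>E j \<omega> \<inter> {0..t}. \<phi> i j t s) =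
          (\<Sum>s\<in>E j \<omega> \<inter> {0..0}. \<phi> i j t s) + (\<Sum>s\<in>E j \<omega> \<inter> {0<..t}. \<phi> i j t s)"
        using assms by (auto intro!: sum.union_disjoint events_finite[OF j \<omega>, where t = t])
      moreover have "(\<Sum>s\<in>E j \<omega> \<inter> {0..0}. \<phi> i j t s) = (\<Sum>s\<in>E j \<omega> \<inter> {0..0}. \<phi> i j t 0)"
        by (intro sum.cong) auto
      moreover have "(\<Sum>s\<in>E j \<omega> \<inter> {0..0}. \<phi> i j t 0) = \<phi> i j t 0 * cnt j 0 \<omega>"
        unfolding cnt_eq sum_constant by (rule mult.commute)
      ultimately show ?thesis by linarith
    qed
    then show "\<mu> i t + (\<Sum>j=1..n. w i j * (\<phi> i j t 0 * cnt j 0 \<omega> + (\<Sum>s\<in>E j \<omega> \<inter> {0<..t}. \<phi> i j t s)))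
        = lam i t \<omega>" by (simp add: lam_eq)
  qed
  finally show ?thesis .
qed

lemma lam_measurable: "i \<in> {1..n} \<Longrightarrow> 0 \<le> t \<Longrightarrow> lam i t \<in> borel_measurable M"
  by (rule measurable_F_M[OF lam_measurable_F])

lemma cnt_measurable: "i \<in> {1..n} \<Longrightarrow> 0 \<le> t \<Longrightarrow> cnt i t \<in> borel_measurable M"
  by (rule measurable_F_M[OF cnt_measurable_F]) auto

lemma cnt_integrable: "i \<in> {1..n} \<Longrightarrow> 0 \<le> t \<Longrightarrow> integrable M (cnt i t)"
  using counts_integrable by (simp add: cnt_def[abs_def])

text \<open>Since kernels are at most 1, this is an integrable envelope for the rate on all of
  [0, t].\<close>

definition lam_dom :: "nat \<Rightarrow> real \<Rightarrow> 'a \<Rightarrow> real" where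
  "lam_dom i t \<omega> = \<mu>_max + (\<Sum>j=1..n. w i j * cnt j t \<omega>)"

lemma lam_bounds:
  assumes i: "i \<in> {1..n}" and \<omega>: "\<omega> \<in> space M" and s: "0 \<le> s" "s \<le> t"
  shows "\<mu>_min \<le> lam i s \<omega>" "lam i s \<omega> \<le> lam_dom i t \<omega>"
proof -
  have inner: "0 \<le> (\<Sum>s'\<in>E j \<omega> \<inter> {0..s}. \<phi> i j s s')" if "j \<in> {1..n}" for j
    by (rule sum_nonneg, rule phi_nonneg'[OF i that]) auto
  have "0 \<le> (\<Sum>j=1..n. w i j * (\<Sum>s'\<in>E j \<omega> \<inter> {0..s}. \<phi> i j s s'))"
    by (rule sum_nonneg, rule mult_nonneg_nonneg[OF w_nonneg[OF i] inner])
  then show "\<mu>_min \<le> lam i s \<omega>" using mu_bounds(1)[OF i s(1)] by (simp add: lam_eq)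
  have "(\<Sum>s'\<in>E j \<omega> \<inter> {0..s}. \<phi> i j s s') \<le> cnt j t \<omega>" if j: "j \<in> {1..n}" for j
  proof -
    have "(\<Sum>s'\<in>E j \<omega> \<inter> {0..s}. \<phi> i j s s') \<le> (\<Sum>s'\<in>E j \<omega> \<inter> {0..s}. 1)"
      by (rule sum_mono) (use phi_le_1[OF i j] in auto)
    also have "\<dots> = cnt j s \<omega>" by (simp add: cnt_eq)
    also have "\<dots> \<le> cnt j t \<omega>" by (rule cnt_mono[OF j \<omega> s(2)])
    finally show ?thesis .
  qed
  then show "lam i s \<omega> \<le> lam_dom i t \<omega>"
    unfolding lam_eq lam_dom_def
    by (intro add_mono mu_bounds(2) sum_mono mult_left_mono w_nonneg i s) auto
qed

lemma lam_dom_integrable: "i \<in> {1..n} \<Longrightarrow> 0 \<le> t \<Longrightarrow> integrable M (lam_dom i t)"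
  unfolding lam_dom_def
  by (intro Bochner_Integration.integrable_add Bochner_Integration.integrable_sum
      integrable_mult_right cnt_integrable) auto

lemma lam_integrable:
  assumes "i \<in> {1..n}" "0 \<le> t"
  shows "integrable M (lam i t)"
proof (rule Bochner_Integration.integrable_bound[OF lam_dom_integrable[OF assms] lam_measurable[OF assms]])
  show "AE \<omega> in M. norm (lam i t \<omega>) \<le> norm (lam_dom i t \<omega>)"
    using lam_bounds[OF assms(1) _ assms(2) order_refl] mu_min_pos by (intro AE_I2) force
qed

section \<open>The compensator formula\<close>

text \<open>Paths may jump, but a fixed time is almost surely not a jump time. Continuity in the
  mean then follows by dominated convergence along sequences.\<close>

lemma expectation_continuous:
  fixes Z :: "'a \<Rightarrow> real" and f :: "real \<Rightarrow> 'a \<Rightarrow> real"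
  assumes Z: "Z \<in> borel_measurable M" "\<And>\<omega>. \<omega> \<in> space M \<Longrightarrow> \<bar>Z \<omega>\<bar> \<le> c"
    and f: "\<And>t. 0 \<le> t \<Longrightarrow> f t \<in> borel_measurable M"
    and cont: "\<And>t. 0 \<le> t \<Longrightarrow> AE \<omega> in M. ((\<lambda>u. f u \<omega>) \<longlongrightarrow> f t \<omega>) (at t within {0..})"
    and D: "\<And>t. 0 \<le> t \<Longrightarrow> integrable M (D t)"
      "\<And>s t \<omega>. \<omega> \<in> space M \<Longrightarrow> 0 \<le> s \<Longrightarrow> s \<le> t \<Longrightarrow> \<bar>f s \<omega>\<bar> \<le> D t \<omega>"
  shows "continuous_on {0..} (\<lambda>t. expectation (\<lambda>\<omega>. Z \<omega> * f t \<omega>))"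
proof (rule continuous_on_sequentiallyI)
  fix u :: "nat \<Rightarrow> real" and a
  assume u: "\<forall>k. u k \<in> {0..}" "a \<in> {0..}" "u \<longlonglongrightarrow> a"
  obtain b where b: "\<And>k. \<bar>u k\<bar> \<le> b"
    using convergent_imp_Bseq[of u] u(3) by (auto simp: convergent_def Bseq_def)
  have u0: "0 \<le> u k" "u k \<le> b" for k using u(1) b[of k] by (auto simp: abs_le_iff)
  have a0: "0 \<le> a" using u(2) by simp
  have b0: "0 \<le> b" using u0[of 0] by simp
  show "(\<lambda>k. expectation (\<lambda>\<omega>. Z \<omega> * f (u k) \<omega>)) \<longlonglongrightarrow> expectation (\<lambda>\<omega>. Z \<omega> * f a \<omega>)"
  proof (rule integral_dominated_convergence[where w = "\<lambda>\<omega>. \<bar>c\<bar> * D b \<omega>"])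
    show "AE \<omega> in M. (\<lambda>k. Z \<omega> * f (u k) \<omega>) \<longlonglongrightarrow> Z \<omega> * f a \<omega>"
      using cont[OF a0]
    proof eventually_elim
      case (elim \<omega>)
      then have "continuous (at a within {0..}) (\<lambda>u. f u \<omega>)" by (simp add: continuous_within)
      then have "(\<lambda>k. f (u k) \<omega>) \<longlonglongrightarrow> f a \<omega>"
        using u unfolding continuous_within_sequentially comp_def by blast
      then show ?case by (rule tendsto_mult_left)
    qed
    show "AE \<omega> in M. norm (Z \<omega> * f (u k) \<omega>) \<le> \<bar>c\<bar> * D b \<omega>" for k
    proof (rule AE_I2)
      fix \<omega> assume \<omega>: "\<omega> \<in> space M"
      have "\<bar>Z \<omega>\<bar> \<le> \<bar>c\<bar>" using Z(2)[OF \<omega>] by simp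
      then show "norm (Z \<omega> * f (u k) \<omega>) \<le> \<bar>c\<bar> * D b \<omega>"
        using D(2)[OF \<omega> u0] by (auto simp: abs_mult intro: mult_mono)
    qed
  qed (use Z f D b0 u0 a0 in auto)
qed

lemma expectation_lam_continuous:
  assumes "i \<in> {1..n}" "Z \<in> borel_measurable M" "\<And>\<omega>. \<omega> \<in> space M \<Longrightarrow> \<bar>Z \<omega>\<bar> \<le> c"
  shows "continuous_on {0..} (\<lambda>t. expectation (\<lambda>\<omega>. Z \<omega> * lam i t \<omega>))"
proof (rule expectation_continuous[OF assms(2,3)])
  show "AE \<omega> in M. ((\<lambda>u. lam i u \<omega>) \<longlongrightarrow> lam i t \<omega>) (at t within {0..})" if "0 \<le> t" for t
    using AE_no_event_at[OF that] AE_space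
    by eventually_elim (rule lam_continuous[OF assms(1) _ that])
  show "\<bar>lam i s \<omega>\<bar> \<le> lam_dom i t \<omega>" if "\<omega> \<in> space M" "0 \<le> s" "s \<le> t" for s t \<omega>
    using lam_bounds[OF assms(1) that] mu_min_pos by simp
qed (use assms lam_measurable lam_dom_integrable in auto)

lemma expectation_cnt_continuous:
  assumes "i \<in> {1..n}" "Z \<in> borel_measurable M" "\<And>\<omega>. \<omega> \<in> space M \<Longrightarrow> \<bar>Z \<omega>\<bar> \<le> c"
  shows "continuous_on {0..} (\<lambda>t. expectation (\<lambda>\<omega>. Z \<omega> * cnt i t \<omega>))"
proof (rule expectation_continuous[OF assms(2,3)])
  show "AE \<omega> in M. ((\<lambda>u. cnt i u \<omega>) \<longlongrightarrow> cnt i t \<omega>) (at t within {0..})" if "0 \<le> t" for t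
    using no_fixed_time[OF assms(1) that] AE_space
    by eventually_elim (rule cnt_continuous[OF assms(1)])
  show "\<bar>cnt i s \<omega>\<bar> \<le> cnt i t \<omega>" if "\<omega> \<in> space M" "0 \<le> s" "s \<le> t" for s t \<omega>
    using cnt_mono[OF assms(1) that(1,3)] by simp
qed (use assms cnt_measurable cnt_integrable in auto)

text \<open>A weight known at time \<open>t\<close> may be moved inside the conditional expectation
  given \<open>F t\<close>, and multiplication by a bounded weight preserves the convergence in mean
  that defines the rate.\<close>

lemma expectation_cnt_deriv:
  assumes i: "i \<in> {1..n}" and t: "0 \<le> t"
    and Z: "Z \<in> borel_measurable (F t)" "\<And>\<omega>. \<omega> \<in> space M \<Longrightarrow> \<bar>Z \<omega>\<bar> \<le> c"
  shows "((\<lambda>t. expectation (\<lambda>\<omega>. Z \<omega> * cnt i t \<omega>)) has_real_derivative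
    expectation (\<lambda>\<omega>. Z \<omega> * lam i t \<omega>)) (at_right t)"
proof -
  interpret sub: finite_measure_subalgebra M "F t"
    by unfold_locales (rule subalgebra_F)
  define C where "C = (\<lambda>h. real_cond_exp M (F t) (cnt i (t + h)))"
  define R where "R = (\<lambda>h \<omega>. (C h \<omega> - cnt i t \<omega>) / h - lam i t \<omega>)"
  have c0: "0 \<le> c" using Z(2) not_empty by force
  note ZM = measurable_F_M[OF Z(1)]
  have rate0: "((\<lambda>h. \<integral>\<^sup>+\<omega>. ennreal \<bar>R h \<omega>\<bar> \<partial>M) \<longlongrightarrow> 0) (at_right 0)"
    using rate[OF i] t unfolding has_rate_def R_def C_def cnt_def[abs_def] lam_def by blast
  have int: "integrable M (\<lambda>\<omega>. Z \<omega> * f \<omega>)" if "integrable M f" for f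
    by (rule integrable_bounded_mult[OF that ZM Z(2)])
  have bound: "ennreal \<bar>(expectation (\<lambda>\<omega>. Z \<omega> * cnt i (t + h) \<omega>) - expectation (\<lambda>\<omega>. Z \<omega> * cnt i t \<omega>)) / h
      - expectation (\<lambda>\<omega>. Z \<omega> * lam i t \<omega>)\<bar> \<le> ennreal c * (\<integral>\<^sup>+\<omega>. ennreal \<bar>R h \<omega>\<bar> \<partial>M)"
    if h: "0 < h" for h
  proof -
    have cint: "integrable M (cnt i (t + h))" using cnt_integrable[OF i] t h by simp
    have Cint: "integrable M (C h)" unfolding C_def using cint by (rule sub.real_cond_exp_int)
    note li = lam_integrable[OF i t] and ci = cnt_integrable[OF i t]
    have Rint: "integrable M (R h)" unfolding R_def
      by (intro Bochner_Integration.integrable_diff integrable_divide_zero impI Cint li ci)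
    have "expectation (\<lambda>\<omega>. Z \<omega> * C h \<omega>) = expectation (\<lambda>\<omega>. Z \<omega> * cnt i (t + h) \<omega>)"
      unfolding C_def
      by (rule sub.real_cond_exp_intg(2)[OF int[OF cint] Z(1)]) (use cint in auto)
    moreover have "expectation (\<lambda>\<omega>. Z \<omega> * R h \<omega>) =
        (expectation (\<lambda>\<omega>. Z \<omega> * C h \<omega>) - expectation (\<lambda>\<omega>. Z \<omega> * cnt i t \<omega>)) / h
        - expectation (\<lambda>\<omega>. Z \<omega> * lam i t \<omega>)"
    proof -
      have "(\<lambda>\<omega>. Z \<omega> * R h \<omega>) = (\<lambda>\<omega>. (Z \<omega> * C h \<omega> - Z \<omega> * cnt i t \<omega>) / h - Z \<omega> * lam i t \<omega>)"
        by (simp add: R_def algebra_simps diff_divide_distrib)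
      then show ?thesis using int[OF Cint] int[OF li] int[OF ci] by simp
    qed
    ultimately have eq: "(expectation (\<lambda>\<omega>. Z \<omega> * cnt i (t + h) \<omega>) - expectation (\<lambda>\<omega>. Z \<omega> * cnt i t \<omega>)) / h
      - expectation (\<lambda>\<omega>. Z \<omega> * lam i t \<omega>) = expectation (\<lambda>\<omega>. Z \<omega> * R h \<omega>)" by simp
    have "ennreal \<bar>expectation (\<lambda>\<omega>. Z \<omega> * R h \<omega>)\<bar> \<le> (\<integral>\<^sup>+\<omega>. ennreal \<bar>Z \<omega> * R h \<omega>\<bar> \<partial>M)"
      using integral_norm_bound_ennreal[OF int[OF Rint]] by simp
    also have "\<dots> \<le> (\<integral>\<^sup>+\<omega>. ennreal c * ennreal \<bar>R h \<omega>\<bar> \<partial>M)"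
      using Z(2) c0 by (intro nn_integral_mono)
        (simp add: abs_mult mult_right_mono flip: ennreal_mult)
    also have "\<dots> = ennreal c * (\<integral>\<^sup>+\<omega>. ennreal \<bar>R h \<omega>\<bar> \<partial>M)"
      by (rule nn_integral_cmult) (use Rint in measurable)
    finally show ?thesis unfolding eq .
  qed
  define q where "q = (\<lambda>h. (expectation (\<lambda>\<omega>. Z \<omega> * cnt i (t + h) \<omega>) - expectation (\<lambda>\<omega>. Z \<omega> * cnt i t \<omega>)) / h
      - expectation (\<lambda>\<omega>. Z \<omega> * lam i t \<omega>))"
  have "((\<lambda>h. ennreal c * (\<integral>\<^sup>+\<omega>. ennreal \<bar>R h \<omega>\<bar> \<partial>M)) \<longlongrightarrow> ennreal c * 0) (at_right 0)"
    by (rule ennreal_tendsto_cmult[OF _ rate0]) simp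
  then have "((\<lambda>h. ennreal c * (\<integral>\<^sup>+\<omega>. ennreal \<bar>R h \<omega>\<bar> \<partial>M)) \<longlongrightarrow> 0) (at_right 0)" by simp
  then have "((\<lambda>h. ennreal \<bar>q h\<bar>) \<longlongrightarrow> 0) (at_right 0)"
  proof (rule tendsto_sandwich[rotated 3])
    show "\<forall>\<^sub>F h in at_right 0. ennreal \<bar>q h\<bar> \<le> ennreal c * (\<integral>\<^sup>+\<omega>. ennreal \<bar>R h \<omega>\<bar> \<partial>M)"
      unfolding q_def by (rule eventually_at_rightI[of 0 1]) (use bound in auto)
  qed auto
  then have "((\<lambda>h. ennreal \<bar>q h\<bar>) \<longlongrightarrow> ennreal 0) (at_right 0)" by simp
  then have "((\<lambda>h. \<bar>q h\<bar>) \<longlongrightarrow> 0) (at_right 0)"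
    by (subst (asm) tendsto_ennreal_iff) auto
  then have "(q \<longlongrightarrow> 0) (at_right 0)" by (simp add: tendsto_rabs_zero_iff)
  then have "((\<lambda>h. (expectation (\<lambda>\<omega>. Z \<omega> * cnt i (t + h) \<omega>) - expectation (\<lambda>\<omega>. Z \<omega> * cnt i t \<omega>)) / h)
      \<longlongrightarrow> expectation (\<lambda>\<omega>. Z \<omega> * lam i t \<omega>)) (at_right 0)"
    unfolding q_def by (rule LIM_zero_cancel)
  then show ?thesis
    unfolding has_field_derivative_iff by (subst filterlim_at_right_to_0) (simp add: add.commute)
qed

text \<open>A weight known at \<open>a\<close> is known at all later times, so the right derivative
  is available on the whole of [a, b); together with continuity in the mean this integrates. It is
  the compensator formula for an integrand that is constant in time.\<close>

lemma expectation_increment: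
  assumes i: "i \<in> {1..n}" and ab: "0 \<le> a" "a \<le> b"
    and Z: "Z \<in> borel_measurable (F a)" "\<And>\<omega>. \<omega> \<in> space M \<Longrightarrow> \<bar>Z \<omega>\<bar> \<le> c"
  shows "expectation (\<lambda>\<omega>. Z \<omega> * (cnt i b \<omega> - cnt i a \<omega>))
    = (LINT s:{a<..b}|lborel. expectation (\<lambda>\<omega>. Z \<omega> * lam i s \<omega>))"
proof -
  note ZM = measurable_F_M[OF Z(1)]
  have int: "integrable M (\<lambda>\<omega>. Z \<omega> * f \<omega>)" if "integrable M f" for f
    by (rule integrable_bounded_mult[OF that ZM Z(2)])
  have c1: "continuous_on {a..b} (\<lambda>t. expectation (\<lambda>\<omega>. Z \<omega> * cnt i t \<omega>))"
    by (rule continuous_on_subset[OF expectation_cnt_continuous[OF i ZM Z(2)]]) (use ab in auto)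
  have c2: "continuous_on {a..b} (\<lambda>t. expectation (\<lambda>\<omega>. Z \<omega> * lam i t \<omega>))"
    by (rule continuous_on_subset[OF expectation_lam_continuous[OF i ZM Z(2)]]) (use ab in auto)
  have si: "set_integrable lborel {a..b} (\<lambda>t. expectation (\<lambda>\<omega>. Z \<omega> * lam i t \<omega>))"
    using c2 by (rule borel_integrable_atLeastAtMost')
  have si': "set_integrable lborel {a<..b} (\<lambda>t. expectation (\<lambda>\<omega>. Z \<omega> * lam i t \<omega>))"
    by (rule set_integrable_subset[OF si]) auto
  have "(LINT s:{a<..b}|lborel. expectation (\<lambda>\<omega>. Z \<omega> * lam i s \<omega>))
      = (LINT s:{a..b}|lborel. expectation (\<lambda>\<omega>. Z \<omega> * lam i s \<omega>))"
  proof (rule set_integral_cong_set)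
    show "AE x in lborel. (x \<in> {a..b}) = (x \<in> {a<..b})"
      using AE_lborel_singleton[of a] by eventually_elim auto
  qed (use si si' in \<open>auto simp: set_borel_measurable_def set_integrable_def dest: borel_measurable_integrable\<close>)
  also have "\<dots> = integral {a..b} (\<lambda>t. expectation (\<lambda>\<omega>. Z \<omega> * lam i t \<omega>))"
    by (rule set_borel_integral_eq_integral(2)[OF si])
  also have "\<dots> = expectation (\<lambda>\<omega>. Z \<omega> * cnt i b \<omega>) - expectation (\<lambda>\<omega>. Z \<omega> * cnt i a \<omega>)"
    by (rule integral_right_derivative[OF ab(2) c1 c2], rule expectation_cnt_deriv[OF i _ measurable_F_mono[OF Z(1)] Z(2)])
      (use ab in auto)
  also have "\<dots> = expectation (\<lambda>\<omega>. Z \<omega> * (cnt i b \<omega> - cnt i a \<omega>))"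
    using int[OF cnt_integrable[OF i]] ab by (simp add: right_diff_distrib)
  finally show ?thesis ..
qed

lemma expectation_increment_integrable:
  assumes i: "i \<in> {1..n}" and ab: "0 \<le> a" "a \<le> b"
    and Z: "Z \<in> borel_measurable (F a)" "\<And>\<omega>. \<omega> \<in> space M \<Longrightarrow> \<bar>Z \<omega>\<bar> \<le> c"
  shows "set_integrable lborel {a<..b} (\<lambda>s. expectation (\<lambda>\<omega>. Z \<omega> * lam i s \<omega>))"
proof (rule set_integrable_subset[OF borel_integrable_atLeastAtMost'[of a b]])
  show "continuous_on {a..b} (\<lambda>t. expectation (\<lambda>\<omega>. Z \<omega> * lam i t \<omega>))"
    by (rule continuous_on_subset[OF expectation_lam_continuous[OF i measurable_F_M[OF Z(1)] Z(2)]])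
      (use ab in auto)
qed auto

text \<open>On each grid cell \<open>H\<close> is frozen at the left end, where it is a weight known
  in advance, and the formula for constant weights applies. Both sides then converge by dominated
  convergence: the sum over events is bounded by \<open>c * cnt i b\<close>, the rate side by
  \<open>c * lam_dom i b\<close>.\<close>

lemma compensator_formula:
  fixes H :: "real \<Rightarrow> 'a \<Rightarrow> real"
  assumes i: "i \<in> {1..n}" and ab: "0 \<le> a" "a < b"
    and H: "\<And>s. s \<in> {a..b} \<Longrightarrow> H s \<in> borel_measurable (F s)"
    and lc: "\<And>s \<omega>. \<omega> \<in> space M \<Longrightarrow> s \<in> {a<..b} \<Longrightarrow> ((\<lambda>u. H u \<omega>) \<longlongrightarrow> H s \<omega>) (at_left s)"
    and c: "\<And>s \<omega>. \<omega> \<in> space M \<Longrightarrow> s \<in> {a..b} \<Longrightarrow> \<bar>H s \<omega>\<bar> \<le> c"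
  shows "integrable M (\<lambda>\<omega>. \<Sum>s\<in>E i \<omega> \<inter> {a<..b}. H s \<omega>)"
    and "set_integrable lborel {a<..b} (\<lambda>s. expectation (\<lambda>\<omega>. H s \<omega> * lam i s \<omega>))"
    and "expectation (\<lambda>\<omega>. \<Sum>s\<in>E i \<omega> \<inter> {a<..b}. H s \<omega>)
      = (LINT s:{a<..b}|lborel. expectation (\<lambda>\<omega>. H s \<omega> * lam i s \<omega>))"
proof -
  let ?g = "gridpt a b"
  let ?cell = "\<lambda>m k. {?g m k<..?g m (Suc k)}"
  define S where "S = (\<lambda>m \<omega>. \<Sum>k<m. H (?g m k) \<omega> * (cnt i (?g m (Suc k)) \<omega> - cnt i (?g m k) \<omega>))"
  \<comment> \<open>The counterpart of \<open>S m\<close> on the time side: \<open>H\<close> is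
    frozen at the left end of the cell while the rate runs.\<close>
  define \<Psi> where "\<Psi> = (\<lambda>m s. \<Sum>k<m. indicator (?cell m k) s * expectation (\<lambda>\<omega>. H (?g m k) \<omega> * lam i s \<omega>))"
  define \<Psi>' where "\<Psi>' = (\<lambda>s. indicator {a<..b} s * expectation (\<lambda>\<omega>. H s \<omega> * lam i s \<omega>))"
  have c0: "0 \<le> c" using c[of _ a] not_empty ab by force
  have b0: "0 \<le> b" using ab by simp
  have g: "?g m k \<in> {a..b}" "?g m (Suc k) \<in> {a..b}" "?g m k \<le> ?g m (Suc k)" if "k < m" for m k
    using that ab gridpt_range[of a b m k] gridpt_range[of a b m "Suc k"]
      gridpt_mono[of a b k "Suc k" m] by auto
  have int: "integrable M (\<lambda>\<omega>. H s \<omega> * f \<omega>)" if "integrable M f" "s \<in> {a..b}" for f s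
    by (rule integrable_bounded_mult[OF that(1) measurable_F_M[OF H] c]) (use that in auto)
  have S_eq: "S m \<omega> = (\<Sum>k<m. H (?g m k) \<omega> * card (E i \<omega> \<inter> ?cell m k))" if "\<omega> \<in> space M" for m \<omega>
    unfolding S_def
  proof (intro sum.cong refl arg_cong2[where f = "(*)"])
    fix k assume "k \<in> {..<m}"
    then show "cnt i (?g m (Suc k)) \<omega> - cnt i (?g m k) \<omega> = card (E i \<omega> \<inter> ?cell m k)"
      using g[of k m] ab by (intro card_Ioc[OF i that, symmetric]) auto
  qed
  have S_bound: "\<bar>S m \<omega>\<bar> \<le> c * cnt i b \<omega>" if \<omega>: "\<omega> \<in> space M" for m \<omega>
  proof (cases "m = 0")
    case True
    then show ?thesis using c0 by (simp add: S_def)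
  next
    case False
    have "\<bar>S m \<omega>\<bar> \<le> (\<Sum>k<m. c * (cnt i (?g m (Suc k)) \<omega> - cnt i (?g m k) \<omega>))"
      unfolding S_def
    proof (rule sum_abs[THEN order_trans], rule sum_mono)
      fix k assume "k \<in> {..<m}"
      then have k: "k < m" by simp
      show "\<bar>H (?g m k) \<omega> * (cnt i (?g m (Suc k)) \<omega> - cnt i (?g m k) \<omega>)\<bar>
          \<le> c * (cnt i (?g m (Suc k)) \<omega> - cnt i (?g m k) \<omega>)"
        using cnt_mono[OF i \<omega> g(3)[OF k]] c[OF \<omega> g(1)[OF k]] by (simp add: abs_mult mult_right_mono)
    qed
    also have "\<dots> = c * (cnt i b \<omega> - cnt i a \<omega>)"
      using False sum_lessThan_telescope[of "\<lambda>k. cnt i (?g m k) \<omega>" m]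
      by (simp flip: sum_distrib_left)
    also have "\<dots> \<le> c * cnt i b \<omega>" using c0 by (intro mult_left_mono) auto
    finally show ?thesis .
  qed
  have S_meas: "S m \<in> borel_measurable M" for m
    unfolding S_def
  proof (intro borel_measurable_sum borel_measurable_times borel_measurable_diff cnt_measurable i)
    fix k assume "k \<in> {..<m}"
    then have k: "k < m" by simp
    show "H (?g m k) \<in> borel_measurable M" using measurable_F_M[OF H[OF g(1)[OF k]]] by simp
    show "0 \<le> ?g m k" "0 \<le> ?g m (Suc k)" using g[OF k] ab by auto
  qed
  have S_lim: "(\<lambda>m. S m \<omega>) \<longlonglongrightarrow> (\<Sum>s\<in>E i \<omega> \<inter> {a<..b}. H s \<omega>)" if \<omega>: "\<omega> \<in> space M" for \<omega>
    unfolding S_eq[OF \<omega>]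
    by (rule sum_grid_tendsto[OF ab(2) events_finite[OF i \<omega>, where t = b] lc[OF \<omega>]]) auto
  have sum_meas: "(\<lambda>\<omega>. \<Sum>s\<in>E i \<omega> \<inter> {a<..b}. H s \<omega>) \<in> borel_measurable M"
    by (rule measurable_F_M[OF sum_events_measurable[OF i ab(1) _ H lc]]) (use ab in auto)
  have dom: "integrable M (\<lambda>\<omega>. c * cnt i b \<omega>)" using cnt_integrable[OF i b0] by simp
  show "integrable M (\<lambda>\<omega>. \<Sum>s\<in>E i \<omega> \<inter> {a<..b}. H s \<omega>)"
    by (rule integrable_dominated_convergence[OF sum_meas S_meas dom AE_I2 AE_I2])
      (use S_lim S_bound in auto)
  have lim1: "(\<lambda>m. expectation (S m)) \<longlonglongrightarrow> expectation (\<lambda>\<omega>. \<Sum>s\<in>E i \<omega> \<inter> {a<..b}. H s \<omega>)"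
    by (rule integral_dominated_convergence[OF sum_meas S_meas dom AE_I2 AE_I2])
      (use S_lim S_bound in auto)

  have cell_sub: "?cell m k \<subseteq> {a<..b}" if "k < m" for m k
    using g[OF that] by auto
  have cell_int: "set_integrable lborel (?cell m k) (\<lambda>s. expectation (\<lambda>\<omega>. H (?g m k) \<omega> * lam i s \<omega>))"
    if k: "k < m" for m k
    by (rule expectation_increment_integrable[OF i _ g(3)[OF k] H[OF g(1)[OF k]] c]) (use g[OF k] ab in auto)
  have \<Psi>_int: "integrable lborel (\<Psi> m)" for m
    unfolding \<Psi>_def using cell_int by (intro Bochner_Integration.integrable_sum) (simp add: set_integrable_def)
  have eq: "expectation (S m) = integral\<^sup>L lborel (\<Psi> m)" for m
  proof -
    have "expectation (S m) = (\<Sum>k<m. expectation (\<lambda>\<omega>. H (?g m k) \<omega> * (cnt i (?g m (Suc k)) \<omega> - cnt i (?g m k) \<omega>)))"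
      unfolding S_def
      by (intro Bochner_Integration.integral_sum int Bochner_Integration.integrable_diff cnt_integrable i)
        (use g ab in force)+
    also have "\<dots> = (\<Sum>k<m. LINT s:?cell m k|lborel. expectation (\<lambda>\<omega>. H (?g m k) \<omega> * lam i s \<omega>))"
    proof (rule sum.cong[OF refl])
      fix k assume "k \<in> {..<m}"
      then have k: "k < m" by simp
      show "expectation (\<lambda>\<omega>. H (?g m k) \<omega> * (cnt i (?g m (Suc k)) \<omega> - cnt i (?g m k) \<omega>))
          = (LINT s:?cell m k|lborel. expectation (\<lambda>\<omega>. H (?g m k) \<omega> * lam i s \<omega>))"
        by (rule expectation_increment[OF i _ g(3)[OF k] H[OF g(1)[OF k]] c]) (use g[OF k] ab in auto)
    qed
    also have "\<dots> = integral\<^sup>L lborel (\<Psi> m)"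
      unfolding \<Psi>_def set_lebesgue_integral_def real_scaleR_def
      using cell_int by (intro Bochner_Integration.integral_sum[symmetric]) (simp add: set_integrable_def)
    finally show ?thesis .
  qed
  have \<Psi>_in: "\<Psi> m s = expectation (\<lambda>\<omega>. H (gridleft a b m s) \<omega> * lam i s \<omega>)"
    if m: "m > 0" and s: "s \<in> {a<..b}" for m s
  proof -
    obtain k where k: "k < m" "?g m k < s" "s \<le> ?g m (Suc k)" by (rule gridcell_ex[OF ab(2) m s])
    have "indicator (?cell m l) s = (if l = k then 1 else 0 :: real)" for l
      using gridcell_disjoint[OF ab(2) m, of l k] k by (auto simp: indicator_def)
    then have "\<Psi> m s = (\<Sum>l<m. if l = k then expectation (\<lambda>\<omega>. H (?g m l) \<omega> * lam i s \<omega>) else 0)"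
      unfolding \<Psi>_def by (intro sum.cong) auto
    also have "\<dots> = expectation (\<lambda>\<omega>. H (?g m k) \<omega> * lam i s \<omega>)" using k(1) by simp
    finally show ?thesis using gridleft_eq[OF ab(2) m k(2,3)] by simp
  qed
  have \<Psi>_out: "\<Psi> m s = 0" if "s \<notin> {a<..b}" for m s
    unfolding \<Psi>_def
  proof (rule sum.neutral, rule ballI)
    fix k assume "k \<in> {..<m}"
    then have "s \<notin> ?cell m k" using cell_sub[of k m] that by blast
    then show "indicator (?cell m k) s * expectation (\<lambda>\<omega>. H (?g m k) \<omega> * lam i s \<omega>) = 0" by simp
  qed
  \<comment> \<open>The case \<open>m = 0\<close> is included because the limits run over all
    natural \<open>m\<close>; there \<open>gridleft\<close> is \<open>a\<close>.\<close>
  have gl: "gridleft a b m s \<in> {a..b}" if s: "s \<in> {a<..b}" for m s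
  proof (cases "m = 0")
    case False
    then show ?thesis using gridleft_range(1)[OF ab(2) _ s, of m] s by auto
  qed (use ab in \<open>simp add: gridleft_def gridpt_def\<close>)
  define D where "D = c * expectation (lam_dom i b)"
  have lam_le: "\<bar>lam i s \<omega>\<bar> \<le> lam_dom i b \<omega>" if "\<omega> \<in> space M" "s \<in> {a<..b}" for s \<omega>
    using lam_bounds[OF i that(1), of s b] that ab mu_min_pos by auto
  have E_bound: "\<bar>expectation (\<lambda>\<omega>. H u \<omega> * lam i s \<omega>)\<bar> \<le> D" if s: "s \<in> {a<..b}" and u: "u \<in> {a..b}" for s u
  proof -
    have li: "integrable M (lam i s)" using lam_integrable[OF i, of s] s ab by auto
    have "\<bar>expectation (\<lambda>\<omega>. H u \<omega> * lam i s \<omega>)\<bar> \<le> expectation (\<lambda>\<omega>. \<bar>H u \<omega> * lam i s \<omega>\<bar>)"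
      by (rule integral_abs_bound)
    also have "\<dots> \<le> expectation (\<lambda>\<omega>. c * lam_dom i b \<omega>)"
    proof (rule integral_mono)
      fix \<omega> assume "\<omega> \<in> space M"
      then show "\<bar>H u \<omega> * lam i s \<omega>\<bar> \<le> c * lam_dom i b \<omega>"
        using c[of \<omega> u] lam_le[of \<omega> s] s u c0 by (auto simp: abs_mult intro!: mult_mono)
    qed (use int[OF li u] lam_dom_integrable[OF i b0] in auto)
    also have "\<dots> = D" by (simp add: D_def)
    finally show ?thesis .
  qed
  have E_lim: "(\<lambda>m. expectation (\<lambda>\<omega>. H (gridleft a b m s) \<omega> * lam i s \<omega>)) \<longlonglongrightarrow> expectation (\<lambda>\<omega>. H s \<omega> * lam i s \<omega>)"
    if s: "s \<in> {a<..b}" for s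
  proof (rule integral_dominated_convergence[where w = "\<lambda>\<omega>. c * lam_dom i b \<omega>"])
    have s0: "0 \<le> s" "s \<in> {a..b}" using s ab by auto
    show "(\<lambda>\<omega>. H s \<omega> * lam i s \<omega>) \<in> borel_measurable M"
      by (intro borel_measurable_times measurable_F_M[OF H] lam_measurable i s0)
    show "(\<lambda>\<omega>. H (gridleft a b m s) \<omega> * lam i s \<omega>) \<in> borel_measurable M" for m
      by (intro borel_measurable_times measurable_F_M[OF H] lam_measurable i s0 gl s)
    show "AE \<omega> in M. (\<lambda>m. H (gridleft a b m s) \<omega> * lam i s \<omega>) \<longlonglongrightarrow> H s \<omega> * lam i s \<omega>"
    proof (rule AE_I2)
      fix \<omega> assume "\<omega> \<in> space M"
      from filterlim_compose[OF lc[OF this s] gridleft_tendsto[OF ab(2) s]]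
      show "(\<lambda>m. H (gridleft a b m s) \<omega> * lam i s \<omega>) \<longlonglongrightarrow> H s \<omega> * lam i s \<omega>"
        by (rule tendsto_mult_right)
    qed
    show "AE \<omega> in M. norm (H (gridleft a b m s) \<omega> * lam i s \<omega>) \<le> c * lam_dom i b \<omega>" for m
    proof (rule AE_I2)
      fix \<omega> assume "\<omega> \<in> space M"
      then show "norm (H (gridleft a b m s) \<omega> * lam i s \<omega>) \<le> c * lam_dom i b \<omega>"
        using c[OF _ gl[OF s]] lam_le[of \<omega> s] s c0 by (auto simp: abs_mult intro!: mult_mono)
    qed
  qed (use lam_dom_integrable[OF i b0] in auto)
  have \<Psi>_lim: "(\<lambda>m. \<Psi> m s) \<longlonglongrightarrow> \<Psi>' s" for s
  proof (cases "s \<in> {a<..b}")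
    case True
    have "(\<lambda>m. \<Psi> m s) \<longlonglongrightarrow> expectation (\<lambda>\<omega>. H s \<omega> * lam i s \<omega>)"
      by (rule Lim_transform_eventually[OF E_lim[OF True] eventually_mono[OF eventually_gt_at_top[of 0]]])
        (use \<Psi>_in[OF _ True] in auto)
    then show ?thesis using True by (simp add: \<Psi>'_def)
  qed (simp add: \<Psi>_out \<Psi>'_def)
  have \<Psi>_bound: "norm (\<Psi> m s) \<le> indicator {a<..b} s * D" for m s
  proof (cases "s \<in> {a<..b}")
    case True
    show ?thesis
    proof (cases "m = 0")
      case True
      have "0 \<le> D" using E_bound[of b b] ab by (meson abs_ge_zero atLeastAtMost_iff greaterThanAtMost_iff order_refl order_trans less_imp_le)
      then show ?thesis using True by (simp add: \<Psi>_def)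
    next
      case False
      then show ?thesis using True \<Psi>_in[of m s] E_bound[OF True gl[OF True]] by simp
    qed
  qed (simp add: \<Psi>_out)
  have \<Psi>'_meas: "\<Psi>' \<in> borel_measurable lborel"
    by (rule borel_measurable_LIMSEQ_real[OF \<Psi>_lim]) (use \<Psi>_int in auto)
  have domint: "integrable lborel (\<lambda>s. indicator {a<..b} s * D)"
    using ab by (intro integrable_mult_left integrable_real_indicator) auto
  have "integrable lborel \<Psi>'"
    by (rule integrable_dominated_convergence[OF \<Psi>'_meas borel_measurable_integrable[OF \<Psi>_int] domint AE_I2 AE_I2])
      (rule \<Psi>_lim \<Psi>_bound)+
  then show "set_integrable lborel {a<..b} (\<lambda>s. expectation (\<lambda>\<omega>. H s \<omega> * lam i s \<omega>))"
    by (simp add: set_integrable_def \<Psi>'_def)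
  have "(\<lambda>m. integral\<^sup>L lborel (\<Psi> m)) \<longlonglongrightarrow> integral\<^sup>L lborel \<Psi>'"
    by (rule integral_dominated_convergence[OF \<Psi>'_meas borel_measurable_integrable[OF \<Psi>_int] domint AE_I2 AE_I2])
      (rule \<Psi>_lim \<Psi>_bound)+
  with lim1 have "expectation (\<lambda>\<omega>. \<Sum>s\<in>E i \<omega> \<inter> {a<..b}. H s \<omega>) = integral\<^sup>L lborel \<Psi>'"
    unfolding eq by (rule LIMSEQ_unique)
  then show "expectation (\<lambda>\<omega>. \<Sum>s\<in>E i \<omega> \<inter> {a<..b}. H s \<omega>)
      = (LINT s:{a<..b}|lborel. expectation (\<lambda>\<omega>. H s \<omega> * lam i s \<omega>))"
    by (simp add: set_lebesgue_integral_def \<Psi>'_def)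
qed

lemma events_before_stable:
  assumes "j \<in> {1..n}" "\<omega> \<in> space M"
  shows "\<forall>\<^sub>F u in at_left s. E j \<omega> \<inter> {r<..u} = E j \<omega> \<inter> {r<..<s}"
proof -
  obtain \<delta> where \<delta>: "\<delta> > 0" "E j \<omega> \<inter> {s - \<delta><..<s + \<delta>} \<subseteq> {s}"
    by (rule locally_finite_gap[OF locally_finite[OF assms] events_nonneg[OF assms]])
  have "\<forall>\<^sub>F u in at_left s. u \<in> {s - \<delta><..<s}"
    by (rule eventually_at_left_real) (use \<delta> in simp)
  then show ?thesis
  proof eventually_elim
    case (elim u)
    have "x \<le> u" if "x \<in> E j \<omega>" "x < s" for x
    proof (rule ccontr)
      assume "\<not> x \<le> u"
      then have "x \<in> E j \<omega> \<inter> {s - \<delta><..<s + \<delta>}" using that elim \<delta>(1) by auto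
      then show False using \<delta>(2) that by blast
    qed
    then show ?case using elim by force
  qed
qed

text \<open>Sums strictly before \<open>b\<close> are the left-continuous ones that serve as
  integrands. The open interval is exhausted from inside by closed right ends tending to
  \<open>b\<close>, along which the finitely many events eventually stay the same.\<close>

lemma sum_events_before_measurable:
  fixes H :: "real \<Rightarrow> 'a \<Rightarrow> real"
  assumes i: "i \<in> {1..n}" and ab: "0 \<le> a" "a < b"
    and H: "\<And>s. s \<in> {a..b} \<Longrightarrow> H s \<in> borel_measurable (F s)"
    and lc: "\<And>s \<omega>. \<omega> \<in> space M \<Longrightarrow> s \<in> {a<..b} \<Longrightarrow> ((\<lambda>u. H u \<omega>) \<longlongrightarrow> H s \<omega>) (at_left s)"
  shows "(\<lambda>\<omega>. \<Sum>s\<in>E i \<omega> \<inter> {a<..<b}. H s \<omega>) \<in> borel_measurable (F b)"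
proof -
  define u where "u = (\<lambda>m. gridleft a b (Suc m) b)"
  have u: "u m \<in> {a..<b}" for m
    using gridleft_range(1)[OF ab(2), of "Suc m" b] ab by (simp add: u_def)
  have lim: "filterlim u (at_left b) sequentially"
    unfolding u_def by (rule filterlim_compose[OF gridleft_tendsto filterlim_Suc]) (use ab in auto)
  show ?thesis
  proof (rule borel_measurable_LIMSEQ_real)
    fix \<omega> assume "\<omega> \<in> space (F b)"
    then have "\<omega> \<in> space M" by simp
    from events_before_stable[OF i this]
    have "\<forall>\<^sub>F m in sequentially. E i \<omega> \<inter> {a<..u m} = E i \<omega> \<inter> {a<..<b}"
      by (rule eventually_compose_filterlim[OF _ lim])
    then have "\<forall>\<^sub>F m in sequentially. (\<Sum>s\<in>E i \<omega> \<inter> {a<..u m}. H s \<omega>) = (\<Sum>s\<in>E i \<omega> \<inter> {a<..<b}. H s \<omega>)"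
      by eventually_elim simp
    then show "(\<lambda>m. \<Sum>s\<in>E i \<omega> \<inter> {a<..u m}. H s \<omega>) \<longlonglongrightarrow> (\<Sum>s\<in>E i \<omega> \<inter> {a<..<b}. H s \<omega>)"
      by (rule tendsto_eventually)
  next
    fix m
    show "(\<lambda>\<omega>. \<Sum>s\<in>E i \<omega> \<inter> {a<..u m}. H s \<omega>) \<in> borel_measurable (F b)"
      by (rule measurable_F_mono[OF sum_events_measurable[OF i ab(1) _ H lc]]) (use u[of m] ab in auto)
  qed
qed

end

locale hawkes_truncated = hawkes_setting +
  fixes B :: real and K :: nat \<comment> \<open>\<open>K\<close> only keeps the stopped functionals bounded and is chosen last, so large that it is rarely exceeded\<close>
  assumes B_ge: "1 \<le> B" "\<mu>_max \<le> B" "w_max \<le> B"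
begin

section \<open>Truncation\<close>

definition good :: "real \<Rightarrow> 'a \<Rightarrow> bool" where
  "good u \<omega> \<longleftrightarrow> (\<forall>i\<in>{1..n}. lam i u \<omega> \<le> B \<and> cnt i u \<omega> \<le> real K)"

text \<open>Two versions are needed. \<open>good_before\<close>, with a strict inequality, is left
  continuous in \<open>s\<close>, so it may multiply an integrand of the compensator formula.
  \<open>good_upto\<close> includes time \<open>s\<close> and thus bounds the rates at
  \<open>s\<close> itself, which the expansions need at the ends of windows.\<close>

definition good_before :: "real \<Rightarrow> 'a \<Rightarrow> bool" where
  "good_before s \<omega> \<longleftrightarrow> (\<forall>u. 0 \<le> u \<and> u < s \<longrightarrow> good u \<omega>)"

definition good_upto :: "real \<Rightarrow> 'a \<Rightarrow> bool" where
  "good_upto s \<omega> \<longleftrightarrow> (\<forall>u. 0 \<le> u \<and> u \<le> s \<longrightarrow> good u \<omega>)"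

abbreviation V :: "real \<Rightarrow> 'a \<Rightarrow> real" where "V s \<omega> \<equiv> of_bool (good_before s \<omega>)"

abbreviation Vc :: "real \<Rightarrow> 'a \<Rightarrow> real" where "Vc s \<omega> \<equiv> of_bool (good_upto s \<omega>)"

lemma good_before_mono: "s \<le> t \<Longrightarrow> good_before t \<omega> \<Longrightarrow> good_before s \<omega>"
  by (auto simp: good_before_def)

lemma good_upto_mono: "s \<le> t \<Longrightarrow> good_upto t \<omega> \<Longrightarrow> good_upto s \<omega>"
  by (auto simp: good_upto_def)

lemma good_upto_imp_before: "s \<le> t \<Longrightarrow> good_upto t \<omega> \<Longrightarrow> good_before s \<omega>"
  by (auto simp: good_before_def good_upto_def)

lemma V_left_continuous: "((\<lambda>u. V u \<omega>) \<longlongrightarrow> V s \<omega>) (at_left s)"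
proof (rule tendsto_eventually, cases "good_before s \<omega>")
  case True
  have "\<forall>\<^sub>F u in at_left s. u < s" by (simp add: eventually_at_filter)
  then show "\<forall>\<^sub>F u in at_left s. V u \<omega> = V s \<omega>"
    by eventually_elim (use True good_before_mono in \<open>auto intro: less_imp_le\<close>)
next
  case False
  then obtain u0 where u0: "0 \<le> u0" "u0 < s" "\<not> good u0 \<omega>" by (auto simp: good_before_def)
  have "\<forall>\<^sub>F u in at_left s. u \<in> {u0<..<s}" by (rule eventually_at_left_real[OF u0(2)])
  then show "\<forall>\<^sub>F u in at_left s. V u \<omega> = V s \<omega>"
    by eventually_elim (use False u0 in \<open>auto simp: good_before_def\<close>)
qed

lemma not_good_eventually_right:
  assumes "\<omega> \<in> space M" "0 \<le> u" "\<not> good u \<omega>"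
  shows "\<forall>\<^sub>F q in at_right u. \<not> good q \<omega>"
proof -
  obtain i where i: "i \<in> {1..n}" "lam i u \<omega> > B \<or> cnt i u \<omega> > K"
    using assms(3) by (auto simp: good_def not_le)
  from i(2) show ?thesis
  proof
    assume "lam i u \<omega> > B"
    then have "\<forall>\<^sub>F q in at_right u. lam i q \<omega> > B"
      by (rule order_tendstoD(1)[OF lam_right_continuous[OF i(1) assms(1,2)]])
    then show ?thesis by eventually_elim (use i(1) in \<open>auto simp: good_def not_le\<close>)
  next
    assume *: "cnt i u \<omega> > K"
    have "\<not> good q \<omega>" if "u < q" for q
      using cnt_mono[OF i(1) assms(1) less_imp_le[OF that]] * i(1)
      unfolding good_def by (meson not_le order_less_le_trans)
    moreover have "\<forall>\<^sub>F q in at_right u. u < q" by (simp add: eventually_at_filter)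
    ultimately show ?thesis by (auto elim: eventually_mono)
  qed
qed

text \<open>A bad time is followed by an interval of bad times, since rates are right continuous and
  counts never decrease. Hence rational times detect every failure, and the condition becomes a
  countable intersection.\<close>

lemma good_before_rational:
  assumes "\<omega> \<in> space M"
  shows "good_before s \<omega> \<longleftrightarrow> (\<forall>q\<in>{q\<in>\<rat>. 0 \<le> q \<and> q < s}. good q \<omega>)"
proof
  assume rat: "\<forall>q\<in>{q\<in>\<rat>. 0 \<le> q \<and> q < s}. good q \<omega>"
  show "good_before s \<omega>"
  proof (rule ccontr)
    assume "\<not> good_before s \<omega>"
    then obtain u where u: "0 \<le> u" "u < s" "\<not> good u \<omega>" by (auto simp: good_before_def)
    have "\<forall>\<^sub>F q in at_right u. \<not> good q \<omega>" by (rule not_good_eventually_right[OF assms u(1,3)])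
    then obtain b where b: "b > u" "\<forall>y>u. y < b \<longrightarrow> \<not> good y \<omega>"
      by (auto simp: eventually_at_right_field)
    obtain q where "q \<in> \<rat>" "u < q" "q < min b s"
      using Rats_dense_in_real[of u "min b s"] b(1) u(2) by auto
    then show False using b(2) rat u(1) by auto
  qed
qed (auto simp: good_before_def)

lemma good_sets: "0 \<le> u \<Longrightarrow> {\<omega> \<in> space M. good u \<omega>} \<in> sets (F u)"
proof -
  assume u: "0 \<le> u"
  have "{\<omega> \<in> space (F u). \<forall>i\<in>{1..n}. lam i u \<omega> \<le> B \<and> cnt i u \<omega> \<le> real K} \<in> sets (F u)"
  proof (rule sets.sets_Collect_finite_All')
    fix i assume "i \<in> {1..n}"
    note [measurable] = lam_measurable_F[OF this u] cnt_measurable_F[OF this u order_refl]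
    show "{\<omega> \<in> space (F u). lam i u \<omega> \<le> B \<and> cnt i u \<omega> \<le> real K} \<in> sets (F u)"
      by measurable
  qed (use n_pos in auto)
  then show ?thesis by (simp add: good_def)
qed

lemma good_before_sets: "{\<omega> \<in> space M. good_before s \<omega>} \<in> sets (F s)"
proof -
  have "{\<omega> \<in> space (F s). \<forall>q\<in>{q\<in>\<rat>. 0 \<le> q \<and> q < s}. good q \<omega>} \<in> sets (F s)"
  proof (rule sets.sets_Collect_countable_All')
    fix q assume "q \<in> {q\<in>\<rat>. 0 \<le> q \<and> q < s}"
    then have "0 \<le> q" "q \<le> s" by auto
    then show "{\<omega> \<in> space (F s). good q \<omega>} \<in> sets (F s)"
      using good_sets[of q] subalgebra_F_mono[of q s] by (auto simp: subalgebra_def)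
  qed (rule countable_subset[OF _ countable_rat], auto)
  moreover have "{\<omega> \<in> space M. good_before s \<omega>} = {\<omega> \<in> space (F s). \<forall>q\<in>{q\<in>\<rat>. 0 \<le> q \<and> q < s}. good q \<omega>}"
    using good_before_rational by auto
  ultimately show ?thesis by simp
qed

lemma good_upto_sets:
  assumes "0 \<le> s"
  shows "{\<omega> \<in> space M. good_upto s \<omega>} \<in> sets (F s)"
proof -
  have "good_upto s \<omega> \<longleftrightarrow> good_before s \<omega> \<and> good s \<omega>" for \<omega>
    using assms by (auto simp: good_upto_def good_before_def le_less)
  then have "{\<omega> \<in> space M. good_upto s \<omega>} = {\<omega> \<in> space M. good_before s \<omega>} \<inter> {\<omega> \<in> space M. good s \<omega>}"
    by auto
  then show ?thesis using good_before_sets good_sets[OF assms] by simp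
qed

lemma V_measurable_F: "V s \<in> borel_measurable (F s)"
proof -
  have "(\<lambda>\<omega>. indicator {\<omega> \<in> space M. good_before s \<omega>} \<omega> :: real) \<in> borel_measurable (F s)"
    using good_before_sets by simp
  then show ?thesis by (rule measurable_cong[THEN iffD1, rotated]) (auto simp: indicator_def)
qed

lemma Vc_measurable_F:
  assumes "0 \<le> s"
  shows "Vc s \<in> borel_measurable (F s)"
proof -
  have "(\<lambda>\<omega>. indicator {\<omega> \<in> space M. good_upto s \<omega>} \<omega> :: real) \<in> borel_measurable (F s)"
    using good_upto_sets[OF assms] by simp
  then show ?thesis by (rule measurable_cong[THEN iffD1, rotated]) (auto simp: indicator_def)
qed

text \<open>\<open>good_before\<close> says nothing about a jump at \<open>s\<close>. At a fixed
  \<open>s\<close> there is almost surely no event, so the rate is the limit of its earlier values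
  and inherits their bound.\<close>

lemma AE_good_before_lam:
  assumes "i \<in> {1..n}" "0 < s"
  shows "AE \<omega> in M. good_before s \<omega> \<longrightarrow> lam i s \<omega> \<le> B"
  using AE_no_event_at[OF less_imp_le[OF assms(2)]] AE_space
proof eventually_elim
  case (elim \<omega>)
  show ?case
  proof
    assume V: "good_before s \<omega>"
    have "((\<lambda>u. lam i u \<omega>) \<longlongrightarrow> lam i s \<omega>) (at s within {0..})"
      by (rule lam_continuous[OF assms(1) elim(2)]) (use assms elim in auto)
    then have "((\<lambda>u. lam i u \<omega>) \<longlongrightarrow> lam i s \<omega>) (at s within {0..s})"
      by (rule tendsto_within_subset) auto
    then have lim: "((\<lambda>u. lam i u \<omega>) \<longlongrightarrow> lam i s \<omega>) (at_left s)"
      using assms(2) by (simp add: at_within_Icc_at_left)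
    have "\<forall>\<^sub>F u in at_left s. u \<in> {0<..<s}" by (rule eventually_at_left_real[OF assms(2)])
    then have "\<forall>\<^sub>F u in at_left s. lam i u \<omega> \<le> B"
      by eventually_elim (use V assms(1) in \<open>auto simp: good_before_def good_def\<close>)
    then show "lam i s \<omega> \<le> B" by (rule tendsto_upperbound[OF lim]) simp
  qed
qed

lemma good_before_card:
  assumes k: "k \<in> {1..n}" and \<omega>: "\<omega> \<in> space M" and V: "good_before s \<omega>" and r: "0 \<le> r"
  shows "card (E k \<omega> \<inter> {r<..<s}) \<le> K"
proof (cases "E k \<omega> \<inter> {r<..<s} = {}")
  case False
  have fin: "finite (E k \<omega> \<inter> {r<..<s})" by (rule events_finite[OF k \<omega>, where t = s]) auto
  define m where "m = Max (E k \<omega> \<inter> {r<..<s})"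
  have m: "m \<in> E k \<omega> \<inter> {r<..<s}" unfolding m_def by (rule Max_in[OF fin False])
  have "card (E k \<omega> \<inter> {r<..<s}) \<le> card (E k \<omega> \<inter> {0..m})"
    using Max_ge[OF fin] r unfolding m_def[symmetric]
    by (intro card_mono events_finite[OF k \<omega>, where t = m]) auto
  moreover have "cnt k m \<omega> \<le> real K"
    using V m r k unfolding good_before_def good_def by auto
  ultimately show ?thesis by (simp add: cnt_eq)
qed simp

text \<open>The compensator formula with the rate replaced by its cap \<open>B\<close>. The envelope
  \<open>\<beta>\<close> turns the time integral into that of an explicit continuous function, so
  iterated estimates can be integrated by hand.\<close>

lemma stopped_sum_le:
  fixes H :: "real \<Rightarrow> 'a \<Rightarrow> real"
  assumes i: "i \<in> {1..n}" and ab: "0 \<le> a" "a < b"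
    and H: "\<And>s. s \<in> {a..b} \<Longrightarrow> H s \<in> borel_measurable (F s)"
    and lc: "\<And>s \<omega>. \<omega> \<in> space M \<Longrightarrow> s \<in> {a<..b} \<Longrightarrow> ((\<lambda>u. H u \<omega>) \<longlongrightarrow> H s \<omega>) (at_left s)"
    and H0: "\<And>s \<omega>. \<omega> \<in> space M \<Longrightarrow> s \<in> {a..b} \<Longrightarrow> 0 \<le> H s \<omega>"
    and c: "\<And>s \<omega>. \<omega> \<in> space M \<Longrightarrow> s \<in> {a..b} \<Longrightarrow> good_before s \<omega> \<Longrightarrow> H s \<omega> \<le> c"
    and \<beta>: "continuous_on {a..b} \<beta>" "\<And>s. s \<in> {a<..b} \<Longrightarrow> expectation (\<lambda>\<omega>. V s \<omega> * H s \<omega>) \<le> \<beta> s"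
  shows "integrable M (\<lambda>\<omega>. \<Sum>s\<in>E i \<omega> \<inter> {a<..b}. V s \<omega> * H s \<omega>)"
    and "expectation (\<lambda>\<omega>. \<Sum>s\<in>E i \<omega> \<inter> {a<..b}. V s \<omega> * H s \<omega>) \<le> B * integral {a..b} \<beta>"
proof -
  have meas: "(\<lambda>\<omega>. V s \<omega> * H s \<omega>) \<in> borel_measurable (F s)" if "s \<in> {a..b}" for s
    by (intro borel_measurable_times V_measurable_F H that)
  have bound: "\<bar>V s \<omega> * H s \<omega>\<bar> \<le> \<bar>c\<bar>" if "\<omega> \<in> space M" "s \<in> {a..b}" for s \<omega>
    using H0[OF that] c[OF that] by (auto simp: of_bool_def)
  note CF = compensator_formula[OF i ab meas tendsto_mult[OF V_left_continuous lc] bound]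
  show "integrable M (\<lambda>\<omega>. \<Sum>s\<in>E i \<omega> \<inter> {a<..b}. V s \<omega> * H s \<omega>)" by (rule CF(1))
  have B\<beta>: "set_integrable lborel {a..b} (\<lambda>s. B * \<beta> s)"
    by (intro borel_integrable_atLeastAtMost' continuous_intros \<beta>(1))
  have B\<beta>': "set_integrable lborel {a<..b} (\<lambda>s. B * \<beta> s)"
    by (rule set_integrable_subset[OF B\<beta>]) auto
  have "(LINT s:{a<..b}|lborel. expectation (\<lambda>\<omega>. V s \<omega> * H s \<omega> * lam i s \<omega>))
      \<le> (LINT s:{a<..b}|lborel. B * \<beta> s)"
  proof (rule set_integral_mono[OF CF(2) B\<beta>'])
    fix s assume s: "s \<in> {a<..b}"
    then have s': "s \<in> {a..b}" "0 < s" "0 \<le> s" using ab by auto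
    have VM: "(\<lambda>\<omega>. V s \<omega> * H s \<omega>) \<in> borel_measurable M" by (rule measurable_F_M[OF meas[OF s'(1)]])
    have "expectation (\<lambda>\<omega>. V s \<omega> * H s \<omega> * lam i s \<omega>) \<le> expectation (\<lambda>\<omega>. V s \<omega> * H s \<omega> * B)"
    proof (rule integral_mono_AE)
      show "integrable M (\<lambda>\<omega>. V s \<omega> * H s \<omega> * lam i s \<omega>)"
        by (rule integrable_bounded_mult[OF lam_integrable[OF i s'(3)] VM bound[OF _ s'(1)]])
      show "integrable M (\<lambda>\<omega>. V s \<omega> * H s \<omega> * B)"
        by (rule integrable_bounded_mult[OF _ VM bound[OF _ s'(1)]]) simp
      show "AE \<omega> in M. V s \<omega> * H s \<omega> * lam i s \<omega> \<le> V s \<omega> * H s \<omega> * B"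
        using AE_good_before_lam[OF i s'(2)] AE_space
        by eventually_elim (use H0[OF _ s'(1)] in \<open>auto intro!: mult_left_mono\<close>)
    qed
    also have "\<dots> = B * expectation (\<lambda>\<omega>. V s \<omega> * H s \<omega>)" by simp
    also have "\<dots> \<le> B * \<beta> s" using \<beta>(2)[OF s] B_ge(1) by (intro mult_left_mono) auto
    finally show "expectation (\<lambda>\<omega>. V s \<omega> * H s \<omega> * lam i s \<omega>) \<le> B * \<beta> s" .
  qed
  also have "\<dots> = (LINT s:{a..b}|lborel. B * \<beta> s)"
  proof (rule set_integral_cong_set)
    show "AE x in lborel. (x \<in> {a..b}) = (x \<in> {a<..b})"
      using AE_lborel_singleton[of a] by eventually_elim auto
  qed (use B\<beta> B\<beta>' in \<open>auto simp: set_borel_measurable_def set_integrable_def dest: borel_measurable_integrable\<close>)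
  also have "\<dots> = integral {a..b} (\<lambda>s. B * \<beta> s)"
    by (rule set_borel_integral_eq_integral(2)[OF B\<beta>])
  also have "\<dots> = B * integral {a..b} \<beta>" by simp
  finally show "expectation (\<lambda>\<omega>. \<Sum>s\<in>E i \<omega> \<inter> {a<..b}. V s \<omega> * H s \<omega>) \<le> B * integral {a..b} \<beta>"
    using CF(3) by simp
qed

text \<open>Stopping by \<^const>\<open>good_before\<close> still counts the event at which the bound is first exceeded.\<close>

definition stopped :: "nat \<Rightarrow> real \<Rightarrow> real \<Rightarrow> 'a \<Rightarrow> real set" where
  "stopped i a b \<omega> = {s \<in> E i \<omega> \<inter> {a<..b}. good_before s \<omega>}"

lemma stopped_finite: "i \<in> {1..n} \<Longrightarrow> \<omega> \<in> space M \<Longrightarrow> finite (stopped i a b \<omega>)"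
  unfolding stopped_def by (rule finite_subset[OF _ events_finite[where t = b and S = "{a<..b}"]]) auto

lemma stopped_sum:
  assumes "i \<in> {1..n}" "\<omega> \<in> space M"
  shows "(\<Sum>s\<in>stopped i a b \<omega>. h s) = (\<Sum>s\<in>E i \<omega> \<inter> {a<..b}. V s \<omega> * h s)"
  unfolding stopped_def
  by (subst sum.inter_filter[OF events_finite[OF assms, where t = b]]) (auto intro!: sum.cong)

lemma stopped_card_sum:
  assumes "i \<in> {1..n}" "\<omega> \<in> space M"
  shows "real (card (stopped i a b \<omega>)) = (\<Sum>s\<in>E i \<omega> \<inter> {a<..b}. V s \<omega>)"
  using stopped_sum[OF assms, of "\<lambda>_. 1"] by simp

text \<open>All times before the last stopped event are good, so at most \<open>K\<close> events
  precede it; the last event itself accounts for the successor.\<close>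

lemma stopped_card_le:
  assumes i: "i \<in> {1..n}" and \<omega>: "\<omega> \<in> space M" and a: "0 \<le> a"
  shows "card (stopped i a b \<omega>) \<le> Suc K"
proof (cases "stopped i a b \<omega> = {}")
  case False
  note fin = stopped_finite[OF i \<omega>, of a b]
  define m where "m = Max (stopped i a b \<omega>)"
  have m: "m \<in> stopped i a b \<omega>" unfolding m_def by (rule Max_in[OF fin False])
  have "stopped i a b \<omega> \<subseteq> insert m (E i \<omega> \<inter> {a<..<m})"
    using Max_ge[OF fin] unfolding m_def[symmetric] by (fastforce simp: stopped_def)
  then have "card (stopped i a b \<omega>) \<le> card (insert m (E i \<omega> \<inter> {a<..<m}))"
    by (intro card_mono finite.insertI events_finite[OF i \<omega>, where t = m]) auto
  also have "\<dots> \<le> Suc (card (E i \<omega> \<inter> {a<..<m}))" by (rule card_insert_le_m1) auto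
  also have "\<dots> \<le> Suc K" using good_before_card[OF i \<omega> _ a, of m] m by (auto simp: stopped_def)
  finally show ?thesis .
qed simp

lemma stopped_count_integrable:
  assumes r: "0 \<le> r" and i: "i \<in> {1..n}" and b: "r \<le> b"
  shows "(\<lambda>\<omega>. real (card (stopped i r b \<omega>))) \<in> borel_measurable (F b)"
    "integrable M (\<lambda>\<omega>. real (card (stopped i r b \<omega>)))"
proof -
  have "(\<lambda>\<omega>. \<Sum>s\<in>E i \<omega> \<inter> {r<..b}. V s \<omega>) \<in> borel_measurable (F b)"
    by (rule sum_events_measurable[OF i r b V_measurable_F V_left_continuous])
  then show *: "(\<lambda>\<omega>. real (card (stopped i r b \<omega>))) \<in> borel_measurable (F b)"
    by (rule measurable_cong[THEN iffD1, rotated]) (auto simp: stopped_card_sum[OF i])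
  have "real (card (stopped i r b \<omega>)) \<le> real (Suc K)" if "\<omega> \<in> space M" for \<omega>
    using stopped_card_le[OF i that r] by (simp only: of_nat_le_iff)
  then show "integrable M (\<lambda>\<omega>. real (card (stopped i r b \<omega>)))"
    by (intro integrable_const_bound[of _ "real (Suc K)"] AE_I2 measurable_F_M[OF *]) simp
qed

context
  fixes Z :: "'a \<Rightarrow> real" and r c :: real
  assumes r: "0 \<le> r" and Z: "Z \<in> borel_measurable (F r)"
    and Z0: "\<And>\<omega>. \<omega> \<in> space M \<Longrightarrow> 0 \<le> Z \<omega>" and Zc: "\<And>\<omega>. \<omega> \<in> space M \<Longrightarrow> Z \<omega> \<le> c"
begin

lemma Z_integrable: "integrable M Z"
  by (rule integrable_const_bound[of _ c]) (use Z0 Zc measurable_F_M[OF Z] in auto)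

lemma Z_integrable_mult: "integrable M f \<Longrightarrow> integrable M (\<lambda>\<omega>. Z \<omega> * f \<omega>)"
  by (rule integrable_bounded_mult[OF _ measurable_F_M[OF Z], of _ c]) (use Z0 Zc in auto)

lemma stopped_count_expectation:
  assumes i: "i \<in> {1..n}" and b: "r \<le> b"
  shows "expectation (\<lambda>\<omega>. Z \<omega> * card (stopped i r b \<omega>)) \<le> B * (b - r) * expectation Z"
proof (cases "r = b")
  case False
  then have rb: "r < b" using b by simp
  have "expectation (\<lambda>\<omega>. Z \<omega> * card (stopped i r b \<omega>))
      = expectation (\<lambda>\<omega>. \<Sum>s\<in>E i \<omega> \<inter> {r<..b}. V s \<omega> * Z \<omega>)"
    by (intro Bochner_Integration.integral_cong refl)
      (simp add: stopped_card_sum[OF i] sum_distrib_left mult.commute)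
  also have "\<dots> \<le> B * integral {r..b} (\<lambda>_. expectation Z)"
  proof (rule stopped_sum_le(2)[OF i r rb])
    show "Z \<in> borel_measurable (F s)" if "s \<in> {r..b}" for s
      by (rule measurable_F_mono[OF Z]) (use that in auto)
    show "expectation (\<lambda>\<omega>. V s \<omega> * Z \<omega>) \<le> expectation Z" for s
    proof (rule integral_mono)
      show "integrable M (\<lambda>\<omega>. V s \<omega> * Z \<omega>)"
        by (rule integrable_bounded_mult[OF Z_integrable measurable_F_M[OF V_measurable_F], of _ 1]) simp
    qed (use Z_integrable Z0 in auto)
  qed (use Z0 Zc in auto)
  finally show ?thesis using b by (simp add: algebra_simps)
qed (simp add: stopped_def)

text \<open>The compensator formula is used twice: the number of \<open>k\<close>-events strictly
  before \<open>s\<close> is a predictable integrand with weighted mean at most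
  \<open>B * (s - r) * expectation Z\<close>, and integrating this against the cap \<open>B\<close>
  yields the factor 1/2 of ordered pairs.\<close>

lemma stopped_pairs_aux:
  assumes i: "i \<in> {1..n}" and k: "k \<in> {1..n}" and b: "r < b"
  shows "integrable M (\<lambda>\<omega>. Z \<omega> * (\<Sum>x\<in>stopped i r b \<omega>. real (card (stopped k r b \<omega> \<inter> {..<x}))))"
    "expectation (\<lambda>\<omega>. Z \<omega> * (\<Sum>x\<in>stopped i r b \<omega>. real (card (stopped k r b \<omega> \<inter> {..<x}))))
      \<le> (B * (b - r))\<^sup>2 / 2 * expectation Z"
proof -
  \<comment> \<open>The stopping factor stays inside the sum so that \<open>J\<close> compares with
    a stopped count. \<open>J\<close> is capped by \<open>K\<close> only while
    \<open>good_before\<close> holds, hence the outer factor \<open>V s\<close> as well.\<close>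
  define J where "J = (\<lambda>s \<omega>. \<Sum>u\<in>E k \<omega> \<inter> {r<..<s}. V u \<omega>)"
  have J_eq: "real (card (stopped k r b \<omega> \<inter> {..<x})) = J x \<omega>" if "\<omega> \<in> space M" "x \<in> stopped i r b \<omega>" for \<omega> x
  proof -
    have "stopped k r b \<omega> \<inter> {..<x} = {u \<in> E k \<omega> \<inter> {r<..<x}. good_before u \<omega>}"
      using that(2) by (auto simp: stopped_def)
    moreover have "real (card {u \<in> E k \<omega> \<inter> {r<..<x}. good_before u \<omega>})
        = (\<Sum>u\<in>{u \<in> E k \<omega> \<inter> {r<..<x}. good_before u \<omega>}. 1)" by simp
    moreover have "\<dots> = J x \<omega>" unfolding J_def
      by (subst sum.inter_filter[OF events_finite[OF k that(1), where t = x]]) (auto intro!: sum.cong)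
    ultimately show ?thesis by simp
  qed
  have J0: "0 \<le> J s \<omega>" for s \<omega> by (auto simp: J_def intro: sum_nonneg)
  have J_meas: "J s \<in> borel_measurable (F s)" if "s \<in> {r..b}" for s
  proof (cases "s = r")
    case False
    then show ?thesis unfolding J_def using that
      by (intro sum_events_before_measurable[OF k r _ V_measurable_F V_left_continuous]) auto
  qed (simp add: J_def)
  have J_le: "J s \<omega> \<le> real K" if "\<omega> \<in> space M" "good_before s \<omega>" for s \<omega>
  proof -
    have "J s \<omega> \<le> (\<Sum>u\<in>E k \<omega> \<inter> {r<..<s}. 1)" unfolding J_def by (rule sum_mono) auto
    also have "\<dots> \<le> real K" using good_before_card[OF k that r] by simp
    finally show ?thesis .
  qed
  have eq: "Z \<omega> * (\<Sum>x\<in>stopped i r b \<omega>. real (card (stopped k r b \<omega> \<inter> {..<x})))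
      = (\<Sum>s\<in>E i \<omega> \<inter> {r<..b}. V s \<omega> * (Z \<omega> * J s \<omega>))" if "\<omega> \<in> space M" for \<omega>
  proof -
    have "(\<Sum>x\<in>stopped i r b \<omega>. real (card (stopped k r b \<omega> \<inter> {..<x}))) = (\<Sum>x\<in>stopped i r b \<omega>. J x \<omega>)"
      by (intro sum.cong refl J_eq that)
    also have "\<dots> = (\<Sum>s\<in>E i \<omega> \<inter> {r<..b}. V s \<omega> * J s \<omega>)" by (rule stopped_sum[OF i that])
    finally show ?thesis by (simp add: sum_distrib_left mult_ac)
  qed
  have cont: "continuous_on {r..b} (\<lambda>s. B * (s - r) * expectation Z)" by (intro continuous_intros)
    have A1: "(\<lambda>\<omega>. Z \<omega> * J s \<omega>) \<in> borel_measurable (F s)" if "s \<in> {r..b}" for s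
      by (intro borel_measurable_times measurable_F_mono[OF Z] J_meas) (use that in auto)
    have A2: "((\<lambda>u. Z \<omega> * J u \<omega>) \<longlongrightarrow> Z \<omega> * J s \<omega>) (at_left s)" if "\<omega> \<in> space M" for s \<omega>
      unfolding J_def
      by (intro tendsto_mult_left sum_left_continuous locally_finite[OF k that] events_nonneg[OF k that])
    have A3: "0 \<le> Z \<omega> * J s \<omega>" if "\<omega> \<in> space M" for s \<omega> using Z0[OF that] J0 by simp
    have A4: "Z \<omega> * J s \<omega> \<le> c * real K" if "\<omega> \<in> space M" "good_before s \<omega>" for s \<omega>
      using Z0[OF that(1)] Zc[OF that(1)] J0 J_le[OF that] by (intro mult_mono) auto
    have A5: "expectation (\<lambda>\<omega>. V s \<omega> * (Z \<omega> * J s \<omega>)) \<le> B * (s - r) * expectation Z" if s: "s \<in> {r<..b}" for s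
    proof -
      have rs: "r \<le> s" using s by simp
      have "expectation (\<lambda>\<omega>. V s \<omega> * (Z \<omega> * J s \<omega>)) \<le> expectation (\<lambda>\<omega>. Z \<omega> * card (stopped k r s \<omega>))"
      proof (rule integral_mono)
        have JK: "\<bar>V s \<omega> * J s \<omega>\<bar> \<le> real K" if "\<omega> \<in> space M" for \<omega>
          using J_le[OF that] J0[of s \<omega>] by (auto simp: of_bool_def)
        have "integrable M (\<lambda>\<omega>. (V s \<omega> * J s \<omega>) * Z \<omega>)"
          by (rule integrable_bounded_mult[OF Z_integrable _ JK],
              intro measurable_F_M[of _ s] borel_measurable_times V_measurable_F J_meas) (use s in auto)
        then show "integrable M (\<lambda>\<omega>. V s \<omega> * (Z \<omega> * J s \<omega>))" by (simp add: mult_ac)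
        show "integrable M (\<lambda>\<omega>. Z \<omega> * card (stopped k r s \<omega>))"
          by (rule Z_integrable_mult[OF stopped_count_integrable(2)[OF r k rs]])
        fix \<omega> assume \<omega>: "\<omega> \<in> space M"
        have "J s \<omega> \<le> card (stopped k r s \<omega>)"
          unfolding J_def stopped_card_sum[OF k \<omega>]
          by (rule sum_mono2) (auto intro!: events_finite[OF k \<omega>, where t = s])
        then have "Z \<omega> * J s \<omega> \<le> Z \<omega> * card (stopped k r s \<omega>)" using Z0[OF \<omega>] by (rule mult_left_mono)
        moreover have "V s \<omega> * (Z \<omega> * J s \<omega>) \<le> Z \<omega> * J s \<omega>"
          using Z0[OF \<omega>] J0[of s \<omega>] by (auto simp: of_bool_def)
        ultimately show "V s \<omega> * (Z \<omega> * J s \<omega>) \<le> Z \<omega> * card (stopped k r s \<omega>)" by simp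
      qed
      also have "\<dots> \<le> B * (s - r) * expectation Z" by (rule stopped_count_expectation[OF k rs])
      finally show ?thesis .
    qed
  note main = stopped_sum_le[OF i r b A1 A2 A3 A4 cont A5]
  have "((\<lambda>s. B * (s - r) * expectation Z) has_integral
      (B * (b - r)\<^sup>2 / 2 * expectation Z - B * (r - r)\<^sup>2 / 2 * expectation Z)) {r..b}"
    by (rule fundamental_theorem_of_calculus)
      (use b in \<open>auto intro!: derivative_eq_intros simp flip: has_real_derivative_iff_has_vector_derivative\<close>)
  from integral_unique[OF this]
  have "integral {r..b} (\<lambda>s. B * (s - r) * expectation Z) = B * (b - r)\<^sup>2 / 2 * expectation Z"
    unfolding diff_self by simp
  then have "B * integral {r..b} (\<lambda>s. B * (s - r) * expectation Z) = (B * (b - r))\<^sup>2 / 2 * expectation Z"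
    by (simp only:) (simp add: power2_eq_square)
  moreover have "expectation (\<lambda>\<omega>. Z \<omega> * (\<Sum>x\<in>stopped i r b \<omega>. real (card (stopped k r b \<omega> \<inter> {..<x}))))
      = expectation (\<lambda>\<omega>. \<Sum>s\<in>E i \<omega> \<inter> {r<..b}. V s \<omega> * (Z \<omega> * J s \<omega>))"
    by (intro Bochner_Integration.integral_cong refl eq)
  ultimately show "expectation (\<lambda>\<omega>. Z \<omega> * (\<Sum>x\<in>stopped i r b \<omega>. real (card (stopped k r b \<omega> \<inter> {..<x}))))
      \<le> (B * (b - r))\<^sup>2 / 2 * expectation Z" using main(2) by (simp only:)
  show "integrable M (\<lambda>\<omega>. Z \<omega> * (\<Sum>x\<in>stopped i r b \<omega>. real (card (stopped k r b \<omega> \<inter> {..<x}))))"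
    by (rule Bochner_Integration.integrable_cong[OF refl eq, THEN iffD2, OF _ main(1)])
qed

lemma stopped_pairs_expectation:
  assumes i: "i \<in> {1..n}" and k: "k \<in> {1..n}" and b: "r < b"
  shows "integrable M (\<lambda>\<omega>. Z \<omega> * card {(x, y) \<in> stopped i r b \<omega> \<times> stopped k r b \<omega>. x \<noteq> y})"
    "expectation (\<lambda>\<omega>. Z \<omega> * card {(x, y) \<in> stopped i r b \<omega> \<times> stopped k r b \<omega>. x \<noteq> y})
      \<le> (B * (b - r))\<^sup>2 * expectation Z"
proof -
  have eq: "Z \<omega> * card {(x, y) \<in> stopped i r b \<omega> \<times> stopped k r b \<omega>. x \<noteq> y} =
      Z \<omega> * (\<Sum>x\<in>stopped i r b \<omega>. real (card (stopped k r b \<omega> \<inter> {..<x}))) +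
      Z \<omega> * (\<Sum>y\<in>stopped k r b \<omega>. real (card (stopped i r b \<omega> \<inter> {..<y})))" if "\<omega> \<in> space M" for \<omega>
    using card_offdiagonal_eq[OF stopped_finite[OF i that] stopped_finite[OF k that]]
    by (simp add: distrib_left)
  note aux = stopped_pairs_aux[OF i k b] stopped_pairs_aux[OF k i b]
  show "integrable M (\<lambda>\<omega>. Z \<omega> * card {(x, y) \<in> stopped i r b \<omega> \<times> stopped k r b \<omega>. x \<noteq> y})"
    by (rule Bochner_Integration.integrable_cong[OF refl eq, THEN iffD2],
        assumption, intro Bochner_Integration.integrable_add aux(1,3))
  have "expectation (\<lambda>\<omega>. Z \<omega> * card {(x, y) \<in> stopped i r b \<omega> \<times> stopped k r b \<omega>. x \<noteq> y}) =
    expectation (\<lambda>\<omega>. Z \<omega> * (\<Sum>x\<in>stopped i r b \<omega>. real (card (stopped k r b \<omega> \<inter> {..<x})))) +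
    expectation (\<lambda>\<omega>. Z \<omega> * (\<Sum>y\<in>stopped k r b \<omega>. real (card (stopped i r b \<omega> \<inter> {..<y}))))"
    by (subst Bochner_Integration.integral_add[OF aux(1,3), symmetric])
      (intro Bochner_Integration.integral_cong refl eq)
  then show "expectation (\<lambda>\<omega>. Z \<omega> * card {(x, y) \<in> stopped i r b \<omega> \<times> stopped k r b \<omega>. x \<noteq> y})
      \<le> (B * (b - r))\<^sup>2 * expectation Z"
    using aux(2,4) by simp
qed

end

section \<open>The rates stay moderate\<close>

context
  fixes i :: nat and \<theta> t0 :: real
  assumes i: "i \<in> {1..n}" and \<theta>: "0 < \<theta>" "\<theta> * w_max \<le> 1" and t0: "0 \<le> t0"
begin

text \<open>Kernels are viewed from the fixed later time \<open>t0\<close> and scaled by the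
  exponential tilt \<open>\<theta>\<close>. Time then enters the functionals below only through the
  set of events counted so far, so they are additive over events.\<close>

definition kern :: "nat \<Rightarrow> real \<Rightarrow> real" where
  "kern j s = \<theta> * w i j * \<phi> i j t0 s"

text \<open>At \<open>t = t0\<close>, apart from stopping and events at time 0, this is
  \<open>\<theta>\<close> times the self-exciting part of the rate of node \<open>i\<close>. The
  variant \<open>load_before\<close> leaves out time \<open>t\<close>, and is therefore
  predictable.\<close>

definition load :: "real \<Rightarrow> 'a \<Rightarrow> real" where
  "load t \<omega> = (\<Sum>j=1..n. \<Sum>s\<in>stopped j 0 t \<omega>. kern j s)"

definition load_before :: "real \<Rightarrow> 'a \<Rightarrow> real" where
  "load_before t \<omega> = (\<Sum>j=1..n. \<Sum>s\<in>E j \<omega> \<inter> {0<..<t}. V s \<omega> * kern j s)"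

definition load_cap :: real where "load_cap = real n * real (Suc K)"

lemma kern_bounds:
  assumes "j \<in> {1..n}" "0 \<le> s" "s \<le> t0"
  shows "0 \<le> kern j s" "kern j s \<le> \<theta> * w_max"
proof -
  have "0 \<le> \<phi> i j t0 s" "\<phi> i j t0 s \<le> 1"
    using phi_nonneg'[OF i assms] phi_le_1[OF i assms] by auto
  moreover have "0 \<le> w i j" "w i j \<le> w_max" using w_bounds[OF i assms(1)] by auto
  ultimately show "0 \<le> kern j s" "kern j s \<le> \<theta> * w_max"
    unfolding kern_def using \<theta>(1) mult_mono[of "w i j" w_max "\<phi> i j t0 s" 1] by (auto simp: mult.assoc)
qed

lemma kern_continuous: "j \<in> {1..n} \<Longrightarrow> continuous_on {0..t0} (kern j)"
  unfolding kern_def by (intro continuous_intros phi_continuous_second i t0)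

text \<open>Linearising the exponential costs only a factor close to 1 when \<theta> is small. This
  matters because the total loss must fit into the margin left by subcriticality.\<close>

lemma exp_kern_le:
  assumes "j \<in> {1..n}" "0 \<le> s" "s \<le> t0"
  shows "exp (kern j s) - 1 \<le> (1 + \<theta> * w_max) * kern j s"
proof -
  note b = kern_bounds[OF assms]
  have "exp (kern j s) \<le> 1 + kern j s + (kern j s)\<^sup>2" by (rule exp_bound) (use b \<theta> in auto)
  also have "(kern j s)\<^sup>2 \<le> \<theta> * w_max * kern j s" using b by (simp add: power2_eq_square mult_right_mono)
  finally show ?thesis by (simp add: algebra_simps)
qed

lemma load_before_sets:
  assumes "j \<in> {1..n}" "\<omega> \<in> space M"
  shows "(\<Sum>s\<in>E j \<omega> \<inter> {0<..<t}. V s \<omega> * h s) = (\<Sum>s\<in>{s \<in> E j \<omega> \<inter> {0<..<t}. good_before s \<omega>}. h s)"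
  by (subst sum.inter_filter[OF events_finite[OF assms, where t = t]]) (auto intro!: sum.cong)

text \<open>Nodes are merged into one family of pairs (node, time). Absence of simultaneous events
  makes the time an injective label on this family, as the telescoping requires.\<close>

lemma exp_load_telescope:
  assumes \<omega>: "\<omega> \<in> space M" and disj: "disjoint_family_on (\<lambda>j. E j \<omega>) {1..n}"
  shows "exp (load t \<omega>) = 1 + (\<Sum>j=1..n. \<Sum>s\<in>stopped j 0 t \<omega>. exp (load_before s \<omega>) * (exp (kern j s) - 1))"
proof -
  define P where "P = (SIGMA j:{1..n}. stopped j 0 t \<omega>)"
  have fin: "finite P" unfolding P_def by (intro finite_SigmaI stopped_finite \<omega>) auto
  have inj: "inj_on snd P"
  proof (rule inj_onI)
    fix p q assume pq: "p \<in> P" "q \<in> P" "snd p = snd q"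
    then have "snd p \<in> E (fst p) \<omega> \<inter> E (fst q) \<omega>" "fst p \<in> {1..n}" "fst q \<in> {1..n}"
      by (auto simp: P_def stopped_def)
    then have "fst p = fst q" using disj unfolding disjoint_family_on_def by blast
    then show "p = q" using pq(3) by (simp add: prod_eq_iff)
  qed
  have "exp (\<Sum>p\<in>P. case p of (j, s) \<Rightarrow> kern j s) =
     1 + (\<Sum>p\<in>P. exp (\<Sum>q\<in>{q\<in>P. snd q < snd p}. case q of (j, s) \<Rightarrow> kern j s) * (exp (case p of (j, s) \<Rightarrow> kern j s) - 1))"
    by (rule exp_sum_telescope[OF fin inj])
  also have "(\<Sum>p\<in>P. exp (\<Sum>q\<in>{q\<in>P. snd q < snd p}. case q of (j, s) \<Rightarrow> kern j s) * (exp (case p of (j, s) \<Rightarrow> kern j s) - 1))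
      = (\<Sum>p\<in>P. case p of (j, s) \<Rightarrow> exp (load_before s \<omega>) * (exp (kern j s) - 1))"
  proof (rule sum.cong[OF refl])
    fix p assume p: "p \<in> P"
    have eq: "{q\<in>P. snd q < snd p} = (SIGMA j:{1..n}. {s \<in> E j \<omega> \<inter> {0<..<snd p}. good_before s \<omega>})"
      using p by (auto simp: P_def stopped_def)
    have finj: "finite {s \<in> E j \<omega> \<inter> {0<..<snd p}. good_before s \<omega>}" if "j \<in> {1..n}" for j
      by (rule finite_subset[OF _ events_finite[OF that \<omega>, where t = "snd p" and S = "{0<..<snd p}"]]) auto
    have "(\<Sum>q\<in>{q\<in>P. snd q < snd p}. case q of (j, s) \<Rightarrow> kern j s)
        = (\<Sum>j=1..n. \<Sum>s\<in>{s \<in> E j \<omega> \<inter> {0<..<snd p}. good_before s \<omega>}. kern j s)"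
      unfolding eq by (rule sum.Sigma[symmetric]) (use finj in blast)+
    also have "\<dots> = load_before (snd p) \<omega>"
      unfolding load_before_def by (rule sum.cong[OF refl], rule load_before_sets[symmetric, OF _ \<omega>])
    finally have "(\<Sum>q\<in>{q\<in>P. snd q < snd p}. case q of (j, s) \<Rightarrow> kern j s) = load_before (snd p) \<omega>" .
    then show "exp (\<Sum>q\<in>{q\<in>P. snd q < snd p}. case q of (j, s) \<Rightarrow> kern j s) * (exp (case p of (j, s) \<Rightarrow> kern j s) - 1)
        = (case p of (j, s) \<Rightarrow> exp (load_before s \<omega>) * (exp (kern j s) - 1))"
      by (cases p) (simp only: snd_conv prod.case)
  qed
  also have "\<dots> = (\<Sum>j=1..n. \<Sum>s\<in>stopped j 0 t \<omega>. exp (load_before s \<omega>) * (exp (kern j s) - 1))"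
    unfolding P_def by (rule sum.Sigma[symmetric]) (use stopped_finite[OF _ \<omega>] in blast)+
  also have "(\<Sum>p\<in>P. case p of (j, s) \<Rightarrow> kern j s) = load t \<omega>"
    unfolding P_def load_def by (rule sum.Sigma[symmetric]) (use stopped_finite[OF _ \<omega>] in blast)+
  finally show ?thesis .
qed

lemma load_measurable:
  assumes "0 \<le> t" "t \<le> t0"
  shows "load t \<in> borel_measurable M"
proof -
  have "(\<lambda>\<omega>. \<Sum>j=1..n. \<Sum>s\<in>E j \<omega> \<inter> {0<..t}. V s \<omega> * kern j s) \<in> borel_measurable M"
  proof (intro borel_measurable_sum measurable_F_M[of _ t] sum_events_measurable)
    fix j s assume j: "j \<in> {1..n}"
    show "(\<lambda>\<omega>. V s \<omega> * kern j s) \<in> borel_measurable (F s)"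
      by (intro borel_measurable_times V_measurable_F) auto
    fix \<omega> assume s: "s \<in> {0<..t}"
    have "(kern j \<longlongrightarrow> kern j s) (at s within {0..t0})"
      using kern_continuous[OF j] s assms by (simp add: continuous_on_def)
    then have "(kern j \<longlongrightarrow> kern j s) (at s within {0..s})"
      by (rule tendsto_within_subset) (use s assms in auto)
    then show "((\<lambda>u. V u \<omega> * kern j u) \<longlongrightarrow> V s \<omega> * kern j s) (at_left s)"
      using s by (intro tendsto_mult V_left_continuous) (simp add: at_within_Icc_at_left)
  qed (use assms in auto)
  then show ?thesis
    by (rule measurable_cong[THEN iffD1, rotated]) (auto simp: load_def stopped_sum intro!: sum.cong)
qed

lemma load_bounds:
  assumes t: "t \<le> t0" and \<omega>: "\<omega> \<in> space M"
  shows "0 \<le> load t \<omega>" "load t \<omega> \<le> load_cap"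
proof -
  have k: "0 \<le> kern j s" "kern j s \<le> 1" if "j \<in> {1..n}" "s \<in> stopped j 0 t \<omega>" for j s
    using kern_bounds[OF that(1), of s] \<theta>(2) that(2) t by (auto simp: stopped_def)
  show "0 \<le> load t \<omega>" unfolding load_def by (intro sum_nonneg k)
  have "load t \<omega> \<le> (\<Sum>j=1..n. real (Suc K))"
    unfolding load_def
  proof (rule sum_mono)
    fix j assume j: "j \<in> {1..n}"
    have "(\<Sum>s\<in>stopped j 0 t \<omega>. kern j s) \<le> (\<Sum>s\<in>stopped j 0 t \<omega>. 1)" by (rule sum_mono) (rule k[OF j])
    also have "\<dots> = real (card (stopped j 0 t \<omega>))" by simp
    also have "\<dots> \<le> real (Suc K)" by (subst of_nat_le_iff) (rule stopped_card_le[OF j \<omega> order_refl])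
    finally show "(\<Sum>s\<in>stopped j 0 t \<omega>. kern j s) \<le> real (Suc K)" .
  qed
  then show "load t \<omega> \<le> load_cap" by (simp add: load_cap_def)
qed

lemma load_before_le:
  assumes t: "t \<le> t0" and \<omega>: "\<omega> \<in> space M"
  shows "load_before t \<omega> \<le> load t \<omega>"
  unfolding load_before_def load_def
proof (rule sum_mono)
  fix j assume j: "j \<in> {1..n}"
  have "(\<Sum>s\<in>E j \<omega> \<inter> {0<..<t}. V s \<omega> * kern j s) \<le> (\<Sum>s\<in>E j \<omega> \<inter> {0<..t}. V s \<omega> * kern j s)"
    by (rule sum_mono2) (use kern_bounds[OF j] t in \<open>auto intro!: events_finite[OF j \<omega>, where t = t]\<close>)
  then show "(\<Sum>s\<in>E j \<omega> \<inter> {0<..<t}. V s \<omega> * kern j s) \<le> (\<Sum>s\<in>stopped j 0 t \<omega>. kern j s)"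
    by (simp add: stopped_sum[OF j \<omega>])
qed

lemma exp_load_integrable:
  assumes "0 \<le> t" "t \<le> t0"
  shows "integrable M (\<lambda>\<omega>. exp (load t \<omega>))"
  by (rule integrable_const_bound[of _ "exp (load_cap)"])
    (use load_bounds(2)[OF assms(2)] load_measurable[OF assms] in auto)

lemma load_before_measurable:
  assumes "0 \<le> s" "s \<le> t0"
  shows "load_before s \<in> borel_measurable (F s)"
proof (cases "s = 0")
  case True
  then show ?thesis by (simp add: load_before_def[abs_def])
next
  case False
  have "(\<lambda>\<omega>. \<Sum>j=1..n. \<Sum>u\<in>E j \<omega> \<inter> {0<..<s}. V u \<omega> * kern j u) \<in> borel_measurable (F s)"
  proof (intro borel_measurable_sum sum_events_before_measurable)
    fix j u assume j: "j \<in> {1..n}"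
    show "(\<lambda>\<omega>. V u \<omega> * kern j u) \<in> borel_measurable (F u)"
      by (intro borel_measurable_times V_measurable_F) auto
    fix \<omega> assume u: "u \<in> {0<..s}"
    have "(kern j \<longlongrightarrow> kern j u) (at u within {0..t0})"
      using kern_continuous[OF j] u assms by (simp add: continuous_on_def)
    then have "(kern j \<longlongrightarrow> kern j u) (at u within {0..u})"
      by (rule tendsto_within_subset) (use u assms in auto)
    then show "((\<lambda>u. V u \<omega> * kern j u) \<longlongrightarrow> V u \<omega> * kern j u) (at_left u)"
      using u by (intro tendsto_mult V_left_continuous) (simp add: at_within_Icc_at_left)
  qed (use False assms in auto)
  then show ?thesis by (simp add: load_before_def[abs_def])
qed

text \<open>Each term of the telescoped exponential is compensated with the cap \<open>B\<close> in
  place of the rate. The function \<open>g\<close> stands for any continuous upper bound, because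
  the time integral is formed with \<open>g\<close> and not with the exponential moment
  itself.\<close>

lemma exp_load_step:
  assumes t: "0 < t" "t \<le> t0" and g: "continuous_on {0..t} g"
    "\<And>s. 0 \<le> s \<Longrightarrow> s \<le> t \<Longrightarrow> expectation (\<lambda>\<omega>. exp (load s \<omega>)) \<le> g s"
  shows "expectation (\<lambda>\<omega>. exp (load t \<omega>)) \<le>
    1 + integral {0..t} (\<lambda>s. B * (1 + \<theta> * w_max) * (\<Sum>j=1..n. kern j s) * g s)"
proof -
  have step: "integrable M (\<lambda>\<omega>. \<Sum>s\<in>E j \<omega> \<inter> {0<..t}. V s \<omega> * (exp (load_before s \<omega>) * (exp (kern j s) - 1)))"
    "expectation (\<lambda>\<omega>. \<Sum>s\<in>E j \<omega> \<inter> {0<..t}. V s \<omega> * (exp (load_before s \<omega>) * (exp (kern j s) - 1)))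
      \<le> B * integral {0..t} (\<lambda>s. (1 + \<theta> * w_max) * kern j s * g s)" if j: "j \<in> {1..n}" for j
  proof -
    have kc: "continuous_on {0..t} (kern j)"
      by (rule continuous_on_subset[OF kern_continuous[OF j]]) (use t in auto)
    have A1: "(\<lambda>\<omega>. exp (load_before s \<omega>) * (exp (kern j s) - 1)) \<in> borel_measurable (F s)" if "s \<in> {0..t}" for s
      using load_before_measurable[of s] that t by auto
    have A2: "((\<lambda>u. exp (load_before u \<omega>) * (exp (kern j u) - 1)) \<longlongrightarrow> exp (load_before s \<omega>) * (exp (kern j s) - 1)) (at_left s)"
      if \<omega>: "\<omega> \<in> space M" and s: "s \<in> {0<..t}" for s \<omega>
    proof (intro tendsto_mult tendsto_exp tendsto_diff tendsto_const)
      show "((\<lambda>u. load_before u \<omega>) \<longlongrightarrow> load_before s \<omega>) (at_left s)"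
        unfolding load_before_def
        by (intro tendsto_sum sum_left_continuous locally_finite \<omega> events_nonneg)
      have "(kern j \<longlongrightarrow> kern j s) (at s within {0..t})"
        using kc s by (simp add: continuous_on_def)
      then have "(kern j \<longlongrightarrow> kern j s) (at s within {0..s})"
        by (rule tendsto_within_subset) (use s in auto)
      then show "(kern j \<longlongrightarrow> kern j s) (at_left s)" using s by (simp add: at_within_Icc_at_left)
    qed
    have A3: "0 \<le> exp (load_before s \<omega>) * (exp (kern j s) - 1)" if "s \<in> {0..t}" for s \<omega>
      using kern_bounds(1)[OF j, of s] that t by simp
    have lb: "exp (load_before s \<omega>) \<le> exp (load_cap)" if "\<omega> \<in> space M" "s \<in> {0..t}" for s \<omega>
      using load_before_le[OF _ that(1), of s] load_bounds(2)[OF _ that(1), of s] that(2) t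
      by (auto intro: order_trans)
    have A4: "exp (load_before s \<omega>) * (exp (kern j s) - 1) \<le> exp (load_cap) * (exp 1 - 1)"
      if "\<omega> \<in> space M" "s \<in> {0..t}" "good_before s \<omega>" for s \<omega>
      using lb[OF that(1,2)] kern_bounds[OF j, of s] that t \<theta>(2)
      by (intro mult_mono) auto
    have A5: "continuous_on {0..t} (\<lambda>s. (1 + \<theta> * w_max) * kern j s * g s)"
      by (intro continuous_intros kc g)
    have A6: "expectation (\<lambda>\<omega>. V s \<omega> * (exp (load_before s \<omega>) * (exp (kern j s) - 1)))
        \<le> (1 + \<theta> * w_max) * kern j s * g s" if s: "s \<in> {0<..t}" for s
    proof -
      have s': "0 \<le> s" "s \<le> t0" "s \<le> t" using s t by auto
      note kb = kern_bounds[OF j s'(1,2)]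
      have "expectation (\<lambda>\<omega>. V s \<omega> * (exp (load_before s \<omega>) * (exp (kern j s) - 1)))
          \<le> expectation (\<lambda>\<omega>. (1 + \<theta> * w_max) * kern j s * exp (load s \<omega>))"
      proof (rule integral_mono)
        have "integrable M (\<lambda>\<omega>. exp (load_before s \<omega>))"
          by (rule integrable_const_bound[of _ "exp (load_cap)"])
            (use lb[of _ s] s measurable_F_M[OF load_before_measurable[OF s'(1,2)]] in auto)
        then have "integrable M (\<lambda>\<omega>. V s \<omega> * (exp (load_before s \<omega>) * (exp (kern j s) - 1)))"
          by (intro integrable_bounded_mult[where c = 1] integrable_mult_left measurable_F_M[OF V_measurable_F]) auto
        then show "integrable M (\<lambda>\<omega>. V s \<omega> * (exp (load_before s \<omega>) * (exp (kern j s) - 1)))" .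
        show "integrable M (\<lambda>\<omega>. (1 + \<theta> * w_max) * kern j s * exp (load s \<omega>))"
          using exp_load_integrable[OF s'(1,2)] by simp
        fix \<omega> assume \<omega>: "\<omega> \<in> space M"
        have "V s \<omega> * (exp (load_before s \<omega>) * (exp (kern j s) - 1)) \<le> exp (load_before s \<omega>) * (exp (kern j s) - 1)"
          using kb(1) by (auto simp: of_bool_def)
        also have "\<dots> \<le> exp (load s \<omega>) * ((1 + \<theta> * w_max) * kern j s)"
          using load_before_le[OF s'(2) \<omega>] exp_kern_le[OF j s'(1,2)] kb(1) by (intro mult_mono) auto
        finally show "V s \<omega> * (exp (load_before s \<omega>) * (exp (kern j s) - 1)) \<le> (1 + \<theta> * w_max) * kern j s * exp (load s \<omega>)"
          by (simp add: mult_ac)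
      qed
      also have "\<dots> = (1 + \<theta> * w_max) * kern j s * expectation (\<lambda>\<omega>. exp (load s \<omega>))" by simp
      also have "\<dots> \<le> (1 + \<theta> * w_max) * kern j s * g s"
        using g(2)[OF s'(1,3)] kb(1) \<theta> w_max_pos by (intro mult_left_mono) auto
      finally show ?thesis .
    qed
    note * = stopped_sum_le[OF j order_refl t(1) A1 A2 A3 A4 A5 A6]
    show "integrable M (\<lambda>\<omega>. \<Sum>s\<in>E j \<omega> \<inter> {0<..t}. V s \<omega> * (exp (load_before s \<omega>) * (exp (kern j s) - 1)))"
      by (rule *(1))
    show "expectation (\<lambda>\<omega>. \<Sum>s\<in>E j \<omega> \<inter> {0<..t}. V s \<omega> * (exp (load_before s \<omega>) * (exp (kern j s) - 1)))
      \<le> B * integral {0..t} (\<lambda>s. (1 + \<theta> * w_max) * kern j s * g s)"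
      by (rule *(2))
  qed
  have "expectation (\<lambda>\<omega>. exp (load t \<omega>)) = expectation (\<lambda>\<omega>. 1 +
      (\<Sum>j=1..n. \<Sum>s\<in>E j \<omega> \<inter> {0<..t}. V s \<omega> * (exp (load_before s \<omega>) * (exp (kern j s) - 1))))"
  proof (rule integral_cong_AE)
    show "AE \<omega> in M. exp (load t \<omega>) = 1 +
      (\<Sum>j=1..n. \<Sum>s\<in>E j \<omega> \<inter> {0<..t}. V s \<omega> * (exp (load_before s \<omega>) * (exp (kern j s) - 1)))"
      using no_simultaneous AE_space
      by eventually_elim (simp add: exp_load_telescope stopped_sum)
    show "(\<lambda>\<omega>. 1 + (\<Sum>j=1..n. \<Sum>s\<in>E j \<omega> \<inter> {0<..t}. V s \<omega> * (exp (load_before s \<omega>) * (exp (kern j s) - 1))))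
        \<in> borel_measurable M"
      using step(1) by (intro borel_measurable_add borel_measurable_sum) auto
  qed (use load_measurable t in auto)
  also have "\<dots> = 1 + (\<Sum>j=1..n. expectation (\<lambda>\<omega>. \<Sum>s\<in>E j \<omega> \<inter> {0<..t}. V s \<omega> * (exp (load_before s \<omega>) * (exp (kern j s) - 1))))"
    by (subst Bochner_Integration.integral_add, simp, rule Bochner_Integration.integrable_sum, erule step(1),
        subst Bochner_Integration.integral_sum, erule step(1)) (simp add: prob_space)
  also have "\<dots> \<le> 1 + (\<Sum>j=1..n. B * integral {0..t} (\<lambda>s. (1 + \<theta> * w_max) * kern j s * g s))"
    by (intro add_left_mono sum_mono step(2))
  also have "(\<Sum>j=1..n. B * integral {0..t} (\<lambda>s. (1 + \<theta> * w_max) * kern j s * g s))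
      = (\<Sum>j=1..n. integral {0..t} (\<lambda>s. B * ((1 + \<theta> * w_max) * kern j s * g s)))"
    by simp
  also have "\<dots> = integral {0..t} (\<lambda>s. \<Sum>j=1..n. B * ((1 + \<theta> * w_max) * kern j s * g s))"
    by (rule integral_sum[symmetric])
      (auto intro!: integrable_continuous_interval continuous_intros g(1)
        continuous_on_subset[OF kern_continuous] order_trans[OF _ t(2)])
  also have "(\<lambda>s. \<Sum>j=1..n. B * ((1 + \<theta> * w_max) * kern j s * g s))
      = (\<lambda>s. B * (1 + \<theta> * w_max) * (\<Sum>j=1..n. kern j s) * g s)"
    by (simp add: sum_distrib_left sum_distrib_right mult_ac)
  finally show ?thesis .
qed

text \<open>
  Gronwall's inequality without continuity of the left hand side: with
  \<open>m = sup_t (G(t) exp (- c a(t)))\<close> the integral inequality gives \<open>m \<le> 1 + m / c\<close>.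
\<close>

lemma exp_load_bound:
  assumes c: "1 < c"
  shows "expectation (\<lambda>\<omega>. exp (load t0 \<omega>)) \<le>
    c / (c - 1) * exp (c * (B * (1 + \<theta> * w_max) * (\<theta> * (1 - \<eta>))))"
proof -
  define k where "k = (\<lambda>s. B * (1 + \<theta> * w_max) * (\<Sum>j=1..n. kern j s))"
  define a where "a = (\<lambda>t. integral {0..t} k)"
  define G where "G = (\<lambda>t. expectation (\<lambda>\<omega>. exp (load t \<omega>)))"
  have kcont: "continuous_on {0..t0} k" unfolding k_def by (intro continuous_intros kern_continuous)
  have k0: "0 \<le> k s" if "s \<in> {0..t0}" for s
    unfolding k_def using that B_ge(1) \<theta>(1) w_max_pos
    by (intro mult_nonneg_nonneg sum_nonneg kern_bounds) auto
  have a0: "0 \<le> a t" if "t \<le> t0" for t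
    unfolding a_def using that
    by (intro integral_nonneg integrable_continuous_interval continuous_on_subset[OF kcont] k0) auto
  have a_deriv: "(a has_real_derivative k s) (at s within {0..t0})" if "s \<in> {0..t0}" for s
    unfolding a_def has_real_derivative_iff_has_vector_derivative
    by (rule integral_has_vector_derivative[OF kcont that])
  have a_cont: "continuous_on {0..t0} a"
    by (rule DERIV_continuous_on[OF a_deriv])
  have G_bound: "G t \<le> exp (load_cap)" if "t \<in> {0..t0}" for t
  proof -
    have "G t \<le> expectation (\<lambda>_. exp (load_cap))"
      unfolding G_def by (rule integral_mono) (use exp_load_integrable load_bounds that in auto)
    then show ?thesis by (simp add: prob_space)
  qed
  have G0: "0 \<le> G t" for t unfolding G_def by (rule integral_nonneg_AE) simp
  \<comment> \<open>The crude bound by \<open>load_cap\<close>, which depends on \<open>K\<close>,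
    serves only to make this supremum finite; it does not enter the final estimate.\<close>
  define Q where "Q = (\<lambda>t. G t * exp (- (c * a t))) ` {0..t0}"
  define m where "m = Sup Q"
  have bdd: "bdd_above Q"
  proof (rule bdd_aboveI)
    fix q assume "q \<in> Q"
    then obtain t where t: "t \<in> {0..t0}" "q = G t * exp (- (c * a t))" by (auto simp: Q_def)
    have "exp (- (c * a t)) \<le> 1" using a0[of t] t c by simp
    then show "q \<le> exp (load_cap) * 1"
      unfolding t(2) using G_bound[OF t(1)] by (intro mult_mono) auto
  qed
  have Qne: "Q \<noteq> {}" using t0 by (auto simp: Q_def)
  have Gm: "G t \<le> m * exp (c * a t)" if "t \<in> {0..t0}" for t
  proof -
    have "G t * exp (- (c * a t)) \<le> m" unfolding m_def
      by (rule cSup_upper[OF _ bdd]) (use that in \<open>auto simp: Q_def\<close>)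
    then show ?thesis by (simp add: exp_minus field_simps)
  qed
  have m0: "0 \<le> m" using Gm[of 0] G0[of 0] t0 by (simp add: a_def)
  have step: "G t * exp (- (c * a t)) \<le> 1 + m / c" if t: "t \<in> {0..t0}" for t
  proof -
    have ec: "1 \<le> exp (c * a t)" using a0[of t] t c by simp
    have "G t \<le> 1 + m * (exp (c * a t) - 1) / c"
    proof (cases "t = 0")
      case True
      have "G 0 = 1" unfolding G_def load_def stopped_def by (simp add: prob_space)
      then show ?thesis using True by (simp add: a_def)
    next
      case False
      then have t': "0 < t" "t \<le> t0" using t by auto
      have sub: "{0..t} \<subseteq> {0..t0}" using t' by auto
      have "G t \<le> 1 + integral {0..t} (\<lambda>s. B * (1 + \<theta> * w_max) * (\<Sum>j=1..n. kern j s) * (m * exp (c * a s)))"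
        unfolding G_def
      proof (rule exp_load_step[OF t'])
        show "continuous_on {0..t} (\<lambda>s. m * exp (c * a s))"
          by (intro continuous_intros continuous_on_subset[OF a_cont sub])
        show "expectation (\<lambda>\<omega>. exp (load s \<omega>)) \<le> m * exp (c * a s)" if "0 \<le> s" "s \<le> t" for s
          using Gm[of s] that t' by (simp add: G_def)
      qed
      also have "integral {0..t} (\<lambda>s. B * (1 + \<theta> * w_max) * (\<Sum>j=1..n. kern j s) * (m * exp (c * a s)))
          = integral {0..t} (\<lambda>s. k s * (m * exp (c * a s)))" by (simp add: k_def)
      also have "\<dots> = m * exp (c * a t) / c - m * exp (c * a 0) / c"
      proof (rule integral_unique, rule fundamental_theorem_of_calculus)
        fix s assume "s \<in> {0..t}"
        then have s: "s \<in> {0..t0}" using sub by auto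
        have "(a has_real_derivative k s) (at s within {0..t})"
          by (rule DERIV_subset[OF a_deriv[OF s] sub])
        then have "((\<lambda>s. m * exp (c * a s) / c) has_real_derivative k s * (m * exp (c * a s))) (at s within {0..t})"
          using c by (auto intro!: derivative_eq_intros)
        then show "((\<lambda>s. m * exp (c * a s) / c) has_vector_derivative k s * (m * exp (c * a s))) (at s within {0..t})"
          by (simp add: has_real_derivative_iff_has_vector_derivative)
      qed (use t' in auto)
      also have "\<dots> = m * (exp (c * a t) - 1) / c" by (simp add: a_def diff_divide_distrib right_diff_distrib)
      finally show ?thesis by simp
    qed
    also have "\<dots> \<le> exp (c * a t) + m * exp (c * a t) / c"
      using ec m0 c by (intro add_mono divide_right_mono mult_left_mono) auto
    finally have "G t \<le> (1 + m / c) * exp (c * a t)" by (simp add: algebra_simps)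
    then show ?thesis by (simp add: exp_minus field_simps)
  qed
  have "Sup Q \<le> 1 + m / c" by (rule cSup_least[OF Qne]) (use step in \<open>auto simp: Q_def\<close>)
  then have "m \<le> 1 + m / c" by (simp add: m_def)
  then have m: "m \<le> c / (c - 1)" using c by (simp add: field_simps)
  \<comment> \<open>Subcriticality enters here: the total kernel mass seen by node \<open>i\<close>
    is at most 1 - \<eta>.\<close>
  have "a t0 \<le> B * (1 + \<theta> * w_max) * (\<theta> * (1 - \<eta>))"
  proof -
    have "a t0 = B * (1 + \<theta> * w_max) * integral {0..t0} (\<lambda>s. \<Sum>j=1..n. kern j s)"
      unfolding a_def k_def by simp
    also have "integral {0..t0} (\<lambda>s. \<Sum>j=1..n. kern j s) = (\<Sum>j=1..n. integral {0..t0} (kern j))"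
      by (rule integral_sum) (auto intro!: integrable_continuous_interval kern_continuous)
    also have "\<dots> = \<theta> * (\<Sum>j=1..n. w i j * integral {0..t0} (\<lambda>x. \<phi> i j t0 x))"
      unfolding kern_def by (simp add: sum_distrib_left mult.assoc)
    also have "B * (1 + \<theta> * w_max) * (\<theta> * (\<Sum>j=1..n. w i j * integral {0..t0} (\<lambda>x. \<phi> i j t0 x)))
        \<le> B * (1 + \<theta> * w_max) * (\<theta> * (1 - \<eta>))"
      using subcritical i t0 B_ge(1) \<theta>(1) w_max_pos unfolding kernels_subcritical_def
      by (intro mult_left_mono) auto
    finally show ?thesis .
  qed
  then have "exp (c * a t0) \<le> exp (c * (B * (1 + \<theta> * w_max) * (\<theta> * (1 - \<eta>))))" using c by simp
  then have "m * exp (c * a t0) \<le> c / (c - 1) * exp (c * (B * (1 + \<theta> * w_max) * (\<theta> * (1 - \<eta>))))"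
    using m m0 by (intro mult_mono) auto
  then show ?thesis using Gm[of t0] t0 by (simp add: G_def)
qed

end

lemma eta_le_1: "\<eta> \<le> 1"
  using subcritical n_pos unfolding kernels_subcritical_def
  by (auto dest!: bspec[of _ _ 1] spec[of _ 0])

text \<open>\<open>\<sigma>\<close> is the infimum of the times at which some rate exceeds
  \<open>B\<close>. It may fail to be attained, but right continuity of the rates still forces a
  rate of at least \<open>B\<close> at \<open>\<sigma>\<close>. The bound on the counts excludes the
  other reason for being bad.\<close>

lemma good_upto_or_exit:
  assumes \<omega>: "\<omega> \<in> space M" and bad: "\<not> good_upto S \<omega>"
    and cnt: "\<And>i. i \<in> {1..n} \<Longrightarrow> cnt i S \<omega> \<le> K"
  obtains i \<sigma> where "i \<in> {1..n}" "0 \<le> \<sigma>" "\<sigma> \<le> S" "good_before \<sigma> \<omega>" "B \<le> lam i \<sigma> \<omega>"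
proof -
  have cnt': "cnt i u \<omega> \<le> K" if "i \<in> {1..n}" "u \<le> S" for i u
    using cnt_mono[OF that(1) \<omega> that(2)] cnt[OF that(1)] by simp
  define Q where "Q = {u \<in> {0..S}. \<exists>i\<in>{1..n}. B < lam i u \<omega>}"
  obtain u where u: "0 \<le> u" "u \<le> S" "\<not> good u \<omega>" using bad by (auto simp: good_upto_def)
  then have "\<exists>i\<in>{1..n}. B < lam i u \<omega>"
    using cnt' unfolding good_def by (meson not_le)
  then have uQ: "u \<in> Q" using u unfolding Q_def by simp
  then have ne: "Q \<noteq> {}" by blast
  have bdd: "bdd_below Q" by (rule bdd_belowI[of _ 0]) (auto simp: Q_def)
  define \<sigma> where "\<sigma> = Inf Q"
  have \<sigma>0: "0 \<le> \<sigma>" unfolding \<sigma>_def by (rule cInf_greatest[OF ne]) (auto simp: Q_def)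
  have "\<sigma> \<le> u" unfolding \<sigma>_def
    by (rule cInf_lower[OF uQ bdd])
  then have \<sigma>S: "\<sigma> \<le> S" using u by simp
  have before: "good_before \<sigma> \<omega>"
    unfolding good_before_def
  proof (intro allI impI)
    fix v assume v: "0 \<le> v \<and> v < \<sigma>"
    have "v \<notin> Q" using cInf_lower[OF _ bdd, of v] v by (auto simp: \<sigma>_def)
    then have "lam i v \<omega> \<le> B" if "i \<in> {1..n}" for i
      using that v \<sigma>S unfolding Q_def by force
    then show "good v \<omega>" using cnt' v \<sigma>S by (auto simp: good_def)
  qed
  have "\<exists>i\<in>{1..n}. B \<le> lam i \<sigma> \<omega>"
  proof (rule ccontr)
    assume "\<not> (\<exists>i\<in>{1..n}. B \<le> lam i \<sigma> \<omega>)"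
    then have lt: "lam i \<sigma> \<omega> < B" if "i \<in> {1..n}" for i using that by force
    have "\<forall>\<^sub>F v in at_right \<sigma>. \<forall>i\<in>{1..n}. lam i v \<omega> < B"
      using order_tendstoD(2)[OF lam_right_continuous[OF _ \<omega> \<sigma>0] lt] by (simp add: eventually_ball_finite)
    then obtain b where b: "b > \<sigma>" "\<forall>v>\<sigma>. v < b \<longrightarrow> (\<forall>i\<in>{1..n}. lam i v \<omega> < B)"
      by (auto simp: eventually_at_right_field)
    obtain v where v: "v \<in> Q" "v < b" using cInf_lessD[OF ne, of b] b(1) by (auto simp: \<sigma>_def)
    then obtain i where i: "i \<in> {1..n}" "B < lam i v \<omega>" by (auto simp: Q_def)
    have "\<sigma> \<le> v" unfolding \<sigma>_def by (rule cInf_lower[OF v(1) bdd])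
    then have "lam i v \<omega> < B" using b(2) v(2) lt i(1) by (cases "v = \<sigma>") auto
    then show False using i(2) by simp
  qed
  then show ?thesis using that \<sigma>0 \<sigma>S before by blast
qed

text \<open>Between \<open>\<sigma>\<close> and \<open>t0\<close> each kernel loses at most the
  fraction \<open>L * (t0 - \<sigma>)\<close>. Every event up to and including
  \<open>\<sigma>\<close> survives the stopping, and events after \<open>\<sigma>\<close> can only
  increase the load.\<close>

lemma load_ge:
  assumes i: "i \<in> {1..n}" and \<omega>: "\<omega> \<in> space M" and \<theta>: "0 < \<theta>" "\<theta> * w_max \<le> 1"
    and \<sigma>: "0 \<le> \<sigma>" "\<sigma> \<le> t0" and before: "good_before \<sigma> \<omega>"
    and no0: "\<forall>j\<in>{1..n}. 0 \<notin> E j \<omega>"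
  shows "\<theta> * (1 - L * (t0 - \<sigma>)) * (lam i \<sigma> \<omega> - \<mu> i \<sigma>) \<le> load i \<theta> t0 t0 \<omega>"
proof -
  have "0 \<le> t0" using \<sigma> by simp
  note kern_eq = kern_def[OF i \<theta> this] and load_eq = load_def[OF i \<theta> this]
  have "\<theta> * (1 - L * (t0 - \<sigma>)) * (lam i \<sigma> \<omega> - \<mu> i \<sigma>)
      = (\<Sum>j=1..n. \<Sum>s\<in>E j \<omega> \<inter> {0..\<sigma>}. \<theta> * w i j * ((1 - L * (t0 - \<sigma>)) * \<phi> i j \<sigma> s))"
    by (simp add: lam_eq sum_distrib_left mult_ac)
  also have "\<dots> \<le> (\<Sum>j=1..n. \<Sum>s\<in>stopped j 0 t0 \<omega>. kern i \<theta> t0 j s)"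
  proof (rule sum_mono)
    fix j assume j: "j \<in> {1..n}"
    have sub: "E j \<omega> \<inter> {0..\<sigma>} \<subseteq> stopped j 0 t0 \<omega>"
    proof
      fix s assume s: "s \<in> E j \<omega> \<inter> {0..\<sigma>}"
      have "s \<noteq> 0" using no0 j s by auto
      moreover have "good_before s \<omega>" using good_before_mono[OF _ before] s by auto
      ultimately show "s \<in> stopped j 0 t0 \<omega>" using s \<sigma> by (auto simp: stopped_def)
    qed
    have "(\<Sum>s\<in>E j \<omega> \<inter> {0..\<sigma>}. \<theta> * w i j * ((1 - L * (t0 - \<sigma>)) * \<phi> i j \<sigma> s))
        \<le> (\<Sum>s\<in>E j \<omega> \<inter> {0..\<sigma>}. kern i \<theta> t0 j s)"
    proof (rule sum_mono)
      fix s assume s: "s \<in> E j \<omega> \<inter> {0..\<sigma>}"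
      have "(1 - L * (t0 - \<sigma>)) * \<phi> i j \<sigma> s \<le> \<phi> i j t0 s"
        using phi_decay[OF i j, of s \<sigma> t0] s \<sigma> by (auto simp: algebra_simps)
      then show "\<theta> * w i j * ((1 - L * (t0 - \<sigma>)) * \<phi> i j \<sigma> s) \<le> kern i \<theta> t0 j s"
        unfolding kern_eq using \<theta> w_bounds(1)[OF i j] by (intro mult_left_mono) auto
    qed
    also have "\<dots> \<le> (\<Sum>s\<in>stopped j 0 t0 \<omega>. kern i \<theta> t0 j s)"
    proof (rule sum_mono2[OF stopped_finite[OF j \<omega>] sub])
      fix s assume "s \<in> stopped j 0 t0 \<omega> - E j \<omega> \<inter> {0..\<sigma>}"
      then have "0 \<le> s" "s \<le> t0" by (auto simp: stopped_def)
      then have "0 \<le> \<phi> i j t0 s" by (rule phi_nonneg'[OF i j])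
      then show "0 \<le> kern i \<theta> t0 j s"
        unfolding kern_eq using \<theta> w_bounds(1)[OF i j] by (intro mult_nonneg_nonneg) auto
    qed
    finally show "(\<Sum>s\<in>E j \<omega> \<inter> {0..\<sigma>}. \<theta> * w i j * ((1 - L * (t0 - \<sigma>)) * \<phi> i j \<sigma> s))
        \<le> (\<Sum>s\<in>stopped j 0 t0 \<omega>. kern i \<theta> t0 j s)" .
  qed
  also have "\<dots> = load i \<theta> t0 t0 \<omega>" by (simp only: load_eq)
  finally show ?thesis .
qed

text \<open>The prefactor is c / (c - 1) for c = 1 + \<eta>/4, the exponential is the tail bound for
  one node at one grid point, and the last two factors bound the number of such pairs for a grid of
  mesh \<eta> / (4 L).\<close>

definition exit_prob_bound :: "real \<Rightarrow> real" where
  "exit_prob_bound S = (1 + 4 / \<eta>) * exp (\<eta> / (4 * w_max) * \<mu>_max - \<eta>\<^sup>2 / (16 * w_max) * B) * n * (4 * L * S / \<eta> + 2)"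

text \<open>
  If some rate first exceeds \<open>B\<close> at time \<open>\<sigma>\<close>, it is still at least \<open>(1 - \<eta>/4) B\<close> (up to the base
  rate) at the next point of a coarse grid, because kernels decay at a bounded rate. The stopped
  load at that grid point has exponential moments governed by \<open>(1 - \<eta>/2) B\<close>.
\<close>

lemma load_tail:
  assumes i: "i \<in> {1..n}" and t0: "0 \<le> t0"
  defines "\<theta> \<equiv> \<eta> / (4 * w_max)"
  shows "prob {\<omega> \<in> space M. \<theta> * (1 - \<eta> / 4) * (B - \<mu>_max) \<le> load i \<theta> t0 t0 \<omega>}
    \<le> (1 + 4 / \<eta>) * exp (\<eta> / (4 * w_max) * \<mu>_max - \<eta>\<^sup>2 / (16 * w_max) * B)"
proof -
  \<comment> \<open>The tilt is chosen so that the factor lost in linearising the exponential is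
    exactly 1 + \<eta>/4, the same as the constant c used in Gronwall's inequality.\<close>
  have \<theta>: "0 < \<theta>" "\<theta> * w_max = \<eta> / 4" "\<theta> * w_max \<le> 1"
    using eta_pos w_max_pos eta_le_1 by (auto simp: \<theta>_def)
  let ?y = "\<theta> * (1 - \<eta> / 4) * (B - \<mu>_max)"
  define X where "X = (\<lambda>\<omega>. exp (load i \<theta> t0 t0 \<omega>))"
  have Xint: "integrable M X" unfolding X_def
    by (rule exp_load_integrable[OF i \<theta>(1,3) t0 t0 order_refl])
  have "{\<omega> \<in> space M. ?y \<le> load i \<theta> t0 t0 \<omega>} = {\<omega> \<in> space M. exp ?y \<le> X \<omega>}" by (simp add: X_def)
  also have "prob \<dots> \<le> expectation X / exp ?y"
    by (rule integral_Markov_inequality_measure[OF Xint sets.top]) (auto simp: X_def)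
  also have "\<dots> = expectation X * exp (- ?y)" by (simp add: exp_minus field_simps)
  also have "\<dots> \<le> ((1 + \<eta>/4) / (1 + \<eta>/4 - 1) * exp ((1 + \<eta>/4) * (B * (1 + \<theta> * w_max) * (\<theta> * (1 - \<eta>))))) * exp (- ?y)"
    unfolding X_def using eta_pos
    by (intro mult_right_mono exp_load_bound[OF i \<theta>(1,3) t0]) auto
  also have "(1 + \<eta>/4) / (1 + \<eta>/4 - 1) = 1 + 4 / \<eta>" using eta_pos by (simp add: field_simps)
  also have "(1 + 4 / \<eta>) * exp ((1 + \<eta>/4) * (B * (1 + \<theta> * w_max) * (\<theta> * (1 - \<eta>)))) * exp (- ?y)
      = (1 + 4 / \<eta>) * exp ((1 + \<eta>/4) * (B * (1 + \<theta> * w_max) * (\<theta> * (1 - \<eta>))) - ?y)"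
    unfolding mult.assoc[of "1 + 4 / \<eta>"] exp_add[symmetric] by simp
  also have "\<dots> \<le> (1 + 4 / \<eta>) * exp (\<eta> / (4 * w_max) * \<mu>_max - \<eta>\<^sup>2 / (16 * w_max) * B)"
  proof (intro mult_left_mono)
    \<comment> \<open>The two losses of 1 + \<eta>/4 consume at most half of the subcritical margin
      \<eta>, and the decay up to the grid point consumes a quarter. The remaining quarter produces
      the exponent -\<theta> B \<eta> / 4.\<close>
    have "(1 + \<eta>/4) * (1 + \<eta>/4) * (1 - \<eta>) \<le> 1 - \<eta> / 2"
    proof -
      have "(1 - \<eta> / 2) - (1 + \<eta>/4) * (1 + \<eta>/4) * (1 - \<eta>) = \<eta>\<^sup>2 * 7 / 16 + \<eta>^3 / 16"
        by (simp add: power2_eq_square power3_eq_cube field_simps)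
      then show ?thesis using eta_pos by (smt (verit) divide_nonneg_pos mult_nonneg_nonneg zero_le_power)
    qed
    then have "B * \<theta> * ((1 + \<eta>/4) * (1 + \<eta>/4) * (1 - \<eta>)) \<le> B * \<theta> * (1 - \<eta> / 2)"
      using B_ge(1) \<theta>(1) by (intro mult_left_mono) auto
    moreover have "\<theta> * \<mu>_max * (1 - \<eta> / 4) \<le> \<theta> * \<mu>_max * 1"
      using \<theta>(1) mu_max_pos eta_pos by (intro mult_left_mono) auto
    moreover have "\<eta>\<^sup>2 / (16 * w_max) * B = \<theta> * B * \<eta> / 4" by (simp add: \<theta>_def power2_eq_square)
    moreover have "\<eta> / (4 * w_max) * \<mu>_max = \<theta> * \<mu>_max" by (simp add: \<theta>_def)
    ultimately show "exp ((1 + \<eta>/4) * (B * (1 + \<theta> * w_max) * (\<theta> * (1 - \<eta>))) - ?y)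
        \<le> exp (\<eta> / (4 * w_max) * \<mu>_max - \<eta>\<^sup>2 / (16 * w_max) * B)"
      unfolding \<theta>(2) exp_le_cancel_iff
    proof -
      assume a: "B * \<theta> * ((1 + \<eta>/4) * (1 + \<eta>/4) * (1 - \<eta>)) \<le> B * \<theta> * (1 - \<eta> / 2)"
        "\<theta> * \<mu>_max * (1 - \<eta> / 4) \<le> \<theta> * \<mu>_max * 1"
        "\<eta>\<^sup>2 / (16 * w_max) * B = \<theta> * B * \<eta> / 4" "\<eta> / (4 * w_max) * \<mu>_max = \<theta> * \<mu>_max"
      have "(1 + \<eta>/4) * (B * (1 + \<eta>/4) * (\<theta> * (1 - \<eta>))) - ?y
          = B * \<theta> * ((1 + \<eta>/4) * (1 + \<eta>/4) * (1 - \<eta>)) - B * \<theta> * (1 - \<eta>/4) + \<theta> * \<mu>_max * (1 - \<eta>/4)"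
        by (simp add: field_simps)
      moreover have "B * \<theta> * (1 - \<eta> / 2) - B * \<theta> * (1 - \<eta>/4) = - (\<theta> * B * \<eta> / 4)"
        by (simp add: field_simps)
      ultimately show "(1 + \<eta>/4) * (B * (1 + \<eta>/4) * (\<theta> * (1 - \<eta>))) - ?y
          \<le> \<eta> / (4 * w_max) * \<mu>_max - \<eta>\<^sup>2 / (16 * w_max) * B"
        using a by linarith
    qed
  qed (use eta_pos in auto)
  finally show ?thesis .
qed

text \<open>A path turns bad either because a count reaches \<open>K\<close>, handled by Markov's
  inequality, or because a rate reaches \<open>B\<close>. The latter is detected at one of finitely
  many grid times for one of the \<open>n\<close> nodes, so a union bound suffices although the exit
  time is random.\<close>

lemma prob_not_good_upto:
  assumes S: "0 \<le> S" and K: "0 < K"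
  shows "prob {\<omega> \<in> space M. \<not> good_upto S \<omega>} \<le>
    (\<Sum>i=1..n. expectation (cnt i S)) / K + exit_prob_bound S"
proof -
  define \<theta> where "\<theta> = \<eta> / (4 * w_max)"
  \<comment> \<open>This mesh makes the relative decay over one cell, L \<delta>, equal to
    \<eta>/4.\<close>
  define \<delta> where "\<delta> = \<eta> / (4 * L)"
  define m0 where "m0 = nat \<lceil>S / \<delta>\<rceil>"
  define p where "p = (1 + 4 / \<eta>) * exp (\<eta> / (4 * w_max) * \<mu>_max - \<eta>\<^sup>2 / (16 * w_max) * B)"
  have \<delta>: "0 < \<delta>" "L * \<delta> = \<eta> / 4" using eta_pos L_pos by (auto simp: \<delta>_def)
  have \<theta>: "0 < \<theta>" "\<theta> * w_max \<le> 1" using eta_pos w_max_pos eta_le_1 by (auto simp: \<theta>_def)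
  define A where "A = (\<lambda>i. {\<omega> \<in> space M. real K \<le> cnt i S \<omega>})"
  define D where "D = (\<lambda>i m. {\<omega> \<in> space M. \<theta> * (1 - \<eta> / 4) * (B - \<mu>_max) \<le> load i \<theta> (real m * \<delta>) (real m * \<delta>) \<omega>})"
  have A_sets: "A i \<in> sets M" if "i \<in> {1..n}" for i
    unfolding A_def using cnt_measurable[OF that S] by measurable
  have D_sets: "D i m \<in> sets M" if "i \<in> {1..n}" for i m
  proof -
    have "load i \<theta> (real m * \<delta>) (real m * \<delta>) \<in> borel_measurable M"
      by (rule load_measurable[OF that \<theta>]) (use \<delta> in auto)
    then show ?thesis unfolding D_def by measurable
  qed
  have D_prob: "prob (D i m) \<le> p" if "i \<in> {1..n}" for i m
    unfolding D_def p_def \<theta>_def by (rule load_tail[OF that]) (use \<delta> in auto)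
  have A_prob: "prob (A i) \<le> expectation (cnt i S) / K" if "i \<in> {1..n}" for i
    unfolding A_def using K
    by (intro integral_Markov_inequality_measure[OF cnt_integrable[OF that S] sets.top]) auto
  let ?U = "(\<Union>i\<in>{1..n}. A i) \<union> (\<Union>i\<in>{1..n}. \<Union>m\<in>{..m0}. D i m)"
  have U_sets: "?U \<in> sets M" using A_sets D_sets by auto
  have "AE \<omega> in M. \<not> good_upto S \<omega> \<longrightarrow> \<omega> \<in> ?U"
    using AE_no_event_at[OF order_refl] AE_space
  proof eventually_elim
    case (elim \<omega>)
    show ?case
    proof (intro impI)
      assume bad: "\<not> good_upto S \<omega>"
      show "\<omega> \<in> ?U"
      proof (cases "\<exists>i\<in>{1..n}. real K \<le> cnt i S \<omega>")
        case True
        then show ?thesis using elim by (auto simp: A_def)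
      next
        case False
        then have cnt: "cnt i S \<omega> \<le> K" if "i \<in> {1..n}" for i using that by force
        obtain i \<sigma> where \<sigma>: "i \<in> {1..n}" "0 \<le> \<sigma>" "\<sigma> \<le> S" "good_before \<sigma> \<omega>" "B \<le> lam i \<sigma> \<omega>"
          by (rule good_upto_or_exit[OF elim(2) bad cnt])
        \<comment> \<open>Rounding up to the first grid point at or after \<open>\<sigma>\<close>.
          That point may lie beyond \<open>S\<close>, which is harmless since the load is controlled
          at every time.\<close>
        define m where "m = nat \<lceil>\<sigma> / \<delta>\<rceil>"
        have mr: "real m = of_int \<lceil>\<sigma> / \<delta>\<rceil>" using \<sigma>(2) \<delta>(1) by (simp add: m_def)
        have "\<sigma> / \<delta> \<le> real m" "real m \<le> \<sigma> / \<delta> + 1" unfolding mr by linarith+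
        then have m: "\<sigma> \<le> real m * \<delta>" "real m * \<delta> \<le> \<sigma> + \<delta>" using \<delta>(1) by (auto simp: field_simps)
        have mm0: "m \<le> m0" unfolding m_def m0_def
          using \<sigma>(3) \<delta>(1) by (intro nat_mono ceiling_mono divide_right_mono) auto
        have "L * (real m * \<delta> - \<sigma>) \<le> L * \<delta>" using m L_pos by (intro mult_left_mono) auto
        then have "1 - \<eta> / 4 \<le> 1 - L * (real m * \<delta> - \<sigma>)" using \<delta>(2) by simp
        then have "\<theta> * (1 - \<eta> / 4) * (B - \<mu>_max) \<le> \<theta> * (1 - L * (real m * \<delta> - \<sigma>)) * (lam i \<sigma> \<omega> - \<mu> i \<sigma>)"
          using \<theta>(1) B_ge(2) \<sigma>(5) mu_bounds(2)[OF \<sigma>(1,2)] eta_le_1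
          by (intro mult_mono mult_left_mono) auto
        also have "\<dots> \<le> load i \<theta> (real m * \<delta>) (real m * \<delta>) \<omega>"
          by (rule load_ge[OF \<sigma>(1) elim(2) _ \<theta>(2) \<sigma>(2) m(1) \<sigma>(4)]) (use \<theta>(1) elim(1) in auto)
        finally have "\<omega> \<in> D i m" using elim(2) by (simp add: D_def)
        then show ?thesis using \<sigma>(1) mm0 by auto
      qed
    qed
  qed
  then have "prob {\<omega> \<in> space M. \<not> good_upto S \<omega>} \<le> prob ?U"
    by (intro finite_measure_mono_AE U_sets) auto
  also have "\<dots> \<le> prob (\<Union>i\<in>{1..n}. A i) + prob (\<Union>i\<in>{1..n}. \<Union>m\<in>{..m0}. D i m)"
    by (rule measure_Un_le) (use A_sets D_sets in auto)
  also have "prob (\<Union>i\<in>{1..n}. A i) \<le> (\<Sum>i=1..n. prob (A i))"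
    by (rule measure_UNION_le) (use A_sets in auto)
  also have "\<dots> \<le> (\<Sum>i=1..n. expectation (cnt i S) / K)" by (rule sum_mono[OF A_prob])
  also have "\<dots> = (\<Sum>i=1..n. expectation (cnt i S)) / K" by (simp add: sum_divide_distrib)
  also have "prob (\<Union>i\<in>{1..n}. \<Union>m\<in>{..m0}. D i m) \<le> (\<Sum>i=1..n. prob (\<Union>m\<in>{..m0}. D i m))"
    by (rule measure_UNION_le) (use D_sets in auto)
  also have "\<dots> \<le> (\<Sum>i=1..n. \<Sum>m\<le>m0. prob (D i m))"
    by (rule sum_mono, rule measure_UNION_le) (use D_sets in auto)
  also have "\<dots> \<le> (\<Sum>i=1..n. \<Sum>m\<le>m0. p)" by (intro sum_mono D_prob)
  also have "\<dots> = p * n * (real m0 + 1)" by (simp add: algebra_simps)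
  also have "\<dots> \<le> p * n * (4 * L * S / \<eta> + 2)"
  proof (intro mult_left_mono)
    have "real m0 \<le> S / \<delta> + 1" unfolding m0_def using S \<delta>(1)
      by (simp add: of_nat_nat)
    then show "real m0 + 1 \<le> 4 * L * S / \<eta> + 2" by (simp add: \<delta>_def mult_ac)
  qed (use eta_pos in \<open>auto simp: p_def\<close>)
  finally show ?thesis by (simp add: exit_prob_bound_def p_def)
qed

end

context hawkes_setting
begin

section \<open>Short time expansion\<close>

text \<open>A new event contributes its weight because kernels equal 1 on the diagonal; both old and
  new contributions then decay by at most the fraction \<open>L * (s - r)\<close>. The error is
  measured by the old rate and the new events, so no separate count of past events is
  required.\<close>

lemma lam_increment:
  assumes i: "i \<in> {1..n}" and \<omega>: "\<omega> \<in> space M" and rs: "0 \<le> r" "r \<le> s"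
  shows "\<bar>lam i s \<omega> - lam i r \<omega> - (\<Sum>j=1..n. w i j * (cnt j s \<omega> - cnt j r \<omega>))\<bar>
    \<le> L * (s - r) * (\<mu>_max + lam i r \<omega> + (\<Sum>j=1..n. w i j * (cnt j s \<omega> - cnt j r \<omega>)))"
proof -
  define S where "S = (\<lambda>j. \<Sum>u\<in>E j \<omega> \<inter> {0..r}. \<phi> i j r u)"
  define S' where "S' = (\<lambda>j. \<Sum>u\<in>E j \<omega> \<inter> {0..s}. \<phi> i j s u)"
  define N where "N = (\<lambda>j. cnt j s \<omega> - cnt j r \<omega>)"
  have L: "0 \<le> L * (s - r)" using L_pos rs by simp
  have diff: "\<bar>S' j - S j - N j\<bar> \<le> L * (s - r) * (S j + N j)" if j: "j \<in> {1..n}" for j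
  proof -
    have fin: "finite (E j \<omega> \<inter> {0..r})" "finite (E j \<omega> \<inter> {r<..s})"
      by (rule events_finite[OF j \<omega>, where t = s], use rs in auto)+
    have "E j \<omega> \<inter> {0..s} = (E j \<omega> \<inter> {0..r}) \<union> (E j \<omega> \<inter> {r<..s})" using rs by auto
    then have "S' j = (\<Sum>u\<in>E j \<omega> \<inter> {0..r}. \<phi> i j s u) + (\<Sum>u\<in>E j \<omega> \<inter> {r<..s}. \<phi> i j s u)"
      unfolding S'_def using fin by (auto intro!: sum.union_disjoint)
    moreover have "N j = (\<Sum>u\<in>E j \<omega> \<inter> {r<..s}. 1)"
      using card_Ioc[OF j \<omega> rs] by (simp add: N_def)
    ultimately have eq: "S' j - S j - N j = (\<Sum>u\<in>E j \<omega> \<inter> {0..r}. \<phi> i j s u - \<phi> i j r u)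
        + (\<Sum>u\<in>E j \<omega> \<inter> {r<..s}. \<phi> i j s u - 1)"
      by (simp add: S_def sum_subtractf)
    have "\<bar>\<Sum>u\<in>E j \<omega> \<inter> {0..r}. \<phi> i j s u - \<phi> i j r u\<bar> \<le> (\<Sum>u\<in>E j \<omega> \<inter> {0..r}. L * (s - r) * \<phi> i j r u)"
    proof (rule order_trans[OF sum_abs], rule sum_mono)
      fix u assume "u \<in> E j \<omega> \<inter> {0..r}"
      then have u: "0 \<le> u" "u \<le> r" by auto
      show "\<bar>\<phi> i j s u - \<phi> i j r u\<bar> \<le> L * (s - r) * \<phi> i j r u"
        using phi_decay[OF i j u rs(2)] phi_antimono[OF i j u rs(2)] by simp
    qed
    then have 1: "\<bar>\<Sum>u\<in>E j \<omega> \<inter> {0..r}. \<phi> i j s u - \<phi> i j r u\<bar> \<le> L * (s - r) * S j"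
      by (simp add: S_def sum_distrib_left)
    have "\<bar>\<Sum>u\<in>E j \<omega> \<inter> {r<..s}. \<phi> i j s u - 1\<bar> \<le> (\<Sum>u\<in>E j \<omega> \<inter> {r<..s}. L * (s - r) * 1)"
    proof (rule order_trans[OF sum_abs], rule sum_mono)
      fix u assume "u \<in> E j \<omega> \<inter> {r<..s}"
      then have u: "0 \<le> u" "r < u" "u \<le> s" using rs by auto
      have "1 - \<phi> i j s u \<le> L * (s - u) * 1"
        using phi_decay[OF i j u(1) order_refl u(3)] phi_diag[OF i j u(1)] by simp
      also have "\<dots> \<le> L * (s - r) * 1" using L_pos u by simp
      finally show "\<bar>\<phi> i j s u - 1\<bar> \<le> L * (s - r) * 1"
        using phi_le_1[OF i j u(1,3)] by simp
    qed
    then have 2: "\<bar>\<Sum>u\<in>E j \<omega> \<inter> {r<..s}. \<phi> i j s u - 1\<bar> \<le> L * (s - r) * N j"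
      using card_Ioc[OF j \<omega> rs] by (simp add: N_def mult_ac)
    show ?thesis unfolding eq distrib_left using 1 2 by linarith
  qed
  have lam_s: "lam i s \<omega> = \<mu> i s + (\<Sum>j=1..n. w i j * S' j)" by (simp add: lam_eq S'_def)
  have lam_r: "lam i r \<omega> = \<mu> i r + (\<Sum>j=1..n. w i j * S j)" by (simp add: lam_eq S_def)
  have "lam i s \<omega> - lam i r \<omega> - (\<Sum>j=1..n. w i j * N j) = (\<mu> i s - \<mu> i r) + (\<Sum>j=1..n. w i j * (S' j - S j - N j))"
    unfolding lam_s lam_r by (simp add: right_diff_distrib sum_subtractf)
  moreover have "\<bar>\<Sum>j=1..n. w i j * (S' j - S j - N j)\<bar> \<le> (\<Sum>j=1..n. w i j * (L * (s - r) * (S j + N j)))"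
  proof (rule order_trans[OF sum_abs], rule sum_mono)
    fix j assume j: "j \<in> {1..n}"
    show "\<bar>w i j * (S' j - S j - N j)\<bar> \<le> w i j * (L * (s - r) * (S j + N j))"
      using diff[OF j] w_bounds(1)[OF i j] by (simp add: abs_mult mult_left_mono)
  qed
  moreover have "(\<Sum>j=1..n. w i j * (L * (s - r) * (S j + N j)))
      = L * (s - r) * ((\<Sum>j=1..n. w i j * S j) + (\<Sum>j=1..n. w i j * N j))"
    by (simp add: sum_distrib_left sum.distrib distrib_left mult_ac)
  moreover have "L * (s - r) * (\<Sum>j=1..n. w i j * S j) \<le> L * (s - r) * lam i r \<omega>"
    unfolding lam_r using mu_bounds(1)[OF i rs(1)] mu_min_pos L by (intro mult_left_mono) auto
  moreover have "\<bar>\<mu> i s - \<mu> i r\<bar> \<le> L * (s - r) * \<mu>_max"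
    using mu_Lipschitz[OF i rs] by (simp add: mult_ac)
  ultimately show ?thesis unfolding N_def distrib_left by linarith
qed

text \<open>Sparsity makes this bound, and with it all error constants of the expansion, independent
  of \<open>n\<close>.\<close>

lemma sum_weights_le:
  assumes "i \<in> {1..n}"
  shows "(\<Sum>j=1..n. w i j) \<le> d * w_max"
proof -
  have "(\<Sum>j=1..n. w i j) = (\<Sum>j\<in>{j \<in> {1..n}. w i j \<noteq> 0}. w i j)"
    by (rule sum.mono_neutral_right) auto
  also have "\<dots> \<le> (\<Sum>j\<in>{j \<in> {1..n}. w i j \<noteq> 0}. w_max)"
    by (rule sum_mono) (use w_bounds(2)[OF assms] in auto)
  also have "\<dots> = card {j \<in> {1..n}. w i j \<noteq> 0} * w_max" by simp
  also have "\<dots> \<le> d * w_max"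
    using sparse assms w_max_pos unfolding weights_sparse_def by (intro mult_right_mono) auto
  finally show ?thesis .
qed

text \<open>Windows are open on the left here, so that consecutive windows are disjoint and
  increments of counting processes suffice. They agree with the closed windows of the statistics
  when no event falls on a grid time.\<close>

definition one :: "nat \<Rightarrow> real \<Rightarrow> real \<Rightarrow> 'a \<Rightarrow> real" where
  "one a x y \<omega> = of_bool (cnt a y \<omega> - cnt a x \<omega> = 1)"

lemma one_bounds [simp]: "0 \<le> one a x y \<omega>" "one a x y \<omega> \<le> 1"
  by (auto simp: one_def)

lemma one_measurable_F:
  assumes "a \<in> {1..n}" "0 \<le> x" "x \<le> y"
  shows "one a x y \<in> borel_measurable (F y)"
proof -
  note [measurable] = cnt_measurable_F[OF assms] cnt_measurable_F[OF assms(1) order_trans[OF assms(2,3)] order_refl]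
  show ?thesis unfolding one_def by measurable
qed

end

context hawkes_truncated
begin

section \<open>Moments of counts and rate jumps in one window\<close>

lemma stopped_eq:
  assumes "good_before s \<omega>" "u \<le> s"
  shows "stopped a r u \<omega> = E a \<omega> \<inter> {r<..u}"
  using good_before_mono[OF _ assms(1)] assms(2) by (auto simp: stopped_def)

lemma stopped_card_eq:
  assumes "good_before s \<omega>" "a \<in> {1..n}" "\<omega> \<in> space M" "0 \<le> r" "r \<le> s"
  shows "real (card (stopped a r s \<omega>)) = cnt a s \<omega> - cnt a r \<omega>"
  using stopped_eq[OF assms(1) order_refl] card_Ioc[OF assms(2-5)] by simp

lemma good_upto_lam:
  assumes "good_upto s \<omega>" "i \<in> {1..n}" "\<omega> \<in> space M" "0 \<le> s"
  shows "0 \<le> lam i s \<omega>" "lam i s \<omega> \<le> B"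
  using assms lam_bounds(1)[OF assms(2,3,4) order_refl] mu_min_pos
  by (auto simp: good_upto_def good_def)

text \<open>In \<open>\<kappa>\<^sub>1\<close> the first term comes from additional events weighted
  by a row sum of \<open>w\<close>; the factor 3 counts the base rate, the old rate and the jump,
  each at most \<open>B\<close>. In \<open>\<kappa>\<close>, the multiples of
  \<open>\<kappa>\<^sub>1\<close> cover the rate errors in two arguments and in the compensator, and
  the 2 covers windows with several events.\<close>

definition \<kappa>\<^sub>1 :: real where "\<kappa>\<^sub>1 = (1 + L) * d * w_max + 3 * L"
definition \<kappa> :: real where "\<kappa> = 3 * \<kappa>\<^sub>1 + 2"

lemma kappa_pos: "0 \<le> \<kappa>\<^sub>1" "0 \<le> \<kappa>"
  using L_pos w_max_pos by (auto simp: \<kappa>\<^sub>1_def \<kappa>_def)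

lemma w_le_B: "i \<in> {1..n} \<Longrightarrow> j \<in> {1..n} \<Longrightarrow> w i j \<le> B"
  using w_bounds(2) B_ge(3) by (meson order_trans)

context
  fixes Z :: "'a \<Rightarrow> real" and r e c :: real
  assumes r: "0 \<le> r" and Z: "Z \<in> borel_measurable (F r)"
    and Z0: "\<And>\<omega>. \<omega> \<in> space M \<Longrightarrow> 0 \<le> Z \<omega>" and Zc: "\<And>\<omega>. \<omega> \<in> space M \<Longrightarrow> Z \<omega> \<le> c"
    and e: "0 < e" "e \<le> 1"
begin

lemma re: "r \<le> r + e" "r < r + e" "0 \<le> r + e" using e r by auto

lemma Z_int: "integrable M Z" by (rule Z_integrable[OF r Z Z0 Zc])

lemma Z_count_int: "i \<in> {1..n} \<Longrightarrow> r \<le> b \<Longrightarrow> integrable M (\<lambda>\<omega>. Z \<omega> * card (stopped i r b \<omega>))"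
  by (rule Z_integrable_mult[OF r Z Z0 Zc stopped_count_integrable(2)[OF r]])

lemma Z_bdd_int:
  assumes "f \<in> borel_measurable M" "\<And>\<omega>. \<omega> \<in> space M \<Longrightarrow> 0 \<le> f \<omega>" "\<And>\<omega>. \<omega> \<in> space M \<Longrightarrow> f \<omega> \<le> k"
  shows "integrable M (\<lambda>\<omega>. Z \<omega> * f \<omega>)"
proof -
  have "integrable M (\<lambda>\<omega>. f \<omega> * Z \<omega>)"
    by (rule integrable_bounded_mult[OF Z_int assms(1), of k]) (use assms in auto)
  then show ?thesis by (simp add: mult.commute)
qed

lemma EZ_nonneg: "0 \<le> expectation Z"
  by (rule integral_nonneg_AE) (use Z0 in auto)

lemma one_Vc_le:
  assumes "a \<in> {1..n}" "\<omega> \<in> space M"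
  shows "one a r (r + e) \<omega> * Vc (r + e) \<omega> \<le> card (stopped a r (r + e) \<omega>)"
  using stopped_card_eq[OF good_upto_imp_before[OF order_refl] assms r re(1)]
  by (auto simp: one_def of_bool_def)

lemma one_Vc_expectation:
  assumes a: "a \<in> {1..n}"
  shows "expectation (\<lambda>\<omega>. Z \<omega> * one a r (r + e) \<omega> * Vc (r + e) \<omega>) \<le> B * e * expectation Z"
proof -
  have "expectation (\<lambda>\<omega>. Z \<omega> * one a r (r + e) \<omega> * Vc (r + e) \<omega>)
      \<le> expectation (\<lambda>\<omega>. Z \<omega> * card (stopped a r (r + e) \<omega>))"
  proof (rule integral_mono)
    have "integrable M (\<lambda>\<omega>. Z \<omega> * (one a r (r + e) \<omega> * Vc (r + e) \<omega>))"
      by (rule Z_bdd_int[of _ 1])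
        (use measurable_F_M[OF one_measurable_F[OF a r re(1)]] measurable_F_M[OF Vc_measurable_F[OF re(3)]]
          in \<open>auto intro!: mult_le_one\<close>)
    then show "integrable M (\<lambda>\<omega>. Z \<omega> * one a r (r + e) \<omega> * Vc (r + e) \<omega>)" by (simp add: mult.assoc)
    show "integrable M (\<lambda>\<omega>. Z \<omega> * card (stopped a r (r + e) \<omega>))" by (rule Z_count_int[OF a re(1)])
    show "Z \<omega> * one a r (r + e) \<omega> * Vc (r + e) \<omega> \<le> Z \<omega> * card (stopped a r (r + e) \<omega>)" if "\<omega> \<in> space M" for \<omega>
      unfolding mult.assoc using one_Vc_le[OF a that] Z0[OF that] by (rule mult_left_mono)
  qed
  also have "\<dots> \<le> B * e * expectation Z"
    using stopped_count_expectation[OF r Z Z0 Zc a re(1)] by simp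
  finally show ?thesis .
qed

text \<open>Given a single event of \<open>a\<close>, the rate of \<open>k\<close> jumps by
  \<open>w k a\<close>. Events of other nodes in the window form pairs with that event and cost
  order e^2 in the mean; kernel decay and base rate changes cost e, times another e for the event
  itself.\<close>

lemma lam_jump_expectation:
  assumes a: "a \<in> {1..n}" and k: "k \<in> {1..n}"
  shows "integrable M (\<lambda>\<omega>. Z \<omega> * one a r (r + e) \<omega> * Vc (r + e) \<omega> * \<bar>lam k (r + e) \<omega> - (lam k r \<omega> + w k a)\<bar>)"
    and "expectation (\<lambda>\<omega>. Z \<omega> * one a r (r + e) \<omega> * Vc (r + e) \<omega> * \<bar>lam k (r + e) \<omega> - (lam k r \<omega> + w k a)\<bar>)
      \<le> \<kappa>\<^sub>1 * B\<^sup>2 * e\<^sup>2 * expectation Z"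
proof -
  let ?P = "\<lambda>j \<omega>. real (card {(x, y) \<in> stopped a r (r + e) \<omega> \<times> stopped j r (r + e) \<omega>. x \<noteq> y})"
  let ?h = "\<lambda>\<omega>. (1 + L) * (\<Sum>j=1..n. w k j * (Z \<omega> * ?P j \<omega>)) + 3 * B * L * e * (Z \<omega> * card (stopped a r (r + e) \<omega>))"
  have pairs: "integrable M (\<lambda>\<omega>. Z \<omega> * ?P j \<omega>)"
    "expectation (\<lambda>\<omega>. Z \<omega> * ?P j \<omega>) \<le> (B * e)\<^sup>2 * expectation Z" if "j \<in> {1..n}" for j
    using stopped_pairs_expectation[OF r Z Z0 Zc a that re(2)] by simp_all
  have h_int: "integrable M ?h"
    by (intro Bochner_Integration.integrable_add integrable_mult_right Bochner_Integration.integrable_sum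
        pairs(1) Z_count_int a re(1)) auto
  have meas: "(\<lambda>\<omega>. one a r (r + e) \<omega> * Vc (r + e) \<omega> * \<bar>lam k (r + e) \<omega> - (lam k r \<omega> + w k a)\<bar>) \<in> borel_measurable M"
    by (intro borel_measurable_times borel_measurable_abs borel_measurable_diff borel_measurable_add
        measurable_F_M[OF one_measurable_F[OF a r re(1)]] measurable_F_M[OF Vc_measurable_F[OF re(3)]]
        lam_measurable k r re(3)) auto
  have bdd: "one a r (r + e) \<omega> * Vc (r + e) \<omega> * \<bar>lam k (r + e) \<omega> - (lam k r \<omega> + w k a)\<bar> \<le> 3 * B"
    if \<omega>: "\<omega> \<in> space M" for \<omega>
  proof (cases "good_upto (r + e) \<omega>")
    case True
    then have "\<bar>lam k (r + e) \<omega> - (lam k r \<omega> + w k a)\<bar> \<le> 3 * B"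
      using good_upto_lam[OF True k \<omega> re(3)] good_upto_lam[OF good_upto_mono[OF re(1) True] k \<omega> r]
        w_bounds(1)[OF k a] w_le_B[OF k a] by simp
    then show ?thesis using True B_ge(1) by (auto simp: one_def of_bool_def)
  qed (use B_ge(1) in simp)
  have "integrable M (\<lambda>\<omega>. Z \<omega> * (one a r (r + e) \<omega> * Vc (r + e) \<omega> * \<bar>lam k (r + e) \<omega> - (lam k r \<omega> + w k a)\<bar>))"
    by (rule Z_bdd_int[OF meas _ bdd]) auto
  then show int: "integrable M (\<lambda>\<omega>. Z \<omega> * one a r (r + e) \<omega> * Vc (r + e) \<omega> * \<bar>lam k (r + e) \<omega> - (lam k r \<omega> + w k a)\<bar>)"
    by (simp add: mult.assoc)
  have "expectation (\<lambda>\<omega>. Z \<omega> * one a r (r + e) \<omega> * Vc (r + e) \<omega> * \<bar>lam k (r + e) \<omega> - (lam k r \<omega> + w k a)\<bar>)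
      \<le> expectation ?h"
  proof (rule integral_mono_AE[OF int h_int])
    show "AE \<omega> in M. Z \<omega> * one a r (r + e) \<omega> * Vc (r + e) \<omega> * \<bar>lam k (r + e) \<omega> - (lam k r \<omega> + w k a)\<bar> \<le> ?h \<omega>"
      using no_simultaneous AE_space
    proof eventually_elim
      case (elim \<omega>)
      note \<omega> = elim(2)
      have "0 \<le> (\<Sum>j=1..n. w k j * (Z \<omega> * ?P j \<omega>))"
        by (intro sum_nonneg mult_nonneg_nonneg w_nonneg k Z0[OF \<omega>]) auto
      then have h0: "0 \<le> ?h \<omega>" using L_pos B_ge(1) e Z0[OF \<omega>] by simp
      show ?case
      proof (cases "good_upto (r + e) \<omega> \<and> cnt a (r + e) \<omega> - cnt a r \<omega> = 1")
        case False
        then have "one a r (r + e) \<omega> * Vc (r + e) \<omega> = 0" by (auto simp: one_def)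
        then show ?thesis using h0 by (simp only: mult.assoc[of "Z \<omega>"] mult_zero_left mult_zero_right)
      next
        case True
        then have good: "good_upto (r + e) \<omega>" and one: "cnt a (r + e) \<omega> - cnt a r \<omega> = 1" by auto
        note before = good_upto_imp_before[OF order_refl good]
        have Na: "card (stopped a r (r + e) \<omega>) = 1"
          using stopped_card_eq[OF before a \<omega> r re(1)] one by simp
        then obtain x where x: "stopped a r (r + e) \<omega> = {x}" by (auto simp: card_1_singleton_iff)
        define R where "R = (\<Sum>j\<in>{1..n} - {a}. w k j * (cnt j (r + e) \<omega> - cnt j r \<omega>))"
        have sumN: "(\<Sum>j=1..n. w k j * (cnt j (r + e) \<omega> - cnt j r \<omega>)) = w k a + R"
          using a one by (simp add: R_def sum.remove[of _ a])
        have R0: "0 \<le> R" unfolding R_def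
          by (intro sum_nonneg mult_nonneg_nonneg w_nonneg k)
            (use cnt_mono[OF _ \<omega> re(1)] in auto)
        have "\<bar>lam k (r + e) \<omega> - lam k r \<omega> - (w k a + R)\<bar> \<le> L * e * (\<mu>_max + lam k r \<omega> + (w k a + R))"
          using lam_increment[OF k \<omega> r re(1)] unfolding sumN by simp
        also have "\<dots> \<le> L * e * (3 * B + R)"
          using good_upto_lam[OF good_upto_mono[OF re(1) good] k \<omega> r] B_ge(2) w_le_B[OF k a] L_pos e
          by (intro mult_left_mono) auto
        also have "\<dots> = 3 * B * L * e + L * e * R" by (simp add: algebra_simps)
        also have "\<dots> \<le> 3 * B * L * e + L * R"
          using e L_pos R0 by (simp add: mult_left_le_one_le mult_right_mono)
        finally have main: "\<bar>lam k (r + e) \<omega> - (lam k r \<omega> + w k a)\<bar> \<le> (1 + L) * R + 3 * B * L * e"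
          using R0 by (simp add: algebra_simps)
        \<comment> \<open>Node \<open>a\<close> has exactly one stopped event \<open>x\<close> and
          shares no event with \<open>j\<close>. The pairs with distinct times are therefore
          \<open>x\<close> combined with each event of \<open>j\<close>, so the pair count equals
          the increment of \<open>j\<close>.\<close>
        have "R \<le> (\<Sum>j\<in>{1..n} - {a}. w k j * ?P j \<omega>)"
          unfolding R_def
        proof (intro sum_mono mult_left_mono w_nonneg k)
          fix j assume j: "j \<in> {1..n} - {a}"
          then have j': "j \<in> {1..n}" by simp
          have "stopped j r (r + e) \<omega> \<subseteq> E j \<omega>" "x \<in> E a \<omega>" using x by (auto simp: stopped_def)
          moreover have "E a \<omega> \<inter> E j \<omega> = {}"
            using elim(1) a j unfolding disjoint_family_on_def by auto
          ultimately have "{(x, y) \<in> stopped a r (r + e) \<omega> \<times> stopped j r (r + e) \<omega>. x \<noteq> y}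
              = {x} \<times> stopped j r (r + e) \<omega>"
            unfolding x by auto
          then have "?P j \<omega> = card (stopped j r (r + e) \<omega>)" by (simp add: card_cartesian_product_singleton)
          then show "cnt j (r + e) \<omega> - cnt j r \<omega> \<le> ?P j \<omega>"
            using stopped_card_eq[OF before j' \<omega> r re(1)] by simp
        qed auto
        also have "\<dots> \<le> (\<Sum>j=1..n. w k j * ?P j \<omega>)"
          by (rule sum_mono2[OF finite_atLeastAtMost Diff_subset], rule mult_nonneg_nonneg, rule w_nonneg[OF k]) auto
        finally have "(1 + L) * R \<le> (1 + L) * (\<Sum>j=1..n. w k j * ?P j \<omega>)"
          using L_pos by (intro mult_left_mono) auto
        with main have "\<bar>lam k (r + e) \<omega> - (lam k r \<omega> + w k a)\<bar>
            \<le> (1 + L) * (\<Sum>j=1..n. w k j * ?P j \<omega>) + 3 * B * L * e * card (stopped a r (r + e) \<omega>)"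
          using Na by simp
        then have "Z \<omega> * \<bar>lam k (r + e) \<omega> - (lam k r \<omega> + w k a)\<bar>
            \<le> Z \<omega> * ((1 + L) * (\<Sum>j=1..n. w k j * ?P j \<omega>) + 3 * B * L * e * card (stopped a r (r + e) \<omega>))"
          by (rule mult_left_mono[OF _ Z0[OF \<omega>]])
        also have "\<dots> = ?h \<omega>" by (simp add: distrib_left sum_distrib_left mult_ac)
        finally show ?thesis using good one by (simp add: one_def)
      qed
    qed
  qed
  also have "\<dots> = (1 + L) * (\<Sum>j=1..n. w k j * expectation (\<lambda>\<omega>. Z \<omega> * ?P j \<omega>))
      + 3 * B * L * e * expectation (\<lambda>\<omega>. Z \<omega> * card (stopped a r (r + e) \<omega>))"
    using Z_count_int[OF a re(1)] by (subst expectation_weighted_sum[OF pairs(1)]) simp_all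
  also have "\<dots> \<le> (1 + L) * (\<Sum>j=1..n. w k j * ((B * e)\<^sup>2 * expectation Z)) + 3 * B * L * e * (B * e * expectation Z)"
  proof (intro add_mono mult_left_mono sum_mono w_nonneg k)
    show "expectation (\<lambda>\<omega>. Z \<omega> * ?P j \<omega>) \<le> (B * e)\<^sup>2 * expectation Z" if "j \<in> {1..n}" for j
      by (rule pairs(2)[OF that])
    show "expectation (\<lambda>\<omega>. Z \<omega> * card (stopped a r (r + e) \<omega>)) \<le> B * e * expectation Z"
      using stopped_count_expectation[OF r Z Z0 Zc a re(1)] by simp
  qed (use L_pos B_ge(1) e in auto)
  also have "\<dots> = ((1 + L) * (\<Sum>j=1..n. w k j) + 3 * L) * B\<^sup>2 * e\<^sup>2 * expectation Z"
    unfolding sum_distrib_right[symmetric] by (simp add: power2_eq_square algebra_simps)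
  also have "\<dots> \<le> \<kappa>\<^sub>1 * B\<^sup>2 * e\<^sup>2 * expectation Z"
    unfolding \<kappa>\<^sub>1_def using sum_weights_le[OF k] L_pos EZ_nonneg
    by (intro mult_right_mono add_right_mono) (auto simp: mult.assoc)
  finally show "expectation (\<lambda>\<omega>. Z \<omega> * one a r (r + e) \<omega> * Vc (r + e) \<omega> * \<bar>lam k (r + e) \<omega> - (lam k r \<omega> + w k a)\<bar>)
      \<le> \<kappa>\<^sub>1 * B\<^sup>2 * e\<^sup>2 * expectation Z" .
qed

text \<open>A count c differs from the indicator of c = 1 only when c \<ge> 2, and is then dominated
  by the number c (c - 1) of ordered pairs of distinct events. On a bad path the indicator is
  switched off, and a single event is charged to \<open>1 - Vc (r + e)\<close>.\<close>

lemma one_Vc_count_diff: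
  assumes a: "a \<in> {1..n}" and \<omega>: "\<omega> \<in> space M"
  shows "\<bar>one a r (r + e) \<omega> * Vc (r + e) \<omega> - card (stopped a r (r + e) \<omega>)\<bar>
    \<le> 2 * card {(x, y) \<in> stopped a r (r + e) \<omega> \<times> stopped a r (r + e) \<omega>. x \<noteq> y} + (1 - Vc (r + e) \<omega>)"
proof -
  let ?X = "stopped a r (r + e) \<omega>"
  have fin: "finite ?X" by (rule stopped_finite[OF a \<omega>])
  have "{(x, y) \<in> ?X \<times> ?X. x \<noteq> y} = ?X \<times> ?X - (\<lambda>x. (x, x)) ` ?X" by auto
  moreover have "card (?X \<times> ?X - (\<lambda>x. (x, x)) ` ?X) = card (?X \<times> ?X) - card ((\<lambda>x. (x, x)) ` ?X)"
    by (rule card_Diff_subset) (use fin in auto)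
  moreover have "card ((\<lambda>x. (x, x)) ` ?X) = card ?X" by (rule card_image) (auto simp: inj_on_def)
  ultimately have P: "card {(x, y) \<in> ?X \<times> ?X. x \<noteq> y} = card ?X * card ?X - card ?X"
    by (simp add: card_cartesian_product)
  have nat_le: "real c \<le> 2 * real (c * c - c) + 1" "c \<noteq> 1 \<Longrightarrow> real c \<le> 2 * real (c * c - c)" for c :: nat
  proof -
    consider "c = 0" | "c = 1" | "c \<ge> 2" by linarith
    then have "real c \<le> 2 * real (c * c - c) + 1 \<and> (c \<noteq> 1 \<longrightarrow> real c \<le> 2 * real (c * c - c))"
    proof cases
      case 3
      then have "2 * c \<le> c * c" by simp
      then have "c \<le> c * c - c" by linarith
      then have "real c \<le> real (c * c - c)" by (simp only: of_nat_le_iff)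
      then show ?thesis by simp
    qed auto
    then show "real c \<le> 2 * real (c * c - c) + 1" "c \<noteq> 1 \<Longrightarrow> real c \<le> 2 * real (c * c - c)" by auto
  qed
  show ?thesis
  proof (cases "good_upto (r + e) \<omega>")
    case False
    then show ?thesis unfolding P using nat_le(1)[of "card ?X"] by simp
  next
    case True
    have "one a r (r + e) \<omega> = of_bool (card ?X = 1)"
      using stopped_card_eq[OF good_upto_imp_before[OF order_refl True] a \<omega> r re(1)] by (auto simp: one_def)
    then show ?thesis unfolding P using True nat_le(2)[of "card ?X"] by (cases "card ?X = 1") auto
  qed
qed

text \<open>In the compensator the rate at \<open>s\<close> is replaced by the rate at
  \<open>r\<close>. The weight is required to vanish on paths already bad at \<open>r\<close>, so
  that the rate at \<open>r\<close> is at most \<open>B\<close> wherever the weight is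
  positive.\<close>

lemma compensator_expectation:
  assumes a: "a \<in> {1..n}" and Zg: "\<And>\<omega>. \<omega> \<in> space M \<Longrightarrow> \<not> good_upto r \<omega> \<Longrightarrow> Z \<omega> = 0"
  shows "\<bar>expectation (\<lambda>\<omega>. Z \<omega> * card (stopped a r (r + e) \<omega>)) - e * expectation (\<lambda>\<omega>. Z \<omega> * lam a r \<omega>)\<bar>
    \<le> \<kappa>\<^sub>1 * B * e\<^sup>2 * expectation Z + B * e * expectation (\<lambda>\<omega>. Z \<omega> * (1 - Vc (r + e) \<omega>))"
proof -
  let ?rest = "expectation (\<lambda>\<omega>. Z \<omega> * (1 - Vc (r + e) \<omega>))"
  let ?err = "\<kappa>\<^sub>1 * B * e * expectation Z + B * ?rest"
  have rest_int: "integrable M (\<lambda>\<omega>. Z \<omega> * (1 - Vc (r + e) \<omega>))"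
    by (rule Z_bdd_int[of _ 1]) (use measurable_F_M[OF Vc_measurable_F[OF re(3)]] in auto)
  have Zs: "Z \<in> borel_measurable (F s)" if "s \<in> {r..r + e}" for s
    by (rule measurable_F_mono[OF Z]) (use that in auto)
  have H: "(\<lambda>\<omega>. V s \<omega> * Z \<omega>) \<in> borel_measurable (F s)" if "s \<in> {r..r + e}" for s
    by (intro borel_measurable_times V_measurable_F Zs that)
  have Hc: "\<bar>V s \<omega> * Z \<omega>\<bar> \<le> c" if "\<omega> \<in> space M" for s \<omega>
    using Z0[OF that] Zc[OF that] by (auto simp: of_bool_def)
  note CF = compensator_formula[OF a r re(2) H tendsto_mult[OF V_left_continuous tendsto_const] Hc]
  have pt: "\<bar>expectation (\<lambda>\<omega>. V s \<omega> * Z \<omega> * lam a s \<omega>) - expectation (\<lambda>\<omega>. Z \<omega> * lam a r \<omega>)\<bar> \<le> ?err"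
    if s: "s \<in> {r<..r + e}" for s
  proof -
    have s': "r \<le> s" "0 \<le> s" "s \<le> r + e" "s - r \<le> e" using s r by auto
    let ?h = "\<lambda>\<omega>. (1 + L) * (\<Sum>j=1..n. w a j * (Z \<omega> * card (stopped j r s \<omega>)))
        + 2 * L * B * e * Z \<omega> + B * (Z \<omega> * (1 - Vc (r + e) \<omega>))"
    have h_int: "integrable M ?h"
      by (intro Bochner_Integration.integrable_add integrable_mult_right Bochner_Integration.integrable_sum
          Z_count_int s'(1) Z_int rest_int) auto
    have VM: "(\<lambda>\<omega>. V s \<omega> * Z \<omega>) \<in> borel_measurable M"
      by (rule measurable_F_M[OF H]) (use s in auto)
    have "\<bar>expectation (\<lambda>\<omega>. V s \<omega> * Z \<omega> * lam a s \<omega>) - expectation (\<lambda>\<omega>. Z \<omega> * lam a r \<omega>)\<bar> \<le> expectation ?h"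
    proof (rule abs_expectation_diff_le[OF _ _ h_int])
      show "integrable M (\<lambda>\<omega>. V s \<omega> * Z \<omega> * lam a s \<omega>)"
        by (rule integrable_bounded_mult[OF lam_integrable[OF a s'(2)] VM Hc])
      show "integrable M (\<lambda>\<omega>. Z \<omega> * lam a r \<omega>)"
        by (rule Z_integrable_mult[OF r Z Z0 Zc lam_integrable[OF a r]])
      show "AE \<omega> in M. \<bar>V s \<omega> * Z \<omega> * lam a s \<omega> - Z \<omega> * lam a r \<omega>\<bar> \<le> ?h \<omega>"
      proof (rule AE_I2)
        fix \<omega> assume \<omega>: "\<omega> \<in> space M"
        have sum0: "0 \<le> (\<Sum>j=1..n. w a j * real (card (stopped j r s \<omega>)))"
          by (intro sum_nonneg mult_nonneg_nonneg w_nonneg a) auto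
        have h_eq: "?h \<omega> = Z \<omega> * ((1 + L) * (\<Sum>j=1..n. w a j * card (stopped j r s \<omega>))
            + 2 * L * B * e + B * (1 - Vc (r + e) \<omega>))"
          by (simp add: distrib_left sum_distrib_left mult_ac)
        show "\<bar>V s \<omega> * Z \<omega> * lam a s \<omega> - Z \<omega> * lam a r \<omega>\<bar> \<le> ?h \<omega>"
        proof (cases "good_upto r \<omega>")
          case False
          then show ?thesis unfolding h_eq using Zg[OF \<omega>] by simp
        next
          case gr: True
          note lr = good_upto_lam[OF gr a \<omega> r]
          have "\<bar>V s \<omega> * lam a s \<omega> - lam a r \<omega>\<bar> \<le> (1 + L) * (\<Sum>j=1..n. w a j * card (stopped j r s \<omega>))
            + 2 * L * B * e + B * (1 - Vc (r + e) \<omega>)"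
          proof (cases "good_before s \<omega>")
            \<comment> \<open>The path turned bad before \<open>s\<close>: the stopped rate is 0,
              and the whole error, at most \<open>B\<close>, is charged to
              \<open>1 - Vc (r + e)\<close>.\<close>
            case False
            then have "Vc (r + e) \<omega> = 0" using good_upto_imp_before[OF s'(3)] by auto
            moreover have "0 \<le> 2 * L * B * e" using L_pos B_ge(1) e by simp
            moreover have "0 \<le> (1 + L) * (\<Sum>j=1..n. w a j * real (card (stopped j r s \<omega>)))"
              using sum0 L_pos by simp
            moreover have "V s \<omega> = 0" using False by simp
            ultimately show ?thesis using lr by (simp only: mult_zero_left diff_0 abs_minus_cancel diff_zero mult_1_right)
          next
            case True
            define R where "R = (\<Sum>j=1..n. w a j * real (card (stopped j r s \<omega>)))"
            have R: "R = (\<Sum>j=1..n. w a j * (cnt j s \<omega> - cnt j r \<omega>))"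
              unfolding R_def by (intro sum.cong refl) (simp add: stopped_card_eq[OF True _ \<omega> r s'(1)])
            have R0: "0 \<le> R" using sum0 by (simp add: R_def)
            have "\<bar>lam a s \<omega> - lam a r \<omega> - R\<bar> \<le> L * (s - r) * (\<mu>_max + lam a r \<omega> + R)"
              using lam_increment[OF a \<omega> r s'(1)] unfolding R .
            also have "\<dots> \<le> L * e * (2 * B + R)"
              using lr B_ge(2) L_pos s' R0 mu_max_pos by (intro mult_mono mult_left_mono) auto
            also have "\<dots> = 2 * L * B * e + L * e * R" by (simp add: algebra_simps)
            also have "\<dots> \<le> 2 * L * B * e + L * R"
              using e L_pos R0 by (simp add: mult_left_le_one_le mult_right_mono)
            finally have "\<bar>lam a s \<omega> - lam a r \<omega>\<bar> \<le> (1 + L) * R + 2 * L * B * e"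
              using R0 by (simp add: algebra_simps)
            moreover have "0 \<le> B * (1 - Vc (r + e) \<omega>)" using B_ge(1) by simp
            ultimately show ?thesis using True by (simp add: R_def)
          qed
          then have "Z \<omega> * \<bar>V s \<omega> * lam a s \<omega> - lam a r \<omega>\<bar> \<le> ?h \<omega>"
            unfolding h_eq by (rule mult_left_mono[OF _ Z0[OF \<omega>]])
          moreover have "V s \<omega> * Z \<omega> * lam a s \<omega> - Z \<omega> * lam a r \<omega> = Z \<omega> * (V s \<omega> * lam a s \<omega> - lam a r \<omega>)"
            by (simp add: algebra_simps)
          ultimately show ?thesis using Z0[OF \<omega>] by (simp add: abs_mult)
        qed
      qed
    qed
    also have "\<dots> = (1 + L) * (\<Sum>j=1..n. w a j * expectation (\<lambda>\<omega>. Z \<omega> * card (stopped j r s \<omega>)))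
        + 2 * L * B * e * expectation Z + B * ?rest"
      unfolding add.assoc using Z_int rest_int
      by (subst expectation_weighted_sum[OF Z_count_int[OF _ s'(1)]]) simp_all
    also have "\<dots> \<le> (1 + L) * (\<Sum>j=1..n. w a j * (B * e * expectation Z)) + 2 * L * B * e * expectation Z + B * ?rest"
    proof (intro add_right_mono mult_left_mono sum_mono w_nonneg a)
      fix j assume "j \<in> {1..n}"
      from stopped_count_expectation[OF r Z Z0 Zc this s'(1)]
      have "expectation (\<lambda>\<omega>. Z \<omega> * card (stopped j r s \<omega>)) \<le> B * (s - r) * expectation Z" .
      also have "\<dots> \<le> B * e * expectation Z"
        using s' B_ge(1) EZ_nonneg by (intro mult_right_mono mult_left_mono) auto
      finally show "expectation (\<lambda>\<omega>. Z \<omega> * card (stopped j r s \<omega>)) \<le> B * e * expectation Z" .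
    qed (use L_pos in auto)
    also have "\<dots> = ((1 + L) * (\<Sum>j=1..n. w a j) + 2 * L) * (B * e * expectation Z) + B * ?rest"
      unfolding sum_distrib_right[symmetric] by (simp add: algebra_simps)
    also have "\<dots> \<le> \<kappa>\<^sub>1 * (B * e * expectation Z) + B * ?rest"
      unfolding \<kappa>\<^sub>1_def using sum_weights_le[OF a] L_pos EZ_nonneg B_ge(1) e
      by (intro mult_right_mono add_right_mono add_mono) (auto simp: mult.assoc)
    finally show ?thesis by (simp add: mult.assoc)
  qed
  have "expectation (\<lambda>\<omega>. Z \<omega> * card (stopped a r (r + e) \<omega>))
      = expectation (\<lambda>\<omega>. \<Sum>s\<in>E a \<omega> \<inter> {r<..r + e}. V s \<omega> * Z \<omega>)"
    by (intro Bochner_Integration.integral_cong refl)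
      (simp add: stopped_card_sum[OF a] sum_distrib_left mult.commute)
  also have "\<dots> = (LINT s:{r<..r + e}|lborel. expectation (\<lambda>\<omega>. V s \<omega> * Z \<omega> * lam a s \<omega>))"
    by (rule CF(3))
  finally have eq: "expectation (\<lambda>\<omega>. Z \<omega> * card (stopped a r (r + e) \<omega>)) = \<dots>" .
  let ?A = "expectation (\<lambda>\<omega>. Z \<omega> * lam a r \<omega>)"
  have const_int: "set_integrable lborel {r<..r + e} (\<lambda>_. x :: real)" for x
    unfolding set_integrable_def using re by (intro integrable_scaleR_left integrable_real_indicator) auto
  have const: "(LINT s:{r<..r + e}|lborel. x) = e * x" for x :: real
    using e by (simp add: set_lebesgue_integral_def)
  have "(LINT s:{r<..r + e}|lborel. expectation (\<lambda>\<omega>. V s \<omega> * Z \<omega> * lam a s \<omega>)) \<le> (LINT s:{r<..r + e}|lborel. ?A + ?err)"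
  proof (rule set_integral_mono[OF CF(2) const_int])
    fix s assume "s \<in> {r<..r + e}"
    from pt[OF this] show "expectation (\<lambda>\<omega>. V s \<omega> * Z \<omega> * lam a s \<omega>) \<le> ?A + ?err" by linarith
  qed
  moreover have "(LINT s:{r<..r + e}|lborel. ?A - ?err) \<le> (LINT s:{r<..r + e}|lborel. expectation (\<lambda>\<omega>. V s \<omega> * Z \<omega> * lam a s \<omega>))"
  proof (rule set_integral_mono[OF const_int CF(2)])
    fix s assume "s \<in> {r<..r + e}"
    from pt[OF this] show "?A - ?err \<le> expectation (\<lambda>\<omega>. V s \<omega> * Z \<omega> * lam a s \<omega>)" by linarith
  qed
  ultimately have "\<bar>(LINT s:{r<..r + e}|lborel. expectation (\<lambda>\<omega>. V s \<omega> * Z \<omega> * lam a s \<omega>)) - e * ?A\<bar> \<le> e * ?err"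
    unfolding const by (simp add: distrib_left right_diff_distrib abs_le_iff)
  then show ?thesis unfolding eq by (simp add: distrib_left power2_eq_square mult_ac)
qed

end

section \<open>Expansion over one, two and three windows\<close>

text \<open>Three replacements are made: the rates at the end of the window by the initial rates
  plus the jumps due to \<open>a\<close>, the indicator of one event by the stopped count, and the
  count by its compensator. The function \<open>G\<close> is general because the limiting value of
  the later windows is inserted for it, so that chains of windows are evaluated backwards. The range
  up to \<open>2 * B\<close> accommodates a rate and a weight, each at most
  \<open>B\<close>.\<close>

lemma one_step_expansion:
  fixes Z :: "'a \<Rightarrow> real" and G :: "real \<Rightarrow> real \<Rightarrow> real"
  assumes r: "0 \<le> r" and Z: "Z \<in> borel_measurable (F r)"
    and Z0: "\<And>\<omega>. \<omega> \<in> space M \<Longrightarrow> 0 \<le> Z \<omega>" and Zc: "\<And>\<omega>. \<omega> \<in> space M \<Longrightarrow> Z \<omega> \<le> c"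
    and e: "0 < e" "e \<le> 1"
    and a: "a \<in> {1..n}" and b: "b \<in> {1..n}" and b': "b' \<in> {1..n}"
    and G_meas: "(\<lambda>p. G (fst p) (snd p)) \<in> borel_measurable borel"
    and G: "\<And>x y. 0 \<le> x \<Longrightarrow> x \<le> 2 * B \<Longrightarrow> 0 \<le> y \<Longrightarrow> y \<le> 2 * B \<Longrightarrow> 0 \<le> G x y \<and> G x y \<le> Gm"
    and lip: "0 \<le> lip" "\<And>x y x' y'. 0 \<le> x \<Longrightarrow> x \<le> 2 * B \<Longrightarrow> 0 \<le> y \<Longrightarrow> y \<le> 2 * B \<Longrightarrow>
      0 \<le> x' \<Longrightarrow> x' \<le> 2 * B \<Longrightarrow> 0 \<le> y' \<Longrightarrow> y' \<le> 2 * B \<Longrightarrow> \<bar>G x y - G x' y'\<bar> \<le> lip * (\<bar>x - x'\<bar> + \<bar>y - y'\<bar>)"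
  shows "\<bar>expectation (\<lambda>\<omega>. Z \<omega> * one a r (r + e) \<omega> * Vc (r + e) \<omega> * G (lam b (r + e) \<omega>) (lam b' (r + e) \<omega>))
      - e * expectation (\<lambda>\<omega>. Z \<omega> * Vc r \<omega> * (lam a r \<omega> * G (lam b r \<omega> + w b a) (lam b' r \<omega> + w b' a)))\<bar>
    \<le> \<kappa> * (Gm + lip) * B\<^sup>2 * e\<^sup>2 * expectation Z + 2 * B * Gm * expectation (\<lambda>\<omega>. Z \<omega> * (1 - Vc (r + e) \<omega>))"
proof -
  note hyp = r Z Z0 Zc
  have re: "r \<le> r + e" "0 \<le> r + e" using r e by auto
  have B0: "0 \<le> B" using B_ge by simp
  have Gm0: "0 \<le> Gm" using G[of 0 0] B0 by simp
  have EZ0: "0 \<le> expectation Z" by (rule EZ_nonneg[OF hyp e])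
  have c0: "0 \<le> c" using Z0 Zc not_empty by force
  define Y where "Y = (\<lambda>\<omega>. G (lam b r \<omega> + w b a) (lam b' r \<omega> + w b' a))"
  define Y' where "Y' = (\<lambda>\<omega>. G (lam b (r + e) \<omega>) (lam b' (r + e) \<omega>))"
  define J where "J = (\<lambda>\<omega>. one a r (r + e) \<omega> * Vc (r + e) \<omega>)"
  \<comment> \<open>The value of \<open>G\<close> at the shifted initial rates is known at
    \<open>r\<close>, so it can be absorbed into the weight for the second and third
    replacement.\<close>
  define Z1 where "Z1 = (\<lambda>\<omega>. Z \<omega> * (Vc r \<omega> * Y \<omega>))"
  have Y_meas: "Y \<in> borel_measurable (F r)"
    unfolding Y_def
    using measurable_compose[OF borel_measurable_Pair[OF borel_measurable_add[OF lam_measurable_F[OF b r] borel_measurable_const]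
      borel_measurable_add[OF lam_measurable_F[OF b' r] borel_measurable_const]] G_meas] by simp
  have Y'_meas: "Y' \<in> borel_measurable M"
    unfolding Y'_def
    using measurable_compose[OF borel_measurable_Pair[OF lam_measurable[OF b re(2)] lam_measurable[OF b' re(2)]] G_meas] by simp
  have J_meas: "J \<in> borel_measurable M" unfolding J_def
    by (intro borel_measurable_times measurable_F_M[OF one_measurable_F[OF a r re(1)]] measurable_F_M[OF Vc_measurable_F[OF re(2)]])
  have J01: "0 \<le> J \<omega>" "J \<omega> \<le> 1" for \<omega> by (auto simp: J_def one_def of_bool_def)
  have range: "0 \<le> lam k r \<omega> + w k a \<and> lam k r \<omega> + w k a \<le> 2 * B"
    if "good_upto r \<omega>" "k \<in> {1..n}" "\<omega> \<in> space M" for k \<omega>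
    using good_upto_lam[OF that r] w_bounds(1)[OF that(2) a] w_le_B[OF that(2) a] by simp
  have range': "0 \<le> lam k (r + e) \<omega> \<and> lam k (r + e) \<omega> \<le> 2 * B"
    if "good_upto (r + e) \<omega>" "k \<in> {1..n}" "\<omega> \<in> space M" for k \<omega>
    using good_upto_lam[OF that re(2)] B0 by simp
  have VY: "0 \<le> Vc r \<omega> * Y \<omega>" "Vc r \<omega> * Y \<omega> \<le> Gm" if "\<omega> \<in> space M" for \<omega>
    using G[of "lam b r \<omega> + w b a" "lam b' r \<omega> + w b' a"] range[OF _ b that] range[OF _ b' that] Gm0
    by (cases "good_upto r \<omega>"; simp add: Y_def)+
  have JY': "0 \<le> J \<omega> * Y' \<omega>" "J \<omega> * Y' \<omega> \<le> Gm" if \<omega>: "\<omega> \<in> space M" for \<omega>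
  proof -
    have "0 \<le> Y' \<omega> \<and> Y' \<omega> \<le> Gm" if "good_upto (r + e) \<omega>"
      unfolding Y'_def using G range'[OF that b \<omega>] range'[OF that b' \<omega>] by simp
    then show "0 \<le> J \<omega> * Y' \<omega>" "J \<omega> * Y' \<omega> \<le> Gm" using Gm0 by (auto simp: J_def one_def of_bool_def)
  qed
  have Z1_meas: "Z1 \<in> borel_measurable (F r)" unfolding Z1_def
    by (intro borel_measurable_times Z Vc_measurable_F r Y_meas)
  have Z1_0: "0 \<le> Z1 \<omega>" if "\<omega> \<in> space M" for \<omega> using Z0[OF that] VY(1)[OF that] by (simp add: Z1_def)
  have Z1_le: "Z1 \<omega> \<le> Gm * Z \<omega>" if "\<omega> \<in> space M" for \<omega>
    using mult_left_mono[OF VY(2)[OF that] Z0[OF that]] by (simp add: Z1_def mult.commute)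
  have Z1_c: "Z1 \<omega> \<le> Gm * c" if "\<omega> \<in> space M" for \<omega>
    using Z1_le[OF that] mult_left_mono[OF Zc[OF that] Gm0] by simp
  have Z1_good: "Z1 \<omega> = 0" if "\<not> good_upto r \<omega>" for \<omega> using that by (simp add: Z1_def)
  note hyp1 = r Z1_meas Z1_0 Z1_c
  have rest_int: "integrable M (\<lambda>\<omega>. Z \<omega> * (1 - Vc (r + e) \<omega>))"
    by (rule Z_bdd_int[OF hyp e, of _ 1]) (use measurable_F_M[OF Vc_measurable_F[OF re(2)]] in auto)
  have rest1_int: "integrable M (\<lambda>\<omega>. Z1 \<omega> * (1 - Vc (r + e) \<omega>))"
    by (rule Z_bdd_int[OF hyp1 e, of _ 1]) (use measurable_F_M[OF Vc_measurable_F[OF re(2)]] in auto)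
  have EZ1: "expectation Z1 \<le> Gm * expectation Z"
  proof -
    have "expectation Z1 \<le> expectation (\<lambda>\<omega>. Gm * Z \<omega>)"
      by (rule integral_mono) (use Z_int[OF hyp1 e] Z_int[OF hyp e] Z1_le in auto)
    then show ?thesis by simp
  qed
  have Erest: "expectation (\<lambda>\<omega>. Z1 \<omega> * (1 - Vc (r + e) \<omega>)) \<le> Gm * expectation (\<lambda>\<omega>. Z \<omega> * (1 - Vc (r + e) \<omega>))"
  proof -
    have "expectation (\<lambda>\<omega>. Z1 \<omega> * (1 - Vc (r + e) \<omega>)) \<le> expectation (\<lambda>\<omega>. Gm * (Z \<omega> * (1 - Vc (r + e) \<omega>)))"
    proof (rule integral_mono[OF rest1_int integrable_mult_right[OF rest_int]])
      show "Z1 \<omega> * (1 - Vc (r + e) \<omega>) \<le> Gm * (Z \<omega> * (1 - Vc (r + e) \<omega>))" if "\<omega> \<in> space M" for \<omega>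
        using Z1_le[OF that] by (simp add: of_bool_def)
    qed
    then show ?thesis by simp
  qed

  have step1: "\<bar>expectation (\<lambda>\<omega>. Z \<omega> * (J \<omega> * Y' \<omega>)) - expectation (\<lambda>\<omega>. Z1 \<omega> * J \<omega>)\<bar>
      \<le> 2 * lip * (\<kappa>\<^sub>1 * B\<^sup>2 * e\<^sup>2 * expectation Z)"
  proof -
    let ?h = "\<lambda>k \<omega>. Z \<omega> * one a r (r + e) \<omega> * Vc (r + e) \<omega> * \<bar>lam k (r + e) \<omega> - (lam k r \<omega> + w k a)\<bar>"
    have jump: "integrable M (?h k)" "expectation (?h k) \<le> \<kappa>\<^sub>1 * B\<^sup>2 * e\<^sup>2 * expectation Z"
      if "k \<in> {1..n}" for k
      by (rule lam_jump_expectation[OF hyp e a that]; assumption)+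
    have "\<bar>expectation (\<lambda>\<omega>. Z \<omega> * (J \<omega> * Y' \<omega>)) - expectation (\<lambda>\<omega>. Z1 \<omega> * J \<omega>)\<bar>
        \<le> expectation (\<lambda>\<omega>. lip * (?h b \<omega> + ?h b' \<omega>))"
    proof (rule abs_expectation_diff_le)
      show "integrable M (\<lambda>\<omega>. Z \<omega> * (J \<omega> * Y' \<omega>))"
        by (rule Z_bdd_int[OF hyp e]) (use J_meas Y'_meas JY' in auto)
      show "integrable M (\<lambda>\<omega>. Z1 \<omega> * J \<omega>)"
        by (rule Z_bdd_int[OF hyp1 e]) (use J_meas J01 in auto)
      show "integrable M (\<lambda>\<omega>. lip * (?h b \<omega> + ?h b' \<omega>))"
        by (intro integrable_mult_right Bochner_Integration.integrable_add jump(1) b b')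
      show "AE \<omega> in M. \<bar>Z \<omega> * (J \<omega> * Y' \<omega>) - Z1 \<omega> * J \<omega>\<bar> \<le> lip * (?h b \<omega> + ?h b' \<omega>)"
      proof (rule AE_I2)
        fix \<omega> assume \<omega>: "\<omega> \<in> space M"
        show "\<bar>Z \<omega> * (J \<omega> * Y' \<omega>) - Z1 \<omega> * J \<omega>\<bar> \<le> lip * (?h b \<omega> + ?h b' \<omega>)"
        proof (cases "good_upto (r + e) \<omega>")
          case True
          note gr = good_upto_mono[OF re(1) True]
          have "\<bar>Y' \<omega> - Y \<omega>\<bar> \<le> lip * (\<bar>lam b (r + e) \<omega> - (lam b r \<omega> + w b a)\<bar> + \<bar>lam b' (r + e) \<omega> - (lam b' r \<omega> + w b' a)\<bar>)"
            unfolding Y'_def Y_def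
            using range'[OF True b \<omega>] range'[OF True b' \<omega>] range[OF gr b \<omega>] range[OF gr b' \<omega>]
            by (intro lip(2)) auto
          from mult_left_mono[OF this, of "Z \<omega> * J \<omega>"]
          have "Z \<omega> * J \<omega> * \<bar>Y' \<omega> - Y \<omega>\<bar> \<le> lip * (?h b \<omega> + ?h b' \<omega>)"
            using Z0[OF \<omega>] J01[of \<omega>] by (simp add: J_def algebra_simps)
          moreover have "Z \<omega> * (J \<omega> * Y' \<omega>) - Z1 \<omega> * J \<omega> = Z \<omega> * J \<omega> * (Y' \<omega> - Y \<omega>)"
            using gr by (simp add: Z1_def algebra_simps)
          ultimately show ?thesis using Z0[OF \<omega>] J01[of \<omega>] by (simp add: abs_mult)
        qed (simp add: J_def)
      qed
    qed
    also have "\<dots> = lip * (expectation (?h b) + expectation (?h b'))"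
      using jump(1)[OF b] jump(1)[OF b'] by simp
    also have "\<dots> \<le> lip * (\<kappa>\<^sub>1 * B\<^sup>2 * e\<^sup>2 * expectation Z + \<kappa>\<^sub>1 * B\<^sup>2 * e\<^sup>2 * expectation Z)"
      by (intro mult_left_mono add_mono jump(2) b b' lip(1))
    finally show ?thesis by (simp add: mult_ac)
  qed
  have step2: "\<bar>expectation (\<lambda>\<omega>. Z1 \<omega> * J \<omega>) - expectation (\<lambda>\<omega>. Z1 \<omega> * card (stopped a r (r + e) \<omega>))\<bar>
      \<le> 2 * ((B * e)\<^sup>2 * (Gm * expectation Z)) + Gm * expectation (\<lambda>\<omega>. Z \<omega> * (1 - Vc (r + e) \<omega>))"
  proof -
    let ?P = "\<lambda>\<omega>. real (card {(x, y) \<in> stopped a r (r + e) \<omega> \<times> stopped a r (r + e) \<omega>. x \<noteq> y})"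
    have P: "integrable M (\<lambda>\<omega>. Z1 \<omega> * ?P \<omega>)"
      "expectation (\<lambda>\<omega>. Z1 \<omega> * ?P \<omega>) \<le> (B * e)\<^sup>2 * expectation Z1"
      using stopped_pairs_expectation[OF hyp1 a a, of "r + e"] e by simp_all
    have "\<bar>expectation (\<lambda>\<omega>. Z1 \<omega> * J \<omega>) - expectation (\<lambda>\<omega>. Z1 \<omega> * card (stopped a r (r + e) \<omega>))\<bar>
        \<le> expectation (\<lambda>\<omega>. 2 * (Z1 \<omega> * ?P \<omega>) + Z1 \<omega> * (1 - Vc (r + e) \<omega>))"
    proof (rule abs_expectation_diff_le)
      show "integrable M (\<lambda>\<omega>. Z1 \<omega> * J \<omega>)"
        by (rule Z_bdd_int[OF hyp1 e]) (use J_meas J01 in auto)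
      show "integrable M (\<lambda>\<omega>. Z1 \<omega> * card (stopped a r (r + e) \<omega>))"
        by (rule Z_count_int[OF hyp1 e a re(1)])
      show "integrable M (\<lambda>\<omega>. 2 * (Z1 \<omega> * ?P \<omega>) + Z1 \<omega> * (1 - Vc (r + e) \<omega>))"
        by (intro Bochner_Integration.integrable_add integrable_mult_right P(1) rest1_int)
      show "AE \<omega> in M. \<bar>Z1 \<omega> * J \<omega> - Z1 \<omega> * card (stopped a r (r + e) \<omega>)\<bar> \<le> 2 * (Z1 \<omega> * ?P \<omega>) + Z1 \<omega> * (1 - Vc (r + e) \<omega>)"
      proof (rule AE_I2)
        fix \<omega> assume \<omega>: "\<omega> \<in> space M"
        from mult_left_mono[OF one_Vc_count_diff[OF hyp e a \<omega>] Z1_0[OF \<omega>]]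
        have "Z1 \<omega> * \<bar>J \<omega> - card (stopped a r (r + e) \<omega>)\<bar> \<le> 2 * (Z1 \<omega> * ?P \<omega>) + Z1 \<omega> * (1 - Vc (r + e) \<omega>)"
          by (simp add: J_def algebra_simps)
        then show "\<bar>Z1 \<omega> * J \<omega> - Z1 \<omega> * card (stopped a r (r + e) \<omega>)\<bar> \<le> 2 * (Z1 \<omega> * ?P \<omega>) + Z1 \<omega> * (1 - Vc (r + e) \<omega>)"
          using Z1_0[OF \<omega>] by (simp add: abs_mult flip: right_diff_distrib)
      qed
    qed
    also have "\<dots> = 2 * expectation (\<lambda>\<omega>. Z1 \<omega> * ?P \<omega>) + expectation (\<lambda>\<omega>. Z1 \<omega> * (1 - Vc (r + e) \<omega>))"
      using P(1) rest1_int by simp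
    also have "\<dots> \<le> 2 * ((B * e)\<^sup>2 * (Gm * expectation Z)) + Gm * expectation (\<lambda>\<omega>. Z \<omega> * (1 - Vc (r + e) \<omega>))"
      using order_trans[OF P(2) mult_left_mono[OF EZ1]] Erest by (intro add_mono mult_left_mono) auto
    finally show ?thesis .
  qed
  have "\<bar>expectation (\<lambda>\<omega>. Z1 \<omega> * card (stopped a r (r + e) \<omega>)) - e * expectation (\<lambda>\<omega>. Z1 \<omega> * lam a r \<omega>)\<bar>
      \<le> \<kappa>\<^sub>1 * B * e\<^sup>2 * expectation Z1 + B * e * expectation (\<lambda>\<omega>. Z1 \<omega> * (1 - Vc (r + e) \<omega>))"
    by (rule compensator_expectation[OF hyp1 e a Z1_good])
  also have "\<dots> \<le> \<kappa>\<^sub>1 * B * e\<^sup>2 * (Gm * expectation Z) + B * e * (Gm * expectation (\<lambda>\<omega>. Z \<omega> * (1 - Vc (r + e) \<omega>)))"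
    using EZ1 Erest kappa_pos(1) B0 e by (intro add_mono mult_left_mono) auto
  finally have step3: "\<bar>expectation (\<lambda>\<omega>. Z1 \<omega> * card (stopped a r (r + e) \<omega>)) - e * expectation (\<lambda>\<omega>. Z1 \<omega> * lam a r \<omega>)\<bar>
      \<le> \<dots>" .
  let ?R = "expectation (\<lambda>\<omega>. Z \<omega> * (1 - Vc (r + e) \<omega>))"
  have R0: "0 \<le> ?R" by (rule integral_nonneg_AE) (use Z0 in auto)
  have "\<bar>expectation (\<lambda>\<omega>. Z \<omega> * (J \<omega> * Y' \<omega>)) - e * expectation (\<lambda>\<omega>. Z1 \<omega> * lam a r \<omega>)\<bar>
    \<le> 2 * lip * (\<kappa>\<^sub>1 * B\<^sup>2 * e\<^sup>2 * expectation Z) + 2 * ((B * e)\<^sup>2 * (Gm * expectation Z)) + Gm * ?R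
      + (\<kappa>\<^sub>1 * B * e\<^sup>2 * (Gm * expectation Z) + B * e * (Gm * ?R))"
    using step1 step2 step3 by linarith
  also have "\<dots> \<le> \<kappa> * (Gm + lip) * B\<^sup>2 * e\<^sup>2 * expectation Z + 2 * B * Gm * ?R"
  proof -
    have "Gm * ?R + B * e * (Gm * ?R) = (1 + B * e) * (Gm * ?R)" by (simp add: algebra_simps)
    also have "\<dots> \<le> (2 * B) * (Gm * ?R)"
    proof (rule mult_right_mono)
      have "B * e \<le> B" using e B0 by (simp add: mult_left_le)
      then show "1 + B * e \<le> 2 * B" using B_ge(1) by linarith
    qed (use Gm0 R0 in simp)
    finally have 1: "Gm * ?R + B * e * (Gm * ?R) \<le> 2 * B * Gm * ?R" by (simp add: mult.assoc)
    have BB: "B \<le> B\<^sup>2" using B_ge(1) by (simp add: power2_eq_square)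
    have "\<kappa>\<^sub>1 * B * (Gm * (e\<^sup>2 * expectation Z)) \<le> \<kappa>\<^sub>1 * B\<^sup>2 * (Gm * (e\<^sup>2 * expectation Z))"
      using BB kappa_pos(1) Gm0 EZ0 by (intro mult_right_mono mult_left_mono) auto
    moreover have "0 \<le> \<kappa>\<^sub>1 * B\<^sup>2 * (Gm * (e\<^sup>2 * expectation Z))" "0 \<le> \<kappa>\<^sub>1 * B\<^sup>2 * (lip * (e\<^sup>2 * expectation Z))"
        "0 \<le> B\<^sup>2 * (lip * (e\<^sup>2 * expectation Z))"
      using kappa_pos(1) Gm0 EZ0 lip(1) by auto
    ultimately have 2: "2 * lip * (\<kappa>\<^sub>1 * B\<^sup>2 * e\<^sup>2 * expectation Z) + 2 * ((B * e)\<^sup>2 * (Gm * expectation Z))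
        + \<kappa>\<^sub>1 * B * e\<^sup>2 * (Gm * expectation Z) \<le> \<kappa> * (Gm + lip) * B\<^sup>2 * e\<^sup>2 * expectation Z"
      unfolding \<kappa>_def power_mult_distrib by (simp add: algebra_simps)
    show ?thesis using 1 2 by linarith
  qed
  finally have "\<bar>expectation (\<lambda>\<omega>. Z \<omega> * (J \<omega> * Y' \<omega>)) - e * expectation (\<lambda>\<omega>. Z1 \<omega> * lam a r \<omega>)\<bar>
    \<le> \<kappa> * (Gm + lip) * B\<^sup>2 * e\<^sup>2 * expectation Z + 2 * B * Gm * ?R" .
  moreover have "(\<lambda>\<omega>. Z \<omega> * (J \<omega> * Y' \<omega>)) = (\<lambda>\<omega>. Z \<omega> * one a r (r + e) \<omega> * Vc (r + e) \<omega> * G (lam b (r + e) \<omega>) (lam b' (r + e) \<omega>))"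
    by (simp add: J_def Y'_def mult.assoc)
  moreover have "(\<lambda>\<omega>. Z1 \<omega> * lam a r \<omega>) = (\<lambda>\<omega>. Z \<omega> * Vc r \<omega> * (lam a r \<omega> * G (lam b r \<omega> + w b a) (lam b' r \<omega> + w b' a)))"
    by (simp add: Z1_def Y_def mult_ac)
  ultimately show ?thesis by simp
qed

lemma rest_integrable:
  fixes Z :: "'a \<Rightarrow> real"
  assumes "0 \<le> s" "Z \<in> borel_measurable M"
    and "\<And>\<omega>. \<omega> \<in> space M \<Longrightarrow> 0 \<le> Z \<omega>" "\<And>\<omega>. \<omega> \<in> space M \<Longrightarrow> Z \<omega> \<le> c"
  shows "integrable M (\<lambda>\<omega>. Z \<omega> * (1 - Vc s \<omega>))"
proof (rule integrable_bounded)
  show "(\<lambda>\<omega>. Z \<omega> * (1 - Vc s \<omega>)) \<in> borel_measurable M"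
    using assms(2) measurable_F_M[OF Vc_measurable_F[OF assms(1)]] by measurable
  show "\<bar>Z \<omega> * (1 - Vc s \<omega>)\<bar> \<le> \<bar>c\<bar>" if "\<omega> \<in> space M" for \<omega>
    using assms(3,4)[OF that] by (auto simp: of_bool_def)
qed

lemma rest_mono:
  fixes Z Z' :: "'a \<Rightarrow> real"
  assumes s: "0 \<le> s'" "s' \<le> s" and Z: "Z \<in> borel_measurable M" "Z' \<in> borel_measurable M"
    and le: "\<And>\<omega>. \<omega> \<in> space M \<Longrightarrow> 0 \<le> Z' \<omega>" "\<And>\<omega>. \<omega> \<in> space M \<Longrightarrow> Z' \<omega> \<le> Z \<omega>"
      "\<And>\<omega>. \<omega> \<in> space M \<Longrightarrow> Z \<omega> \<le> c"
  shows "expectation (\<lambda>\<omega>. Z' \<omega> * (1 - Vc s' \<omega>)) \<le> expectation (\<lambda>\<omega>. Z \<omega> * (1 - Vc s \<omega>))"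
proof (rule integral_mono)
  show "integrable M (\<lambda>\<omega>. Z' \<omega> * (1 - Vc s' \<omega>))"
    by (rule rest_integrable[OF s(1) Z(2) le(1), of c]) (use le in force)+
  show "integrable M (\<lambda>\<omega>. Z \<omega> * (1 - Vc s \<omega>))"
    by (rule rest_integrable[OF order_trans[OF s] Z(1), of c]) (use le in force)+
  fix \<omega> assume "\<omega> \<in> space M"
  from le(1,2)[OF this] show "Z' \<omega> * (1 - Vc s' \<omega>) \<le> Z \<omega> * (1 - Vc s \<omega>)"
    using good_upto_mono[OF s(2), of \<omega>] by (auto simp: of_bool_def)
qed

context
  fixes Z :: "'a \<Rightarrow> real" and t e c :: real
  assumes t: "0 \<le> t" and Z: "Z \<in> borel_measurable (F t)"
    and Z0: "\<And>\<omega>. \<omega> \<in> space M \<Longrightarrow> 0 \<le> Z \<omega>" and Zc: "\<And>\<omega>. \<omega> \<in> space M \<Longrightarrow> Z \<omega> \<le> c"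
    and e: "0 < e" "e \<le> 1"
begin

lemma one_Vc_weight:
  assumes a: "a \<in> {1..n}"
  shows "(\<lambda>\<omega>. Z \<omega> * one a t (t + e) \<omega> * Vc (t + e) \<omega>) \<in> borel_measurable (F (t + e))"
    and "\<And>\<omega>. \<omega> \<in> space M \<Longrightarrow> 0 \<le> Z \<omega> * one a t (t + e) \<omega> * Vc (t + e) \<omega>"
    and "\<And>\<omega>. \<omega> \<in> space M \<Longrightarrow> Z \<omega> * one a t (t + e) \<omega> * Vc (t + e) \<omega> \<le> Z \<omega>"
proof -
  show "(\<lambda>\<omega>. Z \<omega> * one a t (t + e) \<omega> * Vc (t + e) \<omega>) \<in> borel_measurable (F (t + e))"
    using t e by (intro borel_measurable_times measurable_F_mono[OF Z] one_measurable_F a Vc_measurable_F) auto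
  fix \<omega> assume "\<omega> \<in> space M"
  from Z0[OF this] show "0 \<le> Z \<omega> * one a t (t + e) \<omega> * Vc (t + e) \<omega>"
    "Z \<omega> * one a t (t + e) \<omega> * Vc (t + e) \<omega> \<le> Z \<omega>"
    by (auto simp: one_def of_bool_def)
qed

text \<open>Here the value of the following window is the rate of its node, so \<open>G\<close> is
  the first projection, with bound \<open>2 * B\<close> and Lipschitz constant 1.\<close>

lemma one_step_linear:
  assumes a: "a \<in> {1..n}" and b: "b \<in> {1..n}"
  shows "\<bar>expectation (\<lambda>\<omega>. Z \<omega> * one a t (t + e) \<omega> * Vc (t + e) \<omega> * lam b (t + e) \<omega>)
      - e * expectation (\<lambda>\<omega>. Z \<omega> * Vc t \<omega> * (lam a t \<omega> * (lam b t \<omega> + w b a)))\<bar>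
    \<le> 3 * \<kappa> * B^3 * e\<^sup>2 * expectation Z + 4 * B\<^sup>2 * expectation (\<lambda>\<omega>. Z \<omega> * (1 - Vc (t + e) \<omega>))"
proof -
  have "\<bar>expectation (\<lambda>\<omega>. Z \<omega> * one a t (t + e) \<omega> * Vc (t + e) \<omega> * lam b (t + e) \<omega>)
      - e * expectation (\<lambda>\<omega>. Z \<omega> * Vc t \<omega> * (lam a t \<omega> * (lam b t \<omega> + w b a)))\<bar>
    \<le> \<kappa> * (2 * B + 1) * B\<^sup>2 * e\<^sup>2 * expectation Z + 2 * B * (2 * B) * expectation (\<lambda>\<omega>. Z \<omega> * (1 - Vc (t + e) \<omega>))"
    by (rule one_step_expansion[OF t Z Z0 Zc e a b b, of "\<lambda>x y. x"])
      (auto intro!: borel_measurable_continuous_onI continuous_intros)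
  also have "\<kappa> * (2 * B + 1) * B\<^sup>2 * e\<^sup>2 * expectation Z \<le> \<kappa> * (3 * B) * B\<^sup>2 * e\<^sup>2 * expectation Z"
    using kappa_pos(2) B_ge(1) EZ_nonneg[OF t Z Z0 Zc e] by (intro mult_right_mono mult_left_mono) auto
  finally show ?thesis by (simp add: power2_eq_square power3_eq_cube mult_ac)
qed

text \<open>Here \<open>G\<close> is the value x (y + w) of the following two windows, for the rates
  x of \<open>b\<close> and y of \<open>b'\<close>. On the square up to \<open>2 * B\<close> it is
  at most 6 B^2, with Lipschitz constant 3 B.\<close>

lemma one_step_quadratic:
  assumes a: "a \<in> {1..n}" and b: "b \<in> {1..n}" and b': "b' \<in> {1..n}"
  shows "\<bar>expectation (\<lambda>\<omega>. Z \<omega> * one a t (t + e) \<omega> * Vc (t + e) \<omega> * (lam b (t + e) \<omega> * (lam b' (t + e) \<omega> + w b' b)))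
      - e * expectation (\<lambda>\<omega>. Z \<omega> * Vc t \<omega> * (lam a t \<omega> * ((lam b t \<omega> + w b a) * (lam b' t \<omega> + w b' a + w b' b))))\<bar>
    \<le> 9 * \<kappa> * B^4 * e\<^sup>2 * expectation Z + 12 * B^3 * expectation (\<lambda>\<omega>. Z \<omega> * (1 - Vc (t + e) \<omega>))"
proof -
  have w: "0 \<le> w b' b" "w b' b \<le> B" using w_bounds(1)[OF b' b] w_le_B[OF b' b] by auto
  have B0: "0 \<le> B" "1 \<le> B" using B_ge by auto
  have "\<bar>expectation (\<lambda>\<omega>. Z \<omega> * one a t (t + e) \<omega> * Vc (t + e) \<omega> * (lam b (t + e) \<omega> * (lam b' (t + e) \<omega> + w b' b)))
      - e * expectation (\<lambda>\<omega>. Z \<omega> * Vc t \<omega> * (lam a t \<omega> * ((lam b t \<omega> + w b a) * (lam b' t \<omega> + w b' a + w b' b))))\<bar>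
    \<le> \<kappa> * (6 * B\<^sup>2 + 3 * B) * B\<^sup>2 * e\<^sup>2 * expectation Z + 2 * B * (6 * B\<^sup>2) * expectation (\<lambda>\<omega>. Z \<omega> * (1 - Vc (t + e) \<omega>))"
  proof (rule one_step_expansion[OF t Z Z0 Zc e a b b', of "\<lambda>x y. x * (y + w b' b)"])
    show "(\<lambda>p. fst p * (snd p + w b' b)) \<in> borel_measurable borel"
      by (intro borel_measurable_continuous_onI continuous_intros)
    fix x y :: real assume xy: "0 \<le> x" "x \<le> 2 * B" "0 \<le> y" "y \<le> 2 * B"
    then have "x * (y + w b' b) \<le> (2 * B) * (3 * B)" using w by (intro mult_mono) auto
    then show "0 \<le> x * (y + w b' b) \<and> x * (y + w b' b) \<le> 6 * B\<^sup>2"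
      using xy w by (simp add: power2_eq_square)
    fix x' y' :: real assume xy': "0 \<le> x'" "x' \<le> 2 * B" "0 \<le> y'" "y' \<le> 2 * B"
    have "x * (y + w b' b) - x' * (y' + w b' b) = (x - x') * (y + w b' b) + x' * (y - y')" by (simp add: algebra_simps)
    also have "\<bar>\<dots>\<bar> \<le> \<bar>(x - x') * (y + w b' b)\<bar> + \<bar>x' * (y - y')\<bar>" by (rule abs_triangle_ineq)
    also have "\<dots> = \<bar>x - x'\<bar> * (y + w b' b) + x' * \<bar>y - y'\<bar>" using xy xy' w by (simp add: abs_mult)
    also have "\<dots> \<le> \<bar>x - x'\<bar> * (3 * B) + (3 * B) * \<bar>y - y'\<bar>"
      using xy xy' w B0 by (intro add_mono mult_left_mono mult_right_mono) auto
    finally show "\<bar>x * (y + w b' b) - x' * (y' + w b' b)\<bar> \<le> 3 * B * (\<bar>x - x'\<bar> + \<bar>y - y'\<bar>)"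
      by (simp add: algebra_simps)
  qed (use B0 in auto)
  also have "\<kappa> * (6 * B\<^sup>2 + 3 * B) * B\<^sup>2 * e\<^sup>2 * expectation Z \<le> \<kappa> * (9 * B\<^sup>2) * B\<^sup>2 * e\<^sup>2 * expectation Z"
  proof (intro mult_right_mono mult_left_mono kappa_pos(2))
    show "6 * B\<^sup>2 + 3 * B \<le> 9 * B\<^sup>2" using B0 by (simp add: power2_eq_square)
  qed (use EZ_nonneg[OF t Z Z0 Zc e] in auto)
  finally show ?thesis by (simp add: power_numeral_reduce mult_ac)
qed

lemma one_step_const:
  assumes a: "a \<in> {1..n}"
  shows "\<bar>expectation (\<lambda>\<omega>. Z \<omega> * one a t (t + e) \<omega> * Vc (t + e) \<omega>) - e * expectation (\<lambda>\<omega>. Z \<omega> * Vc t \<omega> * lam a t \<omega>)\<bar>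
    \<le> \<kappa> * B\<^sup>2 * e\<^sup>2 * expectation Z + 2 * B * expectation (\<lambda>\<omega>. Z \<omega> * (1 - Vc (t + e) \<omega>))"
  using one_step_expansion[OF t Z Z0 Zc e a a a, of "\<lambda>x y. 1" 1 0] by simp

end

context
  fixes Z :: "'a \<Rightarrow> real" and t e c :: real
  assumes t: "0 \<le> t" and Z: "Z \<in> borel_measurable (F t)"
    and Z0: "\<And>\<omega>. \<omega> \<in> space M \<Longrightarrow> 0 \<le> Z \<omega>" and Zc: "\<And>\<omega>. \<omega> \<in> space M \<Longrightarrow> Z \<omega> \<le> c"
    and e: "0 < e" "e \<le> 1"
begin

text \<open>The last window is expanded with the indicator of the first as part of the weight. That
  weight has mean of order B e, so this error too is of order e^3. The constants are 1 + 3 and 2 + 4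
  from the two steps. Terms with \<open>1 - Vc\<close> keep no powers of \<open>e\<close>, since
  they are later bounded by the far smaller exit probability.\<close>

lemma pair_expansion:
  assumes a: "a \<in> {1..n}" and b: "b \<in> {1..n}"
  shows "\<bar>expectation (\<lambda>\<omega>. Z \<omega> * one a t (t + e) \<omega> * one b (t + e) (t + e + e) \<omega> * Vc (t + e + e) \<omega>)
      - e\<^sup>2 * expectation (\<lambda>\<omega>. Z \<omega> * Vc t \<omega> * (lam a t \<omega> * (lam b t \<omega> + w b a)))\<bar>
    \<le> 4 * \<kappa> * B^3 * e^3 * expectation Z + 6 * B\<^sup>2 * expectation (\<lambda>\<omega>. Z \<omega> * (1 - Vc (t + e + e) \<omega>))"
proof -
  define Z' where "Z' = (\<lambda>\<omega>. Z \<omega> * one a t (t + e) \<omega> * Vc (t + e) \<omega>)"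
  have Z': "Z' \<in> borel_measurable (F (t + e))" "\<And>\<omega>. \<omega> \<in> space M \<Longrightarrow> 0 \<le> Z' \<omega>"
    "\<And>\<omega>. \<omega> \<in> space M \<Longrightarrow> Z' \<omega> \<le> Z \<omega>"
    unfolding Z'_def by (rule one_Vc_weight[OF t Z Z0 Zc e a]; assumption)+
  have Z'c: "Z' \<omega> \<le> c" if "\<omega> \<in> space M" for \<omega> using Z'(3)[OF that] Zc[OF that] by simp
  have te: "0 \<le> t + e" "t + e \<le> t + e + e" "0 \<le> t + e + e" using t e by auto
  have B0: "1 \<le> B" "0 \<le> B" using B_ge by auto
  have EZ0: "0 \<le> expectation Z" by (rule EZ_nonneg[OF t Z Z0 Zc e])
  note ZM = measurable_F_M[OF Z] and Z'M = measurable_F_M[OF Z'(1)]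
  let ?R = "expectation (\<lambda>\<omega>. Z \<omega> * (1 - Vc (t + e + e) \<omega>))"
  have R0: "0 \<le> ?R" by (rule integral_nonneg_AE) (use Z0 in auto)
  define q2 where "q2 = expectation (\<lambda>\<omega>. Z \<omega> * one a t (t + e) \<omega> * one b (t + e) (t + e + e) \<omega> * Vc (t + e + e) \<omega>)"
  define q1 where "q1 = expectation (\<lambda>\<omega>. Z \<omega> * one a t (t + e) \<omega> * Vc (t + e) \<omega> * lam b (t + e) \<omega>)"
  define q0 where "q0 = expectation (\<lambda>\<omega>. Z \<omega> * Vc t \<omega> * (lam a t \<omega> * (lam b t \<omega> + w b a)))"
  have s2: "\<bar>expectation (\<lambda>\<omega>. Z' \<omega> * one b (t + e) (t + e + e) \<omega> * Vc (t + e + e) \<omega>)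
        - e * expectation (\<lambda>\<omega>. Z' \<omega> * Vc (t + e) \<omega> * lam b (t + e) \<omega>)\<bar>
      \<le> \<kappa> * B\<^sup>2 * e\<^sup>2 * expectation Z' + 2 * B * expectation (\<lambda>\<omega>. Z' \<omega> * (1 - Vc (t + e + e) \<omega>))"
    by (rule one_step_const[OF te(1) Z'(1,2) Z'c e b])
  have eq1: "(\<lambda>\<omega>. Z' \<omega> * one b (t + e) (t + e + e) \<omega> * Vc (t + e + e) \<omega>)
      = (\<lambda>\<omega>. Z \<omega> * one a t (t + e) \<omega> * one b (t + e) (t + e + e) \<omega> * Vc (t + e + e) \<omega>)"
    using good_upto_mono[OF te(2)] by (auto simp: Z'_def fun_eq_iff)
  have eq2: "(\<lambda>\<omega>. Z' \<omega> * Vc (t + e) \<omega> * lam b (t + e) \<omega>) = (\<lambda>\<omega>. Z \<omega> * one a t (t + e) \<omega> * Vc (t + e) \<omega> * lam b (t + e) \<omega>)"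
    by (auto simp: Z'_def fun_eq_iff)
  have EZ': "expectation Z' \<le> B * e * expectation Z"
    unfolding Z'_def by (rule one_Vc_expectation[OF t Z Z0 Zc e a])
  have R1: "expectation (\<lambda>\<omega>. Z' \<omega> * (1 - Vc (t + e + e) \<omega>)) \<le> ?R"
    by (rule rest_mono[OF te(3) order_refl ZM Z'M Z'(2,3) Zc])
  have R2: "expectation (\<lambda>\<omega>. Z \<omega> * (1 - Vc (t + e) \<omega>)) \<le> ?R"
    by (rule rest_mono[OF te(1,2) ZM ZM Z0 order_refl Zc])
  have "\<bar>expectation (\<lambda>\<omega>. Z \<omega> * one a t (t + e) \<omega> * Vc (t + e) \<omega> * lam b (t + e) \<omega>)
      - e * expectation (\<lambda>\<omega>. Z \<omega> * Vc t \<omega> * (lam a t \<omega> * (lam b t \<omega> + w b a)))\<bar>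
    \<le> 3 * \<kappa> * B^3 * e\<^sup>2 * expectation Z + 4 * B\<^sup>2 * expectation (\<lambda>\<omega>. Z \<omega> * (1 - Vc (t + e) \<omega>))"
    by (rule one_step_linear[OF t Z Z0 Zc e a b])
  also have "\<dots> \<le> 3 * \<kappa> * B^3 * e\<^sup>2 * expectation Z + 4 * B\<^sup>2 * ?R"
    using R2 by (intro add_left_mono mult_left_mono) auto
  finally have s1: "e * \<bar>expectation (\<lambda>\<omega>. Z \<omega> * one a t (t + e) \<omega> * Vc (t + e) \<omega> * lam b (t + e) \<omega>)
      - e * expectation (\<lambda>\<omega>. Z \<omega> * Vc t \<omega> * (lam a t \<omega> * (lam b t \<omega> + w b a)))\<bar>
    \<le> e * (3 * \<kappa> * B^3 * e\<^sup>2 * expectation Z + 4 * B\<^sup>2 * ?R)"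
    using e by (intro mult_left_mono) auto
  note s2
  also have "\<kappa> * B\<^sup>2 * e\<^sup>2 * expectation Z' + 2 * B * expectation (\<lambda>\<omega>. Z' \<omega> * (1 - Vc (t + e + e) \<omega>))
      \<le> \<kappa> * B\<^sup>2 * e\<^sup>2 * (B * e * expectation Z) + 2 * B * ?R"
    using EZ' R1 kappa_pos B0 by (intro add_mono mult_left_mono) auto
  finally have s2': "\<bar>q2 - e * q1\<bar> \<le> \<kappa> * B\<^sup>2 * e\<^sup>2 * (B * e * expectation Z) + 2 * B * ?R"
    unfolding eq1 eq2 q2_def q1_def .
  have 1: "e * (4 * B\<^sup>2 * ?R) \<le> 4 * B\<^sup>2 * ?R" using e R0 by (intro mult_left_le_one_le) auto
  have 2: "2 * B * ?R \<le> 2 * B\<^sup>2 * ?R"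
    using B0 R0 by (intro mult_right_mono) (auto simp: power2_eq_square)
  have 3: "\<kappa> * B\<^sup>2 * e\<^sup>2 * (B * e * expectation Z) + e * (3 * \<kappa> * B^3 * e\<^sup>2 * expectation Z)
      = 4 * \<kappa> * B^3 * e^3 * expectation Z"
    by (simp add: power2_eq_square power3_eq_cube algebra_simps)
  have "q2 - e\<^sup>2 * q0 = (q2 - e * q1) + e * (q1 - e * q0)" by (simp add: power2_eq_square algebra_simps)
  also have "\<bar>\<dots>\<bar> \<le> \<bar>q2 - e * q1\<bar> + \<bar>e * (q1 - e * q0)\<bar>" by (rule abs_triangle_ineq)
  also have "\<bar>e * (q1 - e * q0)\<bar> = e * \<bar>q1 - e * q0\<bar>" using e by (simp add: abs_mult)
  also have "\<bar>q2 - e * q1\<bar> + \<dots> \<le> (\<kappa> * B\<^sup>2 * e\<^sup>2 * (B * e * expectation Z) + 2 * B * ?R)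
      + (e * (3 * \<kappa> * B^3 * e\<^sup>2 * expectation Z) + e * (4 * B\<^sup>2 * ?R))"
    using s2' s1 unfolding q1_def q0_def distrib_left by (rule add_mono)
  also have "\<dots> \<le> 4 * \<kappa> * B^3 * e^3 * expectation Z + 6 * B\<^sup>2 * ?R" using 1 2 3 by linarith
  finally show ?thesis unfolding q2_def q0_def .
qed

text \<open>The windows are evaluated from last to first by the constant, the linear and the
  quadratic step, whose errors add up to 13 = 1 + 3 + 9 and, because e \<le> 1, to at most 18 = 2 +
  4 + 12.\<close>

lemma triple_expansion:
  assumes a: "a \<in> {1..n}" and b: "b \<in> {1..n}" and b': "b' \<in> {1..n}"
  shows "\<bar>expectation (\<lambda>\<omega>. Z \<omega> * one a t (t + e) \<omega> * one b (t + e) (t + e + e) \<omega>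
          * one b' (t + e + e) (t + e + e + e) \<omega> * Vc (t + e + e + e) \<omega>)
      - e^3 * expectation (\<lambda>\<omega>. Z \<omega> * Vc t \<omega> * (lam a t \<omega> * ((lam b t \<omega> + w b a) * (lam b' t \<omega> + w b' a + w b' b))))\<bar>
    \<le> 13 * \<kappa> * B^4 * e^4 * expectation Z + 18 * B^3 * expectation (\<lambda>\<omega>. Z \<omega> * (1 - Vc (t + e + e + e) \<omega>))"
proof -
  define Z1 where "Z1 = (\<lambda>\<omega>. Z \<omega> * one a t (t + e) \<omega> * Vc (t + e) \<omega>)"
  have te: "0 \<le> t + e" "t + e \<le> t + e + e" "0 \<le> t + e + e" "t + e + e \<le> t + e + e + e"
    "0 \<le> t + e + e + e" "t + e \<le> t + e + e + e" using t e by auto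
  have Z1: "Z1 \<in> borel_measurable (F (t + e))" "\<And>\<omega>. \<omega> \<in> space M \<Longrightarrow> 0 \<le> Z1 \<omega>"
    "\<And>\<omega>. \<omega> \<in> space M \<Longrightarrow> Z1 \<omega> \<le> Z \<omega>"
    unfolding Z1_def by (rule one_Vc_weight[OF t Z Z0 Zc e a]; assumption)+
  have Z1c: "Z1 \<omega> \<le> c" if "\<omega> \<in> space M" for \<omega> using Z1(3)[OF that] Zc[OF that] by simp
  define Z2 where "Z2 = (\<lambda>\<omega>. Z1 \<omega> * one b (t + e) (t + e + e) \<omega> * Vc (t + e + e) \<omega>)"
  have Z2: "Z2 \<in> borel_measurable (F (t + e + e))" "\<And>\<omega>. \<omega> \<in> space M \<Longrightarrow> 0 \<le> Z2 \<omega>"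
    "\<And>\<omega>. \<omega> \<in> space M \<Longrightarrow> Z2 \<omega> \<le> Z1 \<omega>"
    unfolding Z2_def by (rule one_Vc_weight[OF te(1) Z1(1,2) Z1c e b]; assumption)+
  have Z2Z1: "Z2 \<omega> \<le> Z1 \<omega>" if "\<omega> \<in> space M" for \<omega> by (rule Z2(3)[OF that])
  have Z2Z: "Z2 \<omega> \<le> Z \<omega>" if "\<omega> \<in> space M" for \<omega> using Z2Z1[OF that] Z1(3)[OF that] by simp
  have Z2c: "Z2 \<omega> \<le> c" if "\<omega> \<in> space M" for \<omega> using Z2Z[OF that] Zc[OF that] by simp
  have B0: "1 \<le> B" "0 \<le> B" using B_ge by auto
  have BB: "B \<le> B^3" "B\<^sup>2 \<le> B^3" using B0 by (auto intro: self_le_power power_increasing)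
  have EZ0: "0 \<le> expectation Z" by (rule EZ_nonneg[OF t Z Z0 Zc e])
  note ZM = measurable_F_M[OF Z] and Z1M = measurable_F_M[OF Z1(1)] and Z2M = measurable_F_M[OF Z2(1)]
  let ?R = "expectation (\<lambda>\<omega>. Z \<omega> * (1 - Vc (t + e + e + e) \<omega>))"
  have R0: "0 \<le> ?R" by (rule integral_nonneg_AE) (use Z0 in auto)
  have EZ1: "expectation Z1 \<le> B * e * expectation Z"
    unfolding Z1_def by (rule one_Vc_expectation[OF t Z Z0 Zc e a])
  have "expectation Z2 \<le> B * e * expectation Z1"
    unfolding Z2_def by (rule one_Vc_expectation[OF te(1) Z1(1,2) Z1c e b])
  also have "\<dots> \<le> B * e * (B * e * expectation Z)" using EZ1 B0 e by (intro mult_left_mono) auto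
  finally have EZ2: "expectation Z2 \<le> (B * e)\<^sup>2 * expectation Z" by (simp add: power2_eq_square mult_ac)
  have R3: "expectation (\<lambda>\<omega>. Z2 \<omega> * (1 - Vc (t + e + e + e) \<omega>)) \<le> ?R"
    by (rule rest_mono[OF te(5) order_refl ZM Z2M Z2(2) Z2Z Zc])
  have R2: "expectation (\<lambda>\<omega>. Z1 \<omega> * (1 - Vc (t + e + e) \<omega>)) \<le> ?R"
    by (rule rest_mono[OF te(3,4) ZM Z1M Z1(2,3) Zc])
  have R1: "expectation (\<lambda>\<omega>. Z \<omega> * (1 - Vc (t + e) \<omega>)) \<le> ?R"
    by (rule rest_mono[OF te(1,6) ZM ZM Z0 order_refl Zc])
  define q3 where "q3 = expectation (\<lambda>\<omega>. Z \<omega> * one a t (t + e) \<omega> * one b (t + e) (t + e + e) \<omega>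
          * one b' (t + e + e) (t + e + e + e) \<omega> * Vc (t + e + e + e) \<omega>)"
  define q2 where "q2 = expectation (\<lambda>\<omega>. Z1 \<omega> * one b (t + e) (t + e + e) \<omega> * Vc (t + e + e) \<omega> * lam b' (t + e + e) \<omega>)"
  define q1 where "q1 = expectation (\<lambda>\<omega>. Z \<omega> * one a t (t + e) \<omega> * Vc (t + e) \<omega> * (lam b (t + e) \<omega> * (lam b' (t + e) \<omega> + w b' b)))"
  define q0 where "q0 = expectation (\<lambda>\<omega>. Z \<omega> * Vc t \<omega> * (lam a t \<omega> * ((lam b t \<omega> + w b a) * (lam b' t \<omega> + w b' a + w b' b))))"
  have "\<bar>expectation (\<lambda>\<omega>. Z2 \<omega> * one b' (t + e + e) (t + e + e + e) \<omega> * Vc (t + e + e + e) \<omega>)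
        - e * expectation (\<lambda>\<omega>. Z2 \<omega> * Vc (t + e + e) \<omega> * lam b' (t + e + e) \<omega>)\<bar>
      \<le> \<kappa> * B\<^sup>2 * e\<^sup>2 * expectation Z2 + 2 * B * expectation (\<lambda>\<omega>. Z2 \<omega> * (1 - Vc (t + e + e + e) \<omega>))"
    by (rule one_step_const[OF te(3) Z2(1,2) Z2c e b'])
  also have "\<dots> \<le> \<kappa> * B\<^sup>2 * e\<^sup>2 * ((B * e)\<^sup>2 * expectation Z) + 2 * B^3 * ?R"
    using EZ2 R3 R0 kappa_pos B0 BB by (intro add_mono mult_mono mult_left_mono) (auto intro!: integral_nonneg_AE Z2(2))
  also have "(\<lambda>\<omega>. Z2 \<omega> * one b' (t + e + e) (t + e + e + e) \<omega> * Vc (t + e + e + e) \<omega>)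
      = (\<lambda>\<omega>. Z \<omega> * one a t (t + e) \<omega> * one b (t + e) (t + e + e) \<omega>
          * one b' (t + e + e) (t + e + e + e) \<omega> * Vc (t + e + e + e) \<omega>)"
    using good_upto_mono[OF te(4)] good_upto_mono[OF te(6)] by (auto simp: Z1_def Z2_def fun_eq_iff)
  also have "(\<lambda>\<omega>. Z2 \<omega> * Vc (t + e + e) \<omega> * lam b' (t + e + e) \<omega>)
      = (\<lambda>\<omega>. Z1 \<omega> * one b (t + e) (t + e + e) \<omega> * Vc (t + e + e) \<omega> * lam b' (t + e + e) \<omega>)"
    by (auto simp: Z2_def fun_eq_iff)
  finally have s3: "\<bar>q3 - e * q2\<bar> \<le> \<kappa> * B^4 * e^4 * expectation Z + 2 * B^3 * ?R"
    by (simp add: q3_def q2_def power2_eq_square power_numeral_reduce mult_ac)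
  have "\<bar>q2 - e * expectation (\<lambda>\<omega>. Z1 \<omega> * Vc (t + e) \<omega> * (lam b (t + e) \<omega> * (lam b' (t + e) \<omega> + w b' b)))\<bar>
    \<le> 3 * \<kappa> * B^3 * e\<^sup>2 * expectation Z1 + 4 * B\<^sup>2 * expectation (\<lambda>\<omega>. Z1 \<omega> * (1 - Vc (t + e + e) \<omega>))"
    unfolding q2_def by (rule one_step_linear[OF te(1) Z1(1,2) Z1c e b b'])
  also have "\<dots> \<le> 3 * \<kappa> * B^3 * e\<^sup>2 * (B * e * expectation Z) + 4 * B^3 * ?R"
    using EZ1 R2 R0 kappa_pos B0 BB by (intro add_mono mult_mono mult_left_mono) (auto intro!: integral_nonneg_AE Z1(2))
  also have "(\<lambda>\<omega>. Z1 \<omega> * Vc (t + e) \<omega> * (lam b (t + e) \<omega> * (lam b' (t + e) \<omega> + w b' b)))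
      = (\<lambda>\<omega>. Z \<omega> * one a t (t + e) \<omega> * Vc (t + e) \<omega> * (lam b (t + e) \<omega> * (lam b' (t + e) \<omega> + w b' b)))"
    by (auto simp: Z1_def fun_eq_iff)
  finally have s2: "\<bar>q2 - e * q1\<bar> \<le> 3 * \<kappa> * B^4 * e^3 * expectation Z + 4 * B^3 * ?R"
    by (simp add: q1_def power2_eq_square power_numeral_reduce mult_ac)
  have "\<bar>q1 - e * q0\<bar> \<le> 9 * \<kappa> * B^4 * e\<^sup>2 * expectation Z + 12 * B^3 * expectation (\<lambda>\<omega>. Z \<omega> * (1 - Vc (t + e) \<omega>))"
    unfolding q1_def q0_def by (rule one_step_quadratic[OF t Z Z0 Zc e a b b'])
  also have "\<dots> \<le> 9 * \<kappa> * B^4 * e\<^sup>2 * expectation Z + 12 * B^3 * ?R"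
    using R1 B0 by (intro add_left_mono mult_left_mono) auto
  finally have s1: "\<bar>q1 - e * q0\<bar> \<le> 9 * \<kappa> * B^4 * e\<^sup>2 * expectation Z + 12 * B^3 * ?R" .
  have "\<bar>q3 - e^3 * q0\<bar> \<le> \<bar>q3 - e * q2\<bar> + e * \<bar>q2 - e * q1\<bar> + e\<^sup>2 * \<bar>q1 - e * q0\<bar>"
  proof -
    have "q3 - e^3 * q0 = (q3 - e * q2) + e * (q2 - e * q1) + e\<^sup>2 * (q1 - e * q0)"
      by (simp add: power2_eq_square power3_eq_cube algebra_simps)
    also have "\<bar>\<dots>\<bar> \<le> \<bar>q3 - e * q2\<bar> + \<bar>e * (q2 - e * q1)\<bar> + \<bar>e\<^sup>2 * (q1 - e * q0)\<bar>" by linarith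
    finally show ?thesis using e by (simp add: abs_mult)
  qed
  also have "\<dots> \<le> (\<kappa> * B^4 * e^4 * expectation Z + 2 * B^3 * ?R)
      + e * (3 * \<kappa> * B^4 * e^3 * expectation Z + 4 * B^3 * ?R)
      + e\<^sup>2 * (9 * \<kappa> * B^4 * e\<^sup>2 * expectation Z + 12 * B^3 * ?R)"
    using s1 s2 s3 e by (intro add_mono mult_left_mono) auto
  also have "\<dots> = 13 * \<kappa> * B^4 * e^4 * expectation Z + (2 + 4 * e + 12 * e\<^sup>2) * (B^3 * ?R)"
    by (simp add: power_numeral_reduce algebra_simps)
  also have "\<dots> \<le> 13 * \<kappa> * B^4 * e^4 * expectation Z + 18 * (B^3 * ?R)"
  proof (intro add_left_mono mult_right_mono)
    have "e\<^sup>2 \<le> 1" using e by (simp add: power_le_one)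
    then show "2 + 4 * e + 12 * e\<^sup>2 \<le> 18" using e by linarith
  qed (use B0 R0 in auto)
  finally show ?thesis by (simp add: q3_def q0_def mult.assoc)
qed

end

end

text \<open>A set of unordered pairs remembers a relation only up to symmetrisation, which is why it
  is enough that one of the two ordered tests succeeds.\<close>

lemma edge_sets_eq_iff:
  "{{i, j} | i j. i \<in> I \<and> j \<in> I \<and> i \<noteq> j \<and> P i j} = {{i, j} | i j. i \<in> I \<and> j \<in> I \<and> i \<noteq> j \<and> Q i j} \<longleftrightarrow>
    (\<forall>i\<in>I. \<forall>j\<in>I. i \<noteq> j \<longrightarrow> (P i j \<or> P j i \<longleftrightarrow> Q i j \<or> Q j i))"
proof -
  have mem: "{i, j} \<in> {{i, j} | i j. i \<in> I \<and> j \<in> I \<and> i \<noteq> j \<and> R i j} \<longleftrightarrow> i \<in> I \<and> j \<in> I \<and> i \<noteq> j \<and> (R i j \<or> R j i)"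
    for R and i j
    by (auto simp: doubleton_eq_iff)
  show ?thesis (is "?A = ?B \<longleftrightarrow> ?C")
  proof
    assume eq: "?A = ?B"
    show ?C
    proof (intro ballI impI)
      fix i j assume "i \<in> I" "j \<in> I" "i \<noteq> j"
      then show "(P i j \<or> P j i) = (Q i j \<or> Q j i)" using mem[of i j P] mem[of i j Q] eq by auto
    qed
  next
    assume C: ?C
    show "?A = ?B"
    proof (rule set_eqI)
      fix z
      show "z \<in> ?A \<longleftrightarrow> z \<in> ?B"
      proof
        assume "z \<in> ?A"
        then obtain i j where z: "z = {i, j}" "i \<in> I" "j \<in> I" "i \<noteq> j" "P i j" by blast
        then show "z \<in> ?B" unfolding z(1) mem using C by blast
      next
        assume "z \<in> ?B"
        then obtain i j where z: "z = {i, j}" "i \<in> I" "j \<in> I" "i \<noteq> j" "Q i j" by blast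
        then show "z \<in> ?A" unfolding z(1) mem using C by blast
      qed
    qed
  qed
qed

context hawkes_setting
begin

section \<open>The statistics\<close>

text \<open>The closed window includes its left end, so the part before it is a half-open count.
  That count is not a value of the counting process and is obtained as a sum over events strictly
  before \<open>a\<close>.\<close>

lemma num_events_measurable:
  assumes i: "i \<in> {1..n}" and ab: "0 \<le> a" "a \<le> b"
  shows "(\<lambda>\<omega>. num_events (\<lambda>j. E j \<omega>) i a b) \<in> measurable M (count_space UNIV)"
proof -
  have b: "0 \<le> b" using ab by simp
  have eq: "real (num_events (\<lambda>j. E j \<omega>) i a b) =
      (if a = 0 then cnt i b \<omega> else cnt i b \<omega> - cnt i 0 \<omega> - (\<Sum>s\<in>E i \<omega> \<inter> {0<..<a}. 1))"
    if \<omega>: "\<omega> \<in> space M" for \<omega>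
  proof (cases "a = 0")
    case False
    then have a: "0 < a" using ab by simp
    have fin: "finite (E i \<omega> \<inter> S)" if "S \<subseteq> {..b}" for S by (rule events_finite[OF i \<omega> that])
    have "E i \<omega> \<inter> {0..b} = (E i \<omega> \<inter> {0..0}) \<union> ((E i \<omega> \<inter> {0<..<a}) \<union> (E i \<omega> \<inter> {a..b}))" using a ab by auto
    also have "card \<dots> = card (E i \<omega> \<inter> {0..0}) + card ((E i \<omega> \<inter> {0<..<a}) \<union> (E i \<omega> \<inter> {a..b}))"
      by (rule card_Un_disjoint) (use a ab in \<open>auto intro!: fin\<close>)
    also have "card ((E i \<omega> \<inter> {0<..<a}) \<union> (E i \<omega> \<inter> {a..b})) = card (E i \<omega> \<inter> {0<..<a}) + card (E i \<omega> \<inter> {a..b})"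
      by (rule card_Un_disjoint) (use a ab in \<open>auto intro!: fin\<close>)
    finally show ?thesis using False by (simp add: num_events_def cnt_eq)
  qed (simp add: num_events_def cnt_eq)
  have "(\<lambda>\<omega>. if a = 0 then cnt i b \<omega> else cnt i b \<omega> - cnt i 0 \<omega> - (\<Sum>s\<in>E i \<omega> \<inter> {0<..<a}. 1)) \<in> borel_measurable M"
  proof (cases "a = 0")
    case False
    then have "(\<lambda>\<omega>. \<Sum>s\<in>E i \<omega> \<inter> {0<..<a}. 1 :: real) \<in> borel_measurable M"
      using ab by (intro measurable_F_M[OF sum_events_before_measurable[OF i order_refl, of a]]) auto
    then show ?thesis
      using False cnt_measurable[OF i b] cnt_measurable[OF i order_refl]
      by (simp del: sum_constant)
  qed (use cnt_measurable[OF i b] in simp)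
  then have meas: "(\<lambda>\<omega>. real (num_events (\<lambda>j. E j \<omega>) i a b)) \<in> borel_measurable M"
    by (subst measurable_cong[OF eq])
  have "{\<omega> \<in> space M. real (num_events (\<lambda>j. E j \<omega>) i a b) = real k} \<in> sets M" for k
    using meas by measurable
  then show ?thesis
    by (subst measurable_count_space_eq_countable) (auto simp: vimage_def Int_def conj_commute)
qed

lemma num_events_eq_one:
  assumes "i \<in> {1..n}" "\<omega> \<in> space M" "0 \<le> a" "a \<le> b" "a \<notin> E i \<omega>"
  shows "(of_bool (num_events (\<lambda>j. E j \<omega>) i a b = 1) :: real) = one i a b \<omega>"
proof -
  have "E i \<omega> \<inter> {a..b} = E i \<omega> \<inter> {a<..b}" using assms(5) by (auto simp: le_less)
  then show ?thesis using card_Ioc[OF assms(1-4)] by (auto simp: num_events_def one_def)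
qed

definition delta1 :: "nat \<Rightarrow> nat \<Rightarrow> real \<Rightarrow> real \<Rightarrow> 'a \<Rightarrow> real" where
  "delta1 i j e t \<omega> = one i t (t + e) \<omega> * one j (t + e) (t + e + e) \<omega>
     - one j t (t + e) \<omega> * one i (t + e) (t + e + e) \<omega>"

definition delta2 :: "nat \<Rightarrow> nat \<Rightarrow> real \<Rightarrow> real \<Rightarrow> 'a \<Rightarrow> real" where
  "delta2 i j e t \<omega> =
     one i t (t + e) \<omega> * one i (t + e) (t + e + e) \<omega> * one j (t + e + e) (t + e + e + e) \<omega>
     - 2 * (one i t (t + e) \<omega> * one j (t + e) (t + e + e) \<omega> * one i (t + e + e) (t + e + e + e) \<omega>)
     + one j t (t + e) \<omega> * one i (t + e) (t + e + e) \<omega> * one i (t + e + e) (t + e + e + e) \<omega>"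

text \<open>The difference of the two pair limits. The products of two rates cancel; in
  \<open>mean2\<close> the coefficients 1, -2, 1 cancel all terms of degree two and three in the
  rates. Without interaction nothing would remain.\<close>

definition mean1 :: "nat \<Rightarrow> nat \<Rightarrow> real \<Rightarrow> 'a \<Rightarrow> real" where
  "mean1 i j t \<omega> = lam i t \<omega> * w j i - lam j t \<omega> * w i j"

definition mean2 :: "nat \<Rightarrow> nat \<Rightarrow> real \<Rightarrow> 'a \<Rightarrow> real" where
  "mean2 i j t \<omega> = w i j * (lam j t \<omega> * (w i j + w i i) - 2 * lam i t \<omega> * w j i)"

lemma mean2_plus_mean1: "mean2 i j t \<omega> + 2 * w i j * mean1 i j t \<omega> = w i j * (lam j t \<omega> * (w i i - w i j))"
  by (simp add: mean1_def mean2_def algebra_simps)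

lemma Delta_eq_delta:
  assumes "i \<in> {1..n}" "j \<in> {1..n}" "\<omega> \<in> space M" "0 < e"
    and no: "\<forall>k. \<forall>i\<in>{1..n}. real k * e \<notin> E i \<omega>"
  shows "Delta1 (\<lambda>i. E i \<omega>) i j (real k * e) e = delta1 i j e (real k * e) \<omega>"
    and "Delta2 (\<lambda>i. E i \<omega>) i j (real k * e) e = delta2 i j e (real k * e) \<omega>"
proof -
  let ?t = "real k * e"
  have t: "0 \<le> ?t" using assms(4) by simp
  have grid: "?t + e = real (Suc k) * e" "?t + e + e = real (Suc (Suc k)) * e" by (simp_all add: algebra_simps)
  have *: "(of_bool (num_events (\<lambda>i. E i \<omega>) a ?t (?t + e) = 1) :: real) = one a ?t (?t + e) \<omega>"
    "(of_bool (num_events (\<lambda>i. E i \<omega>) a (?t + e) (?t + e + e) = 1) :: real) = one a (?t + e) (?t + e + e) \<omega>"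
    "(of_bool (num_events (\<lambda>i. E i \<omega>) a (?t + e + e) (?t + e + e + e) = 1) :: real) = one a (?t + e + e) (?t + e + e + e) \<omega>"
    if a: "a \<in> {1..n}" for a
  proof -
    have n1: "?t \<notin> E a \<omega>" using no a by blast
    have n2: "?t + e \<notin> E a \<omega>" unfolding grid(1) using no a by blast
    have n3: "?t + e + e \<notin> E a \<omega>" unfolding grid(2) using no a by blast
    have le: "?t \<le> ?t + e" "0 \<le> ?t + e" "?t + e \<le> ?t + e + e" "0 \<le> ?t + e + e" "?t + e + e \<le> ?t + e + e + e"
      using t assms(4) by auto
    note one = num_events_eq_one[OF a assms(3)]
    show "(of_bool (num_events (\<lambda>i. E i \<omega>) a ?t (?t + e) = 1) :: real) = one a ?t (?t + e) \<omega>"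
      by (rule one[OF t le(1) n1])
    show "(of_bool (num_events (\<lambda>i. E i \<omega>) a (?t + e) (?t + e + e) = 1) :: real) = one a (?t + e) (?t + e + e) \<omega>"
      by (rule one[OF le(2,3) n2])
    show "(of_bool (num_events (\<lambda>i. E i \<omega>) a (?t + e + e) (?t + e + e + e) = 1) :: real) = one a (?t + e + e) (?t + e + e + e) \<omega>"
      by (rule one[OF le(4,5) n3])
  qed
  have s: "?t + 2 * e = ?t + e + e" "?t + 3 * e = ?t + e + e + e" by simp_all
  show "Delta1 (\<lambda>i. E i \<omega>) i j ?t e = delta1 i j e ?t \<omega>"
    unfolding Delta1_def X2_def delta1_def s of_bool_conj by (simp only: *[OF assms(1)] *[OF assms(2)])
  show "Delta2 (\<lambda>i. E i \<omega>) i j ?t e = delta2 i j e ?t \<omega>"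
    unfolding Delta2_def X3_def delta2_def s of_bool_conj
    by (simp only: *[OF assms(1)] *[OF assms(2)] mult.assoc)
qed

lemma recovery_event_iff:
  "estimated_graph n x T e h = dependency_graph n w \<longleftrightarrow>
    (\<forall>i\<in>{1..n}. \<forall>j\<in>{1..n}. i \<noteq> j \<longrightarrow>
      (\<bar>D1 x i j T e\<bar> / (T * e) + \<bar>D2 x i j T e\<bar> / (T * e\<^sup>2) \<ge> h \<or>
       \<bar>D1 x j i T e\<bar> / (T * e) + \<bar>D2 x j i T e\<bar> / (T * e\<^sup>2) \<ge> h \<longleftrightarrow> w i j > 0 \<or> w j i > 0))"
  unfolding estimated_graph_def dependency_graph_def prod.inject
  by (subst edge_sets_eq_iff) auto

lemma recovery_event_measurable:
  assumes e: "0 < e"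
  shows "{\<omega> \<in> space M. estimated_graph n (\<lambda>i. E i \<omega>) T e h = dependency_graph n w} \<in> sets M"
proof -
  have ne: "(\<lambda>\<omega>. num_events (\<lambda>i. E i \<omega>) i a b) \<in> measurable M (count_space UNIV)"
    if "i \<in> {1..n}" "0 \<le> a" "a \<le> b" for i a b
    by (rule num_events_measurable[OF that])
  have x2: "(\<lambda>\<omega>. X2 (\<lambda>i. E i \<omega>) i j (real k * e) e) \<in> borel_measurable M"
    if "i \<in> {1..n}" "j \<in> {1..n}" for i j k
  proof -
    have t: "0 \<le> real k * e" "real k * e \<le> real k * e + e" "0 \<le> real k * e + e" "real k * e + e \<le> real k * e + 2 * e"
      using e by auto
    note [measurable] = ne[OF that(1) t(1,2)] ne[OF that(2) t(3,4)]
    show ?thesis unfolding X2_def by measurable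
  qed
  have x3: "(\<lambda>\<omega>. X3 (\<lambda>i. E i \<omega>) i j l (real k * e) e) \<in> borel_measurable M"
    if "i \<in> {1..n}" "j \<in> {1..n}" "l \<in> {1..n}" for i j l k
  proof -
    have t: "0 \<le> real k * e" "real k * e \<le> real k * e + e" "0 \<le> real k * e + e" "real k * e + e \<le> real k * e + 2 * e"
        "0 \<le> real k * e + 2 * e" "real k * e + 2 * e \<le> real k * e + 3 * e"
      using e by auto
    note [measurable] = ne[OF that(1) t(1,2)] ne[OF that(2) t(3,4)] ne[OF that(3) t(5,6)]
    show ?thesis unfolding X3_def by measurable
  qed
  have D: "(\<lambda>\<omega>. D1 (\<lambda>i. E i \<omega>) i j T e) \<in> borel_measurable M" "(\<lambda>\<omega>. D2 (\<lambda>i. E i \<omega>) i j T e) \<in> borel_measurable M"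
    if "i \<in> {1..n}" "j \<in> {1..n}" for i j
    unfolding D1_def D2_def Delta1_def Delta2_def using x2 x3 that by measurable
  show ?thesis unfolding recovery_event_iff
  proof (intro sets.sets_Collect_finite_All' sets.sets_Collect_imp)
    fix i j assume ij: "i \<in> {1..n}" "j \<in> {1..n}"
    note [measurable] = D[OF ij] D[OF ij(2,1)]
    show "{\<omega> \<in> space M. h \<le> \<bar>D1 (\<lambda>i. E i \<omega>) i j T e\<bar> / (T * e) + \<bar>D2 (\<lambda>i. E i \<omega>) i j T e\<bar> / (T * e\<^sup>2) \<or>
        h \<le> \<bar>D1 (\<lambda>i. E i \<omega>) j i T e\<bar> / (T * e) + \<bar>D2 (\<lambda>i. E i \<omega>) j i T e\<bar> / (T * e\<^sup>2) \<longleftrightarrow> w i j > 0 \<or> w j i > 0} \<in> sets M"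
      by measurable
  qed (use n_pos in auto)
qed

text \<open>Both normalised statistics are within h/6 of their averaged means. For non-neighbours
  the means vanish and the sum is at most h/3. For \<open>w i j > 0\<close> the positive combination
  of the two means excludes that both are small.\<close>

lemma statistic_decides:
  assumes i: "i \<in> {1..n}" and j: "j \<in> {1..n}" and ij: "i \<noteq> j"
    and w1: "w_min \<le> 1" and pos: "0 < T" "0 < e" and N: "T / (3 * e) \<le> real N"
    and lam: "\<And>k. k < N \<Longrightarrow> \<mu>_min \<le> lam j (real k * e) \<omega>"
    and h: "h = w_min * w_sep * \<mu>_min / 8"
    and d1: "\<bar>d1 - e\<^sup>2 * (\<Sum>k<N. mean1 i j (real k * e) \<omega>)\<bar> \<le> h / 6 * (T * e)"
    and d2: "\<bar>d2 - e^3 * (\<Sum>k<N. mean2 i j (real k * e) \<omega>)\<bar> \<le> h / 6 * (T * e\<^sup>2)"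
  shows "w i j > 0 \<Longrightarrow> h \<le> \<bar>d1\<bar> / (T * e) + \<bar>d2\<bar> / (T * e\<^sup>2)"
    and "w i j = 0 \<Longrightarrow> w j i = 0 \<Longrightarrow> \<bar>d1\<bar> / (T * e) + \<bar>d2\<bar> / (T * e\<^sup>2) < h"
proof -
  define s1 where "s1 = d1 / (T * e)"
  define s2 where "s2 = d2 / (T * e\<^sup>2)"
  define S1 where "S1 = (\<Sum>k<N. mean1 i j (real k * e) \<omega>)"
  define S2 where "S2 = (\<Sum>k<N. mean2 i j (real k * e) \<omega>)"
  have h0: "0 < h" unfolding h using w_min_pos w_sep_pos mu_min_pos by simp
  have Te: "0 < T * e" "0 < T * e\<^sup>2" using pos by auto
  have "s1 - e / T * S1 = (d1 - e\<^sup>2 * S1) / (T * e)"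
    using pos by (simp add: s1_def power2_eq_square field_simps)
  then have r1: "\<bar>s1 - e / T * S1\<bar> \<le> h / 6"
    using d1 Te by (simp add: S1_def abs_divide divide_le_eq)
  have "s2 - e / T * S2 = (d2 - e^3 * S2) / (T * e\<^sup>2)"
    using pos by (simp add: s2_def power2_eq_square power3_eq_cube field_simps)
  then have r2: "\<bar>s2 - e / T * S2\<bar> \<le> h / 6"
    using d2 Te by (simp add: S2_def abs_divide divide_le_eq)
  have stat: "\<bar>d1\<bar> / (T * e) + \<bar>d2\<bar> / (T * e\<^sup>2) = \<bar>s1\<bar> + \<bar>s2\<bar>"
    using pos by (simp add: s1_def s2_def abs_divide abs_mult)
  show "\<bar>d1\<bar> / (T * e) + \<bar>d2\<bar> / (T * e\<^sup>2) < h" if "w i j = 0" "w j i = 0"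
  proof -
    have "S1 = 0" "S2 = 0" unfolding S1_def S2_def mean1_def mean2_def using that by simp_all
    then show ?thesis using r1 r2 h0 unfolding stat by simp
  qed
  show "h \<le> \<bar>d1\<bar> / (T * e) + \<bar>d2\<bar> / (T * e\<^sup>2)" if wpos: "w i j > 0"
  proof -
    let ?w = "w i j"
    have wmin: "w_min \<le> ?w" using w_bounds(3)[OF i j] wpos by simp
    have sep: "w_sep \<le> w i i - ?w" using separated i j ij unfolding weights_separated_def by blast
    have "real N * (?w * (\<mu>_min * w_sep)) = (\<Sum>k<N. ?w * (\<mu>_min * w_sep))" by simp
    also have "\<dots> \<le> (\<Sum>k<N. mean2 i j (real k * e) \<omega> + 2 * ?w * mean1 i j (real k * e) \<omega>)"
    proof (rule sum_mono)
      fix k assume "k \<in> {..<N}"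
      then have l: "\<mu>_min \<le> lam j (real k * e) \<omega>" using lam by simp
      show "?w * (\<mu>_min * w_sep) \<le> mean2 i j (real k * e) \<omega> + 2 * ?w * mean1 i j (real k * e) \<omega>"
        unfolding mean2_plus_mean1 using l sep mu_min_pos w_sep_pos wpos
        by (intro mult_left_mono mult_mono) auto
    qed
    also have "\<dots> = S2 + 2 * ?w * S1" by (simp add: S1_def S2_def sum.distrib sum_distrib_left)
    finally have "e / T * (real N * (?w * (\<mu>_min * w_sep))) \<le> e / T * (S2 + 2 * ?w * S1)"
      using pos by (intro mult_left_mono) auto
    \<comment> \<open>The number of summands is about T / (3 e), so one third of the lower bound
      survives the normalisation by T / e.\<close>
    moreover have "1 / 3 \<le> e / T * real N" using N pos by (simp add: field_simps)
    then have "1 / 3 * (?w * (\<mu>_min * w_sep)) \<le> e / T * real N * (?w * (\<mu>_min * w_sep))"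
      using wpos mu_min_pos w_sep_pos by (intro mult_right_mono) auto
    moreover have "e / T * (S2 + 2 * ?w * S1) = e / T * S2 + 2 * ?w * (e / T * S1)"
      by (simp only: distrib_left mult_ac)
    moreover have "e / T * (real N * (?w * (\<mu>_min * w_sep))) = e / T * real N * (?w * (\<mu>_min * w_sep))"
      by (simp only: mult.assoc)
    ultimately have main: "?w * (\<mu>_min * w_sep) / 3 \<le> e / T * S2 + 2 * ?w * (e / T * S1)"
      by linarith
    have "2 * ?w * (e / T * S1) \<le> 2 * ?w * (\<bar>s1\<bar> + h / 6)"
    proof (rule mult_left_mono)
      show "e / T * S1 \<le> \<bar>s1\<bar> + h / 6" using r1 by linarith
    qed (use wpos in simp)
    moreover have "e / T * S2 \<le> \<bar>s2\<bar> + h / 6" using r2 by linarith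
    ultimately have low: "?w * (\<mu>_min * w_sep) / 3 \<le> \<bar>s2\<bar> + 2 * ?w * \<bar>s1\<bar> + (1 + 2 * ?w) * (h / 6)"
      using main by (simp add: algebra_simps)
    have hw: "w_min * (\<mu>_min * w_sep) = 8 * h" by (simp add: h)
    \<comment> \<open>When 2 w \<le> 1, the combination is dominated by the sum of the absolute
      values and w is bounded below by \<open>w_min\<close>. Otherwise division by 2 w cancels the
      weight, and \<open>w_min \<le> 1\<close> restores the comparison with h; there the constant 8
      in h is used up exactly, as 4h/3 - h/3 = h.\<close>
    show ?thesis unfolding stat
    proof (cases "2 * ?w \<le> 1")
      case True
      have "2 * ?w * \<bar>s1\<bar> \<le> 1 * \<bar>s1\<bar>" using True by (intro mult_right_mono) auto
      moreover have "(1 + 2 * ?w) * (h / 6) \<le> 2 * (h / 6)" using True h0 by (intro mult_right_mono) auto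
      moreover have "w_min * (\<mu>_min * w_sep) \<le> ?w * (\<mu>_min * w_sep)"
        using wmin mu_min_pos w_sep_pos by (intro mult_right_mono) auto
      ultimately show "h \<le> \<bar>s1\<bar> + \<bar>s2\<bar>" using low hw h0 by linarith
    next
      case False
      have "\<bar>s2\<bar> \<le> 2 * ?w * \<bar>s2\<bar>" using False by (simp add: mult_le_cancel_right1)
      moreover have "(1 + 2 * ?w) * (h / 6) \<le> (4 * ?w) * (h / 6)" using False h0 by (intro mult_right_mono) auto
      ultimately have "?w * (\<mu>_min * w_sep) / 3 \<le> 2 * ?w * (\<bar>s1\<bar> + \<bar>s2\<bar> + h / 3)"
        using low by (simp add: algebra_simps)
      then have "?w * (\<mu>_min * w_sep / 3) \<le> ?w * (2 * (\<bar>s1\<bar> + \<bar>s2\<bar> + h / 3))" by (simp add: algebra_simps)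
      then have "\<mu>_min * w_sep / 3 \<le> 2 * (\<bar>s1\<bar> + \<bar>s2\<bar> + h / 3)" using wpos by simp
      moreover have "w_min * (\<mu>_min * w_sep) \<le> 1 * (\<mu>_min * w_sep)"
        using w1 mu_min_pos w_sep_pos by (intro mult_right_mono) auto
      then have "8 * h \<le> \<mu>_min * w_sep" unfolding hw by simp
      ultimately have "8 * h / 3 \<le> 2 * (\<bar>s1\<bar> + \<bar>s2\<bar> + h / 3)" by (simp add: divide_le_eq)
      then show "h \<le> \<bar>s1\<bar> + \<bar>s2\<bar>" by (simp add: field_simps)
    qed
  qed
qed

end

section \<open>Drift and concentration of the summands\<close>

context hawkes_truncated
begin

text \<open>The stopping factor of the observed part refers to the end of its last window, that of
  the mean to time \<open>t\<close>. The mean is thus known at \<open>t\<close>, and the summand is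
  bounded on every path.\<close>

definition stat1 :: "nat \<Rightarrow> nat \<Rightarrow> real \<Rightarrow> real \<Rightarrow> 'a \<Rightarrow> real" where
  "stat1 i j e t \<omega> = Vc (t + e + e) \<omega> * delta1 i j e t \<omega> - e\<^sup>2 * (Vc t \<omega> * mean1 i j t \<omega>)"

definition stat2 :: "nat \<Rightarrow> nat \<Rightarrow> real \<Rightarrow> real \<Rightarrow> 'a \<Rightarrow> real" where
  "stat2 i j e t \<omega> = Vc (t + e + e + e) \<omega> * delta2 i j e t \<omega> - e^3 * (Vc t \<omega> * mean2 i j t \<omega>)"

lemma stat_measurable:
  assumes i: "i \<in> {1..n}" and j: "j \<in> {1..n}" and t: "0 \<le> t" and e: "0 < e"
  shows "stat1 i j e t \<in> borel_measurable (F (t + 3 * e))" "stat2 i j e t \<in> borel_measurable (F (t + 3 * e))"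
proof -
  have one: "one a (t + e) (t + e + e) \<in> borel_measurable (F (t + 3 * e))"
    "one a t (t + e) \<in> borel_measurable (F (t + 3 * e))"
    "one a (t + e + e) (t + e + e + e) \<in> borel_measurable (F (t + 3 * e))" if "a \<in> {1..n}" for a
    by (rule measurable_F_mono[OF one_measurable_F[OF that]]; use t e in simp)+
  have V: "Vc s \<in> borel_measurable (F (t + 3 * e))" if "0 \<le> s" "s \<le> t + 3 * e" for s
    by (rule measurable_F_mono[OF Vc_measurable_F[OF that(1)] that(2)])
  have V': "Vc t \<in> borel_measurable (F (t + 3 * e))" "Vc (t + e + e) \<in> borel_measurable (F (t + 3 * e))"
    "Vc (t + e + e + e) \<in> borel_measurable (F (t + 3 * e))"
    by (rule V; use t e in simp)+
  have lam: "lam a t \<in> borel_measurable (F (t + 3 * e))" if "a \<in> {1..n}" for a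
    by (rule measurable_F_mono[OF lam_measurable_F[OF that t]]) (use e in simp)
  note [measurable] = one[OF i] one[OF j] V' lam[OF i] lam[OF j]
  show "stat1 i j e t \<in> borel_measurable (F (t + 3 * e))"
    unfolding stat1_def delta1_def mean1_def by measurable
  show "stat2 i j e t \<in> borel_measurable (F (t + 3 * e))"
    unfolding stat2_def delta2_def mean2_def by measurable
qed

lemma Vc_mean_bounds:
  assumes i: "i \<in> {1..n}" and j: "j \<in> {1..n}" and t: "0 \<le> t" and \<omega>: "\<omega> \<in> space M"
  shows "\<bar>Vc t \<omega> * mean1 i j t \<omega>\<bar> \<le> B\<^sup>2" "\<bar>Vc t \<omega> * mean2 i j t \<omega>\<bar> \<le> 2 * B^3"
proof -
  have B0: "0 \<le> B" using B_ge by simp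
  have w: "0 \<le> w a b" "w a b \<le> B" if "a \<in> {1..n}" "b \<in> {1..n}" for a b
    using w_bounds(1)[OF that] w_le_B[OF that] by auto
  have "\<bar>mean1 i j t \<omega>\<bar> \<le> B\<^sup>2 \<and> \<bar>mean2 i j t \<omega>\<bar> \<le> 2 * B^3" if good: "good_upto t \<omega>"
  proof
    note li = good_upto_lam[OF good i \<omega> t] and lj = good_upto_lam[OF good j \<omega> t]
    show "\<bar>mean1 i j t \<omega>\<bar> \<le> B\<^sup>2"
      unfolding mean1_def power2_eq_square
      by (rule abs_diff_le_max) (use li lj w[OF i j] w[OF j i] B0 in \<open>auto intro: mult_mono\<close>)
    have "\<bar>lam j t \<omega> * (w i j + w i i) - 2 * lam i t \<omega> * w j i\<bar> \<le> 2 * (B * B)"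
    proof (rule abs_diff_le_max)
      have "lam j t \<omega> * (w i j + w i i) \<le> B * (2 * B)"
        using lj w[OF i j] w[OF i i] B0 by (intro mult_mono) auto
      then show "lam j t \<omega> * (w i j + w i i) \<le> 2 * (B * B)" by simp
      have "lam i t \<omega> * w j i \<le> B * B" using li w[OF j i] B0 by (intro mult_mono) auto
      then show "2 * lam i t \<omega> * w j i \<le> 2 * (B * B)" by simp
    qed (use li lj w[OF i j] w[OF i i] w[OF j i] in auto)
    then have "\<bar>w i j\<bar> * \<bar>lam j t \<omega> * (w i j + w i i) - 2 * lam i t \<omega> * w j i\<bar> \<le> B * (2 * (B * B))"
      using w[OF i j] B0 by (intro mult_mono) auto
    then show "\<bar>mean2 i j t \<omega>\<bar> \<le> 2 * B^3" by (simp add: mean2_def abs_mult power3_eq_cube)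
  qed
  then show "\<bar>Vc t \<omega> * mean1 i j t \<omega>\<bar> \<le> B\<^sup>2" "\<bar>Vc t \<omega> * mean2 i j t \<omega>\<bar> \<le> 2 * B^3"
    using B0 by (auto simp: of_bool_def)
qed

text \<open>The condition \<open>B * e \<le> 1\<close> bounds the subtracted means by absolute
  constants; 6 is a convenient common bound for both statistics.\<close>

lemma stat_bounds:
  assumes i: "i \<in> {1..n}" and j: "j \<in> {1..n}" and t: "0 \<le> t" and \<omega>: "\<omega> \<in> space M"
    and e: "0 < e" "B * e \<le> 1"
  shows "\<bar>stat1 i j e t \<omega>\<bar> \<le> 6" "\<bar>stat2 i j e t \<omega>\<bar> \<le> 6"
proof -
  have Be: "0 \<le> B * e" using B_ge e by simp
  have "\<bar>delta1 i j e t \<omega>\<bar> \<le> 1" "\<bar>delta2 i j e t \<omega>\<bar> \<le> 2"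
    by (auto simp: delta1_def delta2_def one_def of_bool_def)
  then have d: "\<bar>Vc (t + e + e) \<omega> * delta1 i j e t \<omega>\<bar> \<le> 1" "\<bar>Vc (t + e + e + e) \<omega> * delta2 i j e t \<omega>\<bar> \<le> 2"
    by (auto simp: of_bool_def)
  have "\<bar>e\<^sup>2 * (Vc t \<omega> * mean1 i j t \<omega>)\<bar> \<le> e\<^sup>2 * B\<^sup>2"
    using Vc_mean_bounds(1)[OF i j t \<omega>] by (simp add: abs_mult mult_left_mono)
  also have "\<dots> = (B * e)^2" by (simp add: power_mult_distrib)
  also have "\<dots> \<le> 1" using Be e(2) by (rule power_le_one)
  finally show "\<bar>stat1 i j e t \<omega>\<bar> \<le> 6" using d(1) unfolding stat1_def by linarith
  have "\<bar>e^3 * (Vc t \<omega> * mean2 i j t \<omega>)\<bar> \<le> e^3 * (2 * B^3)"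
    using Vc_mean_bounds(2)[OF i j t \<omega>] e(1) by (simp only: abs_mult) (simp add: mult_left_mono)
  also have "\<dots> = 2 * (B * e)^3" by (simp add: power_mult_distrib)
  also have "\<dots> \<le> 2 * 1" using power_le_one[OF Be e(2), of 3] by simp
  finally show "\<bar>stat2 i j e t \<omega>\<bar> \<le> 6" using d(2) unfolding stat2_def by linarith
qed

context
  fixes Z :: "'a \<Rightarrow> real" and t e c :: real
  assumes t: "0 \<le> t" and Z: "Z \<in> borel_measurable (F t)"
    and Z0: "\<And>\<omega>. \<omega> \<in> space M \<Longrightarrow> 0 \<le> Z \<omega>" and Zc: "\<And>\<omega>. \<omega> \<in> space M \<Longrightarrow> Z \<omega> \<le> c"
    and e: "0 < e" "e \<le> 1"
begin

lemma Z_bounded_int: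
  assumes "f \<in> borel_measurable M" "\<And>\<omega>. \<omega> \<in> space M \<Longrightarrow> \<bar>f \<omega>\<bar> \<le> k"
  shows "integrable M (\<lambda>\<omega>. Z \<omega> * f \<omega>)"
  by (rule Z_integrable_mult[OF t Z Z0 Zc integrable_bounded[OF assms]])

lemma Z_lam_int:
  assumes "G \<in> borel_measurable borel" and "\<And>x y z. 0 \<le> x \<Longrightarrow> x \<le> B \<Longrightarrow> 0 \<le> y \<Longrightarrow> y \<le> B \<Longrightarrow> 0 \<le> z \<Longrightarrow> z \<le> B \<Longrightarrow> \<bar>G (x, y, z)\<bar> \<le> k"
    and abc: "a \<in> {1..n}" "b \<in> {1..n}" "b' \<in> {1..n}"
  shows "integrable M (\<lambda>\<omega>. Z \<omega> * Vc t \<omega> * (G (lam a t \<omega>, lam b t \<omega>, lam b' t \<omega>) :: real))"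
proof -
  have "(\<lambda>\<omega>. (lam a t \<omega>, lam b t \<omega>, lam b' t \<omega>)) \<in> borel_measurable M"
    by (intro borel_measurable_Pair lam_measurable abc t)
  from measurable_compose[OF this assms(1)]
  have m: "(\<lambda>\<omega>. Vc t \<omega> * G (lam a t \<omega>, lam b t \<omega>, lam b' t \<omega>)) \<in> borel_measurable M"
    by (intro borel_measurable_times measurable_F_M[OF Vc_measurable_F[OF t]])
  have "\<bar>Vc t \<omega> * G (lam a t \<omega>, lam b t \<omega>, lam b' t \<omega>)\<bar> \<le> \<bar>k\<bar>" if \<omega>: "\<omega> \<in> space M" for \<omega>
  proof (cases "good_upto t \<omega>")
    case True
    have "\<bar>G (lam a t \<omega>, lam b t \<omega>, lam b' t \<omega>)\<bar> \<le> k"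
      using good_upto_lam[OF True _ \<omega> t] abc by (intro assms(2)) auto
    then show ?thesis by (auto simp: of_bool_def)
  qed simp
  from Z_bounded_int[OF m this] show ?thesis by (simp add: mult.assoc)
qed

lemma Z_one_int:
  assumes "f \<in> borel_measurable M" "\<And>\<omega>. 0 \<le> f \<omega> \<and> f \<omega> \<le> 1" "0 \<le> s"
  shows "integrable M (\<lambda>\<omega>. Z \<omega> * (f \<omega> * Vc s \<omega>))"
proof (rule Z_bounded_int[of _ 1])
  show "(\<lambda>\<omega>. f \<omega> * Vc s \<omega>) \<in> borel_measurable M"
    by (intro borel_measurable_times assms(1) measurable_F_M[OF Vc_measurable_F[OF assms(3)]])
  show "\<bar>f \<omega> * Vc s \<omega>\<bar> \<le> 1" for \<omega> using assms(2)[of \<omega>] by (auto simp: of_bool_def)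
qed

lemma stat1_drift:
  assumes i: "i \<in> {1..n}" and j: "j \<in> {1..n}"
  shows "\<bar>expectation (\<lambda>\<omega>. Z \<omega> * stat1 i j e t \<omega>)\<bar>
    \<le> 8 * \<kappa> * B^3 * e^3 * expectation Z + expectation (\<lambda>\<omega>. Z \<omega> * (12 * B\<^sup>2 * (1 - Vc (t + e + e) \<omega>)))"
proof -
  let ?p = "\<lambda>a b \<omega>. Z \<omega> * one a t (t + e) \<omega> * one b (t + e) (t + e + e) \<omega> * Vc (t + e + e) \<omega>"
  let ?m = "\<lambda>a b \<omega>. Z \<omega> * Vc t \<omega> * (lam a t \<omega> * (lam b t \<omega> + w b a))"
  have te: "0 \<le> t + e" "t \<le> t + e" "t + e \<le> t + e + e" "0 \<le> t + e + e" using t e by auto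
  have p_int: "integrable M (?p a b)" if "a \<in> {1..n}" "b \<in> {1..n}" for a b
  proof -
    have "(\<lambda>\<omega>. one a t (t + e) \<omega> * one b (t + e) (t + e + e) \<omega>) \<in> borel_measurable M"
      by (intro borel_measurable_times measurable_F_M[OF one_measurable_F] that te t)
    from Z_one_int[OF this _ te(4)] show ?thesis by (simp add: mult.assoc one_def)
  qed
  have m_int: "integrable M (?m a b)" if "a \<in> {1..n}" "b \<in> {1..n}" for a b
  proof -
    have "\<bar>x * (y + w b a)\<bar> \<le> B * (2 * B)" if "0 \<le> x" "x \<le> B" "0 \<le> y" "y \<le> B" for x y
      using that w_bounds(1)[OF \<open>b \<in> _\<close> \<open>a \<in> _\<close>] w_le_B[OF \<open>b \<in> _\<close> \<open>a \<in> _\<close>]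
      by (auto simp: abs_mult intro!: mult_mono)
    moreover have "(\<lambda>(x, y, z :: real). x * (y + w b a)) \<in> borel_measurable borel"
      unfolding case_prod_beta by (intro borel_measurable_continuous_onI continuous_intros)
    ultimately show ?thesis
      using Z_lam_int[of "\<lambda>(x, y, z). x * (y + w b a)" "B * (2 * B)" a b b] that by simp
  qed
  have "(\<lambda>\<omega>. Z \<omega> * stat1 i j e t \<omega>) = (\<lambda>\<omega>. (?p i j \<omega> - ?p j i \<omega>) - e\<^sup>2 * (?m i j \<omega> - ?m j i \<omega>))"
    by (simp add: stat1_def delta1_def mean1_def fun_eq_iff algebra_simps)
  then have "expectation (\<lambda>\<omega>. Z \<omega> * stat1 i j e t \<omega>)
      = (expectation (?p i j) - e\<^sup>2 * expectation (?m i j)) - (expectation (?p j i) - e\<^sup>2 * expectation (?m j i))"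
    using p_int[OF i j] p_int[OF j i] m_int[OF i j] m_int[OF j i] by (simp add: right_diff_distrib)
  moreover have "\<bar>expectation (?p a b) - e\<^sup>2 * expectation (?m a b)\<bar>
      \<le> 4 * \<kappa> * B^3 * e^3 * expectation Z + 6 * B\<^sup>2 * expectation (\<lambda>\<omega>. Z \<omega> * (1 - Vc (t + e + e) \<omega>))"
    if "a \<in> {1..n}" "b \<in> {1..n}" for a b
    by (rule pair_expansion[OF t Z Z0 Zc e that])
  note this[OF i j] this[OF j i]
  moreover have "expectation (\<lambda>\<omega>. Z \<omega> * (12 * B\<^sup>2 * (1 - Vc (t + e + e) \<omega>)))
      = 12 * B\<^sup>2 * expectation (\<lambda>\<omega>. Z \<omega> * (1 - Vc (t + e + e) \<omega>))"
    by (subst integral_mult_right_zero[symmetric]) (simp add: mult_ac)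
  ultimately show ?thesis by linarith
qed

text \<open>The coefficients 1, -2, 1 have absolute sum 4, which multiplies the constants 13 and 18
  of the triple expansion. For the pair statistic the corresponding factor is 2.\<close>

lemma stat2_drift:
  assumes i: "i \<in> {1..n}" and j: "j \<in> {1..n}"
  shows "\<bar>expectation (\<lambda>\<omega>. Z \<omega> * stat2 i j e t \<omega>)\<bar>
    \<le> 52 * \<kappa> * B^4 * e^4 * expectation Z + expectation (\<lambda>\<omega>. Z \<omega> * (72 * B^3 * (1 - Vc (t + e + e + e) \<omega>)))"
proof -
  let ?p = "\<lambda>a b b' \<omega>. Z \<omega> * one a t (t + e) \<omega> * one b (t + e) (t + e + e) \<omega>
      * one b' (t + e + e) (t + e + e + e) \<omega> * Vc (t + e + e + e) \<omega>"
  let ?m = "\<lambda>a b b' \<omega>. Z \<omega> * Vc t \<omega> * (lam a t \<omega> * ((lam b t \<omega> + w b a) * (lam b' t \<omega> + w b' a + w b' b)))"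
  have te: "0 \<le> t + e" "t \<le> t + e" "t + e \<le> t + e + e" "0 \<le> t + e + e" "t + e + e \<le> t + e + e + e"
    "0 \<le> t + e + e + e" using t e by auto
  have p_int: "integrable M (?p a b b')" if "a \<in> {1..n}" "b \<in> {1..n}" "b' \<in> {1..n}" for a b b'
  proof -
    have "(\<lambda>\<omega>. one a t (t + e) \<omega> * one b (t + e) (t + e + e) \<omega> * one b' (t + e + e) (t + e + e + e) \<omega>) \<in> borel_measurable M"
      by (intro borel_measurable_times measurable_F_M[OF one_measurable_F] that te t)
    from Z_one_int[OF this _ te(6)] show ?thesis by (simp add: mult.assoc one_def)
  qed
  have m_int: "integrable M (?m a b b')" if abb: "a \<in> {1..n}" "b \<in> {1..n}" "b' \<in> {1..n}" for a b b'
  proof -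
    have w: "0 \<le> w b a" "w b a \<le> B" "0 \<le> w b' a" "w b' a \<le> B" "0 \<le> w b' b" "w b' b \<le> B"
      using w_bounds(1)[OF abb(2,1)] w_le_B[OF abb(2,1)] w_bounds(1)[OF abb(3,1)] w_le_B[OF abb(3,1)]
        w_bounds(1)[OF abb(3,2)] w_le_B[OF abb(3,2)] by auto
    have "\<bar>x * ((y + w b a) * (z + w b' a + w b' b))\<bar> \<le> B * ((2 * B) * (3 * B))"
      if "0 \<le> x" "x \<le> B" "0 \<le> y" "y \<le> B" "0 \<le> z" "z \<le> B" for x y z
      unfolding abs_mult using that w by (intro mult_mono) auto
    moreover have "(\<lambda>(x, y, z). x * ((y + w b a) * (z + w b' a + w b' b))) \<in> borel_measurable borel"
      unfolding case_prod_beta by (intro borel_measurable_continuous_onI continuous_intros)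
    ultimately show ?thesis
      using Z_lam_int[of "\<lambda>(x, y, z). x * ((y + w b a) * (z + w b' a + w b' b))" "B * ((2 * B) * (3 * B))" a b b'] abb
      by simp
  qed
  have "Z \<omega> * stat2 i j e t \<omega> = (?p i i j \<omega> - 2 * ?p i j i \<omega> + ?p j i i \<omega>)
      - e^3 * (?m i i j \<omega> - 2 * ?m i j i \<omega> + ?m j i i \<omega>)" for \<omega>
  proof -
    \<comment> \<open>The identity behind the second statistic: the three triple limits combine to
      an expression linear in the rates.\<close>
    have "mean2 i j t \<omega> = lam i t \<omega> * ((lam i t \<omega> + w i i) * (lam j t \<omega> + w j i + w j i))
        - 2 * (lam i t \<omega> * ((lam j t \<omega> + w j i) * (lam i t \<omega> + w i i + w i j)))
        + lam j t \<omega> * ((lam i t \<omega> + w i j) * (lam i t \<omega> + w i j + w i i))"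
      unfolding mean2_def by (simp add: algebra_simps)
    then show ?thesis unfolding stat2_def delta2_def by (simp only:) (simp add: algebra_simps)
  qed
  then have "expectation (\<lambda>\<omega>. Z \<omega> * stat2 i j e t \<omega>) = expectation (\<lambda>\<omega>. (?p i i j \<omega> - 2 * ?p i j i \<omega> + ?p j i i \<omega>)
      - e^3 * (?m i i j \<omega> - 2 * ?m i j i \<omega> + ?m j i i \<omega>))" by simp
  also have "\<dots> = (expectation (?p i i j) - 2 * expectation (?p i j i) + expectation (?p j i i))
      - e^3 * (expectation (?m i i j) - 2 * expectation (?m i j i) + expectation (?m j i i))"
    using p_int[OF i i j] p_int[OF i j i] p_int[OF j i i] m_int[OF i i j] m_int[OF i j i] m_int[OF j i i]
    by simp
  also have "\<dots> = (expectation (?p i i j) - e^3 * expectation (?m i i j)) - 2 * (expectation (?p i j i) - e^3 * expectation (?m i j i))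
      + (expectation (?p j i i) - e^3 * expectation (?m j i i))"
    by (simp add: algebra_simps)
  finally have eq: "expectation (\<lambda>\<omega>. Z \<omega> * stat2 i j e t \<omega>) = \<dots>" .
  have ex: "\<bar>expectation (?p a b b') - e^3 * expectation (?m a b b')\<bar>
      \<le> 13 * \<kappa> * B^4 * e^4 * expectation Z + 18 * B^3 * expectation (\<lambda>\<omega>. Z \<omega> * (1 - Vc (t + e + e + e) \<omega>))"
    if "a \<in> {1..n}" "b \<in> {1..n}" "b' \<in> {1..n}" for a b b'
    by (rule triple_expansion[OF t Z Z0 Zc e that])
  have "\<bar>expectation (\<lambda>\<omega>. Z \<omega> * stat2 i j e t \<omega>)\<bar> \<le> 4 * (13 * \<kappa> * B^4 * e^4 * expectation Z
      + 18 * B^3 * expectation (\<lambda>\<omega>. Z \<omega> * (1 - Vc (t + e + e + e) \<omega>)))"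
    by (rule weighted_abs_le[OF eq ex[OF i i j] ex[OF i j i] ex[OF j i i]])
  moreover have "expectation (\<lambda>\<omega>. Z \<omega> * (72 * B^3 * (1 - Vc (t + e + e + e) \<omega>)))
      = 72 * B^3 * expectation (\<lambda>\<omega>. Z \<omega> * (1 - Vc (t + e + e + e) \<omega>))"
    by (subst integral_mult_right_zero[symmetric]) (simp add: mult_ac)
  ultimately show ?thesis by (simp add: algebra_simps)
qed

end

text \<open>
  The summands of the statistics overlap; within each residue class of the time index modulo 3 they
  are adapted to a filtration along which Azuma's inequality applies.
\<close>

lemma interleaved_concentration:
  fixes Y \<rho> :: "nat \<Rightarrow> 'a \<Rightarrow> real"
  assumes e: "0 < e"
    and Y: "\<And>k. k < N \<Longrightarrow> Y k \<in> borel_measurable (F (real k * e + 3 * e))"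
      "\<And>k \<omega>. k < N \<Longrightarrow> \<omega> \<in> space M \<Longrightarrow> \<bar>Y k \<omega>\<bar> \<le> 6"
    and \<rho>: "\<And>k. k < N \<Longrightarrow> integrable M (\<rho> k)" "\<And>k \<omega>. k < N \<Longrightarrow> \<omega> \<in> space M \<Longrightarrow> 0 \<le> \<rho> k \<omega>"
      "\<And>k. k < N \<Longrightarrow> expectation (\<rho> k) \<le> p"
    and drift: "\<And>k Z z. k < N \<Longrightarrow> Z \<in> borel_measurable (F (real k * e)) \<Longrightarrow> (\<And>\<omega>. \<omega> \<in> space M \<Longrightarrow> 0 \<le> Z \<omega>) \<Longrightarrow>
      (\<And>\<omega>. \<omega> \<in> space M \<Longrightarrow> Z \<omega> \<le> z) \<Longrightarrow>
      \<bar>expectation (\<lambda>\<omega>. Z \<omega> * Y k \<omega>)\<bar> \<le> r * expectation Z + expectation (\<lambda>\<omega>. Z \<omega> * \<rho> k \<omega>)"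
    and r: "0 \<le> r" and x: "0 < x" "x \<le> 12 * real R" and y: "0 < y" and p: "0 \<le> p"
    and R: "R = N div 3 + 1"
  shows "prob {\<omega> \<in> space M. 3 * (real R * r + y + x) \<le> \<bar>\<Sum>k<N. Y k \<omega>\<bar>}
    \<le> 6 * (exp (- x\<^sup>2 / (144 * real R)) + real R * p / y)"
proof -
  \<comment> \<open>Padding with zeros beyond \<open>N\<close> gives every residue class the same
    number \<open>R\<close> of terms. Within a class consecutive summands are 3 e apart, so each one
    is known when the next begins.\<close>
  define Y' where "Y' = (\<lambda>s m \<omega>. if m * 3 + s < N then Y (m * 3 + s) \<omega> else 0)"
  define \<rho>' where "\<rho>' = (\<lambda>s m \<omega>. if m * 3 + s < N then \<rho> (m * 3 + s) \<omega> else 0)"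
  define A where "A = (\<lambda>s. {\<omega> \<in> space M. real R * r + y + x \<le> \<bar>\<Sum>m<R. Y' s m \<omega>\<bar>})"
  have R0: "0 < R" by (simp add: R)
  have Y'_meas: "Y' s m \<in> borel_measurable (F (real (Suc m * 3 + s) * e))" for s m
  proof (cases "m * 3 + s < N")
    case True
    have "real (m * 3 + s) * e + 3 * e = real (Suc m * 3 + s) * e" by (simp add: algebra_simps)
    then show ?thesis using Y(1)[OF True] True by (simp add: Y'_def[abs_def])
  qed (simp add: Y'_def[abs_def])
  have A_sets: "A s \<in> sets M" for s
    unfolding A_def using measurable_F_M[OF Y'_meas] by measurable
  have A_prob: "prob (A s) \<le> 2 * (exp (- x\<^sup>2 / (144 * real R)) + real R * p / y)" for s
  proof -
    \<comment> \<open>The bound 6 on the summands accounts for 144 = 4 * 6^2 and for the admissible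
      range \<open>x \<le> 12 * real R\<close>.\<close>
    have "prob (A s) \<le> 2 * (exp (- x\<^sup>2 / (4 * real R * 6\<^sup>2)) + (\<Sum>m<R. expectation (\<rho>' s m)) / y)"
      unfolding A_def
    proof (rule azuma_two_sided[where G = "\<lambda>m. F (real (m * 3 + s) * e)" and \<rho> = "\<rho>' s" and c = 6])
      show "subalgebra (F (real (Suc m * 3 + s) * e)) (F (real (m * 3 + s) * e))" for m
        by (rule subalgebra_F_mono) (use e in simp)
      show "\<bar>Y' s m \<omega>\<bar> \<le> 6" if "\<omega> \<in> space M" for m \<omega> using Y(2)[OF _ that] by (simp add: Y'_def)
      show "integrable M (\<rho>' s m)" for m
        using \<rho>(1) by (cases "m * 3 + s < N") (simp_all add: \<rho>'_def[abs_def])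
      show "0 \<le> \<rho>' s m \<omega>" if "\<omega> \<in> space M" for m \<omega> using \<rho>(2)[OF _ that] by (simp add: \<rho>'_def)
      fix m :: nat and Z :: "'a \<Rightarrow> real" and z :: real
      assume Z: "Z \<in> borel_measurable (F (real (m * 3 + s) * e))" "\<And>\<omega>. \<omega> \<in> space M \<Longrightarrow> 0 \<le> Z \<omega>"
        "\<And>\<omega>. \<omega> \<in> space M \<Longrightarrow> Z \<omega> \<le> z"
      show "\<bar>expectation (\<lambda>\<omega>. Z \<omega> * Y' s m \<omega>)\<bar> \<le> r * expectation Z + expectation (\<lambda>\<omega>. Z \<omega> * \<rho>' s m \<omega>)"
      proof (cases "m * 3 + s < N")
        case True
        then show ?thesis using drift[OF True Z] by (simp add: Y'_def \<rho>'_def)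
      next
        case False
        have "0 \<le> expectation Z" by (rule integral_nonneg_AE) (use Z(2) in auto)
        then show ?thesis using False r by (simp add: Y'_def \<rho>'_def)
      qed
    qed (use Y'_meas r x y R0 subalgebra_F in auto)
    also have "(\<Sum>m<R. expectation (\<rho>' s m)) \<le> (\<Sum>m<R. p)"
    proof (rule sum_mono)
      fix m show "expectation (\<rho>' s m) \<le> p"
        using \<rho>(3) p by (cases "m * 3 + s < N") (simp_all add: \<rho>'_def[abs_def])
    qed
    finally show ?thesis using y by (simp add: divide_right_mono)
  qed
  have sum_eq: "(\<Sum>k<N. Y k \<omega>) = (\<Sum>m<R. Y' 0 m \<omega>) + (\<Sum>m<R. Y' 1 m \<omega>) + (\<Sum>m<R. Y' 2 m \<omega>)" for \<omega>
  proof -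
    let ?f = "\<lambda>k. if k < N then Y k \<omega> else 0"
    have "(\<Sum>k<N. Y k \<omega>) = (\<Sum>k<R * 3. ?f k)"
      by (rule sum.mono_neutral_cong_left) (auto simp: R)
    also have "\<dots> = (\<Sum>m<R. sum ?f {m * 3..<m * 3 + 3})" by (rule sum.nat_group[symmetric])
    also have "\<dots> = (\<Sum>m<R. Y' 0 m \<omega> + Y' 1 m \<omega> + Y' 2 m \<omega>)"
    proof (rule sum.cong[OF refl])
      fix m :: nat
      have "{m * 3..<m * 3 + 3} = {m * 3 + 0, m * 3 + 1, m * 3 + 2}" by auto
      then show "sum ?f {m * 3..<m * 3 + 3} = Y' 0 m \<omega> + Y' 1 m \<omega> + Y' 2 m \<omega>"
        unfolding Y'_def by (simp add: add.assoc)
    qed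
    finally show ?thesis by (simp add: sum.distrib)
  qed
  have "prob {\<omega> \<in> space M. 3 * (real R * r + y + x) \<le> \<bar>\<Sum>k<N. Y k \<omega>\<bar>} \<le> prob (A 0 \<union> (A 1 \<union> A 2))"
  proof (rule finite_measure_mono)
    show "{\<omega> \<in> space M. 3 * (real R * r + y + x) \<le> \<bar>\<Sum>k<N. Y k \<omega>\<bar>} \<subseteq> A 0 \<union> (A 1 \<union> A 2)"
    proof
      fix \<omega> assume \<omega>: "\<omega> \<in> {\<omega> \<in> space M. 3 * (real R * r + y + x) \<le> \<bar>\<Sum>k<N. Y k \<omega>\<bar>}"
      show "\<omega> \<in> A 0 \<union> (A 1 \<union> A 2)"
      proof (rule ccontr)
        assume "\<omega> \<notin> A 0 \<union> (A 1 \<union> A 2)"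
        then have "\<bar>\<Sum>m<R. Y' 0 m \<omega>\<bar> < real R * r + y + x" "\<bar>\<Sum>m<R. Y' 1 m \<omega>\<bar> < real R * r + y + x"
          "\<bar>\<Sum>m<R. Y' 2 m \<omega>\<bar> < real R * r + y + x" using \<omega> by (auto simp: A_def)
        moreover have "3 * (real R * r + y + x) \<le> \<bar>(\<Sum>m<R. Y' 0 m \<omega>) + (\<Sum>m<R. Y' 1 m \<omega>) + (\<Sum>m<R. Y' 2 m \<omega>)\<bar>"
          using \<omega> unfolding sum_eq by blast
        moreover have "\<bar>a + b + c\<bar> < 3 * z" if "\<bar>a\<bar> < z" "\<bar>b\<bar> < z" "\<bar>c\<bar> < z" for a b c z :: real
          using that by linarith
        ultimately show False by (meson not_le)
      qed
    qed
  qed (use A_sets in auto)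
  also have "\<dots> \<le> prob (A 0) + prob (A 1 \<union> A 2)" by (rule measure_Un_le) (use A_sets in auto)
  also have "prob (A 1 \<union> A 2) \<le> prob (A 1) + prob (A 2)" by (rule measure_Un_le) (use A_sets in auto)
  finally have "prob {\<omega> \<in> space M. 3 * (real R * r + y + x) \<le> \<bar>\<Sum>k<N. Y k \<omega>\<bar>}
      \<le> prob (A 0) + (prob (A 1) + prob (A 2))" by simp
  moreover have "u \<le> 6 * z" if "u \<le> a + (b + c)" "a \<le> 2 * z" "b \<le> 2 * z" "c \<le> 2 * z" for u a b c z :: real
    using that by linarith
  ultimately show ?thesis using A_prob by blast
qed

lemma rest_expectation:
  assumes s: "0 \<le> s" "s \<le> S" and q: "prob {\<omega> \<in> space M. \<not> good_upto S \<omega>} \<le> q" and k: "0 \<le> k"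
  shows "integrable M (\<lambda>\<omega>. k * (1 - Vc s \<omega>))" "expectation (\<lambda>\<omega>. k * (1 - Vc s \<omega>)) \<le> k * q"
proof -
  have S: "0 \<le> S" using s by simp
  have sets: "{\<omega> \<in> space M. \<not> good_upto S \<omega>} \<in> sets M"
  proof -
    have "{\<omega> \<in> space M. good_upto S \<omega>} \<in> sets M"
      using good_upto_sets[OF S] subalgebra_F by (auto simp: subalgebra_def)
    then show ?thesis by (rule sets.sets_Collect_neg)
  qed
  have int: "integrable M (\<lambda>\<omega>. 1 - Vc s \<omega>)"
    by (rule integrable_bounded[of _ 1]) (use measurable_F_M[OF Vc_measurable_F[OF s(1)]] in auto)
  then show "integrable M (\<lambda>\<omega>. k * (1 - Vc s \<omega>))" by simp
  have "expectation (\<lambda>\<omega>. 1 - Vc s \<omega>) \<le> expectation (indicator {\<omega> \<in> space M. \<not> good_upto S \<omega>})"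
    by (rule integral_mono[OF int])
      (use sets good_upto_mono[OF s(2)] in \<open>auto simp: indicator_def less_top[symmetric]\<close>)
  also have "\<dots> \<le> q" using q sets by simp
  finally have "expectation (\<lambda>\<omega>. 1 - Vc s \<omega>) \<le> q" .
  then show "expectation (\<lambda>\<omega>. k * (1 - Vc s \<omega>)) \<le> k * q" using k by (simp add: mult_left_mono)
qed

text \<open>Outside the exit event and the two deviation events of each ordered pair, all stopping
  factors equal 1. The sums of \<open>stat1\<close> and \<open>stat2\<close> are then the observed
  statistics minus their means, and every pair is decided correctly. The factor 12 is 6 for each of
  the two statistics, and 312 is 6 times the drift constant 52.\<close>

lemma recovery_failure:
  assumes w1: "w_min \<le> 1" and e: "0 < e" "e \<le> 1" "B * e \<le> 1" and T: "2 * e \<le> T"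
    and h: "h = w_min * w_sep * \<mu>_min / 8" and \<delta>: "\<delta> = h / 6"
    and small: "312 * \<kappa> * B^4 * e \<le> \<delta>" "\<delta> * e \<le> 1"
    and q: "prob {\<omega> \<in> space M. \<not> good_upto (T + 3) \<omega>} \<le> q"
  shows "prob {\<omega> \<in> space M. \<not> estimated_graph n (\<lambda>i. E i \<omega>) T e h = dependency_graph n w}
    \<le> q + 12 * real n^2 * (exp (- \<delta>\<^sup>2 * T * e^5 / 20736) + 864 * B^3 * q / (\<delta> * e^3))"
proof -
  define S where "S = T + 3"
  define N where "N = nat \<lfloor>T / (3 * e)\<rfloor> + 1"
  define R where "R = N div 3 + 1"
  define p where "p = 72 * B^3 * q"
  have B0: "1 \<le> B" "0 \<le> B" using B_ge by auto
  have T0: "0 < T" using T e by simp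
  have h0: "0 < h" unfolding h using w_min_pos w_sep_pos mu_min_pos by simp
  have \<delta>0: "0 < \<delta>" using h0 by (simp add: \<delta>)
  have q0: "0 \<le> q" using q measure_nonneg order_trans by blast
  have p0: "0 \<le> p" using q0 B0 by (simp add: p_def)
  have Tq: "0 \<le> T / (3 * e)" using T0 e by simp
  have Nf: "real N = of_int \<lfloor>T / (3 * e)\<rfloor> + 1" using Tq by (simp add: N_def)
  have N: "T / (3 * e) \<le> real N" "real N \<le> T / (3 * e) + 1" unfolding Nf by linarith+
  have "N \<le> 3 * R" unfolding R_def by presburger
  moreover have "3 * R \<le> N + 3" unfolding R_def by presburger
  ultimately have "real N \<le> real (3 * R)" "real (3 * R) \<le> real (N + 3)" by (simp_all only: of_nat_le_iff)
  then have RN: "real N / 3 \<le> real R" "real R \<le> real N / 3 + 1" by auto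
  have Te: "2 \<le> T / e" using T e by (simp add: field_simps)
  have T3: "T / (3 * e) = T / e / 3" by simp
  have R: "T / (9 * e) \<le> real R" "real R \<le> T / e"
    using RN N Te unfolding T3 by (auto simp: field_simps)
  \<comment> \<open>The sums run only up to time about T / 3, so even the last triple of windows
    ends before \<open>T + 3\<close>, the horizon of the exit bound.\<close>
  have time: "real k * e + 3 * e \<le> S" if "k < N" for k
  proof -
    have "real k + 1 \<le> real N" using that by simp
    then have "real k \<le> T / (3 * e)" using N(2) by linarith
    then have "real k * e \<le> T / 3" using e by (simp add: field_simps)
    then show ?thesis using e T0 by (simp add: S_def)
  qed
  \<comment> \<open>The tolerance is shared as 3 (1/6 + 1/12 + 1/12) = 1: a sixth for the
    deterministic drift in each residue class, a twelfth for the fluctuations, and a twelfth for the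
    drift that is small only in mean.\<close>
  define x1 where "x1 = \<delta> * T * e / 12"
  define x2 where "x2 = \<delta> * T * e\<^sup>2 / 12"
  define r1 where "r1 = 8 * \<kappa> * B^3 * e^3"
  define r2 where "r2 = 52 * \<kappa> * B^4 * e^4"
  have x0: "0 < x1" "0 < x2" using \<delta>0 T0 e by (auto simp: x1_def x2_def)
  have x21: "x2 \<le> x1" unfolding x1_def x2_def power2_eq_square using \<delta>0 T0 e
    by (simp add: mult_left_le)
  have x1R: "x1 \<le> 12 * real R"
  proof -
    have "\<delta> * e * e \<le> 1 * 1" using small(2) e \<delta>0 by (intro mult_mono) auto
    then have "\<delta> * e * e * (T / e) \<le> 1 * (T / e)" using T0 e by (intro mult_right_mono) auto
    then have x1: "x1 \<le> T / e / 12" using e by (simp add: x1_def mult_ac)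
    have frac: "u / 12 \<le> 12 * (u / 9)" if "0 \<le> u" for u :: real using that by simp
    have "0 \<le> T / e" using T0 e by simp
    from order_trans[OF x1 frac[OF this]] have "x1 \<le> 12 * (T / (9 * e))"
      by (simp only: divide_divide_eq_left mult.commute[of e])
    then show ?thesis using R(1) by linarith
  qed
  have r0: "0 \<le> r1" "0 \<le> r2" using kappa_pos B0 e by (auto simp: r1_def r2_def)
  have total: "3 * (a + x + x) \<le> z" if "a \<le> z / 6" "x = z / 12" for a x z :: real
    using that by simp
  have drift1: "3 * (real R * r1 + x1 + x1) \<le> \<delta> * (T * e)"
  proof -
    have "real R * r1 \<le> T / e * r1" using R(2) r0 by (intro mult_right_mono) auto
    also have "\<dots> = 8 * \<kappa> * B^3 * e * (T * e)" using e by (simp add: r1_def power3_eq_cube)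
    also have "\<dots> \<le> \<delta> / 6 * (T * e)"
    proof (rule mult_right_mono)
      have "\<kappa> * (B^3 * e) \<le> \<kappa> * (B^4 * e)"
        using kappa_pos B0 e by (intro mult_left_mono mult_right_mono power_increasing) auto
      moreover have "0 \<le> \<kappa> * (B^3 * e)" using kappa_pos B0 e by simp
      ultimately show "8 * \<kappa> * B^3 * e \<le> \<delta> / 6" using small(1) by (simp add: mult.assoc)
    qed (use T0 e in simp)
    finally have "real R * r1 \<le> \<delta> * (T * e) / 6" by simp
    moreover have "x1 = \<delta> * (T * e) / 12" by (simp add: x1_def mult.assoc)
    ultimately show ?thesis by (rule total)
  qed
  have drift2: "3 * (real R * r2 + x2 + x2) \<le> \<delta> * (T * e\<^sup>2)"
  proof -
    have "real R * r2 \<le> T / e * r2" using R(2) r0 by (intro mult_right_mono) auto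
    also have "\<dots> = 52 * \<kappa> * B^4 * e * (T * e\<^sup>2)" using e by (simp add: r2_def power_numeral_reduce)
    also have "\<dots> \<le> \<delta> / 6 * (T * e\<^sup>2)"
      by (rule mult_right_mono) (use small(1) T0 e in auto)
    finally have "real R * r2 \<le> \<delta> * (T * e\<^sup>2) / 6" by simp
    moreover have "x2 = \<delta> * (T * e\<^sup>2) / 12" by (simp add: x2_def mult.assoc)
    ultimately show ?thesis by (rule total)
  qed
  \<comment> \<open>The smaller threshold \<open>x2\<close> gives the weaker tail bound and serves
    both statistics. Together with \<open>R\<close> at most T / e it yields 20736 = 144^2 in the
    exponent and 864 = 72 * 12 in the second term.\<close>
  define Q where "Q = exp (- \<delta>\<^sup>2 * T * e^5 / 20736) + 864 * B^3 * q / (\<delta> * e^3)"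
  have tail: "exp (- x\<^sup>2 / (144 * real R)) + real R * p / x \<le> Q" if "x2 \<le> x" for x
  proof -
    have xpos: "0 < x" using that x0 by simp
    have Rpos: "0 < real R" by (simp add: R_def)
    have "\<delta>\<^sup>2 * T * e^5 / 20736 = x2\<^sup>2 / (144 * (T / e))"
      using T0 e by (simp add: x2_def power_numeral_reduce power2_eq_square field_simps)
    also have "\<dots> \<le> x\<^sup>2 / (144 * real R)"
      using that x0 R(2) Rpos by (intro frac_le power_mono) auto
    finally have "exp (- x\<^sup>2 / (144 * real R)) \<le> exp (- \<delta>\<^sup>2 * T * e^5 / 20736)" by simp
    moreover have "real R * p / x \<le> (T / e) * p / x2"
      using that x0 R(2) p0 T0 e by (intro frac_le mult_right_mono) auto
    moreover have "(T / e) * p / x2 = 864 * B^3 * q / (\<delta> * e^3)"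
      using T0 e \<delta>0 by (simp add: p_def x2_def power2_eq_square power3_eq_cube field_simps)
    ultimately show ?thesis unfolding Q_def by linarith
  qed
  define A1 where "A1 = (\<lambda>i j. {\<omega> \<in> space M. 3 * (real R * r1 + x1 + x1) \<le> \<bar>\<Sum>k<N. stat1 i j e (real k * e) \<omega>\<bar>})"
  define A2 where "A2 = (\<lambda>i j. {\<omega> \<in> space M. 3 * (real R * r2 + x2 + x2) \<le> \<bar>\<Sum>k<N. stat2 i j e (real k * e) \<omega>\<bar>})"
  have ke: "0 \<le> real k * e" for k using e by simp
  have A_sets: "A1 i j \<in> sets M" "A2 i j \<in> sets M" if "i \<in> {1..n}" "j \<in> {1..n}" for i j
    unfolding A1_def A2_def
    using measurable_F_M[OF stat_measurable(1)[OF that ke e(1)]] measurable_F_M[OF stat_measurable(2)[OF that ke e(1)]]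
    by measurable
  have A1_prob: "prob (A1 i j) \<le> 6 * Q" if ij: "i \<in> {1..n}" "j \<in> {1..n}" for i j
  proof -
    have "prob (A1 i j) \<le> 6 * (exp (- x1\<^sup>2 / (144 * real R)) + real R * p / x1)"
      unfolding A1_def
    proof (rule interleaved_concentration[where \<rho> = "\<lambda>k \<omega>. 12 * B\<^sup>2 * (1 - Vc (real k * e + e + e) \<omega>)", OF e(1)])
      fix k assume k: "k < N"
      have s: "0 \<le> real k * e + e + e" "real k * e + e + e \<le> S" using time[OF k] ke[of k] e by auto
      note rest = rest_expectation[OF s, folded S_def, OF q[folded S_def], of "12 * B\<^sup>2"]
      show "integrable M (\<lambda>\<omega>. 12 * B\<^sup>2 * (1 - Vc (real k * e + e + e) \<omega>))" by (rule rest(1)) simp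
      have "expectation (\<lambda>\<omega>. 12 * B\<^sup>2 * (1 - Vc (real k * e + e + e) \<omega>)) \<le> 12 * B\<^sup>2 * q" by (rule rest(2)) simp
      also have "\<dots> \<le> p" unfolding p_def
      proof (rule mult_right_mono[OF _ q0])
        have "B\<^sup>2 \<le> B^3" using B0 by (intro power_increasing) auto
        moreover have "0 \<le> B^3" using B0 by simp
        ultimately show "12 * B\<^sup>2 \<le> 72 * B^3" by linarith
      qed
      finally show "expectation (\<lambda>\<omega>. 12 * B\<^sup>2 * (1 - Vc (real k * e + e + e) \<omega>)) \<le> p" .
      show "stat1 i j e (real k * e) \<in> borel_measurable (F (real k * e + 3 * e))"
        by (rule stat_measurable(1)[OF ij ke e(1)])
      show "\<bar>stat1 i j e (real k * e) \<omega>\<bar> \<le> 6" if "\<omega> \<in> space M" for \<omega>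
        by (rule stat_bounds(1)[OF ij ke that e(1,3)])
      fix Z :: "'a \<Rightarrow> real" and z
      assume "Z \<in> borel_measurable (F (real k * e))" "\<And>\<omega>. \<omega> \<in> space M \<Longrightarrow> 0 \<le> Z \<omega>" "\<And>\<omega>. \<omega> \<in> space M \<Longrightarrow> Z \<omega> \<le> z"
      then show "\<bar>expectation (\<lambda>\<omega>. Z \<omega> * stat1 i j e (real k * e) \<omega>)\<bar>
        \<le> r1 * expectation Z + expectation (\<lambda>\<omega>. Z \<omega> * (12 * B\<^sup>2 * (1 - Vc (real k * e + e + e) \<omega>)))"
        unfolding r1_def by (rule stat1_drift[OF ke _ _ _ e(1,2) ij])
    qed (use r0 x0 x1R p0 R_def in auto)
    then show ?thesis using tail[OF x21] by simp
  qed
  have A2_prob: "prob (A2 i j) \<le> 6 * Q" if ij: "i \<in> {1..n}" "j \<in> {1..n}" for i j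
  proof -
    have "prob (A2 i j) \<le> 6 * (exp (- x2\<^sup>2 / (144 * real R)) + real R * p / x2)"
      unfolding A2_def
    proof (rule interleaved_concentration[where \<rho> = "\<lambda>k \<omega>. 72 * B^3 * (1 - Vc (real k * e + e + e + e) \<omega>)", OF e(1)])
      fix k assume k: "k < N"
      have s: "0 \<le> real k * e + e + e + e" "real k * e + e + e + e \<le> S" using time[OF k] ke[of k] e by auto
      note rest = rest_expectation[OF s, folded S_def, OF q[folded S_def], of "72 * B^3"]
      show "integrable M (\<lambda>\<omega>. 72 * B^3 * (1 - Vc (real k * e + e + e + e) \<omega>))" by (rule rest(1)) (use B0 in simp)
      show "expectation (\<lambda>\<omega>. 72 * B^3 * (1 - Vc (real k * e + e + e + e) \<omega>)) \<le> p"
        unfolding p_def by (rule rest(2)) (use B0 in simp)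
      show "stat2 i j e (real k * e) \<in> borel_measurable (F (real k * e + 3 * e))"
        by (rule stat_measurable(2)[OF ij ke e(1)])
      show "\<bar>stat2 i j e (real k * e) \<omega>\<bar> \<le> 6" if "\<omega> \<in> space M" for \<omega>
        by (rule stat_bounds(2)[OF ij ke that e(1,3)])
      show "0 \<le> 72 * B^3 * (1 - Vc (real k * e + e + e + e) \<omega>)" for \<omega> using B0 by simp
      fix Z :: "'a \<Rightarrow> real" and z
      assume "Z \<in> borel_measurable (F (real k * e))" "\<And>\<omega>. \<omega> \<in> space M \<Longrightarrow> 0 \<le> Z \<omega>" "\<And>\<omega>. \<omega> \<in> space M \<Longrightarrow> Z \<omega> \<le> z"
      then show "\<bar>expectation (\<lambda>\<omega>. Z \<omega> * stat2 i j e (real k * e) \<omega>)\<bar>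
        \<le> r2 * expectation Z + expectation (\<lambda>\<omega>. Z \<omega> * (72 * B^3 * (1 - Vc (real k * e + e + e + e) \<omega>)))"
        unfolding r2_def by (rule stat2_drift[OF ke _ _ _ e(1,2) ij])
    qed (use r0 x0 x1R x21 p0 R_def in auto)
    then show ?thesis using tail[OF order_refl] by simp
  qed
  let ?bad = "{\<omega> \<in> space M. \<not> good_upto S \<omega>}"
  let ?fail = "{\<omega> \<in> space M. \<not> estimated_graph n (\<lambda>i. E i \<omega>) T e h = dependency_graph n w}"
  let ?U = "\<Union>i\<in>{1..n}. \<Union>j\<in>{1..n}. A1 i j \<union> A2 i j"
  have S0: "0 \<le> S" using T0 by (simp add: S_def)
  have bad_sets: "?bad \<in> sets M"
    using good_upto_sets[OF S0] subalgebra_F[of S] by (intro sets.sets_Collect_neg) (auto simp: subalgebra_def)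
  have U_sets: "?U \<in> sets M" using A_sets by auto
  have "AE \<omega> in M. \<forall>k. \<forall>i\<in>{1..n}. real k * e \<notin> E i \<omega>"
    by (subst AE_all_countable) (intro allI AE_no_event_at ke)
  then have "AE \<omega> in M. \<omega> \<in> ?fail \<longrightarrow> \<omega> \<in> ?bad \<union> ?U"
    using AE_space
  proof eventually_elim
    case (elim \<omega>)
    note \<omega> = elim(2) and no = elim(1)
    show ?case
    proof (rule impI, rule ccontr)
      assume fail: "\<omega> \<in> ?fail" and nU: "\<omega> \<notin> ?bad \<union> ?U"
      then have good: "good_upto S \<omega>" using \<omega> by simp
      have key: "(w i j > 0 \<longrightarrow> h \<le> \<bar>D1 (\<lambda>i. E i \<omega>) i j T e\<bar> / (T * e) + \<bar>D2 (\<lambda>i. E i \<omega>) i j T e\<bar> / (T * e\<^sup>2)) \<and>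
        (w i j = 0 \<and> w j i = 0 \<longrightarrow> \<bar>D1 (\<lambda>i. E i \<omega>) i j T e\<bar> / (T * e) + \<bar>D2 (\<lambda>i. E i \<omega>) i j T e\<bar> / (T * e\<^sup>2) < h)"
        if i: "i \<in> {1..n}" and j: "j \<in> {1..n}" and ij: "i \<noteq> j" for i j
      proof -
        have index: "{0..nat \<lfloor>T / (3 * e)\<rfloor>} = {..<N}" by (auto simp: N_def)
        have V: "Vc (real k * e) \<omega> = 1" "Vc (real k * e + e + e) \<omega> = 1" "Vc (real k * e + e + e + e) \<omega> = 1"
          if "k < N" for k
        proof -
          have "real k * e \<le> S" "real k * e + e + e \<le> S" "real k * e + e + e + e \<le> S"
            using time[OF that] e by auto
          then show "Vc (real k * e) \<omega> = 1" "Vc (real k * e + e + e) \<omega> = 1" "Vc (real k * e + e + e + e) \<omega> = 1"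
            using good_upto_mono[OF _ good] by auto
        qed
        have st1: "stat1 i j e (real k * e) \<omega> = delta1 i j e (real k * e) \<omega> - e\<^sup>2 * mean1 i j (real k * e) \<omega>" if "k < N" for k
          by (simp only: stat1_def V[OF that] mult_1_left)
        have "D1 (\<lambda>i. E i \<omega>) i j T e = (\<Sum>k<N. delta1 i j e (real k * e) \<omega>)"
          unfolding D1_def index by (intro sum.cong refl Delta_eq_delta(1)[OF i j \<omega> e(1) no])
        then have "D1 (\<lambda>i. E i \<omega>) i j T e - e\<^sup>2 * (\<Sum>k<N. mean1 i j (real k * e) \<omega>)
            = (\<Sum>k<N. stat1 i j e (real k * e) \<omega>)"
          by (simp only: sum_distrib_left sum_subtractf[symmetric]) (intro sum.cong refl, simp only: lessThan_iff st1)
        moreover have "\<omega> \<notin> A1 i j" using nU i j by blast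
        ultimately have d1: "\<bar>D1 (\<lambda>i. E i \<omega>) i j T e - e\<^sup>2 * (\<Sum>k<N. mean1 i j (real k * e) \<omega>)\<bar> \<le> h / 6 * (T * e)"
          using \<omega> drift1 by (simp add: A1_def \<delta>)
        have st2: "stat2 i j e (real k * e) \<omega> = delta2 i j e (real k * e) \<omega> - e^3 * mean2 i j (real k * e) \<omega>" if "k < N" for k
          by (simp only: stat2_def V[OF that] mult_1_left)
        have "D2 (\<lambda>i. E i \<omega>) i j T e = (\<Sum>k<N. delta2 i j e (real k * e) \<omega>)"
          unfolding D2_def index by (intro sum.cong refl Delta_eq_delta(2)[OF i j \<omega> e(1) no])
        then have "D2 (\<lambda>i. E i \<omega>) i j T e - e^3 * (\<Sum>k<N. mean2 i j (real k * e) \<omega>)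
            = (\<Sum>k<N. stat2 i j e (real k * e) \<omega>)"
          by (simp only: sum_distrib_left sum_subtractf[symmetric]) (intro sum.cong refl, simp only: lessThan_iff st2)
        moreover have "\<omega> \<notin> A2 i j" using nU i j by blast
        ultimately have d2: "\<bar>D2 (\<lambda>i. E i \<omega>) i j T e - e^3 * (\<Sum>k<N. mean2 i j (real k * e) \<omega>)\<bar> \<le> h / 6 * (T * e\<^sup>2)"
          using \<omega> drift2 by (simp add: A2_def \<delta>)
        have lam: "\<mu>_min \<le> lam j (real k * e) \<omega>" for k
          by (rule lam_bounds(1)[OF j \<omega> ke order_refl])
        show ?thesis
          using statistic_decides[OF i j ij w1 T0 e(1) N(1) lam h d1 d2] by blast
      qed
      have "estimated_graph n (\<lambda>i. E i \<omega>) T e h = dependency_graph n w"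
        unfolding recovery_event_iff
      proof (intro ballI impI)
        fix i j assume ij: "i \<in> {1..n}" "j \<in> {1..n}" "i \<noteq> j"
        have w0: "0 \<le> w i j" "0 \<le> w j i" using w_nonneg ij by auto
        show "(\<bar>D1 (\<lambda>i. E i \<omega>) i j T e\<bar> / (T * e) + \<bar>D2 (\<lambda>i. E i \<omega>) i j T e\<bar> / (T * e\<^sup>2) \<ge> h \<or>
            \<bar>D1 (\<lambda>i. E i \<omega>) j i T e\<bar> / (T * e) + \<bar>D2 (\<lambda>i. E i \<omega>) j i T e\<bar> / (T * e\<^sup>2) \<ge> h)
            = (w i j > 0 \<or> w j i > 0)"
          using key[OF ij] key[OF ij(2,1) ij(3)[symmetric]] w0 by (meson le_less not_le)
      qed
      then show False using fail by simp
    qed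
  qed
  then have "prob ?fail \<le> prob (?bad \<union> ?U)"
    by (rule finite_measure_mono_AE) (use bad_sets U_sets in auto)
  also have "\<dots> \<le> prob ?bad + prob ?U" by (rule measure_Un_le[OF bad_sets U_sets])
  also have "prob ?bad \<le> q" using q by (simp add: S_def)
  also have "prob ?U \<le> (\<Sum>i=1..n. prob (\<Union>j\<in>{1..n}. A1 i j \<union> A2 i j))"
    by (rule measure_UNION_le) (use A_sets in auto)
  also have "\<dots> \<le> (\<Sum>i=1..n. \<Sum>j=1..n. prob (A1 i j \<union> A2 i j))"
    by (rule sum_mono, rule measure_UNION_le) (use A_sets in auto)
  also have "\<dots> \<le> (\<Sum>i=1..n. \<Sum>j=1..n. 12 * Q)"
  proof (intro sum_mono)
    fix i j assume ij: "i \<in> {1..n}" "j \<in> {1..n}"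
    have "prob (A1 i j \<union> A2 i j) \<le> prob (A1 i j) + prob (A2 i j)" by (rule measure_Un_le[OF A_sets[OF ij]])
    then show "prob (A1 i j \<union> A2 i j) \<le> 12 * Q" using A1_prob[OF ij] A2_prob[OF ij] by simp
  qed
  also have "\<dots> = 12 * real n^2 * Q" by (simp add: power2_eq_square)
  finally show ?thesis unfolding Q_def by simp
qed

end

context hawkes_setting
begin

section \<open>Recovery with high probability\<close>

text \<open>The constant \<open>\<kappa>\<close> restated without reference to \<open>B\<close> and
  \<open>K\<close>, so that it can appear in a statement in which both are chosen afterwards. In
  \<open>exit_bound\<close> the additional exp(-B) is the price of the count cap.\<close>

definition drift_const :: real where
  "drift_const = 3 * ((1 + L) * d * w_max + 3 * L) + 2"

definition exit_bound :: "real \<Rightarrow> real \<Rightarrow> real" where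
  "exit_bound B T = exp (- B) + (1 + 4 / \<eta>) * exp (\<eta> / (4 * w_max) * \<mu>_max - \<eta>\<^sup>2 / (16 * w_max) * B)
     * n * (4 * L * (T + 3) / \<eta> + 2)"

lemma recovery_probability:
  assumes w1: "w_min \<le> 1" and B: "1 \<le> B" "\<mu>_max \<le> B" "w_max \<le> B"
    and e: "0 < e" "e \<le> 1" "B * e \<le> 1" and T: "2 * e \<le> T"
    and h: "h = w_min * w_sep * \<mu>_min / 8"
    and small: "312 * drift_const * B^4 * e \<le> h / 6" "h / 6 * e \<le> 1"
  shows "1 - (exit_bound B T + 12 * real n^2 * (exp (- (h / 6)\<^sup>2 * T * e^5 / 20736)
      + 864 * B^3 * exit_bound B T / (h / 6 * e^3)))
    \<le> prob {\<omega> \<in> space M. estimated_graph n (\<lambda>i. E i \<omega>) T e h = dependency_graph n w}"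
proof -
  define S where "S = T + 3"
  have S: "0 \<le> S" using e T by (simp add: S_def)
  define C where "C = (\<Sum>i=1..n. expectation (cnt i S))"
  have C: "0 \<le> C" unfolding C_def by (intro sum_nonneg integral_nonneg_AE) simp
  \<comment> \<open>The cap is chosen in terms of the actual mean \<open>C\<close> of the total
    count, for which no bound uniform in \<open>n\<close> is available. This is possible because no
    other estimate depends on \<open>K\<close>.\<close>
  define K where "K = nat \<lceil>C * exp B\<rceil> + 1"
  have "C * exp B \<le> real (nat \<lceil>C * exp B\<rceil>)" by (rule real_nat_ceiling_ge)
  then have K: "0 < K" "C * exp B \<le> real K" by (auto simp: K_def)
  interpret hawkes_truncated M n E \<mu> \<phi> w \<mu>_min \<mu>_max \<Phi> \<eta> L w_min w_max w_sep d B K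
    by unfold_locales (rule B)+
  have "C / K \<le> exp (- B)" using K by (simp add: exp_minus field_simps)
  then have "C / K + exit_prob_bound S \<le> exp (- B) + exit_prob_bound S" by simp
  with prob_not_good_upto[OF S K(1), folded C_def]
  have "prob {\<omega> \<in> space M. \<not> good_upto S \<omega>} \<le> exp (- B) + exit_prob_bound S" by (rule order_trans)
  then have q: "prob {\<omega> \<in> space M. \<not> good_upto (T + 3) \<omega>} \<le> exit_bound B T"
    unfolding exit_bound_def exit_prob_bound_def S_def .
  have k: "312 * \<kappa> * B^4 * e \<le> h / 6"
    using small(1) by (simp add: drift_const_def \<kappa>_def \<kappa>\<^sub>1_def)
  have "{\<omega> \<in> space M. \<not> estimated_graph n (\<lambda>i. E i \<omega>) T e h = dependency_graph n w}
      = space M - {\<omega> \<in> space M. estimated_graph n (\<lambda>i. E i \<omega>) T e h = dependency_graph n w}"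
    by auto
  then show ?thesis
    using recovery_failure[OF w1 e T h refl k small(2) q] prob_compl[OF recovery_event_measurable[OF e(1), of T h]]
    by simp
qed

end

section \<open>The limit of large n\<close>

text \<open>The factors exp(-b (log n)^2) absorb powers of n and of log n, and (log n)^(100-85)
  dominates the 2 log n coming from n^2. The bound is split so that each limit compares a single
  exponential with a single growing factor.\<close>

lemma recovery_bound_tendsto:
  fixes a b c1 c2 c3 \<delta> :: real
  assumes pos: "0 < a" "0 < b" "0 < c1" "0 < c2" "0 < c3" "0 < \<delta>"
  defines "q \<equiv> \<lambda>n :: nat. exp (- ((ln n)\<^sup>2)) + a * exp (c1 - b * (ln n)\<^sup>2) * n * (c2 * ((ln n)^100 + 3) / c3 + 2)"
  shows "(\<lambda>n. q n + 12 * real n^2 * (exp (- \<delta>\<^sup>2 * (ln n)^100 * (1 / (ln n)^17)^5 / 20736)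
      + 864 * ((ln n)\<^sup>2)^3 * q n / (\<delta> * (1 / (ln n)^17)^3))) \<longlonglongrightarrow> 0"
proof -
  define q1 where "q1 = (\<lambda>n :: nat. exp (- ((ln n)\<^sup>2)))"
  define q2 where "q2 = (\<lambda>n :: nat. a * exp (c1 - b * (ln n)\<^sup>2) * n * (c2 * ((ln n)^100 + 3) / c3 + 2))"
  define D where "D = \<delta>\<^sup>2 / 20736"
  have D: "0 < D" using pos by (simp add: D_def)
  define k where "k = (\<lambda>n :: nat. real n^2 * ((ln n)\<^sup>2)^3 / (\<delta> * (1 / (ln n)^17)^3))"
  have 1: "q1 \<longlonglongrightarrow> 0" unfolding q1_def by real_asymp
  have 2: "q2 \<longlonglongrightarrow> 0" unfolding q2_def using pos by real_asymp
  have 3: "(\<lambda>n. real n^2 * exp (- D * (ln n)^100 * (1 / (ln n)^17)^5)) \<longlonglongrightarrow> 0"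
    using D by real_asymp
  have 4: "(\<lambda>n. k n * q1 n) \<longlonglongrightarrow> 0" unfolding k_def q1_def using pos by real_asymp
  have 5: "(\<lambda>n. k n * q2 n) \<longlonglongrightarrow> 0" unfolding k_def q2_def using pos by real_asymp
  have "(\<lambda>n. q1 n + q2 n + 12 * (real n^2 * exp (- D * (ln n)^100 * (1 / (ln n)^17)^5))
      + 12 * 864 * (k n * q1 n + k n * q2 n)) \<longlonglongrightarrow> 0 + 0 + 12 * 0 + 12 * 864 * (0 + 0)"
    by (intro tendsto_intros 1 2 3 4 5)
  then show ?thesis
    by (simp add: q_def q1_def q2_def k_def D_def algebra_simps add_divide_distrib)
qed

theorem theorem2:
  fixes \<mu>_min \<mu>_max \<Phi> \<eta> L w_min w_max w_sep :: real
    and d :: nat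
    and M :: "nat \<Rightarrow> 'a measure"
    and E :: "nat \<Rightarrow> nat \<Rightarrow> 'a \<Rightarrow> real set"
    and \<mu> :: "nat \<Rightarrow> nat \<Rightarrow> real \<Rightarrow> real"
    and \<phi> :: "nat \<Rightarrow> nat \<Rightarrow> nat \<Rightarrow> real \<Rightarrow> real \<Rightarrow> real"
    and w :: "nat \<Rightarrow> nat \<Rightarrow> nat \<Rightarrow> real"
    and T \<epsilon> :: "nat \<Rightarrow> real"
    and h :: real
  assumes "\<mu>_min > 0" "\<mu>_max > 0" "\<Phi> > 0" "\<eta> > 0" "L > 0" "w_min > 0" "w_max > 0" "w_sep > 0"
    and "w_min \<le> 1"
    and "d \<ge> 1"
    and "\<And>n. n \<ge> 2 \<Longrightarrow> hawkes_process (M n) n (E n) (\<mu> n) (\<phi> n) (w n)"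
    and "\<And>n. n \<ge> 2 \<Longrightarrow> base_rates_bounded n (\<mu> n) \<mu>_min \<mu>_max"
    and "\<And>n. n \<ge> 2 \<Longrightarrow> kernels_regular n (\<phi> n)"
    and "\<And>n. n \<ge> 2 \<Longrightarrow> kernels_subcritical n (\<phi> n) (w n) \<Phi> \<eta>"
    and "\<And>n. n \<ge> 2 \<Longrightarrow> log_derivatives_bounded n (\<mu> n) (\<phi> n) L"
    and "\<And>n. n \<ge> 2 \<Longrightarrow> weights_separated n (w n) w_min w_max w_sep"
    and "\<And>n. n \<ge> 2 \<Longrightarrow> weights_sparse n (w n) d"
    and "\<And>n. T n = ln (real n) ^ 100"
    and "\<And>n. \<epsilon> n = ln (real n) powi (-17)"
    and "h = w_min * w_sep * \<mu>_min / 8"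
  shows "(\<lambda>n. \<P>(\<omega> in M n. estimated_graph n (\<lambda>i. E n i \<omega>) (T n) (\<epsilon> n) h = dependency_graph n (w n)))
           \<longlonglongrightarrow> 1"
proof -
  define \<delta> where "\<delta> = h / 6"
  define \<kappa> where "\<kappa> = 3 * ((1 + L) * d * w_max + 3 * L) + 2"
  \<comment> \<open>\<open>q\<close> and \<open>bound\<close> are the exit bound and the failure
    bound of \<open>recovery_probability\<close> at B = (ln n)^2, T = (ln n)^100 and \<epsilon> =
    (ln n)^(-17).\<close>
  define q where "q = (\<lambda>n :: nat. exp (- ((ln n)\<^sup>2)) + (1 + 4 / \<eta>) * exp (\<eta> / (4 * w_max) * \<mu>_max - \<eta>\<^sup>2 / (16 * w_max) * (ln n)\<^sup>2)
    * n * (4 * L * ((ln n)^100 + 3) / \<eta> + 2))"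
  define bound where "bound = (\<lambda>n :: nat. q n + 12 * real n^2 * (exp (- \<delta>\<^sup>2 * (ln n)^100 * (1 / (ln n)^17)^5 / 20736)
      + 864 * ((ln n)\<^sup>2)^3 * q n / (\<delta> * (1 / (ln n)^17)^3)))"
  have \<delta>: "0 < \<delta>" unfolding \<delta>_def assms(20) using assms(1,6,8) by simp
  have \<kappa>: "0 < \<kappa>" using assms by (simp add: \<kappa>_def add_nonneg_pos)
  have "bound \<longlonglongrightarrow> 0" unfolding bound_def q_def
    by (rule recovery_bound_tendsto) (use assms \<delta> in \<open>auto intro!: divide_pos_pos mult_pos_pos add_pos_pos\<close>)
  then have lower: "(\<lambda>n. 1 - bound n) \<longlonglongrightarrow> 1" using tendsto_diff[OF tendsto_const[of 1]] by fastforce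
  have \<epsilon>: "\<epsilon> n = 1 / (ln n)^17" for n
    unfolding assms(19) by (simp add: power_int_def inverse_eq_divide power_one_over)
  have "\<forall>\<^sub>F n :: nat in sequentially. max 1 (max \<mu>_max w_max) \<le> (ln n)\<^sup>2"
    by real_asymp
  moreover have "\<forall>\<^sub>F n :: nat in sequentially. 0 < 1 / (ln n)^17" by real_asymp
  moreover have "\<forall>\<^sub>F n :: nat in sequentially. 1 / (ln n)^17 \<le> 1" by real_asymp
  moreover have "\<forall>\<^sub>F n :: nat in sequentially. (ln n)\<^sup>2 * (1 / (ln n)^17) \<le> 1" by real_asymp
  moreover have "\<forall>\<^sub>F n :: nat in sequentially. 2 * (1 / (ln n)^17) \<le> (ln n)^100" by real_asymp
  moreover have "\<forall>\<^sub>F n :: nat in sequentially. 312 * \<kappa> * ((ln n)\<^sup>2)^4 * (1 / (ln n)^17) \<le> \<delta>"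
    using \<delta> \<kappa> by real_asymp
  moreover have "\<forall>\<^sub>F n :: nat in sequentially. \<delta> * (1 / (ln n)^17) \<le> 1"
    using \<delta> by real_asymp
  moreover have "\<forall>\<^sub>F n :: nat in sequentially. 2 \<le> n" by (rule eventually_ge_at_top)
  ultimately have ev: "\<forall>\<^sub>F n in sequentially. 1 - bound n
      \<le> \<P>(\<omega> in M n. estimated_graph n (\<lambda>i. E n i \<omega>) (T n) (\<epsilon> n) h = dependency_graph n (w n))"
  proof eventually_elim
    case (elim n)
    interpret hawkes_process "M n" n "E n" "\<mu> n" "\<phi> n" "w n" by (rule assms(11)[OF elim(8)])
    interpret hawkes_setting "M n" n "E n" "\<mu> n" "\<phi> n" "w n" \<mu>_min \<mu>_max \<Phi> \<eta> L w_min w_max w_sep d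
      by unfold_locales (use assms elim(8) in auto)
    have drift: "drift_const = \<kappa>" by (simp add: drift_const_def \<kappa>_def)
    have exit: "exit_bound ((ln n)\<^sup>2) ((ln n)^100) = q n"
      by (simp add: exit_bound_def q_def)
    have bound: "bound n = exit_bound ((ln n)\<^sup>2) (T n) + 12 * real n^2 * (exp (- (h / 6)\<^sup>2 * T n * (\<epsilon> n)^5 / 20736)
      + 864 * ((ln n)\<^sup>2)^3 * exit_bound ((ln n)\<^sup>2) (T n) / (h / 6 * (\<epsilon> n)^3))"
      unfolding assms(18) \<epsilon> exit bound_def \<delta>_def ..
    show ?case
      unfolding bound
      by (rule recovery_probability[OF assms(9) _ _ _ _ _ _ _ assms(20)])
        (use elim in \<open>simp_all only: \<epsilon> assms(18) drift \<delta>_def[symmetric] max.bounded_iff\<close>)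
  qed
  \<comment> \<open>Only eventual, because \<open>M n\<close> is known to be a probability space
    only for \<open>n \<ge> 2\<close>.\<close>
  have upper: "\<forall>\<^sub>F n in sequentially.
      \<P>(\<omega> in M n. estimated_graph n (\<lambda>i. E n i \<omega>) (T n) (\<epsilon> n) h = dependency_graph n (w n)) \<le> 1"
    using eventually_ge_at_top[of 2]
  proof eventually_elim
    case (elim n)
    interpret hawkes_process "M n" n "E n" "\<mu> n" "\<phi> n" "w n" by (rule assms(11)[OF elim])
    show ?case by (rule prob_le_1)
  qed
  show ?thesis by (rule tendsto_sandwich[OF ev upper lower tendsto_const])
qed

end
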